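(* Let $d\ge 1$, $\gamma\in(1,2]$, $T\in(0,\infty]$ and $q\in\left(\frac{d}{\gamma-1},\infty\right)$, and set $\alpha=1-\frac1\gamma-\frac{d}{q\gamma}$. Let $u$ be a (divergence-free) mild solution of the generalized Navier–Stokes equations on $\mathbb R^d\times(0,T)$, i.e. a solution of the integral equation $$u(t)=G(t)*u_0-\int_0^t K(t-r,\cdot)*(u\cdot\nabla u)(r,\cdot)\,dr,\qquad 0<t<T,$$ and assume that $$\sup_{0<t<T} t^{\alpha}\|u(t,\cdot)\|_{L^q(\mathbb R^d)}<\infty .$$ Then there is a constant $C$ such that for every $t\in(0,T)$, every $q'\in[q,\infty]$ and every integer $k\ge 0$, $$\|D^k u(t,\cdot)\|_{L^{q'}(\mathbb R^d)}\le C^{k+1}\,t^{-\frac{k}{\gamma}-\alpha'}\,k^k,\qquad \alpha'=1-\frac1\gamma-\frac{d}{q'\gamma},$$ where $C$ is independent of $k$ and $q'$ (and of $t$). Consequently, for each $t\in(0,T)$, $u(t,\cdot)$ is real analytic in the space variables.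
   Context: The equations considered are $u_t+u\cdot\nabla u+(-\Delta)^{\gamma/2}u+\nabla p=0$, $\operatorname{div}u=0$ on $\mathbb R^d$, with initial data $u(0)=u_0$ (divergence-free). $G(t,x)=G_\gamma(t,x)$ is defined by its Fourier transform $\widehat{G_\gamma}(t,\xi)=e^{-t|\xi|^\gamma}$, $t>0$ (fundamental solution of $\partial_t+(-\Delta)^{\gamma/2}$). $\mathcal P$ denotes the Helmholtz (Leray) projection onto divergence-free vector fields and $K(t,\cdot)=\mathcal P G(t,\cdot)$ is the generalized Oseen kernel, i.e. the kernel of the operator $\mathcal P e^{-t(-\Delta)^{\gamma/2}}$, so that $G(t-r)*\mathcal P f=K(t-r)*f$. $D^k$ denotes the collection of all $k$-th order spatial partial derivatives, and $k^k$ is interpreted as $1$ for $k=0$. *)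

theory Defs
  imports "HOL-Analysis.Analysis" "HOL-Probability.Essential_Supremum"
begin

definition Lnorm :: "ereal \<Rightarrow> (real^'n \<Rightarrow> 'b::euclidean_space) \<Rightarrow> ereal" where
  "Lnorm p f =
     (if f \<notin> borel_measurable lborel then \<infinity>
      else if p = \<infinity> then esssup lborel (\<lambda>x. ereal (norm (f x)))
      else (let I = (\<integral>\<^sup>+ x. ennreal (norm (f x) powr real_of_ereal p) \<partial>lborel)
            in if I = \<infinity> then \<infinity> else ereal (enn2real I powr (1 / real_of_ereal p))))"

definition pdiff :: "'n::finite \<Rightarrow> (real^'n \<Rightarrow> 'b::real_normed_vector) \<Rightarrow> real^'n \<Rightarrow> 'b" where
  "pdiff i f x = vector_derivative (\<lambda>s. f (x + s *\<^sub>R axis i 1)) (at 0)"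

definition has_pdiff :: "'n::finite \<Rightarrow> (real^'n \<Rightarrow> 'b::real_normed_vector) \<Rightarrow> real^'n \<Rightarrow> bool" where
  "has_pdiff i f x \<longleftrightarrow> (\<lambda>s. f (x + s *\<^sub>R axis i 1)) differentiable (at 0)"

fun pdiffs :: "'n::finite list \<Rightarrow> (real^'n \<Rightarrow> 'b::real_normed_vector) \<Rightarrow> real^'n \<Rightarrow> 'b" where
  "pdiffs [] f = f"
| "pdiffs (i # is) f = pdiff i (pdiffs is f)"

definition all_pdiffs_exist :: "(real^'n::finite \<Rightarrow> 'b::real_normed_vector) \<Rightarrow> bool" where
  "all_pdiffs_exist f \<longleftrightarrow> (\<forall>is i x. has_pdiff i (pdiffs is f) x)"

definition real_analytic_on :: "(real^'n::finite \<Rightarrow> real^'m) \<Rightarrow> (real^'n) set \<Rightarrow> bool" where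
  "real_analytic_on f S \<longleftrightarrow>
     (\<forall>x0\<in>S. \<exists>r>0. \<exists>c :: ('n \<Rightarrow> nat) \<Rightarrow> real^'m.
        \<forall>x\<in>ball x0 r. ((\<lambda>a. (\<Prod>i\<in>UNIV. (x$i - x0$i) ^ a i) *\<^sub>R c a) has_sum f x) UNIV)"

text \<open>Fundamental solution G_gamma of d/dt + (-Delta)^(gamma/2), defined by inverse
  Fourier transform of exp(-t|xi|^gamma) (real since the symbol is even).\<close>
definition Gker :: "real \<Rightarrow> real \<Rightarrow> real^'n::finite \<Rightarrow> real" where
  "Gker \<gamma> t x = (1 / (2*pi) ^ CARD('n)) *
      (\<integral>\<xi>. cos (x \<bullet> \<xi>) * exp (- t * norm \<xi> powr \<gamma>) \<partial>lborel)"

text \<open>Generalized Oseen kernel K = P G: inverse Fourier transform of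
  (delta_jl - xi_j xi_l/|xi|^2) exp(-t|xi|^gamma).\<close>
definition Kker :: "real \<Rightarrow> real \<Rightarrow> real^'n::finite \<Rightarrow> real^'n^'n" where
  "Kker \<gamma> t x = (\<chi> j l. (1 / (2*pi) ^ CARD('n)) *
      (\<integral>\<xi>. cos (x \<bullet> \<xi>) * ((if j = l then 1 else 0) - (\<xi>$j * \<xi>$l) / (norm \<xi>)\<^sup>2)
              * exp (- t * norm \<xi> powr \<gamma>) \<partial>lborel))"

text \<open>Integrand of (K(s) * (v . grad v))_j at x, written in divergence form
  (K(s) * div (v tensor v))_j = sum_{l,m} (d_m K_jl(s)) * (v_m v_l).\<close>
definition nl_integrand :: "real \<Rightarrow> real \<Rightarrow> (real^'n::finite \<Rightarrow> real^'n) \<Rightarrow> real^'n \<Rightarrow> 'n \<Rightarrow> 'n \<Rightarrow> 'n \<Rightarrow> real^'n \<Rightarrow> real" where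
  "nl_integrand \<gamma> s v x j l m y =
     pdiff m (\<lambda>z. Kker \<gamma> s z $ j $ l) (x - y) * (v y $ m) * (v y $ l)"

definition nonlin :: "real \<Rightarrow> real \<Rightarrow> (real^'n::finite \<Rightarrow> real^'n) \<Rightarrow> real^'n \<Rightarrow> real^'n" where
  "nonlin \<gamma> s v x = (\<chi> j. \<Sum>l\<in>UNIV. \<Sum>m\<in>UNIV. \<integral>y. nl_integrand \<gamma> s v x j l m y \<partial>lborel)"

definition mild_solution :: "real \<Rightarrow> ereal \<Rightarrow> (real^'n::finite \<Rightarrow> real^'n) \<Rightarrow> (real \<Rightarrow> real^'n \<Rightarrow> real^'n) \<Rightarrow> bool" where
  "mild_solution \<gamma> T u0 u \<longleftrightarrow>
     (\<forall>t. 0 < t \<and> ereal t < T \<longrightarrow> (\<forall>x.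
        integrable lborel (\<lambda>y. Gker \<gamma> t (x - y) *\<^sub>R u0 y)
      \<and> (\<forall>r\<in>{0<..<t}. \<forall>j l m. integrable lborel (nl_integrand \<gamma> (t - r) (u r) x j l m))
      \<and> set_integrable lborel {0<..<t} (\<lambda>r. nonlin \<gamma> (t - r) (u r) x)
      \<and> u t x = (\<integral>y. Gker \<gamma> t (x - y) *\<^sub>R u0 y \<partial>lborel)
                - (LINT r:{0<..<t}|lborel. nonlin \<gamma> (t - r) (u r) x)))"

definition weakly_div_free :: "(real^'n::finite \<Rightarrow> real^'n) \<Rightarrow> bool" where
  "weakly_div_free f \<longleftrightarrow>
     (\<forall>S. compact S \<longrightarrow> set_integrable lborel S f) \<and>
     (\<forall>\<phi> :: real^'n \<Rightarrow> real.
        (\<forall>i x. has_pdiff i \<phi> x) \<and> (\<forall>i. continuous_on UNIV (pdiff i \<phi>))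
        \<and> compact (closure {x. \<phi> x \<noteq> 0})
        \<longrightarrow> (\<integral>x. (\<Sum>i\<in>UNIV. f x $ i * pdiff i \<phi> x) \<partial>lborel) = 0)"

end

theory Submission
  imports Defs "HOL-Probability.Probability" "HOL-Complex_Analysis.Complex_Analysis" "HOL-Real_Asymp.Real_Asymp"
begin

text \<open>
  Since \<open>exp (- t * norm \<xi> powr \<gamma>)\<close> is the Laplace transform of a stable law at \<open>(norm \<xi>)\<^sup>2\<close>, the kernels
  \<open>G\<close> and \<open>\<nabla>K\<close> are mixtures of Gaussian expressions. They extend holomorphically to complex arguments whose
  imaginary part is at most \<open>t powr (1 / \<gamma>)\<close>, with integrable majorants of the same size as on the real axis.

  The equation is restarted at a time \<open>t0\<close> comparable to \<open>t\<close> and solved by Picard iteration after the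
  substitution \<open>x \<mapsto> x + \<tau> \<zeta>\<close> with a constant complex vector \<open>\<zeta>\<close>: in the Duhamel integral the shift \<open>\<tau> \<zeta>\<close>
  splits as \<open>(\<tau> - r) \<zeta> + r \<zeta>\<close>, so that every kernel only sees its own admissible shift. The iteration contracts
  in the norms given by the hypothesis, uniformly in \<open>\<zeta>\<close>, the limit for \<open>\<zeta> = 0\<close> is the given solution, and so
  \<open>u(t)\<close> extends holomorphically to a polydisc of radius \<open>c * t powr (1 / \<gamma>)\<close>, bounded there by a function in
  \<open>L\<^sup>q \<inter> L\<^sup>\<infinity>\<close>. Cauchy's estimates, interpolation between \<open>L\<^sup>q\<close> and \<open>L\<^sup>\<infinity>\<close>, and Taylor's formula conclude.
\<close>

section \<open>Stable subordinators\<close>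

text \<open>A kernel at age s tolerates only shifts of size s powr (1/\<gamma>), which shrinks to 0
  at the end r = \<tau> of the Duhamel integral. A shift linear in the age resolves this: as
  1/\<gamma> < 1, the bound |\<zeta>| < S powr (1/\<gamma> - 1) at the largest age S is enough at
  all smaller ages, and at age S it reaches the full radius S powr (1/\<gamma>). With alp = 1 -
  1/\<gamma> - d/(q\<gamma>) > 0 the contraction factor is a multiple of M t0 powr (-alp) S powr
  alp. It is scale invariant, so S is a fixed multiple of t0 and the constants do not depend on t. A
  scalar iteration with the kernel majorants bounds all complex iterates at once; this gives the
  supremum over \<zeta> a measurable bound in L^q. The given solution is known only in L^q, not in
  the weighted sup norm of the iteration, so its identification with the limit is a separate
  contraction in L^q, based on Cauchy-Schwarz and q \<ge> 2. As q > d/(\<gamma> - 1) \<ge> d, the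
  case q < 2 occurs only for d = 1, where the projected nonlinearity is zero. The condition \<gamma>
  > 1 also makes the stable index exceed 1/2, so that exp(c/s) is integrable for every c.\<close>

lemma laplace_powers:
  assumes "prob_space \<nu>" "sets \<nu> = sets borel" "AE x in \<nu>. (0::real) < x"
  shows "\<exists>N. prob_space N \<and> sets N = sets borel \<and> (AE x in N. (0::real) < x) \<and>
     (\<forall>l\<ge>0. (\<integral>\<^sup>+x. ennreal (exp (- l * x)) \<partial>N) = (\<integral>\<^sup>+x. ennreal (exp (- l * x)) \<partial>\<nu>) ^ Suc n)"
proof (induction n)
  case 0
  show ?case using assms by (intro exI[of _ \<nu>]) auto
next
  case (Suc n)
  then obtain N where N: "prob_space N" "sets N = sets borel" "AE x in N. (0::real) < x"
    and L: "\<And>l. l \<ge> 0 \<Longrightarrow> (\<integral>\<^sup>+x. ennreal (exp (- l * x)) \<partial>N) = (\<integral>\<^sup>+x. ennreal (exp (- l * x)) \<partial>\<nu>) ^ Suc n" by blast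
  interpret N: prob_space N by fact
  interpret nu: prob_space \<nu> by fact
  interpret pair_prob_space N \<nu> ..
  note [measurable_cong] = N(2) assms(2)
  have m[measurable]: "(\<lambda>(x, y). x + y) \<in> N \<Otimes>\<^sub>M \<nu> \<rightarrow>\<^sub>M (borel::real measure)" by measurable
  \<comment> \<open>Convolution is the law of a sum of independent variables: positivity is
    inherited and Laplace transforms multiply.\<close>
  show ?case proof (intro exI[of _ "convolution N \<nu>"] conjI allI impI)
    show "prob_space (N \<star> \<nu>)" unfolding convolution_def by (rule prob_space_distr) measurable
    show "sets (N \<star> \<nu>) = sets borel" by (simp add: convolution_def)
    have "AE p in N \<Otimes>\<^sub>M \<nu>. 0 < fst p + snd p" proof (rule AE_pair_measure)
      show "{x \<in> space (N \<Otimes>\<^sub>M \<nu>). 0 < fst x + snd x} \<in> sets (N \<Otimes>\<^sub>M \<nu>)" by measurable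
      show "AE x in N. AE y in \<nu>. 0 < fst (x, y) + snd (x, y)" using N(3) proof eventually_elim
        case (elim x)
        show ?case using assms(3) by eventually_elim (use elim in auto)
      qed
    qed
    then show "AE x in N \<star> \<nu>. 0 < x" unfolding convolution_def by (subst AE_distr_iff) (auto simp: case_prod_beta)
    fix l :: real assume l: "0 \<le> l"
    have "(\<integral>\<^sup>+x. ennreal (exp (- l * x)) \<partial>(N \<star> \<nu>)) = (\<integral>\<^sup>+x. \<integral>\<^sup>+y. ennreal (exp (- l * (x + y))) \<partial>\<nu> \<partial>N)"
      by (rule nn_integral_convolution) (auto simp: N assms N.finite_measure_axioms nu.finite_measure_axioms)
    also have "\<dots> = (\<integral>\<^sup>+x. \<integral>\<^sup>+y. ennreal (exp (- l * x)) * ennreal (exp (- l * y)) \<partial>\<nu> \<partial>N)"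
      by (simp add: algebra_simps exp_add ennreal_mult exp_diff exp_minus divide_simps flip: ennreal_mult)
    also have "\<dots> = (\<integral>\<^sup>+x. ennreal (exp (- l * x)) \<partial>N) * (\<integral>\<^sup>+y. ennreal (exp (- l * y)) \<partial>\<nu>)"
      by (simp add: nn_integral_cmult nn_integral_multc)
    finally show "(\<integral>\<^sup>+x. ennreal (exp (- l * x)) \<partial>(N \<star> \<nu>)) = (\<integral>\<^sup>+x. ennreal (exp (- l * x)) \<partial>\<nu>) ^ Suc (Suc n)"
      using L[OF l] by (simp add: mult_ac)
  qed
qed

text \<open>The quotient ln(1 - z)/z tends to -1 at 0. Giving it the value -1 at z = 0 makes it
  continuous there, which covers the indices with \<open>y n = 0\<close>.\<close>

lemma pow_exp_limit:
  fixes y :: "nat \<Rightarrow> real"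
  assumes lim: "(\<lambda>n. real (Suc n) * y n) \<longlonglongrightarrow> c"
  shows "(\<lambda>n. (1 - y n) ^ Suc n) \<longlonglongrightarrow> exp (- c)"
proof -
  have "(\<lambda>n. real (Suc n) * y n * inverse (real (Suc n))) \<longlonglongrightarrow> c * 0"
    by (intro tendsto_mult lim LIMSEQ_inverse_real_of_nat)
  moreover have "(\<lambda>n. real (Suc n) * y n * inverse (real (Suc n))) = y" by (rule ext) simp
  ultimately have y0: "y \<longlonglongrightarrow> 0" by (simp only: mult_zero_right)
  have r: "((\<lambda>z::real. if z = 0 then -1 else ln (1 - z) / z) \<longlongrightarrow> -1) (at 0)"
    apply (rule Lim_transform_eventually[of "\<lambda>z::real. ln (1 - z) / z"])
    subgoal by real_asymp
    subgoal by (auto simp: eventually_at_filter)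
    done
  then have "isCont (\<lambda>z::real. if z = 0 then -1 else ln (1 - z) / z) 0" by (simp add: isCont_def)
  then have "(\<lambda>n. (if y n = 0 then -1 else ln (1 - y n) / y n)) \<longlonglongrightarrow> -1"
    using isCont_tendsto_compose[OF _ y0] by fastforce
  from tendsto_mult[OF lim this] have "(\<lambda>n. exp (real (Suc n) * y n * (if y n = 0 then -1 else ln (1 - y n) / y n))) \<longlonglongrightarrow> exp (- c)"
    by (intro tendsto_exp) auto
  moreover have "\<forall>\<^sub>F n in sequentially. exp (real (Suc n) * y n * (if y n = 0 then -1 else ln (1 - y n) / y n)) = (1 - y n) ^ Suc n"
  proof -
    have "\<forall>\<^sub>F n in sequentially. y n < 1" using order_tendstoD(2)[OF y0, of 1] by simp
    then show ?thesis proof eventually_elim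
      case (elim n)
      show ?case proof (cases "y n = 0")
        case False
        have "exp (real (Suc n) * ln (1 - y n)) = (1 - y n) ^ Suc n" using elim by (simp only: exp_of_nat_mult) simp
        then show ?thesis using False by simp
      qed auto
    qed
  qed
  ultimately show ?thesis by (rule Lim_transform_eventually)
qed

section \<open>Stable laws of index \<beta> < 1 as weak limits of rescaled sums of Pareto
  variables\<close>

definition pareto :: "real \<Rightarrow> real measure" where
  "pareto \<beta> = density lborel (\<lambda>x. ennreal (\<beta> * x powr (- \<beta> - 1)) * indicator {1..} x)"

lemma nn_integral_powr_tail:
  fixes a p :: real assumes "0 < a" "0 < p"
  shows "(\<integral>\<^sup>+x. ennreal (p * x powr (- p - 1)) * indicator {a..} x \<partial>lborel) = ennreal (a powr (- p))"
proof -
  have "((\<lambda>x. - (x powr (-p))) \<longlongrightarrow> - 0) at_top" using assms by (intro tendsto_minus tendsto_neg_powr filterlim_ident) auto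
  then have "(\<integral>\<^sup>+x. ennreal (p * x powr (- p - 1)) * indicator {a..} x \<partial>lborel) = ennreal (0 - (- (a powr (- p))))"
    using assms by (intro nn_integral_FTC_atLeast) (auto intro!: derivative_eq_intros simp: )
  then show ?thesis by simp
qed

lemma nn_integral_powr_head:
  fixes a p :: real assumes "0 \<le> a" "0 < p"
  shows "(\<integral>\<^sup>+x. ennreal (x powr (p - 1)) * indicator {0<..<a} x \<partial>lborel) = ennreal (a powr p / p)"
proof -
  have "(\<integral>\<^sup>+x. ennreal (x powr (p - 1)) * indicator {0<..<a} x \<partial>lborel)
      = (\<integral>\<^sup>+x. ennreal (x powr (p - 1) * indicator {0..a} x) \<partial>lborel)"
    by (rule nn_integral_cong_AE, use AE_lborel_singleton[of 0] AE_lborel_singleton[of a] in eventually_elim)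
       (auto simp: indicator_def)
  also have "\<dots> = ennreal (a powr p / p)" proof -
    have i: "((\<lambda>x. x powr (p - 1)) has_integral (a powr (p - 1 + 1) / (p - 1 + 1))) {0..a}"
      by (rule has_integral_powr_from_0) (use assms in auto)
    show ?thesis by (rule nn_integral_has_integral_lborel)
         (use i has_integral_restrict_UNIV[of "{0..a}" "\<lambda>x. x powr (p - 1)"] in \<open>auto simp: indicator_def of_bool_def if_distrib cong: if_cong\<close>)
  qed
  finally show ?thesis .
qed

lemma prob_space_pareto: "0 < \<beta> \<Longrightarrow> prob_space (pareto \<beta>)"
  by (intro prob_spaceI) (simp add: pareto_def emeasure_density nn_integral_powr_tail)

lemma sets_pareto[simp]: "sets (pareto \<beta>) = sets borel"
  by (simp add: pareto_def)

lemma AE_pareto: "0 < \<beta> \<Longrightarrow> AE x in pareto \<beta>. 0 < x"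
  unfolding pareto_def by (subst AE_density) (auto simp: indicator_def)

text \<open>Truncated Levy integral. By the substitution y = k x it is the factor of k powr \<beta>
  in 1 minus the Laplace transform of \<open>pareto \<beta>\<close>; for 0 < \<beta> < 1 its value
  at 0 is the constant Gamma(1 - \<beta>) of the limiting stable law.\<close>

definition pareto_co :: "real \<Rightarrow> real \<Rightarrow> ennreal" where
  "pareto_co \<beta> k = (\<integral>\<^sup>+y. ennreal ((1 - exp (- y)) * (\<beta> * y powr (- \<beta> - 1))) * indicator {k..} y \<partial>lborel)"

text \<open>Near 0 the inequality 1 - exp(-y) \<le> y leaves y powr (-\<beta>), integrable as
  \<beta> < 1; beyond 1 the Pareto tail is integrable.\<close>

lemma pareto_co_0:
  assumes "0 < \<beta>" "\<beta> < 1"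
  shows "pareto_co \<beta> 0 < \<infinity>" "0 < pareto_co \<beta> 0"
proof -
  have "pareto_co \<beta> 0 \<le> (\<integral>\<^sup>+y. ennreal \<beta> * (ennreal (y powr ((1 - \<beta>) - 1)) * indicator {0<..<1} y)
        + ennreal (\<beta> * y powr (- \<beta> - 1)) * indicator {1..} y \<partial>lborel)"
    unfolding pareto_co_def proof (intro nn_integral_mono_AE, use AE_lborel_singleton[of 0] in eventually_elim)
    case (elim y)
    show ?case proof (cases "y < 1")
      case True
      show ?thesis proof (cases "0 < y")
        case y: True
        have "(1 - exp (- y)) * (\<beta> * y powr (- \<beta> - 1)) \<le> y * (\<beta> * y powr (- \<beta> - 1))"
          using assms exp_ge_add_one_self[of "-y"] by (intro mult_right_mono) auto
        also have "\<dots> = \<beta> * y powr ((1 - \<beta>) - 1)" using y by (simp add: powr_diff powr_minus field_simps)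
        finally show ?thesis using True y assms by (auto simp: indicator_def simp flip: ennreal_mult intro!: ennreal_leI)
      qed (use elim in \<open>auto simp: indicator_def\<close>)
    next
      case False
      have "(1 - exp (- y)) * (\<beta> * y powr (- \<beta> - 1)) \<le> 1 * (\<beta> * y powr (- \<beta> - 1))"
        using assms by (intro mult_right_mono) auto
      then show ?thesis using False by (auto simp: indicator_def intro!: ennreal_leI)
    qed
  qed
  also have "\<dots> = ennreal \<beta> * ennreal (1 powr (1 - \<beta>) / (1 - \<beta>)) + ennreal (1 powr (- \<beta>))"
    using assms nn_integral_powr_head[of 1 "1 - \<beta>"] nn_integral_powr_tail[of 1 \<beta>]
    by (subst nn_integral_add) (simp_all add: nn_integral_cmult)
  also have "\<dots> < \<infinity>" by (simp add: ennreal_mult_less_top)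
  finally show "pareto_co \<beta> 0 < \<infinity>" .
  have "ennreal (1 - exp (- 1)) * ennreal (1 powr (- \<beta>)) = (\<integral>\<^sup>+y. ennreal (1 - exp (- 1)) * (ennreal (\<beta> * y powr (- \<beta> - 1)) * indicator {1..} y) \<partial>lborel)"
    using assms nn_integral_powr_tail[of 1 \<beta>] by (simp add: nn_integral_cmult)
  also have "\<dots> \<le> pareto_co \<beta> 0" unfolding pareto_co_def
    using assms by (intro nn_integral_mono) (auto simp: indicator_def simp flip: ennreal_mult intro!: ennreal_leI mult_right_mono)
  finally have "ennreal (1 - exp (- 1)) \<le> pareto_co \<beta> 0" by simp
  moreover have "0 < ennreal (1 - exp (- 1))" by simp
  ultimately show "0 < pareto_co \<beta> 0" by (rule less_le_trans[rotated])
qed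

text \<open>The sets \<open>{k n..}\<close> increase to \<open>{0..}\<close> except possibly at the
  point 0, where the integrand vanishes, so monotone convergence applies.\<close>

lemma pareto_co_tendsto:
  assumes "0 < \<beta>" and k: "decseq k" "k \<longlonglongrightarrow> 0" "\<And>n. 0 \<le> k n"
  shows "(\<lambda>n. pareto_co \<beta> (k n)) \<longlonglongrightarrow> pareto_co \<beta> 0"
proof -
  let ?f = "\<lambda>y. ennreal ((1 - exp (- y)) * (\<beta> * y powr (- \<beta> - 1)))"
  have "(\<lambda>n. pareto_co \<beta> (k n)) \<longlonglongrightarrow> (\<integral>\<^sup>+y. ?f y * indicator {0..} y \<partial>lborel)" unfolding pareto_co_def
  proof (rule nn_integral_LIMSEQ)
    show "incseq (\<lambda>n y. ?f y * indicator {k n..} y)" using k(1) unfolding incseq_def le_fun_def decseq_def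
      by (auto simp: indicator_def intro: order_trans)
    fix y :: real
    show "(\<lambda>n. ?f y * indicator {k n..} y) \<longlonglongrightarrow> ?f y * indicator {0..} y" proof (cases "0 < y")
      case True
      have "\<forall>\<^sub>F n in sequentially. k n < y" using order_tendstoD(2)[OF k(2) True] .
      then have "\<forall>\<^sub>F n in sequentially. ?f y * indicator {k n..} y = ?f y * indicator {0..} y"
        by eventually_elim (use True in \<open>auto simp: indicator_def\<close>)
      then show ?thesis by (rule tendsto_eventually)
    next
      case False
      then have "?f y * indicator {k n..} y = ?f y * indicator {0..} y" for n using k(3)[of n] by (cases "y = 0") (auto simp: indicator_def)
      then show ?thesis by simp
    qed
  qed measurable
  then show ?thesis by (simp add: pareto_co_def)
qed

lemma pareto_co_antimono: "k \<le> k' \<Longrightarrow> pareto_co \<beta> k' \<le> pareto_co \<beta> k"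
  unfolding pareto_co_def by (intro nn_integral_mono) (auto simp: indicator_def)

lemma pareto_laplace:
  assumes b: "0 < \<beta>" "\<beta> < 1" and k: "0 < k"
  shows "(\<integral>\<^sup>+x. ennreal (1 - exp (- k * x)) \<partial>pareto \<beta>) = ennreal (k powr \<beta>) * pareto_co \<beta> k"
proof -
  have "(\<integral>\<^sup>+x. ennreal (1 - exp (- k * x)) \<partial>pareto \<beta>)
     = (\<integral>\<^sup>+x. ennreal (1 - exp (- k * x)) * (ennreal (\<beta> * x powr (- \<beta> - 1)) * indicator {1..} x) \<partial>lborel)"
    unfolding pareto_def by (subst nn_integral_density) (auto simp: mult_ac)
  also have "\<dots> = ennreal (1 / k) * (\<integral>\<^sup>+y. ennreal (1 - exp (- y)) * (ennreal (\<beta> * (y / k) powr (- \<beta> - 1)) * indicator {1..} (y / k)) \<partial>lborel)"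
    using k by (subst nn_integral_real_affine[of _ "1 / k" 0]) auto
  also have "\<dots> = (\<integral>\<^sup>+y. ennreal (k powr \<beta>) * (ennreal ((1 - exp (- y)) * (\<beta> * y powr (- \<beta> - 1))) * indicator {k..} y) \<partial>lborel)"
    apply (subst nn_integral_cmult[symmetric], measurable)
    apply (rule nn_integral_cong)
    subgoal for y using k b by (auto simp: indicator_def powr_divide powr_diff powr_minus field_simps simp flip: ennreal_mult)
    done
  also have "\<dots> = ennreal (k powr \<beta>) * pareto_co \<beta> k"
    unfolding pareto_co_def by (subst nn_integral_cmult) auto
  finally show ?thesis .
qed

text \<open>\<open>N n\<close> is the law of a sum of n + 1 independent Pareto variables scaled by
  \<open>s n\<close>; the tail x powr (-\<beta>) is the simplest one attracted to the stable law.
  The limit of the Laplace transforms identifies that law, and the lower bound, uniform in n, is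
  there to give tightness.\<close>

lemma stable_approx:
  assumes b: "0 < \<beta>" "\<beta> < 1"
  shows "\<exists>N. \<forall>n::nat. prob_space (N n) \<and> sets (N n) = sets borel \<and> (AE x in N n. (0::real) < x) \<and>
     (\<forall>l\<ge>0. ennreal (1 - l powr \<beta>) \<le> (\<integral>\<^sup>+x. ennreal (exp (- l * x)) \<partial>N n)) \<and>
     (\<forall>l\<ge>0. (\<lambda>n. \<integral>\<^sup>+x. ennreal (exp (- l * x)) \<partial>N n) \<longlonglongrightarrow> ennreal (exp (- (l powr \<beta>))))"
proof -
  obtain c where c: "pareto_co \<beta> 0 = ennreal c" "0 < c" using pareto_co_0[OF b] by (cases "pareto_co \<beta> 0") auto
  \<comment> \<open>The scale is fixed by (n + 1) \<open>s n\<close> powr \<beta> = 1/c, so that the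
    n + 1 summands together contribute l powr \<beta> in the limit.\<close>
  define s where "s n = (c * real (Suc n)) powr (- 1 / \<beta>)" for n
  have s_pos: "0 < s n" for n using c by (simp add: s_def)
  have s_powr: "s n powr \<beta> = 1 / (c * real (Suc n))" for n proof -
    have "s n powr \<beta> = (c * real (Suc n)) powr (- 1)" using b unfolding s_def by (simp only: powr_powr) simp
    then show ?thesis using c by (simp add: powr_minus_divide del: of_nat_Suc)
  qed
  define \<nu> where "\<nu> n = distr (pareto \<beta>) borel (\<lambda>x. s n * x)" for n
  interpret P: prob_space "pareto \<beta>" using b by (simp add: prob_space_pareto)
  have meas[measurable]: "(\<lambda>x. s n * x) \<in> pareto \<beta> \<rightarrow>\<^sub>M borel" for n
    by (simp add: measurable_cong_sets[OF sets_pareto refl])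
  define cr where "cr k = enn2real (pareto_co \<beta> k)" for k
  have cr: "pareto_co \<beta> k = ennreal (cr k)" "0 \<le> cr k" "cr k \<le> c" if "0 \<le> k" for k proof -
    have "pareto_co \<beta> k \<le> ennreal c" using pareto_co_antimono[OF that, of \<beta>] c by simp
    then show "pareto_co \<beta> k = ennreal (cr k)" "0 \<le> cr k" "cr k \<le> c"
      using c by (auto simp: cr_def ennreal_enn2real_if top_unique enn2real_leI)
  qed
  have L: "(\<integral>\<^sup>+x. ennreal (exp (- l * x)) \<partial>\<nu> n) = ennreal (1 - l powr \<beta> * cr (l * s n) / (c * real (Suc n)))"
    "l powr \<beta> * cr (l * s n) / (c * real (Suc n)) \<le> 1"
    if l: "0 < l" for l n proof -
    define y where "y = l powr \<beta> * cr (l * s n) / (c * real (Suc n))"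
    have y0: "0 \<le> y" using cr(2)[of "l * s n"] l s_pos[of n] c by (simp add: y_def)
    have "(\<integral>\<^sup>+x. ennreal (1 - exp (- (l * s n) * x)) \<partial>pareto \<beta>) = ennreal y"
      using l s_pos[of n] b s_powr[of n] cr[of "l * s n"] by (subst pareto_laplace) (auto simp: powr_mult y_def field_simps simp flip: ennreal_mult)
    moreover have "(\<integral>\<^sup>+x. ennreal (1 - exp (- (l * s n) * x)) \<partial>pareto \<beta>) + (\<integral>\<^sup>+x. ennreal (exp (- (l * s n) * x)) \<partial>pareto \<beta>)
      = (\<integral>\<^sup>+x. 1 \<partial>pareto \<beta>)"
      apply (subst nn_integral_add[symmetric])
      subgoal by (simp add: measurable_cong_sets[OF sets_pareto refl])
      subgoal by (simp add: measurable_cong_sets[OF sets_pareto refl])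
      apply (rule nn_integral_cong_AE) using AE_pareto[OF b(1)]
      apply eventually_elim using l s_pos[of n] by (auto simp flip: ennreal_plus)
    moreover have "(\<integral>\<^sup>+x. ennreal (exp (- l * x)) \<partial>\<nu> n) = (\<integral>\<^sup>+x. ennreal (exp (- (l * s n) * x)) \<partial>pareto \<beta>)"
      unfolding \<nu>_def by (subst nn_integral_distr) (auto simp: mult_ac)
    ultimately have e: "ennreal y + (\<integral>\<^sup>+x. ennreal (exp (- l * x)) \<partial>\<nu> n) = 1" by (simp add: P.emeasure_space_1)
    then have "(\<integral>\<^sup>+x. ennreal (exp (- l * x)) \<partial>\<nu> n) = 1 - ennreal y"
      by (metis add.commute ennreal_add_diff_cancel_right ennreal_neq_top)
    then show "(\<integral>\<^sup>+x. ennreal (exp (- l * x)) \<partial>\<nu> n) = ennreal (1 - l powr \<beta> * cr (l * s n) / (c * real (Suc n)))"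
      using y0 unfolding y_def[symmetric] by (simp add: ennreal_minus ennreal_1[symmetric] del: ennreal_1)
    have "ennreal y \<le> 1" using e by (metis le_iff_add)
    then show "l powr \<beta> * cr (l * s n) / (c * real (Suc n)) \<le> 1" by (simp add: y_def)
  qed
  have "\<exists>N. prob_space N \<and> sets N = sets borel \<and> (AE x in N. (0::real) < x) \<and>
     (\<forall>l\<ge>0. (\<integral>\<^sup>+x. ennreal (exp (- l * x)) \<partial>N) = (\<integral>\<^sup>+x. ennreal (exp (- l * x)) \<partial>\<nu> n) ^ Suc n)" for n
  proof (rule laplace_powers)
    show "prob_space (\<nu> n)" unfolding \<nu>_def by (rule P.prob_space_distr) measurable
    show "sets (\<nu> n) = sets borel" by (simp add: \<nu>_def)
    show "AE x in \<nu> n. 0 < x" unfolding \<nu>_def using AE_pareto[OF b(1)] s_pos[of n] by (subst AE_distr_iff) (auto elim!: eventually_mono)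
  qed
  then obtain N where N: "\<And>n. prob_space (N n)" "\<And>n. sets (N n) = sets borel" "\<And>n. AE x in N n. (0::real) < x"
    and LN: "\<And>n l. l \<ge> 0 \<Longrightarrow> (\<integral>\<^sup>+x. ennreal (exp (- l * x)) \<partial>N n) = (\<integral>\<^sup>+x. ennreal (exp (- l * x)) \<partial>\<nu> n) ^ Suc n"
    by metis
  have lim: "(\<lambda>n. \<integral>\<^sup>+x. ennreal (exp (- l * x)) \<partial>N n) \<longlonglongrightarrow> ennreal (exp (- (l powr \<beta>)))" if "0 \<le> l" for l
  proof (cases "l = 0")
    case True
    then show ?thesis using N b by (simp add: prob_space.emeasure_space_1)
  next
    case False
    then have l: "0 < l" using that by simp
    have s0: "(\<lambda>n. l * s n) \<longlonglongrightarrow> 0" unfolding s_def using b c by real_asymp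
    have "decseq (\<lambda>n. l * s n)" unfolding decseq_def s_def using b c l by (auto intro!: mult_left_mono powr_mono2')
    from pareto_co_tendsto[OF b(1) this s0] have "(\<lambda>n. pareto_co \<beta> (l * s n)) \<longlonglongrightarrow> pareto_co \<beta> 0"
      using l s_pos by (simp add: less_imp_le)
    then have crl: "(\<lambda>n. cr (l * s n)) \<longlonglongrightarrow> c"
      unfolding cr_def using c by (intro tendsto_enn2real) auto
    have "(\<lambda>n. real (Suc n) * (l powr \<beta> * cr (l * s n) / (c * real (Suc n)))) = (\<lambda>n. l powr \<beta> * cr (l * s n) / c)"
      by (rule ext) simp
    moreover have "(\<lambda>n. l powr \<beta> * cr (l * s n) / c) \<longlonglongrightarrow> l powr \<beta> * c / c"
      by (intro tendsto_intros crl) (use c in auto)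
    ultimately have "(\<lambda>n. (1 - l powr \<beta> * cr (l * s n) / (c * real (Suc n))) ^ Suc n) \<longlonglongrightarrow> exp (- (l powr \<beta>))"
      using c by (intro pow_exp_limit) simp
    moreover have "(\<integral>\<^sup>+x. ennreal (exp (- l * x)) \<partial>N n) = ennreal ((1 - l powr \<beta> * cr (l * s n) / (c * real (Suc n))) ^ Suc n)" for n
      using l L(2)[OF l, of n] by (subst LN) (auto simp only: L(1)[OF l] ennreal_power less_imp_le diff_ge_0_iff_ge)
    ultimately show ?thesis by (simp only:) (intro tendsto_ennrealI)
  qed
  \<comment> \<open>By \<open>cr \<le> c\<close> the deficit of one summand is at most l powr
    \<beta> / (n + 1); Bernoulli's inequality then handles the power.\<close>
  have low: "ennreal (1 - l powr \<beta>) \<le> (\<integral>\<^sup>+x. ennreal (exp (- l * x)) \<partial>N n)" if "0 \<le> l" for l n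
  proof (cases "l = 0")
    case True
    then show ?thesis using N b by (simp add: prob_space.emeasure_space_1)
  next
    case False
    then have l: "0 < l" using that by simp
    define y where "y = l powr \<beta> * cr (l * s n) / (c * real (Suc n))"
    have y: "y \<le> 1" "0 \<le> y" using L(2)[OF l, of n] cr(2)[of "l * s n"] c l s_pos[of n] by (auto simp: y_def)
    have "l powr \<beta> * cr (l * s n) \<le> l powr \<beta> * c" using cr(3)[of "l * s n"] l s_pos[of n] by (intro mult_left_mono) auto
    moreover have "real (Suc n) * y = l powr \<beta> * cr (l * s n) / c" by (simp add: y_def del: of_nat_Suc)
    ultimately have "real (Suc n) * y \<le> l powr \<beta>" using c by (simp add: pos_divide_le_eq)
    then have "1 - l powr \<beta> \<le> 1 + real (Suc n) * (- y)" by simp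
    also have "\<dots> \<le> (1 + (- y)) ^ Suc n" by (rule Bernoulli_inequality) (use y in auto)
    finally have "1 - l powr \<beta> \<le> (1 - y) ^ Suc n" by simp
    then show ?thesis using l y by (subst LN) (auto simp only: L(1)[OF l] y_def[symmetric] ennreal_power less_imp_le diff_ge_0_iff_ge intro!: ennreal_leI)
  qed
  show ?thesis using N lim low by blast
qed

text \<open>Tightness gives a weakly convergent subsequence. On laws carried by the half-line the
  Laplace transform is the integral of a bounded continuous function, so it passes to the
  limit.\<close>

lemma stable_exists:
  assumes b: "0 < \<beta>" "\<beta> < 1"
  shows "\<exists>M. prob_space M \<and> sets M = sets borel \<and> (AE x in M. (0::real) < x) \<and>
     (\<forall>l\<ge>0. (\<integral>\<^sup>+x. ennreal (exp (- l * x)) \<partial>M) = ennreal (exp (- (l powr \<beta>))))"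
proof -
  obtain N where N: "\<And>n::nat. prob_space (N n)" "\<And>n. sets (N n) = sets borel" "\<And>n. AE x in N n. (0::real) < x"
    and low: "\<And>l n. l \<ge> 0 \<Longrightarrow> ennreal (1 - l powr \<beta>) \<le> (\<integral>\<^sup>+x. ennreal (exp (- l * x)) \<partial>N n)"
    and lim: "\<And>l. l \<ge> 0 \<Longrightarrow> (\<lambda>n. \<integral>\<^sup>+x. ennreal (exp (- l * x)) \<partial>N n) \<longlonglongrightarrow> ennreal (exp (- (l powr \<beta>)))"
    using stable_approx[OF b] by blast
  note [measurable_cong] = N(2)
  have rd: "real_distribution (N n)" for n using N by (simp add: real_distribution_def real_distribution_axioms_def)
  have tight: "tight N"
    unfolding tight_def proof (intro conjI allI impI rd)
    fix e :: real assume e: "0 < e"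
    \<comment> \<open>At l = 1/R the lower bound equals 1 - e/4, while exp(-x/R) is at most 1/2 for
      x > R; hence the mass up to R is at least 1 - e/2.\<close>
    define R where "R = (4 / e) powr (1 / \<beta>)"
    have R: "0 < R" using e by (simp add: R_def)
    have Rb: "(1 / R) powr \<beta> = e / 4" using e b by (simp add: R_def powr_divide powr_powr)
    have "measure (N n) {-1<..R} > 1 - e" for n proof -
      interpret prob_space "N n" by (rule N)
      have int: "integrable (N n) (\<lambda>x. exp (- (1 / R) * max x 0))"
        by (rule integrable_const_bound[of _ 1]) (use R in \<open>auto simp: divide_nonneg_pos\<close>)
      have "ennreal (1 - e / 4) \<le> (\<integral>\<^sup>+x. ennreal (exp (- (1 / R) * x)) \<partial>N n)" using low[of "1 / R" n] R Rb by simp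
      also have "\<dots> = (\<integral>\<^sup>+x. ennreal (exp (- (1 / R) * max x 0)) \<partial>N n)"
        by (rule nn_integral_cong_AE, use N(3)[of n] in eventually_elim) (auto simp: max_def)
      also have "\<dots> = ennreal (\<integral>x. exp (- (1 / R) * max x 0) \<partial>N n)" by (rule nn_integral_eq_integral[OF int]) auto
      finally have 1: "1 - e / 4 \<le> (\<integral>x. exp (- (1 / R) * max x 0) \<partial>N n)"
        by (subst (asm) ennreal_le_iff) (auto intro!: integral_nonneg_AE)
      have "(\<integral>x. exp (- (1 / R) * max x 0) \<partial>N n) \<le> (\<integral>x. 1 / 2 + 1 / 2 * indicator {-1<..R} x \<partial>N n)"
      proof (rule integral_mono_AE[OF int])
        show "AE x in N n. exp (- (1 / R) * max x 0) \<le> 1 / 2 + 1 / 2 * indicator {-1<..R} x" using N(3)[of n] proof eventually_elim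
          case (elim x)
          show ?case proof (cases "x \<le> R")
            case False
            then have "exp (- (1 / R) * max x 0) \<le> exp (- 1)" using R by (simp add: field_simps)
            also have "\<dots> \<le> 1 / 2" using exp_ge_add_one_self[of 1] by (simp add: exp_minus field_simps)
            finally show ?thesis using False by simp
          qed (use elim R in auto)
        qed
        show "integrable (N n) (\<lambda>x. 1 / 2 + 1 / 2 * indicator {-1<..R} x :: real)"
          by (rule integrable_const_bound[of _ 1]) (auto simp: indicator_def)
      qed
      also have "\<dots> = 1 / 2 + 1 / 2 * measure (N n) {-1<..R}" proof -
        have "integrable (N n) (indicator {-1<..R} :: real \<Rightarrow> real)" by (rule integrable_const_bound[of _ 1]) auto
        then show ?thesis by (subst Bochner_Integration.integral_add) (auto simp: prob_space N)
      qed
      finally show ?thesis using 1 e by simp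
    qed
    then show "\<exists>a b. a < b \<and> (\<forall>n. 1 - e < measure (N n) {a<..b})" using R by (intro exI[of _ "-1"] exI[of _ R]) auto
  qed
  obtain r M where r: "strict_mono (r::nat\<Rightarrow>nat)" and M: "real_distribution M" and wc: "weak_conv_m (N \<circ> id \<circ> r) M"
    using tight_imp_convergent_subsubsequence[OF tight, of id] by (auto simp: strict_mono_def)
  interpret M: real_distribution M by fact
  have conv: "(\<lambda>n. \<integral>x. f x \<partial>N (r n)) \<longlonglongrightarrow> (\<integral>x. f x \<partial>M)" if "\<And>x. isCont f x" "\<And>x. norm (f x) \<le> B" for f :: "real \<Rightarrow> real" and B
  proof -
    have "(\<lambda>n. integral\<^sup>L ((N \<circ> id \<circ> r) n) f) \<longlonglongrightarrow> integral\<^sup>L M f"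
      by (rule weak_conv_imp_integral_bdd_continuous_conv[OF _ M wc that]) (simp add: rd)
    then show ?thesis by simp
  qed
  have neg: "AE x in M. 0 \<le> x" proof -
    \<comment> \<open>Bounded continuous test function, positive exactly on the negative
      half-line.\<close>
    let ?f = "\<lambda>x::real. min 1 (max 0 (- x))"
    have "(\<integral>x. ?f x \<partial>N n) = 0" for n proof -
      have "(\<integral>x. ?f x \<partial>N n) = (\<integral>x. 0 \<partial>N n)"
        by (rule integral_cong_AE) (use N(3)[of n] in \<open>auto elim!: eventually_mono\<close>)
      then show ?thesis by simp
    qed
    moreover have "(\<lambda>n. \<integral>x. ?f x \<partial>N (r n)) \<longlonglongrightarrow> (\<integral>x. ?f x \<partial>M)"
      by (rule conv[of _ 1]) (auto intro!: continuous_intros)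
    ultimately have "(\<integral>x. ?f x \<partial>M) = 0" using LIMSEQ_unique[OF tendsto_const[of 0]] by simp
    then have "AE x in M. ?f x = 0" by (subst (asm) integral_nonneg_eq_0_iff_AE) (auto intro!: M.integrable_const_bound[of _ 1])
    then show ?thesis by eventually_elim (auto simp: min_def max_def split: if_splits)
  qed
  have lap: "(\<integral>\<^sup>+x. ennreal (exp (- l * x)) \<partial>M) = ennreal (exp (- (l powr \<beta>)))" if l: "0 \<le> l" for l proof -
    \<comment> \<open>The truncation \<open>max x 0\<close> makes the integrand bounded on the whole
      line; almost surely it changes nothing.\<close>
    let ?f = "\<lambda>x::real. exp (- l * max x 0)"
    have i: "(\<integral>\<^sup>+x. ennreal (exp (- l * x)) \<partial>L) = ennreal (\<integral>x. ?f x \<partial>L)"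
      if "prob_space L" "sets L = sets borel" "AE x in L. 0 \<le> x" for L proof -
      interpret L: prob_space L by fact
      note [measurable_cong] = that(2)
      have "integrable L ?f" by (rule L.integrable_const_bound[of _ 1]) (use l in auto)
      then have "(\<integral>\<^sup>+x. ennreal (?f x) \<partial>L) = ennreal (\<integral>x. ?f x \<partial>L)" by (rule nn_integral_eq_integral) auto
      moreover have "(\<integral>\<^sup>+x. ennreal (exp (- l * x)) \<partial>L) = (\<integral>\<^sup>+x. ennreal (?f x) \<partial>L)"
        by (rule nn_integral_cong_AE, use that(3) in eventually_elim) (auto simp: max_def)
      ultimately show ?thesis by simp
    qed
    have "(\<lambda>n. \<integral>x. ?f x \<partial>N (r n)) \<longlonglongrightarrow> (\<integral>x. ?f x \<partial>M)"
      by (rule conv[of _ 1]) (use l in \<open>auto intro!: continuous_intros\<close>)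
    then have "(\<lambda>n. ennreal (\<integral>x. ?f x \<partial>N (r n))) \<longlonglongrightarrow> ennreal (\<integral>x. ?f x \<partial>M)"
      by (rule tendsto_ennrealI)
    moreover have "ennreal (\<integral>x. ?f x \<partial>N (r n)) = (\<integral>\<^sup>+x. ennreal (exp (- l * x)) \<partial>N (r n))" for n
      by (rule i[symmetric]) (use N(1,2) N(3)[of "r n"] in \<open>auto elim: eventually_mono\<close>)
    ultimately have "(\<lambda>n. \<integral>\<^sup>+x. ennreal (exp (- l * x)) \<partial>N (r n)) \<longlonglongrightarrow> ennreal (\<integral>x. ?f x \<partial>M)" by (simp only:)
    moreover have "(\<lambda>n. \<integral>\<^sup>+x. ennreal (exp (- l * x)) \<partial>N (r n)) \<longlonglongrightarrow> ennreal (exp (- (l powr \<beta>)))"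
      using LIMSEQ_subseq_LIMSEQ[OF lim[OF l] r] by (simp add: o_def)
    ultimately have "ennreal (\<integral>x. ?f x \<partial>M) = ennreal (exp (- (l powr \<beta>)))" by (rule LIMSEQ_unique)
    then show ?thesis using i[of M] neg M.prob_space_axioms by simp
  qed
  \<comment> \<open>An atom at 0 would keep the Laplace transform above its mass for all l, but
    exp(-(l powr \<beta>)) tends to 0.\<close>
  have pos: "AE x in M. 0 < x" proof -
    have le: "emeasure M {0} \<le> ennreal (exp (- (real n powr \<beta>)))" for n :: nat proof -
      have "emeasure M {0} = (\<integral>\<^sup>+x. indicator {0} x \<partial>M)" by simp
      also have "\<dots> \<le> (\<integral>\<^sup>+x. ennreal (exp (- real n * x)) \<partial>M)"
        by (intro nn_integral_mono) (auto simp: indicator_def)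
      finally show ?thesis using lap[of "real n"] by simp
    qed
    have "(\<lambda>n. ennreal (exp (- (real n powr \<beta>)))) \<longlonglongrightarrow> ennreal 0" using b by (intro tendsto_ennrealI) real_asymp
    then have "emeasure M {0} \<le> ennreal 0" by (rule LIMSEQ_le_const) (use le in auto)
    then have "AE x in M. x \<notin> {0}" by (intro AE_not_in) (auto simp: null_sets_def)
    with neg show ?thesis by eventually_elim auto
  qed
  show ?thesis using lap pos M.prob_space_axioms by (intro exI[of _ M]) auto
qed

text \<open>As \<beta> > 1/2, the power l powr \<beta> dominates the square root, and the integrand
  is eventually below l powr (-2).\<close>

lemma exp_sqrt_integral_finite:
  assumes "1 / 2 < \<beta>" "0 \<le> c"
  shows "(\<integral>\<^sup>+l. ennreal (exp (2 * sqrt (c * l) - l powr \<beta>)) * indicator {0..} l \<partial>lborel) < \<infinity>"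
proof -
  have "((\<lambda>l. exp (2 * sqrt (c * l) - l powr \<beta>) * l powr 2) \<longlongrightarrow> 0) at_top" proof (cases "c = 0")
    case True
    then show ?thesis using assms by simp real_asymp
  next
    case False
    then show ?thesis using assms by real_asymp
  qed
  then have "\<forall>\<^sub>F l in at_top. exp (2 * sqrt (c * l) - l powr \<beta>) * l powr 2 < 1" by (rule order_tendstoD) simp
  then obtain A where A: "\<And>l. l \<ge> A \<Longrightarrow> exp (2 * sqrt (c * l) - l powr \<beta>) * l powr 2 < 1"
    by (auto simp: eventually_at_top_linorder)
  define B where "B = max A 1"
  have B: "B \<ge> 1" by (simp add: B_def)
  have "(\<integral>\<^sup>+l. ennreal (exp (2 * sqrt (c * l) - l powr \<beta>)) * indicator {0..} l \<partial>lborel)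
     \<le> (\<integral>\<^sup>+l. ennreal (exp (2 * sqrt (c * B))) * indicator {0..B} l + ennreal (1 * l powr (- 1 - 1)) * indicator {B..} l \<partial>lborel)"
  proof (intro nn_integral_mono)
    fix l :: real
    show "ennreal (exp (2 * sqrt (c * l) - l powr \<beta>)) * indicator {0..} l \<le>
       ennreal (exp (2 * sqrt (c * B))) * indicator {0..B} l + ennreal (1 * l powr (- 1 - 1)) * indicator {B..} l"
    proof (cases "l < B")
      case True
      show ?thesis proof (cases "0 \<le> l")
        case l: True
        have "sqrt (c * l) \<le> sqrt (c * B)" using True assms by (intro real_sqrt_le_mono mult_left_mono) auto
        then have "2 * sqrt (c * l) - l powr \<beta> \<le> 2 * sqrt (c * B)" using powr_ge_zero[of l \<beta>] by linarith
        then show ?thesis using l True by (auto intro!: ennreal_leI)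
      qed auto
    next
      case False
      then have l: "l \<ge> 1" "l \<ge> A" using B by (auto simp: B_def)
      have "exp (2 * sqrt (c * l) - l powr \<beta>) \<le> l powr (- 1 - 1)" using A[OF l(2)] l by (simp add: powr_minus field_simps)
      then have "ennreal (exp (2 * sqrt (c * l) - l powr \<beta>)) \<le> ennreal (1 * l powr (- 1 - 1))" by (intro ennreal_leI) simp
      then show ?thesis using False B l by (auto simp: indicator_def intro: order_trans add_increasing)
    qed
  qed
  also have "\<dots> = ennreal (exp (2 * sqrt (c * B))) * ennreal B + ennreal (B powr (- 1))" using nn_integral_powr_tail[of B 1] B
    by (subst nn_integral_add) (auto simp: nn_integral_cmult)
  also have "\<dots> < \<infinity>" by (simp add: ennreal_mult_less_top)
  finally show ?thesis .
qed

text \<open>The exponent 2 sqrt(c l) - l s is maximal at l = c/s^2 with value c/s, and on the window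
  of length 1/s to the right of that point it is still at least c/s - 1. For s < 1 this window is
  longer than 1, which bounds exp(c/s) by a superposition of Laplace integrands.\<close>

lemma exp_div_le_laplace:
  fixes c s :: real
  assumes c: "0 \<le> c" and s: "0 < s"
  shows "ennreal (exp (c / s)) \<le> ennreal (exp c) +
     ennreal (exp 1) * (\<integral>\<^sup>+l. ennreal (exp (2 * sqrt (c * l)) * exp (- l * s)) * indicator {0..} l \<partial>lborel)"
proof (cases "1 \<le> s")
  case True
  have "exp (c / s) \<le> exp c" using True c s by (simp add: field_simps mult_le_cancel_left1)
  then have "ennreal (exp (c / s)) \<le> ennreal (exp c)" by (rule ennreal_leI)
  then show ?thesis by (rule order_trans) simp
next
  case False
  let ?a = "c / s\<^sup>2"
  have a0: "0 \<le> ?a" using c by simp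
  have "ennreal (exp (c / s)) \<le> ennreal (1 / s) * ennreal (exp (c / s))"
    using False s mult_right_mono[of 1 "1 / s" "exp (c / s)"] by (auto simp flip: ennreal_mult intro!: ennreal_leI)
  also have "\<dots> = ennreal (exp 1) * (\<integral>\<^sup>+l. ennreal (exp (c / s - 1)) * indicator {?a..?a + 1 / s} l \<partial>lborel)"
    using s by (simp add: nn_integral_cmult mult_ac exp_diff flip: ennreal_mult mult.assoc)
  also have "\<dots> \<le> ennreal (exp 1) * (\<integral>\<^sup>+l. ennreal (exp (2 * sqrt (c * l)) * exp (- l * s)) * indicator {0..} l \<partial>lborel)"
  proof (intro mult_left_mono nn_integral_mono)
    fix l :: real
    show "ennreal (exp (c / s - 1)) * indicator {?a..?a + 1 / s} l \<le> ennreal (exp (2 * sqrt (c * l)) * exp (- l * s)) * indicator {0..} l"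
    proof (cases "l \<in> {?a..?a + 1 / s}")
      case True
      then have l: "?a \<le> l" "l \<le> ?a + 1 / s" "0 \<le> l" using a0 by auto
      have "(c / s)\<^sup>2 \<le> c * l" using mult_left_mono[OF l(1) c] by (simp add: power_divide power2_eq_square)
      then have "c / s \<le> sqrt (c * l)" by (rule real_le_rsqrt)
      moreover have "l * s \<le> c / s + 1" using mult_right_mono[OF l(2), of s] s by (simp add: distrib_right power2_eq_square)
      ultimately have "c / s - 1 \<le> 2 * sqrt (c * l) + - l * s" by simp
      then have "exp (c / s - 1) \<le> exp (2 * sqrt (c * l)) * exp (- l * s)" by (simp only: exp_add[symmetric] exp_le_cancel_iff)
      then show ?thesis using True l by (auto intro!: ennreal_leI)
    qed auto
  qed auto
  finally show ?thesis by (rule order_trans) simp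
qed

text \<open>Integrating \<open>exp_div_le_laplace\<close> turns exp(c/x) into the integral of exp(2
  sqrt(c l) - l powr \<beta>), finite for \<beta> > 1/2. These moments will pay both for complex
  shifts and for negative powers of the mixing variable. For \<beta> = 1 the law is the point mass
  at 1.\<close>

lemma stable_subordinator:
  assumes b: "1 / 2 < \<beta>" "\<beta> \<le> 1"
  shows "\<exists>M. prob_space M \<and> sets M = sets borel \<and> (AE x in M. (0::real) < x) \<and>
     (\<forall>l\<ge>0. (\<integral>\<^sup>+x. ennreal (exp (- l * x)) \<partial>M) = ennreal (exp (- (l powr \<beta>)))) \<and>
     (\<forall>c\<ge>0. (\<integral>\<^sup>+x. ennreal (exp (c / x)) \<partial>M) < \<infinity>)"
proof (cases "\<beta> = 1")
  case True
  show ?thesis by (rule exI[of _ "return borel (1::real)"]) (auto simp: True prob_space_return nn_integral_return AE_return)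
next
  case False
  with b obtain M where M: "prob_space M" "sets M = sets borel" "AE x in M. (0::real) < x"
    and lap: "\<And>l. l \<ge> 0 \<Longrightarrow> (\<integral>\<^sup>+x. ennreal (exp (- l * x)) \<partial>M) = ennreal (exp (- (l powr \<beta>)))"
    using stable_exists[of \<beta>] by auto
  interpret prob_space M by fact
  note [measurable_cong] = M(2)
  interpret pair_sigma_finite M lborel by standard
  have "(\<integral>\<^sup>+x. ennreal (exp (c / x)) \<partial>M) < \<infinity>" if c: "0 \<le> c" for c proof -
    have "(\<integral>\<^sup>+x. ennreal (exp (c / x)) \<partial>M) \<le> (\<integral>\<^sup>+x. ennreal (exp c) +
     ennreal (exp 1) * (\<integral>\<^sup>+l. ennreal (exp (2 * sqrt (c * l)) * exp (- l * x)) * indicator {0..} l \<partial>lborel) \<partial>M)"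
      by (rule nn_integral_mono_AE, use M(3) in eventually_elim) (rule exp_div_le_laplace[OF c])
    also have "\<dots> = ennreal (exp c) + ennreal (exp 1) * (\<integral>\<^sup>+x. (\<integral>\<^sup>+l. ennreal (exp (2 * sqrt (c * l)) * exp (- l * x)) * indicator {0..} l \<partial>lborel) \<partial>M)"
      by (subst nn_integral_add) (auto simp: nn_integral_cmult emeasure_space_1)
    also have "(\<integral>\<^sup>+x. (\<integral>\<^sup>+l. ennreal (exp (2 * sqrt (c * l)) * exp (- l * x)) * indicator {0..} l \<partial>lborel) \<partial>M)
      = (\<integral>\<^sup>+l. (\<integral>\<^sup>+x. ennreal (exp (2 * sqrt (c * l)) * exp (- l * x)) * indicator {0..} l \<partial>M) \<partial>lborel)"
      by (rule Fubini'[symmetric]) measurable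
    also have "\<dots> = (\<integral>\<^sup>+l. ennreal (exp (2 * sqrt (c * l) - l powr \<beta>)) * indicator {0..} l \<partial>lborel)"
    proof (rule nn_integral_cong)
      fix l :: real
      show "(\<integral>\<^sup>+x. ennreal (exp (2 * sqrt (c * l)) * exp (- l * x)) * indicator {0..} l \<partial>M) = ennreal (exp (2 * sqrt (c * l) - l powr \<beta>)) * indicator {0..} l"
      proof (cases "0 \<le> l")
        case True
        have "(\<integral>\<^sup>+x. ennreal (exp (2 * sqrt (c * l)) * exp (- l * x)) * indicator {0..} l \<partial>M)
          = ennreal (exp (2 * sqrt (c * l))) * (\<integral>\<^sup>+x. ennreal (exp (- l * x)) \<partial>M)"
          using True by (subst nn_integral_cmult[symmetric]) (auto simp: ennreal_mult')
        also have "\<dots> = ennreal (exp (2 * sqrt (c * l) - l powr \<beta>)) * indicator {0..} l"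
          using True by (subst lap[OF True]) (simp add: exp_diff exp_minus divide_inverse flip: ennreal_mult)
        finally show ?thesis .
      qed simp
    qed
    finally show ?thesis using exp_sqrt_integral_finite[OF b(1) c] by (auto simp: ennreal_mult_less_top intro: le_less_trans)
  qed
  then show ?thesis using M lap by (intro exI[of _ M]) auto
qed

section \<open>Integrals depending on a parameter\<close>

lemma has_derivative_lebesgue_integral:
  fixes f :: "'a::{real_normed_vector, perfect_space} \<Rightarrow> 'w \<Rightarrow> 'b::{banach, second_countable_topology}"
  assumes r: "0 < r"
    and int: "\<And>s. s \<in> ball s0 r \<Longrightarrow> integrable M (f s)"
    and der: "\<And>s w. s \<in> ball s0 r \<Longrightarrow> w \<in> space M \<Longrightarrow> ((\<lambda>s. f s w) has_derivative f' s w) (at s)"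
    and bd: "\<And>s w h. s \<in> ball s0 r \<Longrightarrow> w \<in> space M \<Longrightarrow> norm (f' s w h) \<le> B w * norm h"
    and B: "integrable M B"
  shows "\<And>h. integrable M (\<lambda>w. f' s0 w h)"
    and "((\<lambda>s. \<integral>w. f s w \<partial>M) has_derivative (\<lambda>h. \<integral>w. f' s0 w h \<partial>M)) (at s0)"
proof -
  have s0: "s0 \<in> ball s0 r" using r by simp
  note lin = der[OF s0, THEN has_derivative_bounded_linear]
  \<comment> \<open>Mean value inequality on the ball: the remainder divided by the increment is at
    most 2 B, which becomes the majorant for dominated convergence.\<close>
  have quot: "norm (f (s0 + h) w - f s0 w - f' s0 w h) \<le> 2 * B w * norm h" if w: "w \<in> space M" and h: "norm h < r" for w h proof -
    have "norm (f (s0 + h) w - f s0 w) \<le> B w * norm (s0 + h - s0)" proof (rule differentiable_bound[of "ball s0 r"])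
      show "((\<lambda>s. f s w) has_derivative f' s w) (at s within ball s0 r)" if "s \<in> ball s0 r" for s
        using der[OF that w] by (rule has_derivative_at_withinI)
      show "onorm (f' s w) \<le> B w" if "s \<in> ball s0 r" for s by (rule onorm_le) (use bd[OF that w] in auto)
    qed (use h r in \<open>auto simp: dist_norm\<close>)
    then show ?thesis using norm_triangle_ineq4[of "f (s0 + h) w - f s0 w" "f' s0 w h"] bd[OF s0 w, of h] by simp
  qed
  \<comment> \<open>The derivative is a limit of difference quotients with steps 1/(n + N + 1),
    where N is so large that all arguments stay in the ball; its measurability follows.\<close>
  have meas: "(\<lambda>w. f' s0 w h) \<in> borel_measurable M" for h proof -
    obtain N :: nat where N: "norm h / r < real N" using reals_Archimedean2 by blast
    let ?t = "\<lambda>n. 1 / real (n + Suc N)"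
    have hn: "norm (?t n *\<^sub>R h) < r" for n proof -
      have "norm h < r * real N" using N r by (simp add: field_simps)
      also have "\<dots> \<le> r * real (n + Suc N)" using r by simp
      finally show ?thesis by (simp add: field_simps)
    qed
    show ?thesis proof (rule borel_measurable_LIMSEQ_metric)
      show "(\<lambda>w. real (n + Suc N) *\<^sub>R (f (s0 + ?t n *\<^sub>R h) w - f s0 w)) \<in> borel_measurable M" for n
        using int[of "s0 + ?t n *\<^sub>R h"] int[OF s0] hn[of n] by (auto simp: dist_norm intro!: borel_measurable_scaleR borel_measurable_diff)
      fix w assume w: "w \<in> space M"
      have "((\<lambda>t. f (s0 + t *\<^sub>R h) w) has_derivative (\<lambda>t. f' s0 w (t *\<^sub>R h))) (at (0::real))"
        by (rule has_derivative_compose[of "\<lambda>t. s0 + t *\<^sub>R h" _ _ _ "\<lambda>s. f s w"])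
           (auto intro!: derivative_eq_intros der[OF s0 w])
      then have "((\<lambda>t. norm (f (s0 + t *\<^sub>R h) w - f s0 w - f' s0 w (t *\<^sub>R h)) / norm t) \<longlongrightarrow> 0) (at (0::real))"
        by (simp add: has_derivative_at)
      moreover have "filterlim ?t (at 0) sequentially" proof (rule filterlim_atI)
        show "?t \<longlonglongrightarrow> 0"
          using LIMSEQ_ignore_initial_segment[OF LIMSEQ_inverse_real_of_nat, of N] by (simp add: inverse_eq_divide)
      qed simp
      ultimately have "(\<lambda>n. norm (f (s0 + ?t n *\<^sub>R h) w - f s0 w - f' s0 w (?t n *\<^sub>R h)) / norm (?t n)) \<longlonglongrightarrow> 0"
        by (rule filterlim_compose)
      moreover have "norm (f (s0 + ?t n *\<^sub>R h) w - f s0 w - f' s0 w (?t n *\<^sub>R h)) / norm (?t n)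
         = norm (real (n + Suc N) *\<^sub>R (f (s0 + ?t n *\<^sub>R h) w - f s0 w) - f' s0 w h)" for n
      proof -
        have "f' s0 w h = real (n + Suc N) *\<^sub>R f' s0 w (?t n *\<^sub>R h)"
          by (subst linear_cmul[OF bounded_linear.linear[OF lin[OF w]], symmetric]) simp
        then have "real (n + Suc N) *\<^sub>R (f (s0 + ?t n *\<^sub>R h) w - f s0 w) - f' s0 w h
           = real (n + Suc N) *\<^sub>R (f (s0 + ?t n *\<^sub>R h) w - f s0 w - f' s0 w (?t n *\<^sub>R h))"
          by (simp only: scaleR_diff_right)
        moreover have "X / norm (1 / real (n + Suc N)) = norm (real (n + Suc N)) * X" for X :: real by simp
        ultimately show ?thesis by (simp only: norm_scaleR real_norm_def)
      qed
      ultimately show "(\<lambda>n. real (n + Suc N) *\<^sub>R (f (s0 + ?t n *\<^sub>R h) w - f s0 w)) \<longlonglongrightarrow> f' s0 w h"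
        by (simp only: tendsto_norm_zero_iff LIM_zero_iff)
    qed
  qed
  show int': "integrable M (\<lambda>w. f' s0 w h)" for h proof (rule Bochner_Integration.integrable_bound[of M "\<lambda>w. B w * norm h"])
    show "AE w in M. norm (f' s0 w h) \<le> norm (B w * norm h)" proof (rule AE_I2)
      fix w assume "w \<in> space M"
      from bd[OF s0 this, of h] show "norm (f' s0 w h) \<le> norm (B w * norm h)" by (simp add: abs_le_iff)
    qed
  qed (use B meas in auto)
  have bl: "bounded_linear (\<lambda>h. \<integral>w. f' s0 w h \<partial>M)" proof (rule bounded_linear_intro[of _ "\<integral>w. B w \<partial>M"])
    show "(\<integral>w. f' s0 w (x + y) \<partial>M) = (\<integral>w. f' s0 w x \<partial>M) + (\<integral>w. f' s0 w y \<partial>M)" for x y proof -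
      have "(\<integral>w. f' s0 w (x + y) \<partial>M) = (\<integral>w. f' s0 w x + f' s0 w y \<partial>M)"
        by (rule Bochner_Integration.integral_cong) (auto simp: linear_add[OF bounded_linear.linear[OF lin]])
      then show ?thesis by (simp add: int')
    qed
    show "(\<integral>w. f' s0 w (c *\<^sub>R x) \<partial>M) = c *\<^sub>R (\<integral>w. f' s0 w x \<partial>M)" for x c proof -
      have "(\<integral>w. f' s0 w (c *\<^sub>R x) \<partial>M) = (\<integral>w. c *\<^sub>R f' s0 w x \<partial>M)"
        by (rule Bochner_Integration.integral_cong) (auto simp: linear_cmul[OF bounded_linear.linear[OF lin]])
      then show ?thesis by simp
    qed
    show "norm (\<integral>w. f' s0 w x \<partial>M) \<le> norm x * (\<integral>w. B w \<partial>M)" for x proof -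
      have "norm (\<integral>w. f' s0 w x \<partial>M) \<le> (\<integral>w. B w * norm x \<partial>M)"
        by (rule order_trans[OF integral_norm_bound integral_mono]) (use int' B bd[OF s0] in auto)
      then show ?thesis by (simp add: mult.commute)
    qed
  qed
  show "((\<lambda>s. \<integral>w. f s w \<partial>M) has_derivative (\<lambda>h. \<integral>w. f' s0 w h \<partial>M)) (at s0)"
    unfolding has_derivative_at tendsto_at_iff_sequentially proof (intro conjI bl allI impI)
    fix X assume X: "\<forall>i. X i \<in> UNIV - {0::'a}" "X \<longlonglongrightarrow> 0"
    let ?g = "\<lambda>h w. (f (s0 + h) w - f s0 w - f' s0 w h) /\<^sub>R norm h"
    have ev: "\<forall>\<^sub>F n in sequentially. norm (X n) < r" using order_tendstoD(2)[OF tendsto_norm_zero[OF X(2)] r] .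
    then obtain N where N0: "\<forall>n\<ge>N. norm (X n) < r"
      unfolding eventually_sequentially by blast
    have N: "norm (X (n + N)) < r" for n using N0 by simp
    have sp: "s0 + X (n + N) \<in> ball s0 r" for n using N[of n] by (simp add: dist_norm)
    have lim: "(\<lambda>n. \<integral>w. ?g (X (n + N)) w \<partial>M) \<longlonglongrightarrow> (\<integral>w. 0 \<partial>M)"
    proof (rule integral_dominated_convergence[where w = "\<lambda>w. 2 * B w"])
      show "integrable M (\<lambda>w. 2 * B w)" using B by simp
      show "?g (X (n + N)) \<in> borel_measurable M" for n
        using int[OF sp[of n]] int[OF s0] meas by (auto intro!: borel_measurable_scaleR borel_measurable_diff)
      show "AE w in M. norm (?g (X (n + N)) w) \<le> 2 * B w" for n proof (rule AE_I2)
        fix w assume "w \<in> space M"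
        moreover have "norm (X (n + N)) > 0" using X(1) by simp
        ultimately show "norm (?g (X (n + N)) w) \<le> 2 * B w"
          using quot[OF _ N[of n], of w] by (simp only: norm_scaleR) (simp add: divide_simps mult.commute)
      qed
      show "AE w in M. (\<lambda>n. ?g (X (n + N)) w) \<longlonglongrightarrow> 0" proof (rule AE_I2)
        fix w assume w: "w \<in> space M"
        have "((\<lambda>h. norm (f (s0 + h) w - f s0 w - f' s0 w h) / norm h) \<longlongrightarrow> 0) (at 0)"
          using der[OF s0 w] by (simp add: has_derivative_at)
        then have "((\<lambda>h. norm (f (s0 + h) w - f s0 w - f' s0 w h) / norm h) \<circ> X) \<longlonglongrightarrow> 0"
          using X unfolding tendsto_at_iff_sequentially by blast
        then have "(\<lambda>n. norm (?g (X n) w)) \<longlonglongrightarrow> 0" by (simp add: o_def divide_inverse mult.commute)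
        then show "(\<lambda>n. ?g (X (n + N)) w) \<longlonglongrightarrow> 0"
          unfolding tendsto_norm_zero_iff by (rule LIMSEQ_ignore_initial_segment)
      qed
    qed auto
    have "(\<integral>w. ?g (X (n + N)) w \<partial>M) = ((\<integral>w. f (s0 + X (n + N)) w \<partial>M) - (\<integral>w. f s0 w \<partial>M) - (\<integral>w. f' s0 w (X (n + N)) \<partial>M)) /\<^sub>R norm (X (n + N))" for n
      by (simp add: int[OF sp] int[OF s0] int')
    from lim[unfolded this Bochner_Integration.integral_zero] have "(\<lambda>n. norm (((\<integral>w. f (s0 + X (n + N)) w \<partial>M) - (\<integral>w. f s0 w \<partial>M) - (\<integral>w. f' s0 w (X (n + N)) \<partial>M)) /\<^sub>R norm (X (n + N)))) \<longlonglongrightarrow> 0"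
      by (rule tendsto_norm_zero)
    then show "((\<lambda>h. norm ((\<integral>w. f (s0 + h) w \<partial>M) - (\<integral>w. f s0 w \<partial>M) - (\<integral>w. f' s0 w h \<partial>M)) / norm h) \<circ> X) \<longlonglongrightarrow> 0"
      by (rule_tac LIMSEQ_offset[of _ N]) (simp add: o_def divide_inverse mult.commute)
  qed
qed

lemma has_vector_derivative_lebesgue_integral:
  fixes f :: "real \<Rightarrow> 'w \<Rightarrow> 'b::{banach, second_countable_topology}"
  assumes r: "0 < r"
    and int: "\<And>s. s \<in> ball s0 r \<Longrightarrow> integrable M (f s)"
    and der: "\<And>s w. s \<in> ball s0 r \<Longrightarrow> w \<in> space M \<Longrightarrow> ((\<lambda>s. f s w) has_vector_derivative f' s w) (at s)"
    and bd: "\<And>s w. s \<in> ball s0 r \<Longrightarrow> w \<in> space M \<Longrightarrow> norm (f' s w) \<le> B w"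
    and B: "integrable M B"
  shows "integrable M (f' s0)"
    and "((\<lambda>s. \<integral>w. f s w \<partial>M) has_vector_derivative (\<integral>w. f' s0 w \<partial>M)) (at s0)"
proof -
  note * = has_derivative_lebesgue_integral[OF r int, where f' = "\<lambda>s w h. h *\<^sub>R f' s w" and B = B, OF _ _ _ B]
  have d: "((\<lambda>s. f s w) has_derivative (\<lambda>h. h *\<^sub>R f' s w)) (at s)" if "s \<in> ball s0 r" "w \<in> space M" for s w
    using der[OF that] by (simp add: has_vector_derivative_def)
  have e: "norm (h *\<^sub>R f' s w) \<le> B w * norm h" if "s \<in> ball s0 r" "w \<in> space M" for s w and h :: real
    using mult_right_mono[OF bd[OF that], of "\<bar>h\<bar>"] by (simp add: mult.commute)
  show "integrable M (f' s0)" using *(1)[OF _ d e, of s0 1] by simp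
  then show "((\<lambda>s. \<integral>w. f s w \<partial>M) has_vector_derivative (\<integral>w. f' s0 w \<partial>M)) (at s0)"
    using *(2)[OF _ d e] by (simp add: has_vector_derivative_def)
qed

text \<open>Domination of the functions passes to their derivatives: Cauchy's inequality on discs of
  radius r turns the bound \<open>B w\<close> into \<open>B w / r\<close>.\<close>

lemma holomorphic_lebesgue_integral_strong:
  fixes f :: "complex \<Rightarrow> 'w \<Rightarrow> complex"
  assumes S: "open S"
    and hol: "\<And>w. w \<in> space M \<Longrightarrow> (\<lambda>z. f z w) holomorphic_on S"
    and meas: "\<And>z. z \<in> S \<Longrightarrow> f z \<in> borel_measurable M"
    and bd: "\<And>z w. z \<in> S \<Longrightarrow> w \<in> space M \<Longrightarrow> norm (f z w) \<le> B w"
    and B: "integrable M B"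
  shows "(\<lambda>z. \<integral>w. f z w \<partial>M) holomorphic_on S"
proof (rule holomorphic_onI)
  fix z0 assume "z0 \<in> S"
  then obtain e where e: "e > 0" "cball z0 e \<subseteq> S" using S open_contains_cball by blast
  \<comment> \<open>Half the radius, so that closed discs of radius r about points of
    \<open>ball z0 r\<close> stay in \<open>S\<close>.\<close>
  define r where "r = e / 2"
  have r: "r > 0" using e by (simp add: r_def)
  have sub: "cball s r \<subseteq> S" if "s \<in> ball z0 r" for s proof -
    have "cball s r \<subseteq> cball z0 e" proof
      fix x assume "x \<in> cball s r"
      then show "x \<in> cball z0 e" using that dist_triangle[of z0 x s] by (simp add: r_def)
    qed
    then show ?thesis using e by simp
  qed
  have int: "integrable M (f s)" if "s \<in> S" for s proof (rule Bochner_Integration.integrable_bound[OF B])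
    show "AE w in M. norm (f s w) \<le> norm (B w)" proof (rule AE_I2)
      fix w assume "w \<in> space M"
      from bd[OF that this] show "norm (f s w) \<le> norm (B w)" by simp
    qed
  qed (rule meas[OF that])
  have der: "((\<lambda>s. \<integral>w. f s w \<partial>M) has_derivative (\<lambda>h. \<integral>w. deriv (\<lambda>z. f z w) z0 * h \<partial>M)) (at z0)"
  proof (rule has_derivative_lebesgue_integral(2)[OF r, where f' = "\<lambda>s w h. deriv (\<lambda>z. f z w) s * h" and B = "\<lambda>w. B w / r"])
    fix s assume s: "s \<in> ball z0 r"
    then have sS: "s \<in> S" using sub[OF s] r by auto
    show "integrable M (f s)" by (rule int[OF sS])
    fix w assume w: "w \<in> space M"
    show "((\<lambda>s. f s w) has_derivative (\<lambda>h. deriv (\<lambda>z. f z w) s * h)) (at s)"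
      using holomorphic_derivI[OF hol[OF w] S sS] by (simp add: has_field_derivative_def)
    have "norm ((deriv ^^ 1) (\<lambda>z. f z w) s) \<le> fact 1 * B w / r ^ 1" proof (rule Cauchy_inequality)
      show "(\<lambda>z. f z w) holomorphic_on ball s r" using hol[OF w] sub[OF s] ball_subset_cball by (blast intro: holomorphic_on_subset)
      show "continuous_on (cball s r) (\<lambda>z. f z w)"
        using hol[OF w] sub[OF s] by (blast intro: holomorphic_on_imp_continuous_on holomorphic_on_subset)
      show "norm (f x w) \<le> B w" if "norm (s - x) = r" for x using bd[of x w] sub[OF s] that w by (auto simp: dist_norm subset_iff)
    qed (rule r)
    then show "norm (deriv (\<lambda>z. f z w) s * h) \<le> B w / r * norm h" for h
      using mult_right_mono[of "norm (deriv (\<lambda>z. f z w) s)" "B w / r" "norm h"] by (simp add: norm_mult)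
  qed (use B in auto)
  moreover have "(\<integral>w. deriv (\<lambda>z. f z w) z0 * h \<partial>M) = (\<integral>w. deriv (\<lambda>z. f z w) z0 \<partial>M) * h" for h
    by simp
  ultimately have "((\<lambda>s. \<integral>w. f s w \<partial>M) has_field_derivative (\<integral>w. deriv (\<lambda>z. f z w) z0 \<partial>M)) (at z0)"
    by (simp add: has_field_derivative_def)
  then show "(\<lambda>s. \<integral>w. f s w \<partial>M) field_differentiable at z0 within S"
    using field_differentiable_at_within field_differentiable_def by blast
qed

text \<open>The exceptional null set does not depend on z. Replacing the integrand by 0 on it makes
  the hypotheses hold for every w and leaves the integrals unchanged.\<close>

lemma holomorphic_lebesgue_integral:
  fixes f :: "complex \<Rightarrow> 'w \<Rightarrow> complex"
  assumes S: "open S"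
    and hol: "AE w in M. (\<lambda>z. f z w) holomorphic_on S \<and> (\<forall>z\<in>S. norm (f z w) \<le> B w)"
    and meas: "\<And>z. z \<in> S \<Longrightarrow> f z \<in> borel_measurable M"
    and B: "integrable M B"
  shows "(\<lambda>z. \<integral>w. f z w \<partial>M) holomorphic_on S"
proof -
  from hol obtain N where N: "N \<in> null_sets M"
    and g: "{w \<in> space M. \<not> ((\<lambda>z. f z w) holomorphic_on S \<and> (\<forall>z\<in>S. norm (f z w) \<le> B w))} \<subseteq> N"
    unfolding eventually_ae_filter by auto
  have [measurable]: "N \<in> sets M" using N by (rule null_setsD2)
  let ?f = "\<lambda>z w. if w \<in> N then 0 else f z w"
  have "(\<lambda>z. \<integral>w. ?f z w \<partial>M) holomorphic_on S"
  proof (rule holomorphic_lebesgue_integral_strong[OF S, where B = "\<lambda>w. \<bar>B w\<bar>"])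
    show "(\<lambda>z. ?f z w) holomorphic_on S" if "w \<in> space M" for w using g that by (cases "w \<in> N") auto
    show "?f z \<in> borel_measurable M" if "z \<in> S" for z using meas[OF that] by measurable
    show "norm (?f z w) \<le> \<bar>B w\<bar>" if "z \<in> S" "w \<in> space M" for z w proof (cases "w \<in> N")
      case False
      then have "norm (f z w) \<le> B w" using g that by blast
      then show ?thesis using False by simp
    qed simp
  qed (use B in auto)
  moreover have "(\<integral>w. ?f z w \<partial>M) = (\<integral>w. f z w \<partial>M)" if "z \<in> S" for z proof (rule integral_cong_AE)
    show "AE w in M. ?f z w = f z w" using AE_not_in[OF N] by eventually_elim auto
    show "?f z \<in> borel_measurable M" using meas[OF that] by measurable
  qed (use meas[OF that] in auto)
  ultimately show ?thesis by (rule holomorphic_transform)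
qed

lemma Basis_vec_real: "(Basis :: (real^'n) set) = range (\<lambda>i. axis i 1)"
  by (auto simp: Basis_vec_def)

lemma inj_axis1: "inj (\<lambda>i. axis i (1::real))"
  by (auto simp: inj_def axis_eq_axis)

text \<open>Lebesgue measure on \<open>real^'n\<close> is the image of the product measure over
  \<open>Basis\<close>, and \<open>Basis\<close> is indexed by the coordinates through
  \<open>axis\<close>.\<close>

lemma lborel_integral_vec_prod:
  fixes f :: "'n::finite \<Rightarrow> real \<Rightarrow> complex"
  assumes int: "\<And>i. integrable lborel (f i)"
  shows "integrable lborel (\<lambda>x::real^'n. \<Prod>i\<in>UNIV. f i (x $ i))"
    and "(LBINT x. (\<Prod>i\<in>UNIV. f i ((x::real^'n) $ i))) = (\<Prod>i\<in>UNIV. \<integral>x. f i x \<partial>lborel)"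
proof -
  let ?B = "Basis :: (real^'n) set"
  interpret product_sigma_finite "\<lambda>_::real^'n. lborel :: real measure" by standard
  define g where "g b = f (inv (\<lambda>i. axis i (1::real)) b)" for b :: "real^'n"
  have g: "g (axis i 1) = f i" for i by (simp add: g_def inv_f_f[OF inj_axis1])
  have ig: "integrable lborel (g b)" for b by (simp add: g_def int)
  have [measurable]: "f i \<in> borel_measurable borel" for i using int[of i] by (auto dest: borel_measurable_integrable)
  let ?S = "\<lambda>h::real^'n \<Rightarrow> real. (\<Sum>b\<in>?B. h b *\<^sub>R b)"
  have comp: "?S h $ i = h (axis i 1)" for h i proof -
    have "?S h $ i = (\<Sum>b\<in>?B. h b * (b $ i))" by simp
    also have "\<dots> = (\<Sum>j\<in>UNIV. h (axis j 1) * (axis j 1 $ i))"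
      unfolding Basis_vec_real by (subst sum.reindex[OF inj_axis1]) simp
    also have "\<dots> = (\<Sum>j\<in>UNIV. if j = i then h (axis i 1) else 0)" by (rule sum.cong) (auto simp: axis_def)
    finally show ?thesis by simp
  qed
  have pr: "(\<Prod>i\<in>UNIV. f i (?S h $ i)) = (\<Prod>b\<in>?B. g b (h b))" for h
    unfolding comp unfolding Basis_vec_real by (subst prod.reindex[OF inj_axis1]) (simp add: g)
  have m: "?S \<in> (\<Pi>\<^sub>M b\<in>?B. lborel) \<rightarrow>\<^sub>M borel" by measurable
  have mf: "(\<lambda>x::real^'n. \<Prod>i\<in>UNIV. f i (x $ i)) \<in> borel_measurable borel" by measurable
  have "integrable (\<Pi>\<^sub>M b\<in>?B. lborel) (\<lambda>h. \<Prod>b\<in>?B. g b (h b))" by (rule product_integrable_prod) (auto simp: ig)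
  then show "integrable lborel (\<lambda>x::real^'n. \<Prod>i\<in>UNIV. f i (x $ i))"
    by (subst lborel_eq, subst integrable_distr_eq[OF m mf]) (simp only: pr)
  have "(LBINT x. (\<Prod>i\<in>UNIV. f i ((x::real^'n) $ i))) = (\<integral>h. (\<Prod>b\<in>?B. g b (h b)) \<partial>(\<Pi>\<^sub>M b\<in>?B. lborel))"
    by (subst lborel_eq, subst integral_distr[OF m mf]) (simp only: pr)
  also have "\<dots> = (\<Prod>b\<in>?B. \<integral>x. g b x \<partial>lborel)" by (rule product_integral_prod) (auto simp: ig)
  also have "\<dots> = (\<Prod>i\<in>UNIV. \<integral>x. f i x \<partial>lborel)"
    unfolding Basis_vec_real by (subst prod.reindex[OF inj_axis1]) (simp add: g)
  finally show "(LBINT x. (\<Prod>i\<in>UNIV. f i ((x::real^'n) $ i))) = (\<Prod>i\<in>UNIV. \<integral>x. f i x \<partial>lborel)" .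
qed

section \<open>Gaussian kernels\<close>

definition hpoly :: "nat \<Rightarrow> real \<Rightarrow> complex \<Rightarrow> complex" where
  "hpoly a s z = (if a = 0 then 1 else if a = 1 then - z / (2 * of_real s)
     else if a = 2 then z\<^sup>2 / (4 * of_real s ^ 2) - 1 / (2 * of_real s)
     else - (z ^ 3) / (8 * of_real s ^ 3) + 3 * z / (4 * of_real s ^ 2))"

text \<open>For a \<le> 3 and s > 0 this is the a-th derivative of the one-dimensional heat kernel
  at time s, as an entire function; \<open>hpoly\<close> is its Hermite factor. Order 3 is the
  largest that occurs: \<nabla>K carries one derivative, and the projection adds two.\<close>

definition Dg :: "nat \<Rightarrow> real \<Rightarrow> complex \<Rightarrow> complex" where
  "Dg a s z = hpoly a s z * of_real (1 / sqrt (4 * pi * s)) * exp (- (z\<^sup>2) / of_real (4 * s))"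

definition g1 :: "real \<Rightarrow> real \<Rightarrow> real" where
  "g1 s x = exp (- (x\<^sup>2) / (4 * s)) / sqrt (4 * pi * s)"

lemma g1_normal: "0 < s \<Longrightarrow> g1 s = normal_density 0 (sqrt (2 * s))"
  by (rule ext) (simp add: g1_def normal_density_def)

lemma g1_nonneg[simp]: "0 < s \<Longrightarrow> 0 \<le> g1 s x" by (simp add: g1_def)

lemma g1_pos: "0 < s \<Longrightarrow> 0 < g1 s x" by (simp add: g1_def)

lemma integrable_g1: "0 < s \<Longrightarrow> integrable lborel (g1 s)"
  by (simp add: g1_normal)

lemma integral_g1: "0 < s \<Longrightarrow> (LBINT x. g1 s x) = 1"
  by (simp add: g1_normal)

lemma Dg_0: "Dg 0 s (of_real x) = of_real (g1 s x)"
  by (simp add: Dg_def g1_def hpoly_def exp_of_real[symmetric] )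

lemma Dg_holomorphic: "0 < s \<Longrightarrow> (Dg a s) holomorphic_on A"
  unfolding Dg_def[abs_def] hpoly_def by (cases "a = 0"; cases "a = 1"; cases "a = 2") (auto intro!: holomorphic_intros)

lemma Dg_measurable[measurable (raw)]:
  assumes [measurable]: "f \<in> borel_measurable M" "g \<in> borel_measurable M"
  shows "(\<lambda>w. Dg a (f w) (g w)) \<in> borel_measurable M"
  unfolding Dg_def hpoly_def by measurable

lemma Dg_deriv:
  assumes "0 < s" "a \<le> 2"
  shows "((\<lambda>x. Dg a s (of_real x)) has_vector_derivative Dg (Suc a) s (of_real x)) (at x)"
proof -
  have "(Dg a s has_field_derivative Dg (Suc a) s (of_real x)) (at (of_real x))" proof -
    have "a = 0 \<or> a = 1 \<or> a = 2" using assms by linarith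
    then show ?thesis
      unfolding Dg_def[abs_def] hpoly_def using assms
      by (elim disjE) (auto intro!: derivative_eq_intros simp: field_simps power2_eq_square power3_eq_cube)
  qed
  moreover have "(of_real has_vector_derivative (1::complex)) (at x)" using has_vector_derivative_of_real[OF DERIV_ident[of "at x"]] by simp
  ultimately show ?thesis by (auto dest: field_vector_diff_chain_at simp: o_def)
qed

lemma pow_le_exp:
  fixes y :: real assumes "0 \<le> y" "k \<le> 3" shows "y ^ k \<le> 1 + 2000 * exp (y\<^sup>2 / 32)"
proof -
  define t where "t = y\<^sup>2 / 32"
  have t: "0 \<le> t" by (simp add: t_def)
  have "1 + t + t\<^sup>2 / 2 \<le> exp t" using exp_lower_Taylor_quadratic[OF t] by simp
  moreover have "y\<^sup>2 = 32 * t" "y ^ 4 = 1024 * t\<^sup>2" by (auto simp: t_def power_divide simp flip: power_mult)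
  ultimately have e: "y ^ 4 + y\<^sup>2 \<le> 4000 * exp t" using t exp_ge_zero[of t] by linarith
  have "2 * y ^ k \<le> 2 + y ^ 4 + y\<^sup>2" proof -
    have "k = 0 \<or> k = 1 \<or> k = 2 \<or> k = 3" using assms by linarith
    moreover have "2 * y \<le> 1 + y\<^sup>2" using sum_power2_ge_zero[of "y - 1" 0] by (simp add: power2_eq_square algebra_simps)
    moreover have "2 * y ^ 3 \<le> y ^ 4 + y\<^sup>2" proof -
      have "0 \<le> y\<^sup>2 * (y - 1)\<^sup>2" by simp
      also have "\<dots> = y ^ 4 + y\<^sup>2 - 2 * y ^ 3" by (simp add: power2_eq_square power3_eq_cube power4_eq_xxxx algebra_simps)
      finally show ?thesis by simp
    qed
    moreover have "2 * y\<^sup>2 \<le> 1 + y ^ 4" using sum_power2_ge_zero[of "y\<^sup>2 - 1" 0] by (simp add: power2_eq_square power4_eq_xxxx algebra_simps)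
    moreover have "0 \<le> y ^ 4" "0 \<le> y\<^sup>2" by auto
    ultimately show ?thesis by (elim disjE; simp only: power_0 power_one_right; linarith)
  qed
  then show ?thesis using e by (simp add: t_def)
qed

text \<open>A complex displacement h costs the factor exp(|h|^2/s) and a doubling of the time. The
  doubling leaves room in the Gaussian for the polynomial factor and for the cross term between x
  and h.\<close>

lemma Dg_bound:
  assumes s: "0 < s" and a: "a \<le> 3"
  shows "norm (Dg a s (of_real x + h)) \<le> 40000 * s powr (- real a / 2) * g1 (2 * s) x * exp ((norm h)\<^sup>2 / s)"
proof -
  define z where "z = of_real x + h"
  define y where "y = (\<bar>x\<bar> + norm h) / sqrt s"
  have y0: "0 \<le> y" using s by (simp add: y_def)
  have zy: "norm z \<le> y * sqrt s" using s norm_triangle_ineq[of "of_real x" h] by (simp add: z_def y_def)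
  have sq: "sqrt s * sqrt s = s" using s by simp
  have zk: "norm z ^ k \<le> y ^ k * sqrt s ^ k" for k using power_mono[OF zy, of k] by (simp add: power_mult_distrib)
  define E where "E = exp (y\<^sup>2 / 32)"
  have E1: "1 \<le> E" by (simp add: E_def)
  have pE: "y ^ k \<le> 2001 * E" if "k \<le> 3" for k using pow_le_exp[OF y0 that] E1 unfolding E_def[symmetric] by linarith
  have hp: "norm (hpoly a s z) \<le> 10005 * E * sqrt s powr (- real a)" proof -
    have "a = 0 \<or> a = 1 \<or> a = 2 \<or> a = 3" using a by linarith
    then show ?thesis proof (elim disjE)
      assume "a = 0" then show ?thesis using E1 s by (simp add: hpoly_def)
    next
      assume a: "a = 1"
      have "norm (hpoly a s z) = norm z / (2 * s)" using a s by (simp add: hpoly_def norm_divide norm_mult)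
      also have "\<dots> \<le> y * sqrt s / (2 * s)" using zy s by (intro divide_right_mono) auto
      also have "\<dots> = y / (2 * sqrt s)" using s sq by (simp add: field_simps)
      also have "\<dots> \<le> 10005 * E / sqrt s" using pE[of 1] y0 s E1 by (simp add: field_simps)
      finally show ?thesis using a s by (simp add: powr_minus divide_inverse)
    next
      assume a: "a = 2"
      have "norm (hpoly a s z) \<le> norm (z\<^sup>2 / (4 * of_real s ^ 2)) + norm (1 / (2 * complex_of_real s))"
        using a by (simp add: hpoly_def norm_triangle_ineq4)
      also have "\<dots> = (norm z)\<^sup>2 / (4 * s\<^sup>2) + 1 / (2 * s)" using s by (simp add: norm_divide norm_mult norm_power)
      also have "\<dots> \<le> y\<^sup>2 * (sqrt s)\<^sup>2 / (4 * s\<^sup>2) + 1 / (2 * s)" using zk[of 2] s by (intro add_right_mono divide_right_mono) auto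
      also have "\<dots> = (y\<^sup>2 / 4 + 1 / 2) / s" using s by (simp add: field_simps power2_eq_square)
      also have "\<dots> \<le> 10005 * E / s" using pE[of 2] s E1 by (intro divide_right_mono) auto
      finally show ?thesis using a s by (simp add: powr_minus divide_inverse)
    next
      assume a: "a = 3"
      have "norm (hpoly a s z) \<le> norm (- (z ^ 3) / (8 * of_real s ^ 3)) + norm (3 * z / (4 * of_real s ^ 2))"
        using a norm_triangle_ineq[of "- (z ^ 3) / (8 * of_real s ^ 3)" "3 * z / (4 * of_real s ^ 2)"] by (simp only: hpoly_def) simp
      also have "\<dots> = (norm z) ^ 3 / (8 * s ^ 3) + 3 * norm z / (4 * s\<^sup>2)" using s by (simp add: norm_divide norm_mult norm_power)
      also have "\<dots> \<le> y ^ 3 * (sqrt s) ^ 3 / (8 * s ^ 3) + 3 * (y * sqrt s) / (4 * s\<^sup>2)" using zk[of 3] zy s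
        by (intro add_mono divide_right_mono) auto
      also have "\<dots> = (y ^ 3 / 8 + 3 * y / 4) / sqrt s ^ 3" proof -
        define q where "q = sqrt s"
        have "s = q ^ 2" "q > 0" using s by (auto simp: q_def)
        then show ?thesis unfolding q_def[symmetric] by (simp add: field_simps power2_eq_square power3_eq_cube)
      qed
      also have "\<dots> \<le> 10005 * E / sqrt s ^ 3" using pE[of 3] pE[of 1] s E1 by (intro divide_right_mono) auto
      finally show ?thesis using a s by (simp add: powr_minus divide_inverse powr_numeral)
    qed
  qed
  have "norm (exp (- (z\<^sup>2) / of_real (4 * s))) = exp (- ((x + Re h)\<^sup>2 - (Im h)\<^sup>2) / (4 * s))"
    by (simp add: z_def norm_exp_eq_Re Re_divide_of_real power2_eq_square algebra_simps)
  also have "\<dots> \<le> exp (- (3 / 4 * x\<^sup>2 - 3 * (norm h)\<^sup>2) / (4 * s))" proof -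
    \<comment> \<open>The difference of the two sides is exactly the sum of squares below.\<close>
    have "3 / 4 * x\<^sup>2 - 3 * (norm h)\<^sup>2 \<le> (x + Re h)\<^sup>2 - (Im h)\<^sup>2" proof -
      have "0 \<le> (x / 2 + 2 * Re h)\<^sup>2 + 2 * (Im h)\<^sup>2" by simp
      then show ?thesis unfolding cmod_power2 by (simp add: power2_eq_square algebra_simps)
    qed
    then show ?thesis using s by (simp add: divide_right_mono)
  qed
  finally have ex: "norm (exp (- (z\<^sup>2) / of_real (4 * s))) \<le> exp (- (3 / 4 * x\<^sup>2 - 3 * (norm h)\<^sup>2) / (4 * s))" .
  have "E * exp (- (3 / 4 * x\<^sup>2 - 3 * (norm h)\<^sup>2) / (4 * s)) \<le> exp (- (x\<^sup>2) / (8 * s)) * exp ((norm h)\<^sup>2 / s)" proof -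
    have "y\<^sup>2 = (\<bar>x\<bar> + norm h)\<^sup>2 / s" using s by (simp add: y_def power_divide)
    also have "\<dots> \<le> (2 * x\<^sup>2 + 2 * (norm h)\<^sup>2) / s" proof -
      have "0 \<le> (\<bar>x\<bar> - norm h)\<^sup>2" by simp
      then have "(\<bar>x\<bar> + norm h)\<^sup>2 \<le> 2 * x\<^sup>2 + 2 * (norm h)\<^sup>2" by (simp add: power2_eq_square algebra_simps)
      then show ?thesis using s by (simp add: divide_right_mono)
    qed
    finally have y2: "y\<^sup>2 \<le> (2 * x\<^sup>2 + 2 * (norm h)\<^sup>2) / s" .
    \<comment> \<open>In these units the exponents add up to (1/16 - 3/16) X = -X/8, which is the
      Gaussian at time 2 s, and to (1/16 + 3/4) H \<le> H.\<close>
    define X H where "X = x\<^sup>2 / s" and "H = (norm h)\<^sup>2 / s"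
    have H: "0 \<le> H" using s by (simp add: H_def)
    have "y\<^sup>2 \<le> 2 * X + 2 * H" using y2 by (simp add: X_def H_def add_divide_distrib)
    moreover have "- (3 / 4 * x\<^sup>2 - 3 * (norm h)\<^sup>2) / (4 * s) = - 3 / 16 * X + 3 / 4 * H" using s by (simp add: X_def H_def field_simps)
    moreover have "- (x\<^sup>2) / (8 * s) = - X / 8" by (simp add: X_def)
    ultimately have "y\<^sup>2 / 32 + - (3 / 4 * x\<^sup>2 - 3 * (norm h)\<^sup>2) / (4 * s) \<le> - (x\<^sup>2) / (8 * s) + (norm h)\<^sup>2 / s"
      using H unfolding H_def[symmetric] by linarith
    then show ?thesis by (simp only: E_def exp_add[symmetric] exp_le_cancel_iff)
  qed
  then have ee: "E * norm (exp (- (z\<^sup>2) / of_real (4 * s))) \<le> exp (- (x\<^sup>2) / (8 * s)) * exp ((norm h)\<^sup>2 / s)"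
    using mult_left_mono[OF ex, of E] E1 by linarith
  have "norm (Dg a s z) = norm (hpoly a s z) * (1 / sqrt (4 * pi * s)) * norm (exp (- (z\<^sup>2) / of_real (4 * s)))"
    using s by (simp add: Dg_def norm_mult norm_divide)
  also have "\<dots> \<le> (10005 * E * sqrt s powr (- real a)) * (1 / sqrt (4 * pi * s)) * norm (exp (- (z\<^sup>2) / of_real (4 * s)))"
    using hp s by (intro mult_right_mono) auto
  also have "\<dots> = 10005 * sqrt s powr (- real a) * (1 / sqrt (4 * pi * s)) * (E * norm (exp (- (z\<^sup>2) / of_real (4 * s))))"
    by (simp add: mult_ac)
  also have "\<dots> \<le> 10005 * sqrt s powr (- real a) * (1 / sqrt (4 * pi * s)) * (exp (- (x\<^sup>2) / (8 * s)) * exp ((norm h)\<^sup>2 / s))"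
    using s ee by (intro mult_left_mono) auto
  also have "\<dots> = 10005 * sqrt 2 * s powr (- real a / 2) * g1 (2 * s) x * exp ((norm h)\<^sup>2 / s)" proof -
    have "sqrt s powr (- real a) = s powr (- real a / 2)" using s by (simp add: powr_half_sqrt[symmetric] powr_powr)
    moreover have "1 / sqrt (4 * pi * s) = sqrt 2 / sqrt (4 * pi * (2 * s))" using s real_sqrt_mult[of 2 "4 * pi * s"] by (simp add: mult_ac)
    moreover have "- (x\<^sup>2) / (8 * s) = - (x\<^sup>2) / (4 * (2 * s))" by simp
    ultimately show ?thesis by (simp only: g1_def) (simp add: field_simps)
  qed
  also have "\<dots> \<le> 40000 * s powr (- real a / 2) * g1 (2 * s) x * exp ((norm h)\<^sup>2 / s)"
    using s sqrt2_less_2 by (intro mult_right_mono) auto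
  finally show ?thesis by (simp add: z_def)
qed

text \<open>Scaling by sqrt(2 s) reduces the claim to the characteristic function of the standard
  normal law.\<close>

lemma fourier_g1:
  assumes s: "0 < s"
  shows "(LBINT y. of_real (g1 s y) * cis (y * t)) = complex_of_real (exp (- s * t\<^sup>2))"
proof -
  define c where "c = sqrt (2 * s)"
  have c: "c > 0" "c\<^sup>2 = 2 * s" using s by (auto simp: c_def)
  have "(LBINT y. of_real (g1 s y) * cis (y * t)) = c *\<^sub>R (LBINT x. of_real (g1 s (0 + c * x)) * cis ((0 + c * x) * t))"
    using c by (subst lborel_integral_real_affine[of c _ 0]) auto
  also have "\<dots> = (LBINT x. of_real (std_normal_density x) * cis (x * (c * t)))" proof -
    have "c * g1 s (c * x) = std_normal_density x" for x
      using c s by (simp add: g1_def std_normal_density_def power_mult_distrib c_def real_sqrt_mult field_simps)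
    then have "c *\<^sub>R (of_real (g1 s (0 + c * x)) * cis ((0 + c * x) * t)) = of_real (std_normal_density x) * cis (x * (c * t))" for x
      by (simp only: add_0 scaleR_conv_of_real mult.assoc[symmetric] of_real_mult[symmetric]) (simp add: mult_ac)
    then show ?thesis by (simp only: integral_scaleR_right[symmetric])
  qed
  also have "\<dots> = char std_normal_distribution (c * t)"
    unfolding char_def by (subst integral_density) (auto simp: scaleR_conv_of_real cis_conv_exp mult_ac)
  also have "\<dots> = complex_of_real (exp (- s * t\<^sup>2))" using c by (simp add: char_std_normal_distribution power_mult_distrib)
  finally show ?thesis .
qed

lemma integrable_poly_gauss:
  assumes s: "0 < s"
  shows "integrable lborel (\<lambda>t::real. \<bar>t\<bar> ^ k * exp (- s * t\<^sup>2))"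
proof -
  define c where "c = sqrt (1 / (2 * s))"
  have c: "c > 0" "c\<^sup>2 = 1 / (2 * s)" using s by (auto simp: c_def)
  have "integrable lborel (\<lambda>t. sqrt (2 * pi * c\<^sup>2) * (normal_density 0 c t * \<bar>t - 0\<bar> ^ k))"
    by (intro integrable_mult_right integrable_normal_moment_abs) (use c in auto)
  moreover have "sqrt (2 * pi * c\<^sup>2) * (normal_density 0 c t * \<bar>t - 0\<bar> ^ k) = \<bar>t\<bar> ^ k * exp (- s * t\<^sup>2)" for t
    using s unfolding normal_density_def c(2) by (simp add: field_simps)
  ultimately show ?thesis by (simp only:)
qed

lemma cis_measurable[measurable (raw)]: "f \<in> borel_measurable M \<Longrightarrow> (\<lambda>w. cis (f w)) \<in> borel_measurable M"
  by (rule borel_measurable_continuous_on[of cis]) (auto intro!: continuous_intros simp: cis_conv_exp[abs_def])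

lemma integrable_fourier_Dg:
  assumes s: "0 < s"
  shows "integrable lborel (\<lambda>t. (\<i> * of_real t) ^ a * cis (x * t) * of_real (exp (- s * t\<^sup>2)))"
  by (rule Bochner_Integration.integrable_bound[OF integrable_poly_gauss[OF s, of a]])
     (auto simp: norm_mult norm_power)

text \<open>In order 0 a Gaussian transforms into a Gaussian; every further factor i t arises by
  differentiating both sides in x.\<close>

lemma fourier_Dg:
  assumes s: "0 < s" and a: "a \<le> 3"
  shows "(LBINT t. (\<i> * of_real t) ^ a * cis (x * t) * of_real (exp (- s * t\<^sup>2))) = 2 * of_real pi * Dg a s (of_real x)"
  using a proof (induction a arbitrary: x)
  case 0
  define r where "r = 1 / (4 * s)"
  have r: "r > 0" using s by (simp add: r_def)
  have g: "exp (- s * t\<^sup>2) = sqrt (pi / s) * g1 r t" for t using s by (simp add: g1_def r_def real_sqrt_divide field_simps)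
  have "(LBINT t. (\<i> * of_real t) ^ 0 * cis (x * t) * of_real (exp (- s * t\<^sup>2)))
     = (LBINT t. of_real (sqrt (pi / s)) * (of_real (g1 r t) * cis (t * x)))"
    unfolding g by (simp add: mult_ac)
  also have "\<dots> = of_real (sqrt (pi / s)) * of_real (exp (- r * x\<^sup>2))"
    unfolding fourier_g1[OF r, symmetric] by simp
  also have "\<dots> = of_real (2 * pi * g1 s x)" proof -
    have "2 * pi / sqrt (4 * pi * s) = sqrt (pi / s)" using s by (simp add: real_sqrt_mult real_sqrt_divide field_simps)
    moreover have "2 * pi * g1 s x = 2 * pi / sqrt (4 * pi * s) * exp (- r * x\<^sup>2)" by (simp add: g1_def r_def)
    ultimately have "sqrt (pi / s) * exp (- r * x\<^sup>2) = 2 * pi * g1 s x" by simp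
    then show ?thesis by (simp only: of_real_mult[symmetric])
  qed
  finally show ?case by (simp add: Dg_0)
next
  case (Suc a)
  let ?F = "\<lambda>a x t. (\<i> * of_real t) ^ a * cis (x * t) * complex_of_real (exp (- s * t\<^sup>2))"
  have "((\<lambda>x. \<integral>t. ?F a x t \<partial>lborel) has_vector_derivative (LBINT t. ?F (Suc a) x t)) (at x)"
  proof (rule has_vector_derivative_lebesgue_integral(2)[where r = 1 and B = "\<lambda>t. \<bar>t\<bar> ^ Suc a * exp (- s * t\<^sup>2)"])
    show "integrable lborel (\<lambda>t. \<bar>t\<bar> ^ Suc a * exp (- s * t\<^sup>2))" by (rule integrable_poly_gauss[OF s])
    show "integrable lborel (?F a x)" for x by (rule integrable_fourier_Dg[OF s])
    show "((\<lambda>x. ?F a x t) has_vector_derivative ?F (Suc a) x t) (at x)" for x t proof -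
      have "((\<lambda>x. cis (x * t)) has_vector_derivative (\<i> * of_real t) * cis (x * t)) (at x)" proof -
        have "((\<lambda>z. exp (\<i> * (z * of_real t))) has_field_derivative (\<i> * of_real t) * exp (\<i> * (of_real x * of_real t))) (at (of_real x))"
          by (auto intro!: derivative_eq_intros)
        from has_vector_derivative_real_field[OF this] show ?thesis by (simp add: cis_conv_exp)
      qed
      from has_vector_derivative_mult_left[OF has_vector_derivative_mult_right[OF this, of "(\<i> * of_real t) ^ a"], of "of_real (exp (- s * t\<^sup>2))"]
      show ?thesis by (simp add: mult.assoc) (simp only: mult.left_commute mult.assoc)
    qed
    show "norm (?F (Suc a) x t) \<le> \<bar>t\<bar> ^ Suc a * exp (- s * t\<^sup>2)" for x t by (simp add: norm_mult norm_power)
  qed auto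
  moreover have "(\<lambda>x. \<integral>t. ?F a x t \<partial>lborel) = (\<lambda>x. 2 * of_real pi * Dg a s (of_real x))"
    using Suc by (intro ext) simp
  ultimately have "((\<lambda>x. 2 * of_real pi * Dg a s (of_real x)) has_vector_derivative (LBINT t. ?F (Suc a) x t)) (at x)" by (simp only:)
  moreover have "((\<lambda>x. 2 * of_real pi * Dg a s (of_real x)) has_vector_derivative 2 * of_real pi * Dg (Suc a) s (of_real x)) (at x)"
    using Suc.prems by (intro has_vector_derivative_mult_right Dg_deriv s) auto
  ultimately show ?case by (rule vector_derivative_unique_at)
qed

definition gn :: "real \<Rightarrow> real^'n::finite \<Rightarrow> real" where
  "gn s x = (\<Prod>i\<in>UNIV. g1 s (x $ i))"

text \<open>Mixed partial derivative of order a of the n-dimensional heat kernel, with each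
  coordinate complexified. The product form reduces estimates, holomorphy and Fourier identities to
  one variable.\<close>

definition Qg :: "('n::finite \<Rightarrow> nat) \<Rightarrow> real \<Rightarrow> ('n \<Rightarrow> complex) \<Rightarrow> complex" where
  "Qg a s z = (\<Prod>i\<in>UNIV. Dg (a i) s (z i))"

definition cvec :: "real^'n \<Rightarrow> 'n \<Rightarrow> complex" where "cvec x = (\<lambda>i. of_real (x $ i))"

definition msym :: "('n::finite \<Rightarrow> nat) \<Rightarrow> real^'n \<Rightarrow> complex" where
  "msym a x = (\<Prod>i\<in>UNIV. (\<i> * of_real (x $ i)) ^ a i)"

lemma gn_nonneg[simp]: "0 < s \<Longrightarrow> 0 \<le> gn s x" by (simp add: gn_def prod_nonneg)

lemma gn_pos: "0 < s \<Longrightarrow> 0 < gn s x" by (simp add: gn_def prod_pos g1_pos)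

lemma g1_measurable[measurable (raw)]:
  fixes f :: "'w \<Rightarrow> real"
  assumes [measurable]: "f \<in> borel_measurable M" "g \<in> borel_measurable M"
  shows "(\<lambda>w. g1 (f w) (g w)) \<in> borel_measurable M"
  unfolding g1_def by measurable

lemma vec_nth_measurable[measurable (raw)]:
  fixes g :: "'w \<Rightarrow> real^'n::finite"
  shows "g \<in> borel_measurable M \<Longrightarrow> (\<lambda>w. g w $ i) \<in> borel_measurable M"
  using measurable_compose[of g M borel "\<lambda>x. x $ i" borel] by simp

lemma gn_measurable[measurable (raw)]:
  fixes g :: "'w \<Rightarrow> real^'n::finite"
  assumes [measurable]: "f \<in> borel_measurable M" "g \<in> borel_measurable M"
  shows "(\<lambda>w. gn (f w) (g w)) \<in> borel_measurable M"
  unfolding gn_def by measurable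

lemma Qg_measurable[measurable (raw)]:
  fixes g :: "'w \<Rightarrow> 'n::finite \<Rightarrow> complex"
  assumes [measurable]: "f \<in> borel_measurable M" "\<And>i. (\<lambda>w. g w i) \<in> borel_measurable M"
  shows "(\<lambda>w. Qg a (f w) (g w)) \<in> borel_measurable M"
  unfolding Qg_def by measurable

lemma gn_eq: "0 < s \<Longrightarrow> gn s (x::real^'n::finite) = (4 * pi * s) powr (- real CARD('n) / 2) * exp (- (norm x)\<^sup>2 / (4 * s))"
proof -
  assume s: "0 < s"
  have "gn s x = (\<Prod>i\<in>UNIV. exp (- ((x $ i)\<^sup>2) / (4 * s))) / (\<Prod>i\<in>(UNIV::'n set). sqrt (4 * pi * s))"
    by (simp add: gn_def g1_def prod_dividef)
  also have "(\<Prod>i\<in>UNIV. exp (- ((x $ i)\<^sup>2) / (4 * s))) = exp (- (norm x)\<^sup>2 / (4 * s))"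
    by (simp add: exp_sum[symmetric] norm_vec_def L2_set_def sum_nonneg sum_negf sum_divide_distrib[symmetric])
  also have "(\<Prod>i\<in>(UNIV::'n set). sqrt (4 * pi * s)) = (4 * pi * s) powr (real CARD('n) / 2)"
    using s by (simp add: powr_half_sqrt[symmetric] powr_powr powr_realpow[symmetric])
  finally show ?thesis using s by (simp add: powr_minus field_simps)
qed

lemma gn_le: "0 < s \<Longrightarrow> gn s (x::real^'n::finite) \<le> (4 * pi * s) powr (- real CARD('n) / 2)"
  by (simp add: gn_eq mult_left_le)

lemma gn_uminus[simp]: "gn s (- x) = gn s x" by (simp add: gn_def g1_def)

lemma integrable_gn: "0 < s \<Longrightarrow> integrable lborel (gn s :: real^'n::finite \<Rightarrow> real)"
  and integral_gn: "0 < s \<Longrightarrow> (LBINT x. gn s (x::real^'n::finite)) = 1"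
proof -
  assume s: "0 < s"
  have i: "integrable lborel (\<lambda>x. complex_of_real (g1 s x))" using integrable_g1[OF s] by simp
  have e: "complex_of_real (gn s x) = (\<Prod>i\<in>UNIV. complex_of_real (g1 s (x $ i)))" for x :: "real^'n" by (simp add: gn_def)
  have "integrable lborel (\<lambda>x. complex_of_real (gn s (x::real^'n)))"
    unfolding e by (rule lborel_integral_vec_prod(1)) (rule i)
  from integrable_Re[OF this] show "integrable lborel (gn s :: real^'n \<Rightarrow> real)" by simp
  have "(LBINT x. complex_of_real (gn s (x::real^'n))) = 1"
    unfolding e by (subst lborel_integral_vec_prod(2)) (auto simp: i integral_g1[OF s] integrable_g1[OF s])
  then show "(LBINT x. gn s (x::real^'n)) = 1" using of_real_eq_1_iff by (simp add: integral_complex_of_real)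
qed

lemma nn_integral_gn: "0 < s \<Longrightarrow> (\<integral>\<^sup>+x. ennreal (gn s (x::real^'n::finite)) \<partial>lborel) = 1"
  by (subst nn_integral_eq_integral) (auto simp: integrable_gn integral_gn)

lemma cis_inner: "cis (x \<bullet> y) = (\<Prod>i\<in>UNIV. cis (x $ i * y $ i))" for x y :: "real^'n::finite"
  by (simp add: cis_conv_exp inner_vec_def sum_distrib_left exp_sum)

lemma exp_norm_sq: "complex_of_real (exp (- s * (norm y)\<^sup>2)) = (\<Prod>i\<in>UNIV. of_real (exp (- s * (y $ i)\<^sup>2)))" for y :: "real^'n::finite"
  by (simp add: exp_sum[symmetric] norm_vec_def L2_set_def sum_nonneg sum_negf sum_distrib_left flip: of_real_prod)

lemma fourier_gn:
  assumes s: "0 < s"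
  shows "(LBINT y. of_real (gn s y) * cis (y \<bullet> t)) = complex_of_real (exp (- s * (norm (t::real^'n::finite))\<^sup>2))"
proof -
  have i: "integrable lborel (\<lambda>y. complex_of_real (g1 s y) * cis (y * r))" for r
    by (rule Bochner_Integration.integrable_bound[OF integrable_g1[OF s]]) (use s in \<open>auto simp: norm_mult\<close>)
  have "(LBINT y. of_real (gn s y) * cis (y \<bullet> t)) = (LBINT y. (\<Prod>i\<in>UNIV. of_real (g1 s (y $ i)) * cis (y $ i * t $ i)))"
    by (simp add: gn_def cis_inner prod.distrib)
  also have "\<dots> = (\<Prod>i\<in>UNIV. \<integral>y. of_real (g1 s y) * cis (y * t $ i) \<partial>lborel)"
    by (rule lborel_integral_vec_prod(2)) (rule i)
  finally show ?thesis by (simp only: fourier_g1[OF s] exp_norm_sq)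
qed

lemma fourier_Qg:
  assumes s: "0 < s" and a: "\<And>i. a i \<le> 3"
  shows "(LBINT t. msym a t * cis (x \<bullet> t) * of_real (exp (- s * (norm (t::real^'n::finite))\<^sup>2)))
     = (2 * of_real pi) ^ CARD('n) * Qg a s (cvec x)"
  unfolding msym_def cis_inner exp_norm_sq prod.distrib[symmetric] by (subst lborel_integral_vec_prod(2)[OF integrable_fourier_Dg[OF s]])
     (simp only: fourier_Dg[OF s a] Qg_def cvec_def prod.distrib prod_constant, simp only: power_mult_distrib)

lemma Qg_holomorphic: "0 < s \<Longrightarrow> (\<lambda>z. Qg a s (w(i := z))) holomorphic_on A"
proof -
  assume s: "0 < s"
  have "(\<lambda>z. Dg (a j) s ((w(i := z)) j)) holomorphic_on A" for j using Dg_holomorphic[OF s] by (cases "j = i") auto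
  then show ?thesis unfolding Qg_def by (intro holomorphic_on_prod)
qed

text \<open>One factor 40000 of \<open>Dg_bound\<close> for each coordinate.\<close>

definition Qc :: "'n::finite itself \<Rightarrow> real" where "Qc _ = 40000 ^ CARD('n)"

lemma Qg_bound:
  fixes x :: "real^'n::finite"
  assumes s: "0 < s" and a: "\<And>i. a i \<le> 3" and h: "\<And>i. norm (h i) \<le> r"
  shows "norm (Qg a s (\<lambda>i. cvec x i + h i)) \<le> Qc TYPE('n) * s powr (- real (sum a UNIV) / 2) * gn (2 * s) x * exp (real CARD('n) * r\<^sup>2 / s)"
proof -
  have "norm (Qg a s (\<lambda>i. cvec x i + h i)) = (\<Prod>i\<in>UNIV. norm (Dg (a i) s (of_real (x $ i) + h i)))"
    by (simp add: Qg_def cvec_def prod_norm)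
  also have "\<dots> \<le> (\<Prod>i\<in>UNIV. 40000 * s powr (- real (a i) / 2) * g1 (2 * s) (x $ i) * exp (r\<^sup>2 / s))"
  proof (rule prod_mono, safe)
    fix i
    have "norm (Dg (a i) s (of_real (x $ i) + h i)) \<le> 40000 * s powr (- real (a i) / 2) * g1 (2 * s) (x $ i) * exp ((norm (h i))\<^sup>2 / s)"
      by (rule Dg_bound[OF s a])
    also have "\<dots> \<le> 40000 * s powr (- real (a i) / 2) * g1 (2 * s) (x $ i) * exp (r\<^sup>2 / s)"
      using s h[of i] by (intro mult_left_mono) (auto intro!: divide_right_mono power_mono)
    finally show "norm (Dg (a i) s (of_real (x $ i) + h i)) \<le> 40000 * s powr (- real (a i) / 2) * g1 (2 * s) (x $ i) * exp (r\<^sup>2 / s)" .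
  qed auto
  also have "\<dots> = Qc TYPE('n) * s powr (- real (sum a UNIV) / 2) * gn (2 * s) x * exp (real CARD('n) * r\<^sup>2 / s)" proof -
    have "(\<Prod>i\<in>UNIV. s powr (- real (a i) / 2)) = s powr (- real (sum a UNIV) / 2)"
      using s by (simp add: powr_sum[symmetric] sum_negf sum_divide_distrib[symmetric])
    moreover have "(\<Prod>i\<in>(UNIV::'n set). exp (r\<^sup>2 / s)) = exp (real CARD('n) * r\<^sup>2 / s)" by (simp add: exp_of_nat_mult[symmetric])
    ultimately show ?thesis by (simp add: prod.distrib Qc_def gn_def)
  qed
  finally show ?thesis .
qed

section \<open>Subordinated kernels and their complex extension\<close>

lemma norm_integral_le_nn_integral:
  fixes f :: "'w \<Rightarrow> 'b::{banach, second_countable_topology}"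
  shows "ennreal (norm (\<integral>w. f w \<partial>M)) \<le> (\<integral>\<^sup>+w. ennreal (norm (f w)) \<partial>M)"
  by (cases "integrable M f") (auto simp: integral_norm_bound_ennreal not_integrable_integral_eq)

lemma nn_integral_gauss:
  assumes "0 < a"
  shows "(\<integral>\<^sup>+x. ennreal (exp (- a * (norm (x::real^'n::finite))\<^sup>2)) \<partial>lborel) = ennreal ((pi / a) powr (real CARD('n) / 2))"
proof -
  have e: "exp (- a * (norm x)\<^sup>2) = (pi / a) powr (real CARD('n) / 2) * gn (1 / (4 * a)) x" for x :: "real^'n"
    using assms by (simp add: gn_eq powr_minus field_simps)
  show ?thesis unfolding e using assms by (simp add: ennreal_mult' nn_integral_cmult nn_integral_gn)
qed

section \<open>Fourier symbols and the mixture representation\<close>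

definition ei :: "'n \<Rightarrow> 'n \<Rightarrow> nat" where "ei m = (\<lambda>i. if i = m then 1 else 0)"
definition ei3 :: "'n \<Rightarrow> 'n \<Rightarrow> 'n \<Rightarrow> 'n \<Rightarrow> nat" where "ei3 m j l = (\<lambda>i. ei m i + ei j i + ei l i)"

lemma ei_le[simp]: "ei m i \<le> 3" "ei3 m j l i \<le> 3" by (auto simp: ei_def ei3_def)

lemma sum_ei[simp]: "sum (ei m) (UNIV::'n::finite set) = 1" "sum (ei3 m j l) (UNIV::'n::finite set) = 3"
  by (simp_all add: ei_def ei3_def sum.distrib)

lemma msym_ei: "msym (ei m) (x::real^'n::finite) = \<i> * of_real (x $ m)"
proof -
  have "msym (ei m) x = (\<Prod>i\<in>UNIV. if i = m then \<i> * of_real (x $ m) else 1)"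
    unfolding msym_def by (rule prod.cong) (auto simp: ei_def)
  then show ?thesis by simp
qed

lemma msym_ei3: "msym (ei3 m j l) (x::real^'n::finite) = (\<i> * of_real (x $ m)) * (\<i> * of_real (x $ j)) * (\<i> * of_real (x $ l))"
  unfolding msym_ei[symmetric] by (simp add: msym_def ei3_def power_add prod.distrib)

lemma msym_measurable[measurable]: "msym a \<in> borel_measurable borel"
  unfolding msym_def[abs_def] by measurable

text \<open>Symbol of the derivative d_m K_jl, up to the factor i and the exponential. At the origin
  the quotient is 0 by convention and the factor \<open>x $ m\<close> is 0 as well.\<close>

definition ksym :: "'n \<Rightarrow> 'n \<Rightarrow> 'n \<Rightarrow> real^'n::finite \<Rightarrow> real" where
  "ksym m j l x = x $ m * ((if j = l then 1 else 0) - x $ j * x $ l / (norm x)\<^sup>2)"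

lemma ksym_measurable[measurable]: "ksym m j l \<in> borel_measurable borel"
  unfolding ksym_def[abs_def] by measurable

lemma projection_symbol_bound: "\<bar>(if j = l then 1 else 0) - x $ j * x $ l / (norm x)\<^sup>2\<bar> \<le> 2" for x :: "real^'n::finite"
proof -
  have "\<bar>x $ j * x $ l\<bar> \<le> norm x * norm x" unfolding abs_mult by (intro mult_mono component_le_norm_cart) auto
  then have "\<bar>x $ j * x $ l / (norm x)\<^sup>2\<bar> \<le> 1" by (cases "x = 0") (simp_all add: abs_divide power2_eq_square divide_le_eq)
  then show ?thesis by (smt (verit))
qed

lemma ksym_bound: "\<bar>ksym m j l x\<bar> \<le> 2 * norm x"
proof -
  have "\<bar>ksym m j l x\<bar> \<le> norm x * 2" unfolding ksym_def abs_mult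
    by (intro mult_mono component_le_norm_cart projection_symbol_bound) auto
  then show ?thesis by simp
qed

text \<open>Half of the Gaussian absorbs the linear factor, since sqrt a t \<le> exp(a
  t^2/2).\<close>

lemma moment_gauss_le: "0 < a \<Longrightarrow> (1 + t) * exp (- a * t\<^sup>2) \<le> (1 + 1 / sqrt a) * exp (- (a / 2) * t\<^sup>2)" if "0 \<le> t" for t :: real
proof -
  assume a: "0 < a"
  have "sqrt a * t \<le> exp (a / 2 * t\<^sup>2)" proof -
    have "2 * (sqrt a * t) \<le> 1 + (sqrt a * t)\<^sup>2" using sum_squares_bound[of 1 "sqrt a * t"] by simp
    then have "sqrt a * t \<le> 1 + a / 2 * t\<^sup>2" using a that by (simp add: power_mult_distrib)
    then show ?thesis using exp_ge_add_one_self[of "a / 2 * t\<^sup>2"] by linarith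
  qed
  then have "t \<le> exp (a / 2 * t\<^sup>2) / sqrt a" using a by (simp add: field_simps)
  moreover have "1 \<le> exp (a / 2 * t\<^sup>2)" using a by simp
  ultimately have "1 + t \<le> exp (a / 2 * t\<^sup>2) + exp (a / 2 * t\<^sup>2) / sqrt a" by linarith
  then have "1 + t \<le> (1 + 1 / sqrt a) * exp (a / 2 * t\<^sup>2)" by (simp add: distrib_right)
  then have "(1 + t) * exp (- a * t\<^sup>2) \<le> (1 + 1 / sqrt a) * exp (a / 2 * t\<^sup>2) * exp (- a * t\<^sup>2)" by (rule mult_right_mono) simp
  also have "\<dots> = (1 + 1 / sqrt a) * exp (- (a / 2) * t\<^sup>2)" by (simp add: mult.assoc flip: exp_add)
  finally show ?thesis .
qed

text \<open>The reason is ln(1/s) \<le> 1/s. Exponential moments of 1/s thereby control all negative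
  powers of s.\<close>

lemma powr_neg_le_exp: "0 < s \<Longrightarrow> 0 \<le> p \<Longrightarrow> s powr (- p) \<le> exp (p / s)" for s p :: real
proof -
  assume s: "0 < s" and p: "0 \<le> p"
  have "s powr (- p) = exp (p * ln (1 / s))" using s by (simp add: powr_def ln_div)
  also have "\<dots> \<le> exp (p * (1 / s))" using s p ln_le_minus_one[of "1 / s"] unfolding exp_le_cancel_iff by (intro mult_left_mono) auto
  finally show ?thesis by simp
qed

text \<open>By \<open>laplace\<close>, \<mu> is the law at time 1 of the stable subordinator of
  index \<gamma>/2. By self-similarity the law at time t is the image of \<mu> under
  \<open>Sg t\<close>, so one measure serves all times.\<close>

locale subordinator =
  fixes \<gamma> :: real and \<mu> :: "real measure"
  assumes g1: "1 < \<gamma>" and g2: "\<gamma> \<le> 2"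
    and prob: "prob_space \<mu>" and sets_mu[simp, measurable_cong]: "sets \<mu> = sets borel"
    and AE_pos: "AE s in \<mu>. 0 < s"
    and laplace: "\<And>l. 0 \<le> l \<Longrightarrow> (\<integral>\<^sup>+s. ennreal (exp (- l * s)) \<partial>\<mu>) = ennreal (exp (- (l powr (\<gamma> / 2))))"
    and expmom: "\<And>c. 0 \<le> c \<Longrightarrow> (\<integral>\<^sup>+s. ennreal (exp (c / s)) \<partial>\<mu>) < \<infinity>"
begin

sublocale prob_space \<mu> by (rule prob)

abbreviation Sg :: "real \<Rightarrow> real \<Rightarrow> real" where "Sg t s \<equiv> t powr (2 / \<gamma>) * s"

lemma Sg_pos: "0 < t \<Longrightarrow> 0 < s \<Longrightarrow> 0 < Sg t s" by simp

lemma laplace_norm: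
  assumes t: "0 < t"
  shows "(\<integral>\<^sup>+s. ennreal (exp (- Sg t s * (norm (x::real^'n::finite))\<^sup>2)) \<partial>\<mu>) = ennreal (exp (- t * norm x powr \<gamma>))"
proof -
  have "(\<integral>\<^sup>+s. ennreal (exp (- (t powr (2 / \<gamma>) * (norm x)\<^sup>2) * s)) \<partial>\<mu>) = ennreal (exp (- ((t powr (2 / \<gamma>) * (norm x)\<^sup>2) powr (\<gamma> / 2))))"
    by (rule laplace) simp
  moreover have "(t powr (2 / \<gamma>) * (norm x)\<^sup>2) powr (\<gamma> / 2) = t * norm x powr \<gamma>" proof (cases "x = 0")
    case False
    then have e: "(norm x)\<^sup>2 = norm x powr 2" by (simp add: powr_numeral)
    have "(norm x)\<^sup>2 powr (\<gamma> / 2) = norm x powr \<gamma>" unfolding e powr_powr by simp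
    then show ?thesis using t g1 by (simp add: powr_mult powr_powr)
  qed (use g1 in simp)
  ultimately show ?thesis by (simp add: mult_ac)
qed

text \<open>The exponent 2 CARD('n)/s is split evenly: one half pays for the complex shift, the
  other for factors s powr (-p) with p \<le> CARD('n).\<close>

definition EC :: "'n::finite itself \<Rightarrow> real" where
  "EC _ = enn2real (\<integral>\<^sup>+s. ennreal (exp (2 * real CARD('n) / s)) \<partial>\<mu>)"

lemma EC: "(\<integral>\<^sup>+s. ennreal (exp (2 * real CARD('n) / s)) \<partial>\<mu>) = ennreal (EC TYPE('n::finite))" "0 \<le> EC TYPE('n)"
  using expmom[of "2 * real CARD('n)"] by (auto simp: EC_def less_top)

text \<open>Absolute integrability on the product space, for symbols of linear growth; it justifies
  exchanging the mixture over s with the Fourier integral.\<close>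

lemma integrable_gauss_pair:
  fixes p :: "real^'n::finite \<Rightarrow> complex"
  assumes t: "0 < t" and [measurable]: "p \<in> borel_measurable borel" and p: "\<And>x. norm (p x) \<le> B * (1 + norm x)"
  shows "integrable (\<mu> \<Otimes>\<^sub>M lborel) (\<lambda>(s, x). p x * of_real (exp (- Sg t s * (norm x)\<^sup>2)))"
proof (rule integrableI_bounded)
  interpret pair_sigma_finite \<mu> "lborel :: (real^'n) measure" by standard
  have B: "0 \<le> B" using order_trans[OF norm_ge_zero p[of 0]] by simp
  let ?d = "real CARD('n)"
  have "(\<integral>\<^sup>+z. ennreal (norm (case z of (s, x) \<Rightarrow> p x * of_real (exp (- Sg t s * (norm x)\<^sup>2)))) \<partial>(\<mu> \<Otimes>\<^sub>M lborel))
      = (\<integral>\<^sup>+s. \<integral>\<^sup>+x. ennreal (norm (p x * of_real (exp (- Sg t s * (norm x)\<^sup>2)))) \<partial>lborel \<partial>\<mu>)"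
    by (subst sigma_finite_measure.nn_integral_fst[symmetric]) (auto intro: lborel.sigma_finite_measure_axioms)
  also have "\<dots> \<le> (\<integral>\<^sup>+s. ennreal (B * (1 + 1 / t powr (1 / \<gamma>)) * (2 * pi) powr (?d / 2) * t powr (- ?d / \<gamma>)) * ennreal (exp (2 * ?d / s)) \<partial>\<mu>)"
  proof (rule nn_integral_mono_AE, use AE_pos in eventually_elim)
    case (elim s)
    have S: "0 < Sg t s" using t elim by simp
    have "norm (p x * of_real (exp (- Sg t s * (norm x)\<^sup>2))) \<le> B * (1 + 1 / sqrt (Sg t s)) * exp (- (Sg t s / 2) * (norm x)\<^sup>2)" for x :: "real^'n"
    proof -
      have "norm (p x * of_real (exp (- Sg t s * (norm x)\<^sup>2))) \<le> B * (1 + norm x) * exp (- Sg t s * (norm x)\<^sup>2)"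
        using p[of x] by (simp add: norm_mult mult_right_mono)
      also have "\<dots> \<le> B * ((1 + 1 / sqrt (Sg t s)) * exp (- (Sg t s / 2) * (norm x)\<^sup>2))"
        unfolding mult.assoc using moment_gauss_le[OF norm_ge_zero S, of x] B by (intro mult_left_mono) (auto simp: mult.assoc)
      finally show ?thesis by (simp add: mult.assoc)
    qed
    note n1 = this
    have "(\<integral>\<^sup>+x. ennreal (norm (p x * of_real (exp (- Sg t s * (norm x)\<^sup>2)))) \<partial>lborel)
        \<le> (\<integral>\<^sup>+x. ennreal (B * (1 + 1 / sqrt (Sg t s))) * ennreal (exp (- (Sg t s / 2) * (norm (x::real^'n))\<^sup>2)) \<partial>lborel)"
      by (intro nn_integral_mono, subst ennreal_mult[symmetric]) (use B S n1 in \<open>auto intro!: ennreal_leI\<close>)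
    also have "\<dots> = ennreal (B * (1 + 1 / sqrt (Sg t s)) * (pi / (Sg t s / 2)) powr (?d / 2))"
      using S B nn_integral_gauss[of "Sg t s / 2", where 'n='n] by (subst nn_integral_cmult) (auto simp flip: ennreal_mult)
    also have "\<dots> \<le> ennreal ((B * (1 + 1 / t powr (1 / \<gamma>)) * (2 * pi) powr (?d / 2) * t powr (- ?d / \<gamma>)) * exp (2 * ?d / s))"
    proof (rule ennreal_leI)
      \<comment> \<open>The linear factor costs s powr (-1/2) and the volume of the Gaussian costs s
        powr (-d/2); exp(2 d/s) pays for both.\<close>
      have r: "sqrt (Sg t s) = t powr (1 / \<gamma>) * s powr (1 / 2)" using t elim by (simp add: real_sqrt_mult powr_half_sqrt[symmetric] powr_powr)
      have "1 / s powr (1 / 2) \<le> exp (1 / 2 / s)" using powr_neg_le_exp[of s "1 / 2"] elim by (simp add: powr_minus_divide)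
      then have "1 / sqrt (Sg t s) \<le> 1 / t powr (1 / \<gamma>) * exp (1 / 2 / s)" unfolding r using t by (simp add: field_simps)
      moreover have "1 \<le> exp (1 / 2 / s)" using elim by simp
      ultimately have 1: "1 + 1 / sqrt (Sg t s) \<le> (1 + 1 / t powr (1 / \<gamma>)) * exp (1 / 2 / s)" by (simp only: distrib_right mult_1_left)
      have "(pi / (Sg t s / 2)) powr (?d / 2) = (2 * pi) powr (?d / 2) * (t powr (2 / \<gamma>)) powr (- ?d / 2) * s powr (- ?d / 2)"
        using t elim by (simp add: powr_divide powr_mult powr_minus_divide)
      also have "(t powr (2 / \<gamma>)) powr (- ?d / 2) = t powr (- ?d / \<gamma>)" using g1 by (simp add: powr_powr)
      also have "(2 * pi) powr (?d / 2) * t powr (- ?d / \<gamma>) * s powr (- ?d / 2) \<le> (2 * pi) powr (?d / 2) * t powr (- ?d / \<gamma>) * exp (?d / 2 / s)"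
        using powr_neg_le_exp[of s "?d / 2"] elim by (intro mult_left_mono) auto
      finally have 2: "(pi / (Sg t s / 2)) powr (?d / 2) \<le> (2 * pi) powr (?d / 2) * t powr (- ?d / \<gamma>) * exp (?d / 2 / s)" .
      have "(1 + 1 / sqrt (Sg t s)) * (pi / (Sg t s / 2)) powr (?d / 2)
        \<le> ((1 + 1 / t powr (1 / \<gamma>)) * exp (1 / 2 / s)) * ((2 * pi) powr (?d / 2) * t powr (- ?d / \<gamma>) * exp (?d / 2 / s))"
        using 1 2 S by (intro mult_mono) auto
      also have "\<dots> = ((1 + 1 / t powr (1 / \<gamma>)) * (2 * pi) powr (?d / 2) * t powr (- ?d / \<gamma>)) * exp (1 / 2 / s + ?d / 2 / s)"
        by (simp add: exp_add mult_ac)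
      also have "\<dots> \<le> ((1 + 1 / t powr (1 / \<gamma>)) * (2 * pi) powr (?d / 2) * t powr (- ?d / \<gamma>)) * exp (2 * ?d / s)" proof -
        have "1 \<le> ?d" by (simp add: Suc_leI)
        then have "(1 / 2 + ?d / 2) / s \<le> 2 * ?d / s" using elim by (intro divide_right_mono) linarith+
        then have "1 / 2 / s + ?d / 2 / s \<le> 2 * ?d / s" by (simp only: add_divide_distrib)
        then show ?thesis using t by (intro mult_left_mono) auto
      qed
      finally show "B * (1 + 1 / sqrt (Sg t s)) * (pi / (Sg t s / 2)) powr (?d / 2) \<le> (B * (1 + 1 / t powr (1 / \<gamma>)) * (2 * pi) powr (?d / 2) * t powr (- ?d / \<gamma>)) * exp (2 * ?d / s)"
        unfolding mult.assoc by (rule mult_left_mono[OF _ B])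
    qed
    finally show ?case using B by (simp add: ennreal_mult)
  qed
  also have "\<dots> = ennreal (B * (1 + 1 / t powr (1 / \<gamma>)) * (2 * pi) powr (?d / 2) * t powr (- ?d / \<gamma>)) * ennreal (EC TYPE('n))"
    by (subst nn_integral_cmult) (auto simp: EC)
  also have "\<dots> < \<infinity>" by (simp add: ennreal_mult_less_top)
  finally show "(\<integral>\<^sup>+z. ennreal (norm (case z of (s, x) \<Rightarrow> p x * of_real (exp (- Sg t s * (norm x)\<^sup>2)))) \<partial>(\<mu> \<Otimes>\<^sub>M lborel)) < \<infinity>" .
qed measurable

lemma laplace_norm_integral:
  assumes t: "0 < t"
  shows "(\<integral>s. exp (- Sg t s * (norm (x::real^'n::finite))\<^sup>2) \<partial>\<mu>) = exp (- t * norm x powr \<gamma>)"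
  by (subst integral_eq_nn_integral) (use laplace_norm[OF t, of x] in simp_all)

text \<open>After Fubini the integral of the Gaussians over s is the Laplace transform of \<mu>,
  which restores exp(-t |x|^\<gamma>).\<close>

lemma gauss_mixture_fourier:
  fixes p :: "real^'n::finite \<Rightarrow> complex"
  assumes t: "0 < t" and [measurable]: "p \<in> borel_measurable borel" and p: "\<And>x. norm (p x) \<le> B * (1 + norm x)"
  shows "integrable lborel (\<lambda>x. p x * of_real (exp (- t * norm x powr \<gamma>)))"
    and "(\<integral>s. (LBINT x. p x * of_real (exp (- Sg t s * (norm x)\<^sup>2))) \<partial>\<mu>) = (LBINT x. p x * of_real (exp (- t * norm x powr \<gamma>)))"
proof -
  interpret pair_sigma_finite \<mu> "lborel :: (real^'n) measure" by standard
  note int = integrable_gauss_pair[OF assms]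
  have e: "(\<integral>s. p x * of_real (exp (- Sg t s * (norm x)\<^sup>2)) \<partial>\<mu>) = p x * of_real (exp (- t * norm x powr \<gamma>))" for x
    using laplace_norm_integral[OF t, of x] by (simp add: integral_complex_of_real)
  show "integrable lborel (\<lambda>x. p x * of_real (exp (- t * norm x powr \<gamma>)))" using integrable_snd[OF int] by (simp only: e)
  show "(\<integral>s. (LBINT x. p x * of_real (exp (- Sg t s * (norm x)\<^sup>2))) \<partial>\<mu>) = (LBINT x. p x * of_real (exp (- t * norm x powr \<gamma>)))"
    using Fubini_integral[OF int] by (simp only: e)
qed

end

lemma nn_integral_powr_ge1:
  "(\<integral>\<^sup>+w. ennreal (w powr (- 3 / 2)) * indicator {1..} w \<partial>lborel) = 2" proof -
  have "((\<lambda>x::real. - 2 * x powr (- 1 / 2)) \<longlongrightarrow> - 2 * 0) at_top"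
    by (intro tendsto_intros tendsto_neg_powr filterlim_ident) auto
  then have "(\<integral>\<^sup>+w. ennreal (w powr (- 3 / 2)) * indicator {1..} w \<partial>lborel) = ennreal (0 - (- 2 * 1 powr (- 1 / 2)))"
    by (intro nn_integral_FTC_atLeast) (auto intro!: derivative_eq_intros)
  then show ?thesis by simp
qed

lemma exp_div_integral_ge1:
  fixes a :: real assumes "0 < a"
  shows "(\<integral>\<^sup>+w. ennreal (exp (- a * w)) * indicator {1..} w \<partial>lborel) = ennreal (exp (- a) / a)"
proof -
  have "((\<lambda>x::real. - exp (- a * x) / a) \<longlongrightarrow> - 0 / a) at_top"
    using assms by (intro tendsto_intros filterlim_compose[OF exp_at_bot] filterlim_tendsto_neg_mult_at_bot[OF tendsto_const _ filterlim_ident]) auto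
  then have "(\<integral>\<^sup>+w. ennreal (exp (- a * w)) * indicator {1..} w \<partial>lborel) = ennreal (- 0 / a - (- exp (- a * 1) / a))"
    using assms by (intro nn_integral_FTC_atLeast) (auto intro!: derivative_eq_intros)
  then show ?thesis by simp
qed

lemma ennreal_add_double: "0 \<le> a \<Longrightarrow> ennreal a + ennreal a * 2 = ennreal (3 * a)"
proof -
  assume a: "0 \<le> a"
  have "ennreal a * 2 = ennreal (2 * a)" using a by (simp add: ennreal_mult mult.commute)
  then show ?thesis using a by (simp flip: ennreal_plus)
qed

section \<open>Complex kernels and their majorants\<close>

context subordinator
begin

definition gc :: "real \<Rightarrow> ('n::finite \<Rightarrow> complex) \<Rightarrow> complex" where
  "gc t z = (\<integral>s. Qg (\<lambda>_. 0) (Sg t s) z \<partial>\<mu>)"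

text \<open>Comes from exp(-S |\<xi>|^2) / |\<xi>|^2 = S times the integral over w \<ge> 1 of exp(-S
  w |\<xi>|^2): the singular part of the projection becomes a superposition of third derivatives of
  heat kernels at the later times S w.\<close>

definition kin :: "'n \<Rightarrow> 'n \<Rightarrow> 'n \<Rightarrow> real \<Rightarrow> ('n::finite \<Rightarrow> complex) \<Rightarrow> complex" where
  "kin m j l S z = (if j = l then Qg (ei m) S z else 0)
     + (LBINT w. indicator {1..} w *\<^sub>R (of_real S * Qg (ei3 m j l) (S * w) z))"

definition kc :: "'n \<Rightarrow> 'n \<Rightarrow> 'n \<Rightarrow> real \<Rightarrow> ('n::finite \<Rightarrow> complex) \<Rightarrow> complex" where
  "kc m j l t z = (\<integral>s. kin m j l (Sg t s) z \<partial>\<mu>)"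

text \<open>The constant and the exponential are the price of an arbitrary shift of size up to t
  powr (1/\<gamma>); the majorant itself depends on the real point only.\<close>

definition gm :: "real \<Rightarrow> real^'n::finite \<Rightarrow> ennreal" where
  "gm t x = (\<integral>\<^sup>+s. ennreal (Qc TYPE('n) * exp (real CARD('n) / s) * gn (2 * Sg t s) x) \<partial>\<mu>)"

text \<open>The weight is S (S w) powr (-3/2) = S powr (-1/2) w powr (-3/2), integrable at infinity.
  The derivative on K is essential: with two derivatives instead of three the weight would be
  1/w.\<close>

definition kinm :: "real \<Rightarrow> real^'n::finite \<Rightarrow> ennreal" where
  "kinm S x = ennreal (S powr (- 1 / 2) * gn (2 * S) x)
      + (\<integral>\<^sup>+w. ennreal (S powr (- 1 / 2) * w powr (- 3 / 2) * gn (2 * (S * w)) x) * indicator {1..} w \<partial>lborel)"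

definition km :: "real \<Rightarrow> real^'n::finite \<Rightarrow> ennreal" where
  "km t x = (\<integral>\<^sup>+s. ennreal (Qc TYPE('n) * exp (real CARD('n) / s)) * kinm (Sg t s) x \<partial>\<mu>)"

lemma gc_measurable[measurable (raw)]:
  fixes z :: "'w \<Rightarrow> 'n::finite \<Rightarrow> complex"
  assumes [measurable]: "f \<in> borel_measurable M" "\<And>i. (\<lambda>w. z w i) \<in> borel_measurable M"
  shows "(\<lambda>w. gc (f w) (z w)) \<in> borel_measurable M"
  unfolding gc_def by measurable

lemma kin_measurable[measurable (raw)]:
  fixes z :: "'w \<Rightarrow> 'n::finite \<Rightarrow> complex"
  assumes [measurable]: "f \<in> borel_measurable M" "\<And>i. (\<lambda>w. z w i) \<in> borel_measurable M"
  shows "(\<lambda>w. kin m j l (f w) (z w)) \<in> borel_measurable M"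
  unfolding kin_def by measurable

lemma kc_measurable[measurable (raw)]:
  fixes z :: "'w \<Rightarrow> 'n::finite \<Rightarrow> complex"
  assumes [measurable]: "f \<in> borel_measurable M" "\<And>i. (\<lambda>w. z w i) \<in> borel_measurable M"
  shows "(\<lambda>w. kc m j l (f w) (z w)) \<in> borel_measurable M"
  unfolding kc_def by measurable

lemma gm_measurable[measurable (raw)]:
  fixes z :: "'w \<Rightarrow> real^'n::finite"
  assumes [measurable]: "f \<in> borel_measurable M" "z \<in> borel_measurable M"
  shows "(\<lambda>w. gm (f w) (z w)) \<in> borel_measurable M"
  unfolding gm_def by measurable

lemma kinm_measurable[measurable (raw)]:
  fixes z :: "'w \<Rightarrow> real^'n::finite"
  assumes [measurable]: "f \<in> borel_measurable M" "z \<in> borel_measurable M"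
  shows "(\<lambda>w. kinm (f w) (z w)) \<in> borel_measurable M"
  unfolding kinm_def by measurable

lemma km_measurable[measurable (raw)]:
  fixes z :: "'w \<Rightarrow> real^'n::finite"
  assumes [measurable]: "f \<in> borel_measurable M" "z \<in> borel_measurable M"
  shows "(\<lambda>w. km (f w) (z w)) \<in> borel_measurable M"
  unfolding km_def by measurable

text \<open>The size of h is chosen so that |h i|^2 / (\<open>Sg t s\<close> w) \<le> 1/(s w) \<le>
  1/s: the cost of the shift depends on s alone and not on t.\<close>

lemma Qg_integrand_bound:
  fixes x :: "real^'n::finite"
  assumes t: "0 < t" and s: "0 < s" and w: "1 \<le> w" and a: "\<And>i. a i \<le> 3" and h: "\<And>i. norm (h i) \<le> t powr (1 / \<gamma>)"
  shows "norm (Qg a (Sg t s * w) (\<lambda>i. cvec x i + h i))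
     \<le> Qc TYPE('n) * exp (real CARD('n) / s) * ((Sg t s * w) powr (- real (sum a UNIV) / 2) * gn (2 * (Sg t s * w)) x)"
proof -
  let ?S = "Sg t s * w"
  have S: "0 < ?S" using t s w by simp
  have "norm (Qg a ?S (\<lambda>i. cvec x i + h i)) \<le> Qc TYPE('n) * ?S powr (- real (sum a UNIV) / 2) * gn (2 * ?S) x * exp (real CARD('n) * (t powr (1 / \<gamma>))\<^sup>2 / ?S)"
    by (rule Qg_bound[OF S a h])
  also have "\<dots> \<le> Qc TYPE('n) * ?S powr (- real (sum a UNIV) / 2) * gn (2 * ?S) x * exp (real CARD('n) / s)" proof (rule mult_left_mono)
    have "(t powr (1 / \<gamma>))\<^sup>2 = t powr (2 / \<gamma>)" by (simp add: powr_powr flip: powr_numeral)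
    then have "real CARD('n) * (t powr (1 / \<gamma>))\<^sup>2 / ?S = real CARD('n) / (s * w)" using t by simp
    also have "\<dots> \<le> real CARD('n) / s" using s w by (intro divide_left_mono) (auto simp: mult_le_cancel_left1)
    finally show "exp (real CARD('n) * (t powr (1 / \<gamma>))\<^sup>2 / ?S) \<le> exp (real CARD('n) / s)" by simp
  qed (use S in \<open>auto simp: Qc_def\<close>)
  finally show ?thesis by (simp only: mult_ac)
qed

lemma gc_integrand_bound:
  fixes x :: "real^'n::finite"
  assumes t: "0 < t" and s: "0 < s" and h: "\<And>i. norm (h i) \<le> t powr (1 / \<gamma>)"
  shows "norm (Qg (\<lambda>_. 0) (Sg t s) (\<lambda>i. cvec x i + h i)) \<le> Qc TYPE('n) * exp (real CARD('n) / s) * gn (2 * Sg t s) x"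
  using Qg_integrand_bound[OF t s order_refl, of "\<lambda>_. 0" h x] h t s by simp

lemma kin_tail_bound:
  fixes x :: "real^'n::finite"
  assumes t: "0 < t" and s: "0 < s" and h: "\<And>i. norm (h i) \<le> t powr (1 / \<gamma>)"
  shows "norm (indicator {1..} w *\<^sub>R (of_real (Sg t s) * Qg (ei3 m j l) (Sg t s * w) (\<lambda>i. cvec x i + h i)))
    \<le> Qc TYPE('n) * exp (real CARD('n) / s) * (Sg t s powr (- 1 / 2) * w powr (- 3 / 2) * gn (2 * (Sg t s * w)) x) * indicator {1..} w"
proof (cases "1 \<le> w")
  case w: True
  have S: "0 < Sg t s" using t s by simp
  have e: "Sg t s * (Sg t s * w) powr (- 3 / 2) = Sg t s powr (- 1 / 2) * w powr (- 3 / 2)" proof -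
    have "Sg t s powr 1 * Sg t s powr (- 3 / 2) = Sg t s powr (- 1 / 2)" by (simp only: powr_add[symmetric]) simp
    then show ?thesis using S w by (simp add: powr_mult)
  qed
  have "norm (indicator {1..} w *\<^sub>R (of_real (Sg t s) * Qg (ei3 m j l) (Sg t s * w) (\<lambda>i. cvec x i + h i)))
     = Sg t s * norm (Qg (ei3 m j l) (Sg t s * w) (\<lambda>i. cvec x i + h i))"
    using w S by (simp add: norm_mult del: of_real_mult zero_less_mult_iff)
  also have "\<dots> \<le> Sg t s * (Qc TYPE('n) * exp (real CARD('n) / s) * ((Sg t s * w) powr (- 3 / 2) * gn (2 * (Sg t s * w)) x))"
    using Qg_integrand_bound[OF t s w, of "ei3 m j l" h x] h S by (intro mult_left_mono) auto
  also have "\<dots> = Qc TYPE('n) * exp (real CARD('n) / s) * ((Sg t s * (Sg t s * w) powr (- 3 / 2)) * gn (2 * (Sg t s * w)) x)"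
    by (simp only: mult_ac)
  finally show ?thesis unfolding e using w by simp
qed simp

lemma Qc_nonneg[simp]: "0 \<le> Qc TYPE('n::finite)" by (simp add: Qc_def)

lemma kin_bound:
  fixes x :: "real^'n::finite"
  assumes t: "0 < t" and s: "0 < s" and h: "\<And>i. norm (h i) \<le> t powr (1 / \<gamma>)"
  shows "ennreal (norm (kin m j l (Sg t s) (\<lambda>i. cvec x i + h i))) \<le> ennreal (Qc TYPE('n) * exp (real CARD('n) / s)) * kinm (Sg t s) x"
proof -
  have S: "0 < Sg t s" using t s by simp
  let ?Q = "Qc TYPE('n) * exp (real CARD('n) / s)"
  let ?I = "\<integral>w. indicator {1..} w *\<^sub>R (of_real (Sg t s) * Qg (ei3 m j l) (Sg t s * w) (\<lambda>i. cvec x i + h i)) \<partial>lborel"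
  have 1: "norm (if j = l then Qg (ei m) (Sg t s) (\<lambda>i. cvec x i + h i) else 0) \<le> ?Q * (Sg t s powr (- 1 / 2) * gn (2 * Sg t s) x)"
    using Qg_integrand_bound[OF t s order_refl, of "ei m" h x] h S by simp
  have "ennreal (norm ?I) \<le> (\<integral>\<^sup>+w. ennreal (norm (indicator {1..} w *\<^sub>R (of_real (Sg t s) * Qg (ei3 m j l) (Sg t s * w) (\<lambda>i. cvec x i + h i)))) \<partial>lborel)"
    by (rule norm_integral_le_nn_integral)
  also have "\<dots> \<le> (\<integral>\<^sup>+w. ennreal ?Q * (ennreal (Sg t s powr (- 1 / 2) * w powr (- 3 / 2) * gn (2 * (Sg t s * w)) x) * indicator {1..} w) \<partial>lborel)"
  proof (rule nn_integral_mono)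
    fix w :: real
    have "ennreal (norm (indicator {1..} w *\<^sub>R (of_real (Sg t s) * Qg (ei3 m j l) (Sg t s * w) (\<lambda>i. cvec x i + h i))))
      \<le> ennreal (?Q * (Sg t s powr (- 1 / 2) * w powr (- 3 / 2) * gn (2 * (Sg t s * w)) x) * indicator {1..} w)"
      by (rule ennreal_leI[OF kin_tail_bound[OF t s h]])
    also have "\<dots> = ennreal ?Q * (ennreal (Sg t s powr (- 1 / 2) * w powr (- 3 / 2) * gn (2 * (Sg t s * w)) x) * indicator {1..} w)"
      by (auto simp: indicator_def ennreal_mult')
    finally show "ennreal (norm (indicator {1..} w *\<^sub>R (of_real (Sg t s) * Qg (ei3 m j l) (Sg t s * w) (\<lambda>i. cvec x i + h i))))
       \<le> ennreal ?Q * (ennreal (Sg t s powr (- 1 / 2) * w powr (- 3 / 2) * gn (2 * (Sg t s * w)) x) * indicator {1..} w)" .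
  qed
  also have "\<dots> = ennreal ?Q * (\<integral>\<^sup>+w. ennreal (Sg t s powr (- 1 / 2) * w powr (- 3 / 2) * gn (2 * (Sg t s * w)) x) * indicator {1..} w \<partial>lborel)"
    by (rule nn_integral_cmult) measurable
  finally have 2: "ennreal (norm ?I) \<le> \<dots>" .
  have "ennreal (norm (kin m j l (Sg t s) (\<lambda>i. cvec x i + h i))) \<le> ennreal (norm (if j = l then Qg (ei m) (Sg t s) (\<lambda>i. cvec x i + h i) else 0)) + ennreal (norm ?I)"
    unfolding kin_def by (subst ennreal_plus[symmetric], simp, simp, rule ennreal_leI, rule norm_triangle_ineq)
  also have "\<dots> \<le> ennreal (?Q * (Sg t s powr (- 1 / 2) * gn (2 * Sg t s) x)) + ennreal ?Q * (\<integral>\<^sup>+w. ennreal (Sg t s powr (- 1 / 2) * w powr (- 3 / 2) * gn (2 * (Sg t s * w)) x) * indicator {1..} w \<partial>lborel)"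
    by (rule add_mono[OF ennreal_leI[OF 1] 2])
  also have "\<dots> = ennreal ?Q * kinm (Sg t s) x"
    unfolding kinm_def distrib_left by (subst ennreal_mult[of ?Q]) (use S in auto)
  finally show ?thesis .
qed

lemma gc_bound:
  fixes x :: "real^'n::finite"
  assumes t: "0 < t" and h: "\<And>i. norm (h i) \<le> t powr (1 / \<gamma>)"
  shows "ennreal (norm (gc t (\<lambda>i. cvec x i + h i))) \<le> gm t x"
proof -
  have "ennreal (norm (gc t (\<lambda>i. cvec x i + h i))) \<le> (\<integral>\<^sup>+s. ennreal (norm (Qg (\<lambda>_. 0) (Sg t s) (\<lambda>i. cvec x i + h i))) \<partial>\<mu>)"
    unfolding gc_def by (rule norm_integral_le_nn_integral)
  also have "\<dots> \<le> gm t x" unfolding gm_def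
    by (rule nn_integral_mono_AE, use AE_pos in eventually_elim) (rule ennreal_leI[OF gc_integrand_bound[OF t _ h]])
  finally show ?thesis .
qed

lemma kc_bound:
  fixes x :: "real^'n::finite"
  assumes t: "0 < t" and h: "\<And>i. norm (h i) \<le> t powr (1 / \<gamma>)"
  shows "ennreal (norm (kc m j l t (\<lambda>i. cvec x i + h i))) \<le> km t x"
proof -
  have "ennreal (norm (kc m j l t (\<lambda>i. cvec x i + h i))) \<le> (\<integral>\<^sup>+s. ennreal (norm (kin m j l (Sg t s) (\<lambda>i. cvec x i + h i))) \<partial>\<mu>)"
    unfolding kc_def by (rule norm_integral_le_nn_integral)
  also have "\<dots> \<le> km t x" unfolding km_def by (rule nn_integral_mono_AE, use AE_pos in eventually_elim) (rule kin_bound[OF t _ h])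
  finally show ?thesis .
qed

text \<open>One constant for all four kernel bounds: 3 = 1 + 2 adds the head of \<open>kinm\<close>
  and the integral of w powr (-3/2) over [1, \<infinity>), and the summand 1 makes it
  positive.\<close>

definition CK :: "'n::finite itself \<Rightarrow> real" where "CK _ = 3 * Qc TYPE('n) * EC TYPE('n) + 1"

lemma CK_pos: "0 < CK TYPE('n::finite)" using EC(2)[where 'n='n] by (simp add: CK_def add_nonneg_pos)

lemma weight_le:
  assumes s: "0 < s" and "0 \<le> p" "p \<le> real CARD('n::finite)"
  shows "exp (real CARD('n) / s) * s powr (- p) \<le> exp (2 * real CARD('n) / s)"
proof -
  have "s powr (- p) \<le> exp (real CARD('n) / s)" using powr_neg_le_exp[OF s assms(2)] assms by (auto intro: order_trans simp: divide_right_mono)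
  then have "exp (real CARD('n) / s) * s powr (- p) \<le> exp (real CARD('n) / s) * exp (real CARD('n) / s)" by (intro mult_left_mono) auto
  also have "\<dots> = exp (2 * real CARD('n) / s)" by (simp flip: exp_add)
  finally show ?thesis .
qed

lemma EC_integral_le:
  assumes f: "\<And>s. 0 < s \<Longrightarrow> f s \<le> ennreal (c * exp (2 * real CARD('n::finite) / s))" and c: "0 \<le> c"
  shows "(\<integral>\<^sup>+s. f s \<partial>\<mu>) \<le> ennreal (c * EC TYPE('n))"
proof -
  have "(\<integral>\<^sup>+s. f s \<partial>\<mu>) \<le> (\<integral>\<^sup>+s. ennreal c * ennreal (exp (2 * real CARD('n) / s)) \<partial>\<mu>)"
    by (rule nn_integral_mono_AE, use AE_pos in eventually_elim) (use f c in \<open>auto simp: ennreal_mult\<close>)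
  also have "\<dots> = ennreal (c * EC TYPE('n))" using c EC(2)[where 'n='n] by (subst nn_integral_cmult) (auto simp: EC ennreal_mult)
  finally show ?thesis .
qed

lemma gm_L1: assumes t: "0 < t" shows "(\<integral>\<^sup>+x. gm t (x::real^'n::finite) \<partial>lborel) \<le> ennreal (CK TYPE('n))"
proof -
  interpret pair_sigma_finite "lborel :: (real^'n) measure" \<mu> by standard
  have "(\<integral>\<^sup>+x. gm t (x::real^'n) \<partial>lborel) = (\<integral>\<^sup>+s. (\<integral>\<^sup>+x. ennreal (Qc TYPE('n) * exp (real CARD('n) / s) * gn (2 * Sg t s) (x::real^'n)) \<partial>lborel) \<partial>\<mu>)"
    unfolding gm_def by (rule Fubini'[symmetric]) measurable
  also have "\<dots> \<le> ennreal (Qc TYPE('n) * EC TYPE('n))" proof (rule EC_integral_le)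
    fix s :: real assume s: "0 < s"
    have "(\<integral>\<^sup>+x. ennreal (Qc TYPE('n) * exp (real CARD('n) / s) * gn (2 * Sg t s) (x::real^'n)) \<partial>lborel) = ennreal (Qc TYPE('n) * exp (real CARD('n) / s))"
      using s t by (simp add: ennreal_mult nn_integral_cmult nn_integral_gn)
    also have "\<dots> \<le> ennreal (Qc TYPE('n) * exp (2 * real CARD('n) / s))"
      using s by (intro ennreal_leI mult_left_mono) (auto simp: divide_right_mono)
    finally show "(\<integral>\<^sup>+x. ennreal (Qc TYPE('n) * exp (real CARD('n) / s) * gn (2 * Sg t s) (x::real^'n)) \<partial>lborel) \<le> \<dots>" .
  qed simp
  also have "\<dots> \<le> ennreal (CK TYPE('n))" using EC(2)[where 'n='n] by (intro ennreal_leI) (simp add: CK_def)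
  finally show ?thesis .
qed

text \<open>The peak of the Gaussian is a power -d/2 of 8 \<pi> w \<open>Sg t s\<close>, and 8 \<pi>
  w \<ge> 1.\<close>

lemma gn_Sg_le:
  assumes t: "0 < t" and s: "0 < s" and w: "1 \<le> w"
  shows "gn (2 * (Sg t s * w)) (x::real^'n::finite) \<le> t powr (- real CARD('n) / \<gamma>) * s powr (- real CARD('n) / 2)"
proof -
  have S: "0 < Sg t s * w" using t s w by simp
  have "gn (2 * (Sg t s * w)) x \<le> (4 * pi * (2 * (Sg t s * w))) powr (- real CARD('n) / 2)" by (rule gn_le) (use S in simp)
  also have "\<dots> \<le> (Sg t s) powr (- real CARD('n) / 2)" proof (rule powr_mono2')
    have "Sg t s * 1 \<le> Sg t s * (8 * pi * w)" proof (rule mult_left_mono)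
      show "1 \<le> 8 * pi * w" using w pi_ge_two mult_mono[of 1 "8 * pi" 1 w] by simp
    qed (use t s in simp)
    then show "Sg t s \<le> 4 * pi * (2 * (Sg t s * w))" by (simp add: mult_ac)
  qed (use t s in auto)
  also have "\<dots> = t powr (- real CARD('n) / \<gamma>) * s powr (- real CARD('n) / 2)" using t s by (simp add: powr_mult powr_powr)
  finally show ?thesis .
qed

text \<open>The peak bound contributes t powr (-d/\<gamma>) and a negative power of s, for which the
  exponential moment pays.\<close>

lemma gm_sup: assumes t: "0 < t" shows "gm t (x::real^'n::finite) \<le> ennreal (CK TYPE('n) * t powr (- real CARD('n) / \<gamma>))"
proof -
  have "gm t x \<le> ennreal ((Qc TYPE('n) * t powr (- real CARD('n) / \<gamma>)) * EC TYPE('n))"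
    unfolding gm_def proof (rule EC_integral_le[OF ennreal_leI])
    fix s :: real assume s: "0 < s"
    have "Qc TYPE('n) * exp (real CARD('n) / s) * gn (2 * Sg t s) x \<le> Qc TYPE('n) * exp (real CARD('n) / s) * (t powr (- real CARD('n) / \<gamma>) * s powr (- real CARD('n) / 2))"
      using gn_Sg_le[OF t s order_refl, of x] by (intro mult_left_mono) auto
    also have "\<dots> = Qc TYPE('n) * t powr (- real CARD('n) / \<gamma>) * (exp (real CARD('n) / s) * s powr (- (real CARD('n) / 2)))" by (simp add: mult_ac)
    also have "\<dots> \<le> Qc TYPE('n) * t powr (- real CARD('n) / \<gamma>) * exp (2 * real CARD('n) / s)"
      by (intro mult_left_mono weight_le s) auto
    finally show "Qc TYPE('n) * exp (real CARD('n) / s) * gn (2 * Sg t s) x \<le> \<dots>" .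
  qed simp
  also have "\<dots> \<le> ennreal (CK TYPE('n) * t powr (- real CARD('n) / \<gamma>))" proof (rule ennreal_leI)
    have "Qc TYPE('n) * EC TYPE('n) * t powr (- real CARD('n) / \<gamma>) \<le> CK TYPE('n) * t powr (- real CARD('n) / \<gamma>)"
      using EC(2)[where 'n='n] by (intro mult_right_mono) (auto simp: CK_def)
    then show "Qc TYPE('n) * t powr (- real CARD('n) / \<gamma>) * EC TYPE('n) \<le> CK TYPE('n) * t powr (- real CARD('n) / \<gamma>)" by (simp add: mult_ac)
  qed
  finally show ?thesis .
qed

lemma Sg_powr_half: "0 < t \<Longrightarrow> 0 < s \<Longrightarrow> Sg t s powr (- 1 / 2) = t powr (- 1 / \<gamma>) * s powr (- 1 / 2)"
  by (simp add: powr_mult powr_powr)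

lemma kinm_L1:
  assumes S: "0 < S"
  shows "(\<integral>\<^sup>+x. kinm S (x::real^'n::finite) \<partial>lborel) = ennreal (3 * S powr (- 1 / 2))"
proof -
  have "(\<integral>\<^sup>+x. kinm S (x::real^'n) \<partial>lborel) = (\<integral>\<^sup>+x. ennreal (S powr (- 1 / 2) * gn (2 * S) (x::real^'n)) \<partial>lborel)
     + (\<integral>\<^sup>+x. (\<integral>\<^sup>+w. ennreal (S powr (- 1 / 2) * w powr (- 3 / 2) * gn (2 * (S * w)) (x::real^'n)) * indicator {1..} w \<partial>lborel) \<partial>lborel)"
    unfolding kinm_def by (rule nn_integral_add) measurable
  also have "(\<integral>\<^sup>+x. ennreal (S powr (- 1 / 2) * gn (2 * S) (x::real^'n)) \<partial>lborel) = ennreal (S powr (- 1 / 2))"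
    using S by (simp add: ennreal_mult' nn_integral_cmult nn_integral_gn)
  also have "(\<integral>\<^sup>+x. (\<integral>\<^sup>+w. ennreal (S powr (- 1 / 2) * w powr (- 3 / 2) * gn (2 * (S * w)) (x::real^'n)) * indicator {1..} w \<partial>lborel) \<partial>lborel)
     = (\<integral>\<^sup>+w. (\<integral>\<^sup>+x. ennreal (S powr (- 1 / 2) * w powr (- 3 / 2) * gn (2 * (S * w)) (x::real^'n)) * indicator {1..} w \<partial>lborel) \<partial>lborel)"
    by (rule lborel_pair.Fubini'[symmetric]) measurable
  also have "\<dots> = (\<integral>\<^sup>+w. ennreal (S powr (- 1 / 2)) * (ennreal (w powr (- 3 / 2)) * indicator {1..} w) \<partial>lborel)"
  proof (rule nn_integral_cong)
    fix w :: real
    show "(\<integral>\<^sup>+x. ennreal (S powr (- 1 / 2) * w powr (- 3 / 2) * gn (2 * (S * w)) (x::real^'n)) * indicator {1..} w \<partial>lborel) = ennreal (S powr (- 1 / 2)) * (ennreal (w powr (- 3 / 2)) * indicator {1..} w)"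
      using S by (cases "1 \<le> w") (auto simp: ennreal_mult' nn_integral_cmult nn_integral_gn mult.assoc)
  qed
  also have "\<dots> = ennreal (S powr (- 1 / 2)) * 2" by (subst nn_integral_cmult) (measurable, simp only: nn_integral_powr_ge1)
  also have "ennreal (S powr (- 1 / 2)) + ennreal (S powr (- 1 / 2)) * 2 = ennreal (3 * S powr (- 1 / 2))" by (rule ennreal_add_double) simp
  finally show ?thesis .
qed

lemma kinm_sup:
  assumes t: "0 < t" and s: "0 < s"
  shows "kinm (Sg t s) (x::real^'n::finite) \<le> ennreal (3 * (Sg t s powr (- 1 / 2) * (t powr (- real CARD('n) / \<gamma>) * s powr (- real CARD('n) / 2))))"
proof -
  let ?b = "t powr (- real CARD('n) / \<gamma>) * s powr (- real CARD('n) / 2)" and ?c = "Sg t s powr (- 1 / 2)"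
  have 1: "ennreal (?c * gn (2 * Sg t s) x) \<le> ennreal (?c * ?b)"
    using gn_Sg_le[OF t s order_refl, of x] by (intro ennreal_leI mult_left_mono) auto
  have "(\<integral>\<^sup>+w. ennreal (?c * w powr (- 3 / 2) * gn (2 * (Sg t s * w)) x) * indicator {1..} w \<partial>lborel)
     \<le> (\<integral>\<^sup>+w. ennreal (?c * ?b) * (ennreal (w powr (- 3 / 2)) * indicator {1..} w) \<partial>lborel)"
  proof (rule nn_integral_mono)
    fix w :: real
    show "ennreal (?c * w powr (- 3 / 2) * gn (2 * (Sg t s * w)) x) * indicator {1..} w \<le> ennreal (?c * ?b) * (ennreal (w powr (- 3 / 2)) * indicator {1..} w)"
    proof (cases "1 \<le> w")
      case True
      have "?c * w powr (- 3 / 2) * gn (2 * (Sg t s * w)) x \<le> ?c * w powr (- 3 / 2) * ?b"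
        using gn_Sg_le[OF t s True, of x] by (intro mult_left_mono) auto
      then have "?c * w powr (- 3 / 2) * gn (2 * (Sg t s * w)) x \<le> ?c * ?b * w powr (- 3 / 2)" by (simp only: mult_ac)
      from ennreal_leI[OF this] show ?thesis using True by (simp add: ennreal_mult)
    qed simp
  qed
  also have "\<dots> = ennreal (?c * ?b) * 2" by (subst nn_integral_cmult) (measurable, simp only: nn_integral_powr_ge1)
  finally have 2: "(\<integral>\<^sup>+w. ennreal (?c * w powr (- 3 / 2) * gn (2 * (Sg t s * w)) x) * indicator {1..} w \<partial>lborel) \<le> ennreal (?c * ?b) * 2" .
  have "kinm (Sg t s) x \<le> ennreal (?c * ?b) + ennreal (?c * ?b) * 2"
    unfolding kinm_def by (rule add_mono[OF 1 2])
  also have "\<dots> = ennreal (3 * (?c * ?b))" by (rule ennreal_add_double) simp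
  finally show ?thesis .
qed

lemma half_le_card: "1 / 2 \<le> real CARD('n::finite)" "1 / 2 + real CARD('n) / 2 \<le> real CARD('n)"
proof -
  have "1 \<le> real CARD('n)" by (simp add: Suc_leI)
  then show "1 / 2 \<le> real CARD('n::finite)" "1 / 2 + real CARD('n) / 2 \<le> real CARD('n)" by linarith+
qed

text \<open>Gaussians have mass 1, so only the weights remain; the factor S powr (-1/2) at S =
  \<open>Sg t s\<close> produces t powr (-1/\<gamma>).\<close>

lemma km_L1: assumes t: "0 < t" shows "(\<integral>\<^sup>+x. km t (x::real^'n::finite) \<partial>lborel) \<le> ennreal (CK TYPE('n) * t powr (- 1 / \<gamma>))"
proof -
  interpret pair_sigma_finite "lborel :: (real^'n) measure" \<mu> by standard
  have "(\<integral>\<^sup>+x. km t (x::real^'n) \<partial>lborel) = (\<integral>\<^sup>+s. (\<integral>\<^sup>+x. ennreal (Qc TYPE('n) * exp (real CARD('n) / s)) * kinm (Sg t s) (x::real^'n) \<partial>lborel) \<partial>\<mu>)"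
    unfolding km_def by (rule Fubini'[symmetric]) measurable
  also have "\<dots> \<le> ennreal ((3 * Qc TYPE('n) * t powr (- 1 / \<gamma>)) * EC TYPE('n))" proof (rule EC_integral_le)
    fix s :: real assume s: "0 < s"
    have "(\<integral>\<^sup>+x. ennreal (Qc TYPE('n) * exp (real CARD('n) / s)) * kinm (Sg t s) (x::real^'n) \<partial>lborel)
       = ennreal (Qc TYPE('n) * exp (real CARD('n) / s)) * ennreal (3 * Sg t s powr (- 1 / 2))"
      using s t by (subst nn_integral_cmult) (auto simp: kinm_L1)
    also have "\<dots> = ennreal (3 * Qc TYPE('n) * t powr (- 1 / \<gamma>) * (exp (real CARD('n) / s) * s powr (- (1 / 2))))"
      by (subst ennreal_mult[symmetric]) (simp, simp, simp only: Sg_powr_half[OF t s], simp add: mult_ac)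
    also have "\<dots> \<le> ennreal (3 * Qc TYPE('n) * t powr (- 1 / \<gamma>) * exp (2 * real CARD('n) / s))"
      by (intro ennreal_leI mult_left_mono weight_le s half_le_card) auto
    finally show "(\<integral>\<^sup>+x. ennreal (Qc TYPE('n) * exp (real CARD('n) / s)) * kinm (Sg t s) (x::real^'n) \<partial>lborel) \<le> \<dots>" .
  qed simp
  also have "\<dots> \<le> ennreal (CK TYPE('n) * t powr (- 1 / \<gamma>))" by (intro ennreal_leI) (simp add: CK_def algebra_simps)
  finally show ?thesis .
qed

lemma km_sup: assumes t: "0 < t" shows "km t (x::real^'n::finite) \<le> ennreal (CK TYPE('n) * t powr (- 1 / \<gamma> - real CARD('n) / \<gamma>))"
proof -
  have "km t x \<le> ennreal ((3 * Qc TYPE('n) * t powr (- 1 / \<gamma> - real CARD('n) / \<gamma>)) * EC TYPE('n))"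
    unfolding km_def proof (rule EC_integral_le)
    fix s :: real assume s: "0 < s"
    have e: "3 * (Sg t s powr (- 1 / 2) * (t powr (- real CARD('n) / \<gamma>) * s powr (- real CARD('n) / 2)))
       = 3 * t powr (- 1 / \<gamma> - real CARD('n) / \<gamma>) * s powr (- (1 / 2 + real CARD('n) / 2))"
    proof -
      have "t powr (- 1 / \<gamma>) * t powr (- real CARD('n) / \<gamma>) = t powr (- 1 / \<gamma> - real CARD('n) / \<gamma>)"
        by (simp flip: powr_add)
      moreover have "s powr (- 1 / 2) * s powr (- real CARD('n) / 2) = s powr (- (1 / 2 + real CARD('n) / 2))" by (simp flip: powr_add)
      moreover have "3 * ((a * b) * (c * d)) = 3 * (a * c) * (b * d)" for a b c d :: real by (simp only: mult_ac)
      ultimately show ?thesis unfolding Sg_powr_half[OF t s] by metis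
    qed
    have "ennreal (Qc TYPE('n) * exp (real CARD('n) / s)) * kinm (Sg t s) x \<le> ennreal (Qc TYPE('n) * exp (real CARD('n) / s)) * ennreal (3 * t powr (- 1 / \<gamma> - real CARD('n) / \<gamma>) * s powr (- (1 / 2 + real CARD('n) / 2)))"
      using kinm_sup[OF t s, of x] unfolding e by (intro mult_left_mono) auto
    also have "\<dots> = ennreal (3 * Qc TYPE('n) * t powr (- 1 / \<gamma> - real CARD('n) / \<gamma>) * (exp (real CARD('n) / s) * s powr (- (1 / 2 + real CARD('n) / 2))))"
      by (subst ennreal_mult[symmetric]) (auto simp: mult_ac)
    also have "\<dots> \<le> ennreal (3 * Qc TYPE('n) * t powr (- 1 / \<gamma> - real CARD('n) / \<gamma>) * exp (2 * real CARD('n) / s))"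
      by (intro ennreal_leI mult_left_mono weight_le s half_le_card) auto
    finally show "ennreal (Qc TYPE('n) * exp (real CARD('n) / s)) * kinm (Sg t s) x \<le> \<dots>" .
  qed simp
  also have "\<dots> \<le> ennreal (CK TYPE('n) * t powr (- 1 / \<gamma> - real CARD('n) / \<gamma>))"
    by (intro ennreal_leI) (simp add: CK_def algebra_simps)
  finally show ?thesis .
qed

end

section \<open>Holomorphic dependence on the shift, and Fourier representation on the real
  axis\<close>

lemma cnj_Dg: "cnj (Dg a s (of_real x)) = Dg a s (of_real x)"
  by (simp add: Dg_def hpoly_def exp_cnj)

lemma cnj_Qg: "cnj (Qg a s (cvec x)) = Qg a s (cvec x)"
  by (simp add: Qg_def cvec_def cnj_Dg)

lemma Qg_0: "Qg (\<lambda>_. 0) s (cvec x) = of_real (gn s x)"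
  by (simp add: Qg_def cvec_def Dg_0 gn_def)

lemma integrable_of_nn_bound:
  fixes f :: "'w \<Rightarrow> 'b::{banach, second_countable_topology}"
  assumes [measurable]: "f \<in> borel_measurable M" and "\<And>w. w \<in> space M \<Longrightarrow> ennreal (norm (f w)) \<le> B w" and "(\<integral>\<^sup>+w. B w \<partial>M) < \<infinity>"
  shows "integrable M f"
  by (rule integrableI_bounded[OF assms(1)], rule le_less_trans[OF nn_integral_mono assms(3)], rule assms(2))

lemma upd_norm_le:
  fixes h :: "'n \<Rightarrow> complex"
  assumes "\<And>k. norm (h k) < r" "z \<in> ball 0 r"
  shows "norm ((h(i := z)) k) \<le> r"
  using assms(1)[of k] assms(2) by (cases "k = i") auto

lemma integrable_enn2real:
  assumes [measurable]: "B \<in> borel_measurable M" and "(\<integral>\<^sup>+w. B w \<partial>M) < \<infinity>"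
  shows "integrable M (\<lambda>w. enn2real (B w))"
proof (rule integrable_of_nn_bound[OF _ _ assms(2)])
  fix w show "ennreal (norm (enn2real (B w))) \<le> B w" by (cases "B w") auto
qed measurable

lemma norm_le_enn2real: "ennreal a \<le> B \<Longrightarrow> B < \<infinity> \<Longrightarrow> a \<le> enn2real B"
  by (cases B) (auto simp: ennreal_le_iff2 split: if_splits)

lemma upd_shift: "(\<lambda>k. cvec x k + (h(i := z)) k) = (\<lambda>k. cvec x k + h k)(i := cvec x i + z)"
  by auto

lemma Qg_holomorphic_shift: "0 < s \<Longrightarrow> (\<lambda>z. Qg a s (\<lambda>k. cvec x k + (h(i := z)) k)) holomorphic_on A"
proof -
  assume s: "0 < s"
  have "((\<lambda>z. Qg a s ((\<lambda>k. cvec x k + h k)(i := z))) \<circ> (\<lambda>z. cvec x i + z)) holomorphic_on A"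
    by (rule holomorphic_on_compose[OF _ Qg_holomorphic[OF s]]) (intro holomorphic_intros)
  then show ?thesis unfolding upd_shift o_def .
qed

lemma Qg_measurable_const:
  fixes z :: "'n::finite \<Rightarrow> complex"
  shows "f \<in> borel_measurable M \<Longrightarrow> (\<lambda>w. Qg a (f w) z) \<in> borel_measurable M"
  by (rule Qg_measurable) auto

context subordinator
begin

text \<open>One coordinate of the shift varies while the others are frozen. The integrand of
  \<open>gm\<close> serves as the majorant over s, since it does not depend on z.\<close>

lemma gc_holomorphic:
  fixes x :: "real^'n::finite"
  assumes t: "0 < t" and h: "\<And>k. norm (h k) < t powr (1 / \<gamma>)"
  shows "(\<lambda>z. gc t (\<lambda>k. cvec x k + (h(i := z)) k)) holomorphic_on ball 0 (t powr (1 / \<gamma>))"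
  unfolding gc_def
proof (rule holomorphic_lebesgue_integral[where B = "\<lambda>s. enn2real (ennreal (Qc TYPE('n) * exp (real CARD('n) / s) * gn (2 * Sg t s) x))"])
  show "AE s in \<mu>. (\<lambda>z. Qg (\<lambda>_. 0) (Sg t s) (\<lambda>k. cvec x k + (h(i := z)) k)) holomorphic_on ball 0 (t powr (1 / \<gamma>)) \<and>
     (\<forall>z\<in>ball 0 (t powr (1 / \<gamma>)). norm (Qg (\<lambda>_. 0) (Sg t s) (\<lambda>k. cvec x k + (h(i := z)) k)) \<le> enn2real (ennreal (Qc TYPE('n) * exp (real CARD('n) / s) * gn (2 * Sg t s) x)))"
    using AE_pos proof eventually_elim
    case (elim s)
    have "norm (Qg (\<lambda>_. 0) (Sg t s) (\<lambda>k. cvec x k + (h(i := z)) k)) \<le> Qc TYPE('n) * exp (real CARD('n) / s) * gn (2 * Sg t s) x" if "z \<in> ball 0 (t powr (1 / \<gamma>))" for z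
      by (rule gc_integrand_bound[OF t elim]) (rule upd_norm_le[OF h that])
    then show ?case using Qg_holomorphic_shift[OF Sg_pos[OF t elim]] t elim by simp
  qed
  show "integrable \<mu> (\<lambda>s. enn2real (ennreal (Qc TYPE('n) * exp (real CARD('n) / s) * gn (2 * Sg t s) x)))"
    by (rule integrable_enn2real) (use gm_sup[OF t, of x] in \<open>auto simp: gm_def less_top[symmetric] top_unique\<close>)
  show "(\<lambda>s. Qg (\<lambda>_. 0) (Sg t s) (\<lambda>k. cvec x k + (h(i := z)) k)) \<in> borel_measurable \<mu>" for z
    by (rule Qg_measurable_const) measurable
qed auto

lemma kinm_finite: "0 < t \<Longrightarrow> 0 < s \<Longrightarrow> kinm (Sg t s) x < \<infinity>"
  using kinm_sup[of t s x] by (auto intro: le_less_trans)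

lemma kin_holomorphic:
  fixes x :: "real^'n::finite"
  assumes t: "0 < t" and s: "0 < s" and h: "\<And>k. norm (h k) < t powr (1 / \<gamma>)"
  shows "(\<lambda>z. kin m j l (Sg t s) (\<lambda>k. cvec x k + (h(i := z)) k)) holomorphic_on ball 0 (t powr (1 / \<gamma>))"
  unfolding kin_def proof (intro holomorphic_on_add)
  show "(\<lambda>z. if j = l then Qg (ei m) (Sg t s) (\<lambda>k. cvec x k + (h(i := z)) k) else 0) holomorphic_on ball 0 (t powr (1 / \<gamma>))"
    using Qg_holomorphic_shift[OF Sg_pos[OF t s]] by (cases "j = l") auto
  let ?B = "\<lambda>w. ennreal (Qc TYPE('n) * exp (real CARD('n) / s) * (Sg t s powr (- 1 / 2) * w powr (- 3 / 2) * gn (2 * (Sg t s * w)) x) * indicator {1..} w)"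
  show "(\<lambda>z. \<integral>w. indicator {1..} w *\<^sub>R (of_real (Sg t s) * Qg (ei3 m j l) (Sg t s * w) (\<lambda>k. cvec x k + (h(i := z)) k)) \<partial>lborel) holomorphic_on ball 0 (t powr (1 / \<gamma>))"
  proof (rule holomorphic_lebesgue_integral[where B = "\<lambda>w. enn2real (?B w)"])
    show "AE w in lborel. (\<lambda>z. indicator {1..} w *\<^sub>R (of_real (Sg t s) * Qg (ei3 m j l) (Sg t s * w) (\<lambda>k. cvec x k + (h(i := z)) k))) holomorphic_on ball 0 (t powr (1 / \<gamma>))
       \<and> (\<forall>z\<in>ball 0 (t powr (1 / \<gamma>)). norm (indicator {1..} w *\<^sub>R (of_real (Sg t s) * Qg (ei3 m j l) (Sg t s * w) (\<lambda>k. cvec x k + (h(i := z)) k))) \<le> enn2real (?B w))"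
    proof (rule AE_I2, intro conjI ballI)
      fix w :: real
      show "(\<lambda>z. indicator {1..} w *\<^sub>R (of_real (Sg t s) * Qg (ei3 m j l) (Sg t s * w) (\<lambda>k. cvec x k + (h(i := z)) k))) holomorphic_on ball 0 (t powr (1 / \<gamma>))"
      proof (cases "1 \<le> w")
        case True
        then have "0 < Sg t s * w" using t s by simp
        then have "(\<lambda>z. of_real (Sg t s) * Qg (ei3 m j l) (Sg t s * w) (\<lambda>k. cvec x k + (h(i := z)) k)) holomorphic_on ball 0 (t powr (1 / \<gamma>))"
          by (intro holomorphic_on_mult holomorphic_on_const Qg_holomorphic_shift)
        then show ?thesis using True by simp
      qed simp
      fix z :: complex assume z: "z \<in> ball 0 (t powr (1 / \<gamma>))"
      have "norm (indicator {1..} w *\<^sub>R (of_real (Sg t s) * Qg (ei3 m j l) (Sg t s * w) (\<lambda>k. cvec x k + (h(i := z)) k)))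
         \<le> Qc TYPE('n) * exp (real CARD('n) / s) * (Sg t s powr (- 1 / 2) * w powr (- 3 / 2) * gn (2 * (Sg t s * w)) x) * indicator {1..} w" (is "?L \<le> ?R")
        by (rule kin_tail_bound[OF t s]) (rule upd_norm_le[OF h z])
      moreover from this have "0 \<le> ?R" by (rule order_trans[OF norm_ge_zero])
      ultimately show "?L \<le> enn2real (?B w)" by (simp only: enn2real_ennreal)
    qed
    show "integrable lborel (\<lambda>w. enn2real (?B w))" proof (rule integrable_enn2real)
      have "(\<integral>\<^sup>+w. ?B w \<partial>lborel) = (\<integral>\<^sup>+w. ennreal (Qc TYPE('n) * exp (real CARD('n) / s)) * (ennreal (Sg t s powr (- 1 / 2) * w powr (- 3 / 2) * gn (2 * (Sg t s * w)) x) * indicator {1..} w) \<partial>lborel)"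
        by (rule nn_integral_cong) (auto simp: indicator_def ennreal_mult')
      also have "\<dots> = ennreal (Qc TYPE('n) * exp (real CARD('n) / s)) * (\<integral>\<^sup>+w. ennreal (Sg t s powr (- 1 / 2) * w powr (- 3 / 2) * gn (2 * (Sg t s * w)) x) * indicator {1..} w \<partial>lborel)"
        by (rule nn_integral_cmult) measurable
      also have "\<dots> < \<infinity>" using kinm_finite[OF t s, of x] unfolding kinm_def by (auto simp: ennreal_mult_less_top)
      finally show "(\<integral>\<^sup>+w. ?B w \<partial>lborel) < \<infinity>" .
    qed measurable
    show "(\<lambda>w. indicator {1..} w *\<^sub>R (of_real (Sg t s) * Qg (ei3 m j l) (Sg t s * w) (\<lambda>k. cvec x k + (h(i := z)) k))) \<in> borel_measurable lborel" for z
      by (intro borel_measurable_scaleR borel_measurable_times Qg_measurable_const) measurable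
  qed auto
qed

lemma kc_holomorphic:
  fixes x :: "real^'n::finite"
  assumes t: "0 < t" and h: "\<And>k. norm (h k) < t powr (1 / \<gamma>)"
  shows "(\<lambda>z. kc m j l t (\<lambda>k. cvec x k + (h(i := z)) k)) holomorphic_on ball 0 (t powr (1 / \<gamma>))"
  unfolding kc_def
proof (rule holomorphic_lebesgue_integral[where B = "\<lambda>s. enn2real (ennreal (Qc TYPE('n) * exp (real CARD('n) / s)) * kinm (Sg t s) x)"])
  show "AE s in \<mu>. (\<lambda>z. kin m j l (Sg t s) (\<lambda>k. cvec x k + (h(i := z)) k)) holomorphic_on ball 0 (t powr (1 / \<gamma>)) \<and>
     (\<forall>z\<in>ball 0 (t powr (1 / \<gamma>)). norm (kin m j l (Sg t s) (\<lambda>k. cvec x k + (h(i := z)) k)) \<le> enn2real (ennreal (Qc TYPE('n) * exp (real CARD('n) / s)) * kinm (Sg t s) x))"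
    using AE_pos proof eventually_elim
    case (elim s)
    have "norm (kin m j l (Sg t s) (\<lambda>k. cvec x k + (h(i := z)) k)) \<le> enn2real (ennreal (Qc TYPE('n) * exp (real CARD('n) / s)) * kinm (Sg t s) x)" if "z \<in> ball 0 (t powr (1 / \<gamma>))" for z
    proof (rule norm_le_enn2real)
      show "ennreal (norm (kin m j l (Sg t s) (\<lambda>k. cvec x k + (h(i := z)) k))) \<le> ennreal (Qc TYPE('n) * exp (real CARD('n) / s)) * kinm (Sg t s) x"
        by (rule kin_bound[OF t elim]) (rule upd_norm_le[OF h that])
    qed (use kinm_finite[OF t elim, of x] in \<open>auto simp: ennreal_mult_less_top\<close>)
    moreover have "(\<lambda>z. kin m j l (Sg t s) (\<lambda>k. cvec x k + (h(i := z)) k)) holomorphic_on ball 0 (t powr (1 / \<gamma>))"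
      by (rule kin_holomorphic[OF t elim h])
    ultimately show ?case by blast
  qed
  show "integrable \<mu> (\<lambda>s. enn2real (ennreal (Qc TYPE('n) * exp (real CARD('n) / s)) * kinm (Sg t s) x))"
    by (rule integrable_enn2real) (use km_sup[OF t, of x] in \<open>auto simp: km_def less_top[symmetric] top_unique\<close>)
  show "(\<lambda>s. kin m j l (Sg t s) (\<lambda>k. cvec x k + (h(i := z)) k)) \<in> borel_measurable \<mu>" for z by (rule kin_measurable) auto
qed auto

lemma integrable_symbol:
  fixes p :: "real^'n::finite \<Rightarrow> complex"
  assumes t: "0 < t" and [measurable]: "p \<in> borel_measurable borel" and p: "\<And>x. norm (p x) \<le> B * (1 + norm x)"
  shows "integrable lborel (\<lambda>y. p y * cis (x \<bullet> y) * of_real (exp (- t * norm y powr \<gamma>)))"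
  by (rule gauss_mixture_fourier(1)[OF t]) (use p in \<open>auto simp: norm_mult\<close>)

lemma gc_fourier:
  fixes x :: "real^'n::finite"
  assumes t: "0 < t"
  shows "(2 * of_real pi) ^ CARD('n) * gc t (cvec x) = (LBINT y. cis (x \<bullet> y) * of_real (exp (- t * norm y powr \<gamma>)))"
proof -
  have "(2 * of_real pi) ^ CARD('n) * gc t (cvec x) = (\<integral>s. (2 * of_real pi) ^ CARD('n) * Qg (\<lambda>_. 0) (Sg t s) (cvec x) \<partial>\<mu>)"
    unfolding gc_def by simp
  also have "\<dots> = (\<integral>s. (LBINT y. cis (x \<bullet> y) * of_real (exp (- Sg t s * (norm y)\<^sup>2))) \<partial>\<mu>)"
  proof (rule integral_cong_AE)
    show "AE s in \<mu>. (2 * of_real pi) ^ CARD('n) * Qg (\<lambda>_. 0) (Sg t s) (cvec x) = (LBINT y. cis (x \<bullet> y) * of_real (exp (- Sg t s * (norm y)\<^sup>2)))"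
      using AE_pos by eventually_elim (subst fourier_Qg[symmetric], use t in \<open>auto simp: msym_def\<close>)
  qed measurable
  also have "\<dots> = (LBINT y. cis (x \<bullet> y) * of_real (exp (- t * norm y powr \<gamma>)))"
    by (rule gauss_mixture_fourier(2)[OF t, where B = 1]) auto
  finally show ?thesis .
qed

text \<open>The integral over w is exchanged with the Fourier integral. Integrating over w produces
  |y| powr (-2), which cancels two of the three factors of y in \<open>msym (ei3 m j l)\<close>; the
  Gaussian absorbs the remaining one.\<close>

lemma kin_fourier:
  fixes x :: "real^'n::finite"
  assumes S: "0 < S"
  shows "(2 * of_real pi) ^ CARD('n) * kin m j l S (cvec x) = (LBINT y. \<i> * of_real (ksym m j l y) * cis (x \<bullet> y) * of_real (exp (- S * (norm y)\<^sup>2)))"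
proof -
  let ?c = "(2 * complex_of_real pi) ^ CARD('n)"
  let ?m3 = "\<lambda>y. msym (ei3 m j l) y"
  let ?F = "\<lambda>(w, y). indicator {1..} w *\<^sub>R (of_real S * (?m3 y * cis (x \<bullet> y) * of_real (exp (- (S * w) * (norm y)\<^sup>2))))"
  have n3: "norm (?m3 y) \<le> norm y * (norm y)\<^sup>2" for y
    unfolding msym_ei3 norm_mult power2_eq_square mult.assoc by (simp, intro mult_mono component_le_norm_cart mult_nonneg_nonneg) auto
  have wint: "(\<integral>\<^sup>+w. ennreal (indicator {1..} w * (S * exp (- (S * w) * (norm y)\<^sup>2))) \<partial>lborel) = ennreal (exp (- S * (norm y)\<^sup>2) / (norm y)\<^sup>2)" if "y \<noteq> 0" for y :: "real^'n"
  proof -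
    have a: "0 < S * (norm y)\<^sup>2" using S that by simp
    have "(\<integral>\<^sup>+w. ennreal (indicator {1..} w * (S * exp (- (S * w) * (norm y)\<^sup>2))) \<partial>lborel) = (\<integral>\<^sup>+w. ennreal S * (ennreal (exp (- (S * (norm y)\<^sup>2) * w)) * indicator {1..} w) \<partial>lborel)"
      using S by (intro nn_integral_cong) (auto simp: indicator_def ennreal_mult' mult_ac)
    also have "\<dots> = ennreal S * ennreal (exp (- (S * (norm y)\<^sup>2)) / (S * (norm y)\<^sup>2))"
      using exp_div_integral_ge1[OF a] by (subst nn_integral_cmult) auto
    also have "\<dots> = ennreal (exp (- S * (norm y)\<^sup>2) / (norm y)\<^sup>2)" using S that by (subst ennreal_mult[symmetric]) auto
    finally show ?thesis .
  qed
  have int: "integrable (lborel \<Otimes>\<^sub>M lborel) ?F" proof (rule integrableI_bounded)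
    have "(\<integral>\<^sup>+z. ennreal (norm (?F z)) \<partial>(lborel \<Otimes>\<^sub>M lborel)) = (\<integral>\<^sup>+y. \<integral>\<^sup>+w. ennreal (norm (?F (w, y))) \<partial>lborel \<partial>lborel)"
      by (rule lborel_pair.nn_integral_snd[symmetric]) measurable
    also have "\<dots> \<le> (\<integral>\<^sup>+y. ennreal ((1 + 1 / sqrt S) * exp (- (S / 2) * (norm (y::real^'n))\<^sup>2)) \<partial>lborel)"
    proof (rule nn_integral_mono_AE, use AE_lborel_singleton[of "0::real^'n"] in eventually_elim)
      case (elim y)
      have "(\<integral>\<^sup>+w. ennreal (norm (?F (w, y))) \<partial>lborel) = (\<integral>\<^sup>+w. ennreal (norm (?m3 y)) * ennreal (indicator {1..} w * (S * exp (- (S * w) * (norm y)\<^sup>2))) \<partial>lborel)"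
        using S by (intro nn_integral_cong) (auto simp: norm_mult indicator_def ennreal_mult'[symmetric] mult_ac)
      also have "\<dots> = ennreal (norm (?m3 y)) * ennreal (exp (- S * (norm y)\<^sup>2) / (norm y)\<^sup>2)"
        by (subst nn_integral_cmult) (measurable, subst wint[OF elim], rule refl)
      also have "\<dots> = ennreal (norm (?m3 y) * (exp (- S * (norm y)\<^sup>2) / (norm y)\<^sup>2))" by (subst ennreal_mult[symmetric]) auto
      also have "\<dots> \<le> ennreal ((1 + 1 / sqrt S) * exp (- (S / 2) * (norm y)\<^sup>2))" proof (rule ennreal_leI)
        have "norm (?m3 y) * (exp (- S * (norm y)\<^sup>2) / (norm y)\<^sup>2) \<le> (norm y * (norm y)\<^sup>2) * (exp (- S * (norm y)\<^sup>2) / (norm y)\<^sup>2)"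
          by (intro mult_right_mono n3) auto
        also have "\<dots> = norm y * exp (- S * (norm y)\<^sup>2)" using elim by simp
        also have "\<dots> \<le> (1 + norm y) * exp (- S * (norm y)\<^sup>2)" by (intro mult_right_mono) auto
        also have "\<dots> \<le> (1 + 1 / sqrt S) * exp (- (S / 2) * (norm y)\<^sup>2)" by (rule moment_gauss_le[OF norm_ge_zero S])
        finally show "norm (?m3 y) * (exp (- S * (norm y)\<^sup>2) / (norm y)\<^sup>2) \<le> (1 + 1 / sqrt S) * exp (- (S / 2) * (norm y)\<^sup>2)" .
      qed
      finally show ?case .
    qed
    also have "\<dots> = ennreal (1 + 1 / sqrt S) * (\<integral>\<^sup>+y. ennreal (exp (- (S / 2) * (norm (y::real^'n))\<^sup>2)) \<partial>lborel)"
      using S by (subst nn_integral_cmult[symmetric]) (auto simp: ennreal_mult)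
    also have "\<dots> < \<infinity>" using S nn_integral_gauss[of "S / 2", where 'n='n] by (simp add: ennreal_mult_less_top)
    finally show "(\<integral>\<^sup>+z. ennreal (norm (?F z)) \<partial>(lborel \<Otimes>\<^sub>M lborel)) < \<infinity>" .
  qed measurable
  have tail: "?c * (LBINT w. indicator {1..} w *\<^sub>R (of_real S * Qg (ei3 m j l) (S * w) (cvec x)))
     = (LBINT y. ?m3 y / of_real ((norm y)\<^sup>2) * cis (x \<bullet> y) * of_real (exp (- S * (norm y)\<^sup>2)))"
  proof -
    have "?c * (LBINT w. indicator {1..} w *\<^sub>R (of_real S * Qg (ei3 m j l) (S * w) (cvec x)))
       = (LBINT w. indicator {1..} w *\<^sub>R (of_real S * (?c * Qg (ei3 m j l) (S * w) (cvec x))))"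
      by (subst integral_mult_right_zero[symmetric]) (simp add: mult_ac)
    also have "\<dots> = (LBINT w. (LBINT y. ?F (w, y)))" proof (rule Bochner_Integration.integral_cong[OF refl])
      fix w :: real
      show "indicator {1..} w *\<^sub>R (of_real S * (?c * Qg (ei3 m j l) (S * w) (cvec x))) = (LBINT y. ?F (w, y))" proof (cases "1 \<le> w")
        case True
        have "0 < S * w" using S True by simp
        then have "?c * Qg (ei3 m j l) (S * w) (cvec x) = (LBINT t. ?m3 t * cis (x \<bullet> t) * of_real (exp (- (S * w) * (norm t)\<^sup>2)))"
          by (rule fourier_Qg[symmetric]) simp
        then show ?thesis using True by simp
      qed simp
    qed
    also have "\<dots> = (LBINT y. (LBINT w. ?F (w, y)))" by (rule lborel_pair.Fubini_integral[symmetric]) (use int in simp)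
    also have "\<dots> = (LBINT y. ?m3 y / of_real ((norm y)\<^sup>2) * cis (x \<bullet> y) * of_real (exp (- S * (norm y)\<^sup>2)))"
    proof (rule integral_cong_AE)
      show "AE y in lborel. (LBINT w. ?F (w, y)) = ?m3 y / of_real ((norm y)\<^sup>2) * cis (x \<bullet> y) * of_real (exp (- S * (norm y)\<^sup>2))"
        using AE_lborel_singleton[of "0::real^'n"] proof eventually_elim
        case (elim y)
        have "(LBINT w. indicator {1..} w * (S * exp (- (S * w) * (norm y)\<^sup>2))) = exp (- S * (norm y)\<^sup>2) / (norm y)\<^sup>2"
          using wint[OF elim] S by (subst integral_eq_nn_integral) (auto simp: indicator_def)
        then have e: "(LBINT w. complex_of_real (indicator {1..} w * (S * exp (- (S * w) * (norm y)\<^sup>2)))) = of_real (exp (- S * (norm y)\<^sup>2) / (norm y)\<^sup>2)"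
          by (simp only: integral_complex_of_real)
        have "(LBINT w. ?F (w, y)) = (LBINT w. ?m3 y * cis (x \<bullet> y) * complex_of_real (indicator {1..} w * (S * exp (- (S * w) * (norm y)\<^sup>2))))"
          by (rule Bochner_Integration.integral_cong) (auto simp: indicator_def)
        also have "\<dots> = ?m3 y * cis (x \<bullet> y) * of_real (exp (- S * (norm y)\<^sup>2) / (norm y)\<^sup>2)"
          unfolding integral_mult_right_zero e ..
        finally show ?case by (simp add: mult_ac)
      qed
    qed measurable
    finally show ?thesis .
  qed
  have b3: "norm (?m3 y / of_real ((norm y)\<^sup>2)) \<le> 1 * (1 + norm y)" for y proof (cases "y = 0")
    case False
    then show ?thesis using n3[of y] by (simp add: norm_divide norm_power divide_le_eq)
       (smt (verit) mult_right_mono zero_le_power2)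
  qed simp
  have g: "integrable lborel (\<lambda>y. p y * cis (x \<bullet> y) * of_real (exp (- S * (norm y)\<^sup>2)))"
    if [measurable]: "p \<in> borel_measurable borel" and p: "\<And>y. norm (p y) \<le> 1 * (1 + norm y)" for p :: "real^'n \<Rightarrow> complex"
  proof (rule integrable_of_nn_bound)
    show "ennreal (norm (p y * cis (x \<bullet> y) * of_real (exp (- S * (norm y)\<^sup>2)))) \<le> ennreal (1 + 1 / sqrt S) * ennreal (exp (- (S / 2) * (norm y)\<^sup>2))" for y
    proof -
      have "norm (p y * cis (x \<bullet> y) * of_real (exp (- S * (norm y)\<^sup>2))) \<le> (1 + norm y) * exp (- S * (norm y)\<^sup>2)"
        using p[of y] by (simp add: norm_mult)
      also have "\<dots> \<le> (1 + 1 / sqrt S) * exp (- (S / 2) * (norm y)\<^sup>2)" by (rule moment_gauss_le[OF norm_ge_zero S])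
      finally show ?thesis using S by (subst ennreal_mult[symmetric]) (auto intro: ennreal_leI)
    qed
    show "(\<integral>\<^sup>+y. ennreal (1 + 1 / sqrt S) * ennreal (exp (- (S / 2) * (norm (y::real^'n))\<^sup>2)) \<partial>lborel) < \<infinity>"
      using S nn_integral_gauss[of "S / 2", where 'n='n] by (subst nn_integral_cmult) (auto simp: ennreal_mult_less_top)
  qed measurable
  have head: "?c * (if j = l then Qg (ei m) S (cvec x) else 0) = (LBINT y. (if j = l then msym (ei m) y else 0) * cis (x \<bullet> y) * of_real (exp (- S * (norm y)\<^sup>2)))"
    using fourier_Qg[OF S, of "ei m" x] by simp
  have "?c * kin m j l S (cvec x) = (LBINT y. (if j = l then msym (ei m) y else 0) * cis (x \<bullet> y) * of_real (exp (- S * (norm y)\<^sup>2)))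
     + (LBINT y. ?m3 y / of_real ((norm y)\<^sup>2) * cis (x \<bullet> y) * of_real (exp (- S * (norm y)\<^sup>2)))"
    unfolding kin_def distrib_left head tail ..
  also have "\<dots> = (LBINT y. (if j = l then msym (ei m) y else 0) * cis (x \<bullet> y) * of_real (exp (- S * (norm y)\<^sup>2))
      + ?m3 y / of_real ((norm y)\<^sup>2) * cis (x \<bullet> y) * of_real (exp (- S * (norm y)\<^sup>2)))"
  proof (rule Bochner_Integration.integral_add[symmetric])
    have "norm (if j = l then msym (ei m) y else 0) \<le> 1 * (1 + norm y)" for y
      using component_le_norm_cart[of y m] by (simp add: msym_ei norm_mult)
    then show "integrable lborel (\<lambda>y. (if j = l then msym (ei m) y else 0) * cis (x \<bullet> y) * of_real (exp (- S * (norm y)\<^sup>2)))"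
      by (intro g) auto
    show "integrable lborel (\<lambda>y. ?m3 y / of_real ((norm y)\<^sup>2) * cis (x \<bullet> y) * of_real (exp (- S * (norm y)\<^sup>2)))"
      by (intro g b3) measurable
  qed
  also have "\<dots> = (LBINT y. \<i> * of_real (ksym m j l y) * cis (x \<bullet> y) * of_real (exp (- S * (norm y)\<^sup>2)))"
  proof (rule Bochner_Integration.integral_cong[OF refl])
    fix y :: "real^'n"
    \<comment> \<open>The three factors i multiply to -i, which supplies the minus sign of the
      projection.\<close>
    have "(if j = l then msym (ei m) y else 0) + ?m3 y / of_real ((norm y)\<^sup>2) = \<i> * of_real (ksym m j l y)"
      unfolding msym_ei msym_ei3 ksym_def by (simp add: algebra_simps complex_i_mult_minus)
    then show "(if j = l then msym (ei m) y else 0) * cis (x \<bullet> y) * of_real (exp (- S * (norm y)\<^sup>2)) + ?m3 y / of_real ((norm y)\<^sup>2) * cis (x \<bullet> y) * of_real (exp (- S * (norm y)\<^sup>2)) = \<i> * of_real (ksym m j l y) * cis (x \<bullet> y) * of_real (exp (- S * (norm y)\<^sup>2))"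
      by (simp only: distrib_right[symmetric])
  qed
  finally show ?thesis .
qed

lemma kc_fourier:
  fixes x :: "real^'n::finite"
  assumes t: "0 < t"
  shows "(2 * of_real pi) ^ CARD('n) * kc m j l t (cvec x) = (LBINT y. \<i> * of_real (ksym m j l y) * cis (x \<bullet> y) * of_real (exp (- t * norm y powr \<gamma>)))"
proof -
  have "(2 * of_real pi) ^ CARD('n) * kc m j l t (cvec x) = (\<integral>s. (2 * of_real pi) ^ CARD('n) * kin m j l (Sg t s) (cvec x) \<partial>\<mu>)"
    unfolding kc_def by simp
  also have "\<dots> = (\<integral>s. (LBINT y. \<i> * of_real (ksym m j l y) * cis (x \<bullet> y) * of_real (exp (- Sg t s * (norm y)\<^sup>2))) \<partial>\<mu>)"
  proof (rule integral_cong_AE)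
    show "AE s in \<mu>. (2 * of_real pi) ^ CARD('n) * kin m j l (Sg t s) (cvec x) = (LBINT y. \<i> * of_real (ksym m j l y) * cis (x \<bullet> y) * of_real (exp (- Sg t s * (norm y)\<^sup>2)))"
      using AE_pos by eventually_elim (rule kin_fourier, use t in simp)
  qed measurable
  also have "\<dots> = (LBINT y. \<i> * of_real (ksym m j l y) * cis (x \<bullet> y) * of_real (exp (- t * norm y powr \<gamma>)))"
  proof (rule gauss_mixture_fourier(2)[OF t, where B = 2])
    show "norm (\<i> * of_real (ksym m j l y) * cis (x \<bullet> y)) \<le> 2 * (1 + norm y)" for y
      using ksym_bound[of m j l y] by (simp add: norm_mult)
  qed measurable
  finally show ?thesis .
qed

end

section \<open>Real kernels: identification with \<open>Gker\<close> and \<open>Kker\<close>,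
  positivity, semigroup law\<close>

lemma lborel_reflect: "distr lborel borel (\<lambda>y. x - y) = (lborel :: (real^'n::finite) measure)"
proof -
  have "lborel = density (distr lborel borel (\<lambda>y::real^'n. x + (-1) *\<^sub>R y)) (\<lambda>_. ennreal (\<bar>-1::real\<bar> ^ DIM(real^'n)))"
    by (rule lborel_affine) simp
  then show ?thesis by (simp add: density_1)
qed

lemma nn_integral_reflect:
  assumes [measurable]: "f \<in> borel_measurable borel"
  shows "(\<integral>\<^sup>+y. f (x - y) \<partial>lborel) = (\<integral>\<^sup>+y. f (y::real^'n::finite) \<partial>lborel)"
  by (subst lborel_reflect[of x, symmetric], subst nn_integral_distr) auto

lemma integral_reflect:
  fixes f :: "real^'n::finite \<Rightarrow> 'b::{banach, second_countable_topology}"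
  assumes [measurable]: "f \<in> borel_measurable borel"
  shows "(LBINT y. f (x - y)) = (LBINT y. f y)"
  by (subst lborel_reflect[of x, symmetric], subst integral_distr) auto

lemma cvec_measurable[measurable (raw)]:
  fixes g :: "'w \<Rightarrow> real^'n::finite"
  shows "g \<in> borel_measurable M \<Longrightarrow> (\<lambda>w. cvec (g w) i) \<in> borel_measurable M"
  unfolding cvec_def by measurable

lemma cnj_fixed_real: "cnj z = z \<Longrightarrow> z = of_real (Re z)"
  by (simp add: complex_eq_iff)

text \<open>In the non-integrable case both sides are 0, so conjugation passes at once through all
  integrals in \<open>gc\<close>, \<open>kin\<close> and \<open>kc\<close>.\<close>

lemma lebesgue_integral_cnj: "(\<integral>w. cnj (f w) \<partial>M) = cnj (\<integral>w. f w \<partial>M)"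
proof (cases "integrable M f")
  case True
  then show ?thesis by (rule integral_bounded_linear[OF bounded_linear_cnj])
next
  case False
  moreover from this have "\<not> integrable M (\<lambda>w. cnj (f w))"
    using integrable_bounded_linear[OF bounded_linear_cnj, of M "\<lambda>w. cnj (f w)"] by auto
  ultimately show ?thesis by (simp add: not_integrable_integral_eq)
qed

lemma Re_two_pi_power: "Re ((2 * of_real pi) ^ k * complex_of_real a) = (2 * pi) ^ k * a"
proof -
  have "(2 * of_real pi) ^ k * complex_of_real a = of_real ((2 * pi) ^ k * a)" by simp
  then show ?thesis by (simp only: Re_complex_of_real)
qed

context subordinator
begin

lemma cnj_gc: "cnj (gc t (cvec x)) = gc t (cvec x)"
  unfolding gc_def lebesgue_integral_cnj[symmetric] cnj_Qg ..

lemma cnj_kin: "cnj (kin m j l S (cvec x)) = kin m j l S (cvec x)"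
  unfolding kin_def by (simp add: cnj_Qg flip: lebesgue_integral_cnj)

lemma cnj_kc: "cnj (kc m j l t (cvec x)) = kc m j l t (cvec x)"
  unfolding kc_def lebesgue_integral_cnj[symmetric] cnj_kin ..

text \<open>The complex kernels are invariant under conjugation at real points, so taking the real
  part loses nothing there.\<close>

definition Gr :: "real \<Rightarrow> real^'n::finite \<Rightarrow> real" where "Gr t x = Re (gc t (cvec x))"
definition kr :: "'n \<Rightarrow> 'n \<Rightarrow> 'n \<Rightarrow> real \<Rightarrow> real^'n::finite \<Rightarrow> real" where "kr m j l t x = Re (kc m j l t (cvec x))"

lemma gc_real: "gc t (cvec x) = of_real (Gr t x)"
  unfolding Gr_def by (rule cnj_fixed_real[OF cnj_gc])

lemma kc_real: "kc m j l t (cvec x) = of_real (kr m j l t x)"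
  unfolding kr_def by (rule cnj_fixed_real[OF cnj_kc])

lemma Gr_measurable[measurable (raw)]:
  fixes z :: "'w \<Rightarrow> real^'n::finite"
  assumes [measurable]: "f \<in> borel_measurable M" "z \<in> borel_measurable M"
  shows "(\<lambda>w. Gr (f w) (z w)) \<in> borel_measurable M"
  unfolding Gr_def by measurable

lemma kr_measurable[measurable (raw)]:
  fixes z :: "'w \<Rightarrow> real^'n::finite"
  assumes [measurable]: "f \<in> borel_measurable M" "z \<in> borel_measurable M"
  shows "(\<lambda>w. kr m j l (f w) (z w)) \<in> borel_measurable M"
  unfolding kr_def by measurable

lemma symbol_Re:
  fixes p :: "real^'n::finite \<Rightarrow> complex"
  assumes t: "0 < t" and [measurable]: "p \<in> borel_measurable borel" and p: "\<And>x. norm (p x) \<le> B * (1 + norm x)"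
  shows "Re (LBINT y. p y * cis (x \<bullet> y) * of_real (exp (- t * norm y powr \<gamma>)))
    = (LBINT y. Re (p y * cis (x \<bullet> y)) * exp (- t * norm y powr \<gamma>))"
  using integral_Re[OF integrable_symbol[OF assms, of x]] by simp

lemma Gr_fourier:
  assumes t: "0 < t"
  shows "(2 * pi) ^ CARD('n) * Gr t (x::real^'n::finite) = (LBINT y. cos (x \<bullet> y) * exp (- t * norm y powr \<gamma>))"
proof -
  have "(2 * pi) ^ CARD('n) * Gr t x = Re ((2 * of_real pi) ^ CARD('n) * gc t (cvec x))"
    unfolding gc_real by (rule Re_two_pi_power[symmetric])
  also have "\<dots> = (LBINT y. Re (1 * cis (x \<bullet> y)) * exp (- t * norm y powr \<gamma>))"
    unfolding gc_fourier[OF t] using symbol_Re[OF t, of "\<lambda>_. 1" 1 x] by simp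
  finally show ?thesis by simp
qed

lemma kr_fourier:
  assumes t: "0 < t"
  shows "(2 * pi) ^ CARD('n) * kr m j l t (x::real^'n::finite) = (LBINT y. - ksym m j l y * sin (x \<bullet> y) * exp (- t * norm y powr \<gamma>))"
proof -
  have "(2 * pi) ^ CARD('n) * kr m j l t x = Re ((2 * of_real pi) ^ CARD('n) * kc m j l t (cvec x))"
    unfolding kc_real by (rule Re_two_pi_power[symmetric])
  also have "\<dots> = (LBINT y. Re (\<i> * of_real (ksym m j l y) * cis (x \<bullet> y)) * exp (- t * norm y powr \<gamma>))"
    unfolding kc_fourier[OF t] proof (rule symbol_Re[OF t])
    show "norm (\<i> * complex_of_real (ksym m j l y)) \<le> 2 * (1 + norm y)" for y :: "real^'n"
      using ksym_bound[of m j l y] by (simp add: norm_mult)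
  qed measurable
  finally show ?thesis by simp
qed

lemma Gker_eq: "0 < t \<Longrightarrow> Gker \<gamma> t (x::real^'n::finite) = Gr t x"
  unfolding Gker_def Gr_fourier[symmetric] by simp

lemma integrable_ksym: "0 < t \<Longrightarrow> integrable lborel (\<lambda>y. 2 * norm (y::real^'n::finite) * exp (- t * norm y powr \<gamma>))"
proof -
  assume t: "0 < t"
  have "integrable lborel (\<lambda>y::real^'n. of_real (2 * norm y) * complex_of_real (exp (- t * norm y powr \<gamma>)))"
    by (rule gauss_mixture_fourier(1)[OF t, where B = 2]) (auto simp: norm_mult)
  from integrable_Re[OF this] show ?thesis by simp
qed

lemma integrable_Gsym: "0 < t \<Longrightarrow> integrable lborel (\<lambda>y. exp (- t * norm (y::real^'n::finite) powr \<gamma>))"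
proof -
  assume t: "0 < t"
  have "integrable lborel (\<lambda>y::real^'n. 1 * complex_of_real (exp (- t * norm y powr \<gamma>)))"
    by (rule gauss_mixture_fourier(1)[OF t, where B = 1]) auto
  from integrable_Re[OF this] show ?thesis by simp
qed

text \<open>Links the nonlinearity of a mild solution to the mixtures: \<open>Kker\<close> is given
  as a Fourier integral, and its derivative is taken under the integral sign with the majorant 2 |y|
  exp(-t |y|^\<gamma>).\<close>

lemma pdiff_Kker:
  assumes t: "0 < t"
  shows "pdiff m (\<lambda>z. Kker \<gamma> t z $ j $ l) (x::real^'n::finite) = kr m j l t x"
proof -
  let ?e = "axis m (1::real) :: real^'n"
  let ?P = "\<lambda>y. (if j = l then 1 else 0) - y $ j * y $ l / (norm (y::real^'n))\<^sup>2"
  let ?E = "\<lambda>y. exp (- t * norm (y::real^'n) powr \<gamma>)"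
  have "((\<lambda>s. \<integral>y. cos ((x + s *\<^sub>R ?e) \<bullet> y) * ?P y * ?E y \<partial>lborel) has_vector_derivative (LBINT y. (- sin ((x + 0 *\<^sub>R ?e) \<bullet> y) * y $ m) * ?P y * ?E y)) (at 0)"
  proof (rule has_vector_derivative_lebesgue_integral(2)[where r = 1 and B = "\<lambda>y. 2 * norm y * ?E y" and f = "\<lambda>s y. cos ((x + s *\<^sub>R ?e) \<bullet> y) * ?P y * ?E y"
       and f' = "\<lambda>s y. (- sin ((x + s *\<^sub>R ?e) \<bullet> y) * y $ m) * ?P y * ?E y"])
    show "integrable lborel (\<lambda>y. cos ((x + s *\<^sub>R ?e) \<bullet> y) * ?P y * ?E y)" for s
    proof (rule Bochner_Integration.integrable_bound)
      show "integrable lborel (\<lambda>y. 2 * ?E y)" using integrable_Gsym[OF t] by simp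
      show "AE y in lborel. norm (cos ((x + s *\<^sub>R ?e) \<bullet> y) * ?P y * ?E y) \<le> norm (2 * ?E y)" proof (rule AE_I2)
        fix y :: "real^'n"
        have "\<bar>cos ((x + s *\<^sub>R ?e) \<bullet> y)\<bar> * \<bar>?P y\<bar> \<le> 1 * 2" by (intro mult_mono projection_symbol_bound) auto
        then have "\<bar>cos ((x + s *\<^sub>R ?e) \<bullet> y)\<bar> * \<bar>?P y\<bar> * ?E y \<le> 2 * ?E y" by (intro mult_right_mono) auto
        then show "norm (cos ((x + s *\<^sub>R ?e) \<bullet> y) * ?P y * ?E y) \<le> norm (2 * ?E y)" by (simp add: abs_mult)
      qed
    qed measurable
    show "((\<lambda>s. cos ((x + s *\<^sub>R ?e) \<bullet> y) * ?P y * ?E y) has_vector_derivative (- sin ((x + s *\<^sub>R ?e) \<bullet> y) * y $ m) * ?P y * ?E y) (at s)" for s y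
    proof -
      have "((\<lambda>s. cos ((x + s *\<^sub>R ?e) \<bullet> y)) has_real_derivative - sin ((x + s *\<^sub>R ?e) \<bullet> y) * y $ m) (at s)"
        unfolding inner_add_left inner_scaleR_left inner_axis' by (auto intro!: derivative_eq_intros)
      from DERIV_cmult_right[OF DERIV_cmult_right[OF this, of "?P y"], of "?E y"] show ?thesis
        unfolding has_real_derivative_iff_has_vector_derivative .
    qed
    show "norm ((- sin ((x + s *\<^sub>R ?e) \<bullet> y) * y $ m) * ?P y * ?E y) \<le> 2 * norm y * ?E y" for s y proof -
      have "\<bar>sin ((x + s *\<^sub>R ?e) \<bullet> y)\<bar> * \<bar>y $ m\<bar> * \<bar>?P y\<bar> \<le> 1 * norm y * 2"
        by (intro mult_mono projection_symbol_bound component_le_norm_cart) auto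
      then have "\<bar>sin ((x + s *\<^sub>R ?e) \<bullet> y)\<bar> * \<bar>y $ m\<bar> * \<bar>?P y\<bar> * ?E y \<le> 1 * norm y * 2 * ?E y" by (intro mult_right_mono) auto
      then show ?thesis by (simp add: abs_mult)
    qed
  qed (use integrable_ksym[OF t] in auto)
  then have d: "((\<lambda>s. Kker \<gamma> t (x + s *\<^sub>R ?e) $ j $ l) has_vector_derivative (1 / (2 * pi) ^ CARD('n)) * (LBINT y. (- sin ((x + 0 *\<^sub>R ?e) \<bullet> y) * y $ m) * ?P y * ?E y)) (at 0)"
    unfolding Kker_def vec_lambda_beta by (rule has_vector_derivative_mult_right)
  have e: "(LBINT y. (- sin ((x + 0 *\<^sub>R ?e) \<bullet> y) * y $ m) * ?P y * ?E y) = (2 * pi) ^ CARD('n) * kr m j l t x"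
    unfolding kr_fourier[OF t] ksym_def by (rule Bochner_Integration.integral_cong) (auto simp: mult_ac)
  show ?thesis unfolding pdiff_def vector_derivative_at[OF d] e by simp
qed

lemma kr_isCont:
  assumes t: "0 < t"
  shows "isCont (kr m j l t) (x::real^'n::finite)"
proof -
  have "isCont (\<lambda>x. \<integral>y. - ksym m j l y * sin (x \<bullet> y) * exp (- t * norm y powr \<gamma>) \<partial>lborel) x"
    unfolding isCont_def tendsto_at_iff_sequentially o_def proof (intro allI impI)
    fix X assume X: "\<forall>i. X i \<in> UNIV - {x}" "X \<longlonglongrightarrow> x"
    show "(\<lambda>i. \<integral>y. - ksym m j l y * sin (X i \<bullet> y) * exp (- t * norm y powr \<gamma>) \<partial>lborel) \<longlonglongrightarrow> (LBINT y. - ksym m j l y * sin (x \<bullet> y) * exp (- t * norm y powr \<gamma>))"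
    proof (rule integral_dominated_convergence[OF _ _ integrable_ksym[OF t]])
      show "AE y in lborel. (\<lambda>i. - ksym m j l y * sin (X i \<bullet> y) * exp (- t * norm y powr \<gamma>)) \<longlonglongrightarrow> - ksym m j l y * sin (x \<bullet> y) * exp (- t * norm y powr \<gamma>)"
        by (intro AE_I2 tendsto_intros X)
      show "AE y in lborel. norm (- ksym m j l y * sin (X i \<bullet> y) * exp (- t * norm y powr \<gamma>)) \<le> 2 * norm y * exp (- t * norm y powr \<gamma>)" for i
      proof (rule AE_I2)
        fix y :: "real^'n"
        have "\<bar>ksym m j l y\<bar> * \<bar>sin (X i \<bullet> y)\<bar> \<le> 2 * norm y * 1" by (intro mult_mono ksym_bound) auto
        then have "\<bar>ksym m j l y\<bar> * \<bar>sin (X i \<bullet> y)\<bar> * exp (- t * norm y powr \<gamma>) \<le> 2 * norm y * 1 * exp (- t * norm y powr \<gamma>)" by (intro mult_right_mono) auto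
        then show "norm (- ksym m j l y * sin (X i \<bullet> y) * exp (- t * norm y powr \<gamma>)) \<le> 2 * norm y * exp (- t * norm y powr \<gamma>)" by (simp add: abs_mult)
      qed
    qed measurable
  qed
  moreover have "kr m j l t = (\<lambda>x. (1 / (2 * pi) ^ CARD('n)) * (LBINT y. - ksym m j l y * sin (x \<bullet> y) * exp (- t * norm y powr \<gamma>)))"
    unfolding kr_fourier[OF t, symmetric] by (rule ext) simp
  ultimately show ?thesis by (simp only:) (rule continuous_mult[OF continuous_const])
qed

lemma Gr_mixture:
  assumes t: "0 < t"
  shows "Gr t (x::real^'n::finite) = (\<integral>s. gn (Sg t s) x \<partial>\<mu>)" "integrable \<mu> (\<lambda>s. gn (Sg t s) x)"
proof -
  show "Gr t x = (\<integral>s. gn (Sg t s) x \<partial>\<mu>)" unfolding Gr_def gc_def Qg_0 by (simp add: integral_complex_of_real)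
  show "integrable \<mu> (\<lambda>s. gn (Sg t s) x)" proof (rule integrableI_bounded)
    have "(\<integral>\<^sup>+s. ennreal (norm (gn (Sg t s) x)) \<partial>\<mu>) \<le> gm t x"
      unfolding gm_def proof (rule nn_integral_mono_AE, use AE_pos in eventually_elim)
      case (elim s)
      have "norm (gn (Sg t s) x) \<le> Qc TYPE('n) * exp (real CARD('n) / s) * gn (2 * Sg t s) x"
        using gc_integrand_bound[OF t elim, of "\<lambda>_. 0" x] by (simp add: Qg_0)
      then show ?case by (rule ennreal_leI)
    qed
    also have "\<dots> < \<infinity>" using le_less_trans[OF gm_sup[OF t, of x] ennreal_less_top] by simp
    finally show "(\<integral>\<^sup>+s. ennreal (norm (gn (Sg t s) x)) \<partial>\<mu>) < \<infinity>" .
  qed measurable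
qed

text \<open>Strictness matters later: it allows division by the kernel to recover \<open>u0\<close>,
  and it turns a nonzero integral into integrability.\<close>

lemma Gr_pos:
  assumes t: "0 < t" shows "0 < Gr t (x::real^'n::finite)"
proof -
  have nn: "AE s in \<mu>. 0 \<le> gn (Sg t s) x" using AE_pos by eventually_elim (use t in simp)
  have "Gr t x \<noteq> 0" proof
    assume "Gr t x = 0"
    then have "AE s in \<mu>. gn (Sg t s) x = 0" using integral_nonneg_eq_0_iff_AE[OF Gr_mixture(2)[OF t, of x] nn] Gr_mixture(1)[OF t, of x] by simp
    with AE_pos have "AE s in \<mu>. False" by eventually_elim (metis Sg_pos gn_pos less_irrefl t)
    then show False by simp
  qed
  moreover have "0 \<le> Gr t x" unfolding Gr_mixture(1)[OF t] by (rule integral_nonneg_AE[OF nn])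
  ultimately show ?thesis by simp
qed

lemma Gr_le_gm: "0 < t \<Longrightarrow> ennreal (Gr t (x::real^'n::finite)) \<le> gm t x"
  using gc_bound[of t "\<lambda>_. 0" x] Gr_pos[of t x] by (simp add: gc_real)

lemma kr_le_km: "0 < t \<Longrightarrow> ennreal \<bar>kr m j l t (x::real^'n::finite)\<bar> \<le> km t x"
  using kc_bound[of t "\<lambda>_. 0" m j l x] by (simp add: kc_real)

lemma cvec_add: "cvec (x + h) = (\<lambda>i. cvec x i + cvec h i)" by (auto simp: cvec_def)

text \<open>A real translation is a special complex shift, so \<open>km\<close> dominates all nearby
  translates at once; this is the majorant behind the continuity of convolutions.\<close>

lemma kr_shift_le_km:
  assumes "0 < t" "norm (h::real^'n::finite) \<le> t powr (1 / \<gamma>)"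
  shows "ennreal \<bar>kr m j l t (x + h)\<bar> \<le> km t x"
proof -
  have "norm (cvec h i) \<le> t powr (1 / \<gamma>)" for i using component_le_norm_cart[of h i] assms by (simp add: cvec_def)
  from kc_bound[where h = "cvec h", OF assms(1) this, of m j l x] show ?thesis
    unfolding cvec_add[symmetric] kc_real by simp
qed

lemma integrable_Gr: "0 < t \<Longrightarrow> integrable lborel (Gr t :: real^'n::finite \<Rightarrow> real)"
proof (rule integrable_of_nn_bound[of _ _ "gm t"])
  assume t: "0 < t"
  show "ennreal (norm (Gr t y)) \<le> gm t y" for y :: "real^'n" using Gr_le_gm[OF t, of y] Gr_pos[OF t, of y] by simp
  show "(\<integral>\<^sup>+y. gm t (y::real^'n) \<partial>lborel) < \<infinity>" using le_less_trans[OF gm_L1[OF t] ennreal_less_top] by simp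
qed measurable

lemma fourier_Gr:
  assumes t: "0 < t"
  shows "(LBINT y. of_real (Gr t y) * cis (y \<bullet> z)) = complex_of_real (exp (- t * norm (z::real^'n::finite) powr \<gamma>))"
proof -
  interpret pair_sigma_finite \<mu> "lborel :: (real^'n) measure" by standard
  let ?F = "\<lambda>(s, y). of_real (gn (Sg t s) y) * cis (y \<bullet> z)"
  have int: "integrable (\<mu> \<Otimes>\<^sub>M lborel) ?F" proof (rule integrableI_bounded)
    have "(\<integral>\<^sup>+p. ennreal (norm (?F p)) \<partial>(\<mu> \<Otimes>\<^sub>M lborel)) = (\<integral>\<^sup>+s. \<integral>\<^sup>+y. ennreal (norm (?F (s, y))) \<partial>lborel \<partial>\<mu>)"
      by (rule lborel.nn_integral_fst[symmetric]) measurable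
    also have "\<dots> = (\<integral>\<^sup>+s. 1 \<partial>\<mu>)"
      by (rule nn_integral_cong_AE, use AE_pos in eventually_elim) (use t in \<open>simp add: norm_mult nn_integral_gn\<close>)
    also have "\<dots> < \<infinity>" by (simp add: emeasure_space_1)
    finally show "(\<integral>\<^sup>+p. ennreal (norm (?F p)) \<partial>(\<mu> \<Otimes>\<^sub>M lborel)) < \<infinity>" .
  qed measurable
  have "(LBINT y. of_real (Gr t y) * cis (y \<bullet> z)) = (LBINT y. (\<integral>s. ?F (s, y) \<partial>\<mu>))"
    by (simp add: Gr_mixture(1)[OF t] integral_complex_of_real)
  also have "\<dots> = (\<integral>s. (LBINT y. ?F (s, y)) \<partial>\<mu>)" by (rule Fubini_integral) (use int in simp)
  also have "\<dots> = (\<integral>s. of_real (exp (- Sg t s * (norm z)\<^sup>2)) \<partial>\<mu>)" proof (rule integral_cong_AE)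
    show "AE s in \<mu>. (LBINT y. ?F (s, y)) = of_real (exp (- Sg t s * (norm z)\<^sup>2))" using AE_pos proof eventually_elim
      case (elim s)
      from fourier_gn[OF Sg_pos[OF t elim], of z] show ?case by simp
    qed
  qed measurable
  also have "\<dots> = of_real (exp (- t * norm z powr \<gamma>))" using laplace_norm_integral[OF t, of z] by (simp add: integral_complex_of_real)
  finally show ?thesis .
qed

text \<open>Convolution with \<open>Gr a\<close> multiplies the symbol by exp(-a |\<xi>|^\<gamma>).
  The choices p = 1 and p = i \<open>ksym\<close> give the semigroup law for the two
  kernels.\<close>

lemma conv_symbol:
  fixes p :: "real^'n::finite \<Rightarrow> complex"
  assumes a: "0 < a" and b: "0 < b" and [measurable]: "p \<in> borel_measurable borel" and p: "\<And>x. norm (p x) \<le> B * (1 + norm x)"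
  shows "(LBINT y. of_real (Gr a y) * (LBINT z. p z * cis ((x - y) \<bullet> z) * of_real (exp (- b * norm z powr \<gamma>))))
     = (LBINT z. p z * cis (x \<bullet> z) * of_real (exp (- (a + b) * norm z powr \<gamma>)))"
proof -
  let ?F = "\<lambda>(y, z). of_real (Gr a y) * (p z * cis ((x - y) \<bullet> z) * of_real (exp (- b * norm z powr \<gamma>)))"
  have i0: "integrable lborel (\<lambda>z. p z * of_real (exp (- b * norm z powr \<gamma>)))" by (rule gauss_mixture_fourier(1)[OF b assms(3) p])
  have int: "integrable (lborel \<Otimes>\<^sub>M lborel) ?F" proof (rule integrableI_bounded)
    have "(\<integral>\<^sup>+q. ennreal (norm (?F q)) \<partial>(lborel \<Otimes>\<^sub>M lborel)) = (\<integral>\<^sup>+y. \<integral>\<^sup>+z. ennreal (norm (?F (y, z))) \<partial>lborel \<partial>lborel)"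
      by (rule lborel.nn_integral_fst[symmetric]) measurable
    also have "\<dots> = (\<integral>\<^sup>+y. ennreal (norm (Gr a (y::real^'n))) * (\<integral>\<^sup>+z. ennreal (norm (p z * of_real (exp (- b * norm z powr \<gamma>)))) \<partial>lborel) \<partial>lborel)"
      by (intro nn_integral_cong, subst nn_integral_cmult[symmetric]) (auto simp: norm_mult ennreal_mult')
    also have "\<dots> = (\<integral>\<^sup>+y. ennreal (norm (Gr a (y::real^'n))) \<partial>lborel) * (\<integral>\<^sup>+z. ennreal (norm (p z * of_real (exp (- b * norm z powr \<gamma>)))) \<partial>lborel)"
      by (rule nn_integral_multc) measurable
    also have "\<dots> < \<infinity>" using integrable_Gr[OF a, where 'n='n] i0 unfolding integrable_iff_bounded by (simp add: ennreal_mult_less_top)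
    finally show "(\<integral>\<^sup>+q. ennreal (norm (?F q)) \<partial>(lborel \<Otimes>\<^sub>M lborel)) < \<infinity>" .
  qed measurable
  have "(LBINT y. of_real (Gr a y) * (LBINT z. p z * cis ((x - y) \<bullet> z) * of_real (exp (- b * norm z powr \<gamma>))))
     = (LBINT y. (LBINT z. ?F (y, z)))" by simp
  also have "\<dots> = (LBINT z. (LBINT y. ?F (y, z)))" by (rule lborel_pair.Fubini_integral[symmetric]) (use int in simp)
  also have "\<dots> = (LBINT z. p z * cis (x \<bullet> z) * of_real (exp (- (a + b) * norm z powr \<gamma>)))"
  proof (rule Bochner_Integration.integral_cong[OF refl])
    fix z :: "real^'n"
    have c: "cis ((x - y) \<bullet> z) = cis (x \<bullet> z) * cis (y \<bullet> (- z))" for y by (simp add: cis_mult inner_diff_left)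
    have "(LBINT y. ?F (y, z)) = (LBINT y. (p z * cis (x \<bullet> z) * of_real (exp (- b * norm z powr \<gamma>))) * (of_real (Gr a y) * cis (y \<bullet> (- z))))"
      by (rule Bochner_Integration.integral_cong[OF refl]) (simp only: c case_prod_conv mult_ac)
    also have "\<dots> = (p z * cis (x \<bullet> z) * of_real (exp (- b * norm z powr \<gamma>))) * of_real (exp (- a * norm z powr \<gamma>))"
      unfolding integral_mult_right_zero fourier_Gr[OF a] by simp
    also have "\<dots> = p z * cis (x \<bullet> z) * of_real (exp (- (a + b) * norm z powr \<gamma>))" proof -
      have "exp (- b * norm z powr \<gamma>) * exp (- a * norm z powr \<gamma>) = exp (- (a + b) * norm z powr \<gamma>)"
        by (simp add: algebra_simps flip: exp_add)
      then show ?thesis by (simp only: mult.assoc of_real_mult[symmetric])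
    qed
    finally show "(LBINT y. ?F (y, z)) = p z * cis (x \<bullet> z) * of_real (exp (- (a + b) * norm z powr \<gamma>))" .
  qed
  finally show ?thesis .
qed

lemma conv_Gr:
  assumes a: "0 < a" and b: "0 < b"
  shows "(LBINT y. Gr a y * Gr b (x - y)) = Gr (a + b) (x::real^'n::finite)"
proof -
  let ?c = "(2 * complex_of_real pi) ^ CARD('n)"
  have "?c * (LBINT y. of_real (Gr a y * Gr b (x - y))) = (LBINT y. of_real (Gr a y) * (?c * gc b (cvec (x - y))))"
    unfolding gc_real integral_mult_right_zero[symmetric] by (simp add: mult_ac)
  also have "\<dots> = ?c * gc (a + b) (cvec x)"
    unfolding gc_fourier[OF b] using conv_symbol[OF a b, of "\<lambda>_. 1" 1 x] gc_fourier[of "a + b" x] a b by simp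
  finally have "(LBINT y. complex_of_real (Gr a y * Gr b (x - y))) = of_real (Gr (a + b) x)"
    unfolding gc_real by simp
  then show ?thesis by (simp only: integral_complex_of_real of_real_eq_iff)
qed

lemma conv_kr:
  assumes a: "0 < a" and b: "0 < b"
  shows "(LBINT y. Gr a y * kr m j l b (x - y)) = kr m j l (a + b) (x::real^'n::finite)"
proof -
  let ?c = "(2 * complex_of_real pi) ^ CARD('n)"
  have k: "norm (\<i> * complex_of_real (ksym m j l y)) \<le> 2 * (1 + norm y)" for y :: "real^'n"
    using ksym_bound[of m j l y] by (simp add: norm_mult)
  have "?c * (LBINT y. of_real (Gr a y * kr m j l b (x - y))) = (LBINT y. of_real (Gr a y) * (?c * kc m j l b (cvec (x - y))))"
    unfolding kc_real integral_mult_right_zero[symmetric] by (simp add: mult_ac)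
  also have "\<dots> = ?c * kc m j l (a + b) (cvec x)"
    unfolding kc_fourier[OF b] using conv_symbol[OF a b, of "\<lambda>y. \<i> * complex_of_real (ksym m j l y)" 2 x] kc_fourier[of "a + b" m j l x] a b k by simp
  finally have "(LBINT y. complex_of_real (Gr a y * kr m j l b (x - y))) = of_real (kr m j l (a + b) x)"
    unfolding kc_real by simp
  then show ?thesis by (simp only: integral_complex_of_real of_real_eq_iff)
qed

text \<open>In one dimension the projection symbol 1 - \<xi>^2/|\<xi>|^2 is 0 off the origin, and at
  the origin the additional factor \<xi> is 0.\<close>

lemma kr_zero_1d:
  assumes "CARD('n::finite) = 1" "0 < t"
  shows "kr m j l t (x::real^'n) = 0"
proof -
  obtain c :: 'n where c: "UNIV = {c}" using assms(1) by (rule card_1_singletonE)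
  have s: "a = b" for a b :: 'n using UNIV_I[of a, unfolded c] UNIV_I[of b, unfolded c] by simp
  have "ksym m j l y = 0" for y :: "real^'n" proof (cases "y = 0")
    case False
    have u: "(UNIV::'n set) = {j}" using c unfolding s[of c j] .
    have e: "(norm y)\<^sup>2 = (y $ j)\<^sup>2" unfolding norm_vec_def L2_set_def u by simp
    then have nz: "y $ j \<noteq> 0" using False by auto
    have l: "l = j" by (rule s)
    show ?thesis unfolding ksym_def l e using nz by (simp add: power2_eq_square)
  qed (simp add: ksym_def)
  then show ?thesis using kr_fourier[OF assms(2), of m j l x] by simp
qed

end

section \<open>Integral inequalities\<close>

text \<open>Infinity is kept as a value, so that L^q bounds can be stated for majorants before these
  are known to be finite.\<close>

definition epow :: "real \<Rightarrow> ennreal \<Rightarrow> ennreal" where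
  "epow q x = (if x = \<infinity> then \<infinity> else ennreal (enn2real x powr q))"

lemma epow_ennreal[simp]: "0 \<le> a \<Longrightarrow> epow q (ennreal a) = ennreal (a powr q)"
  by (simp add: epow_def)

lemma epow_top[simp]: "epow q \<infinity> = \<infinity>" "epow q top = top" by (simp_all add: epow_def)

lemma epow_0[simp]: "epow q 0 = 0" by (simp add: epow_def)

lemma epow_mono: "0 < q \<Longrightarrow> x \<le> y \<Longrightarrow> epow q x \<le> epow q y"
  by (cases x; cases y) (auto simp: ennreal_le_iff2 top_unique intro!: ennreal_leI powr_mono2 split: if_splits)

lemma epow_measurable[measurable (raw)]:
  assumes [measurable]: "f \<in> borel_measurable M"
  shows "(\<lambda>x. epow q (f x)) \<in> borel_measurable M"
  unfolding epow_def by (rule measurable_If) measurable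

lemma ennreal_lincomb:
  "0 \<le> a \<Longrightarrow> 0 \<le> b \<Longrightarrow> 0 \<le> c \<Longrightarrow> 0 \<le> d \<Longrightarrow> ennreal a * ennreal b + ennreal c * ennreal d = ennreal (a * b + c * d)"
  by (simp add: ennreal_mult)

lemma epow_mult: "0 < q \<Longrightarrow> epow q (x * y) = epow q x * epow q y"
  by (cases x; cases y) (auto simp: ennreal_mult[symmetric] powr_mult ennreal_top_mult ennreal_mult_top powr_eq_0_iff)

lemma epow_half: "0 < q \<Longrightarrow> (epow (q / 2) x)\<^sup>2 = epow q x"
  by (cases x) (auto simp: ennreal_power power2_eq_square ennreal_mult[symmetric] powr_add[symmetric] ennreal_top_mult)

lemma epow_le_cancel: "0 < q \<Longrightarrow> 0 \<le> b \<Longrightarrow> epow q x \<le> ennreal (b powr q) \<Longrightarrow> x \<le> ennreal b"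
proof (cases x)
  case (real r)
  assume "0 < q" "0 \<le> b" "epow q x \<le> ennreal (b powr q)"
  with real have "r powr q \<le> b powr q" by simp
  then have "r \<le> b" using \<open>0 < q\<close> \<open>0 \<le> b\<close> real powr_less_mono2[of q b r] by force
  then show ?thesis using real by (simp add: ennreal_leI)
qed (simp add: top_unique)

lemma epow_add: "0 < q \<Longrightarrow> epow q (x + y) \<le> ennreal (2 powr q) * (epow q x + epow q y)"
proof -
  assume q: "0 < q"
  have "epow q (x + y) \<le> epow q (2 * max x y)" by (rule epow_mono[OF q]) (simp add: mult_2 add_mono)
  also have "\<dots> = ennreal (2 powr q) * epow q (max x y)" using epow_mult[OF q, of 2 "max x y"] epow_ennreal[of 2 q] by simp
  also have "\<dots> \<le> ennreal (2 powr q) * (epow q x + epow q y)" by (intro mult_left_mono) (auto simp: max_def add_increasing add_increasing2)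
  finally show ?thesis .
qed

text \<open>Young's inequality with equality at y = a. The right side is affine in y powr q and can
  be integrated; optimising in a afterwards yields Jensen's inequality.\<close>

lemma tangent_powr:
  fixes y a q :: real assumes y: "0 \<le> y" and a: "0 < a" and q: "1 \<le> q"
  shows "y \<le> a powr (1 - q) / q * y powr q + (1 - 1 / q) * a"
proof (cases "y = 0")
  case False
  then have y: "0 < y" using y by simp
  have "(y powr q * a powr (1 - q)) powr (1 / q) * a powr (1 - 1 / q) \<le> (1 / q) * (y powr q * a powr (1 - q)) + (1 - 1 / q) * a"
    by (rule Youngs_inequality_0) (use q a y in auto)
  moreover have "(y powr q * a powr (1 - q)) powr (1 / q) * a powr (1 - 1 / q) = y" proof -
    have "(1 - q) * (1 / q) + (1 - 1 / q) = 0" using q by (simp add: field_simps)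
    then have "a powr ((1 - q) * (1 / q)) * a powr (1 - 1 / q) = 1" using a by (simp flip: powr_add)
    then show ?thesis using q a y by (simp add: powr_mult powr_powr)
  qed
  ultimately show ?thesis by (simp add: mult_ac)
qed (use q a in simp)

text \<open>The tangent inequality is integrated against k; the optimal parameter satisfies a powr q
  = j/W, where j is the integral on the right-hand side.\<close>

lemma jensen_epow:
  assumes [measurable]: "k \<in> borel_measurable M" "f \<in> borel_measurable M"
    and W: "(\<integral>\<^sup>+x. k x \<partial>M) \<le> ennreal W" "0 < W" and q: "1 \<le> q"
  shows "epow q (\<integral>\<^sup>+x. k x * f x \<partial>M) \<le> ennreal (W powr (q - 1)) * (\<integral>\<^sup>+x. k x * epow q (f x) \<partial>M)"
proof (cases "(\<integral>\<^sup>+x. k x * epow q (f x) \<partial>M)")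
  case top
  then show ?thesis using W by (simp add: ennreal_mult_top)
next
  case (real j)
  have t: "(\<integral>\<^sup>+x. k x * f x \<partial>M) \<le> ennreal (a powr (1 - q) / q * j + (1 - 1 / q) * a * W)" if a: "0 < a" for a proof -
    have c: "0 \<le> a powr (1 - q) / q" "0 \<le> (1 - 1 / q) * a" using q a by (auto simp: field_simps)
    have "f x \<le> ennreal (a powr (1 - q) / q) * epow q (f x) + ennreal ((1 - 1 / q) * a)" for x proof (cases "f x")
      case (real y)
      then show ?thesis using ennreal_leI[OF tangent_powr[OF real(1) a q]] ennreal_lincomb[OF c(1) _ c(2), of "y powr q" 1] by simp
    next
      case top
      then show ?thesis using a q by (simp add: ennreal_mult_top)
    qed
    then have "k x * f x \<le> k x * (ennreal (a powr (1 - q) / q) * epow q (f x) + ennreal ((1 - 1 / q) * a))" for x by (rule mult_left_mono) simp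
    moreover have "k x * (ennreal (a powr (1 - q) / q) * epow q (f x) + ennreal ((1 - 1 / q) * a)) = ennreal (a powr (1 - q) / q) * (k x * epow q (f x)) + ennreal ((1 - 1 / q) * a) * k x" for x
      by (simp only: distrib_left mult_ac)
    ultimately have "(\<integral>\<^sup>+x. k x * f x \<partial>M) \<le> (\<integral>\<^sup>+x. ennreal (a powr (1 - q) / q) * (k x * epow q (f x)) + ennreal ((1 - 1 / q) * a) * k x \<partial>M)"
      by (intro nn_integral_mono) simp
    also have "\<dots> = ennreal (a powr (1 - q) / q) * ennreal j + ennreal ((1 - 1 / q) * a) * (\<integral>\<^sup>+x. k x \<partial>M)"
      by (subst nn_integral_add) (auto simp: nn_integral_cmult real)
    also have "\<dots> \<le> ennreal (a powr (1 - q) / q) * ennreal j + ennreal ((1 - 1 / q) * a) * ennreal W"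
      by (intro add_mono mult_left_mono W) auto
    also have "\<dots> = ennreal (a powr (1 - q) / q * j + (1 - 1 / q) * a * W)" by (rule ennreal_lincomb) (use c real W in auto)
    finally show ?thesis .
  qed
  \<comment> \<open>For j = 0 the optimal parameter degenerates to 0, and the bound follows by
    making a arbitrarily small.\<close>
  show ?thesis proof (cases "j = 0")
    case True
    have "(\<integral>\<^sup>+x. k x * f x \<partial>M) \<le> 0" proof (rule ennreal_le_epsilon)
      fix e :: real assume e: "0 < e"
      have "(\<integral>\<^sup>+x. k x * f x \<partial>M) \<le> ennreal ((1 - 1 / q) * (e / W) * W)" using t[of "e / W"] e W True by simp
      also have "\<dots> \<le> ennreal e" using W q e by (intro ennreal_leI) (simp add: algebra_simps)
      finally show "(\<integral>\<^sup>+x. k x * f x \<partial>M) \<le> 0 + ennreal e" by simp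
    qed
    then have "(\<integral>\<^sup>+x. k x * f x \<partial>M) = 0" by simp
    then show ?thesis by (simp only: epow_0 zero_le)
  next
    case False
    then have j: "0 < j" using real by simp
    define a where "a = (j / W) powr (1 / q)"
    have a: "0 < a" "a powr q = j / W" using j W q by (auto simp: a_def powr_powr)
    have "a powr (1 - q) * j = a * W" using a j W by (simp add: powr_diff)
    then have "a powr (1 - q) / q * j + (1 - 1 / q) * a * W = a * W" using q by (simp add: field_simps)
    then have "(\<integral>\<^sup>+x. k x * f x \<partial>M) \<le> ennreal (a * W)" using t[OF a(1)] by simp
    then have "epow q (\<integral>\<^sup>+x. k x * f x \<partial>M) \<le> epow q (ennreal (a * W))" using q by (intro epow_mono) auto
    also have "\<dots> = ennreal (W powr (q - 1) * j)" using a W q by (simp add: powr_mult powr_diff mult.commute)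
    finally show ?thesis using real W by (simp add: ennreal_mult)
  qed
qed

text \<open>Jensen with exponent q/2, which is where q \<ge> 2 enters, followed by Cauchy-Schwarz
  for the measure with density k.\<close>

lemma trilinear_epow:
  assumes [measurable]: "k \<in> borel_measurable M" "u \<in> borel_measurable M" "w \<in> borel_measurable M"
    and W: "(\<integral>\<^sup>+x. k x \<partial>M) \<le> ennreal W" "0 < W" and q: "2 \<le> q"
  shows "epow q (\<integral>\<^sup>+x. k x * (u x * w x) \<partial>M) \<le> ennreal (W powr (q - 2)) * ((\<integral>\<^sup>+x. k x * epow q (u x) \<partial>M) * (\<integral>\<^sup>+x. k x * epow q (w x) \<partial>M))"
proof -
  have "epow (q / 2) (\<integral>\<^sup>+x. k x * (u x * w x) \<partial>M) \<le> ennreal (W powr (q / 2 - 1)) * (\<integral>\<^sup>+x. k x * epow (q / 2) (u x * w x) \<partial>M)"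
    by (rule jensen_epow) (use W q in auto)
  then have "epow q (\<integral>\<^sup>+x. k x * (u x * w x) \<partial>M) \<le> (ennreal (W powr (q / 2 - 1)) * (\<integral>\<^sup>+x. k x * epow (q / 2) (u x * w x) \<partial>M))\<^sup>2"
    using q power_mono[of "epow (q / 2) (\<integral>\<^sup>+x. k x * (u x * w x) \<partial>M)" _ 2] epow_half[of q "\<integral>\<^sup>+x. k x * (u x * w x) \<partial>M"] by simp
  also have "\<dots> = ennreal (W powr (q - 2)) * (\<integral>\<^sup>+x. epow (q / 2) (u x) * epow (q / 2) (w x) \<partial>density M k)\<^sup>2"
  proof -
    have "(\<integral>\<^sup>+x. k x * epow (q / 2) (u x * w x) \<partial>M) = (\<integral>\<^sup>+x. epow (q / 2) (u x) * epow (q / 2) (w x) \<partial>density M k)"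
      using q by (subst nn_integral_density) (auto simp: epow_mult)
    moreover have "(ennreal (W powr (q / 2 - 1)))\<^sup>2 = ennreal (W powr (q - 2))"
      unfolding power2_eq_square by (subst ennreal_mult[symmetric]) (simp_all flip: powr_add)
    ultimately show ?thesis by (simp add: power_mult_distrib)
  qed
  also have "\<dots> \<le> ennreal (W powr (q - 2)) * ((\<integral>\<^sup>+x. (epow (q / 2) (u x))\<^sup>2 \<partial>density M k) * (\<integral>\<^sup>+x. (epow (q / 2) (w x))\<^sup>2 \<partial>density M k))"
    by (intro mult_left_mono Cauchy_Schwarz_nn_integral) auto
  also have "\<dots> = ennreal (W powr (q - 2)) * ((\<integral>\<^sup>+x. k x * epow q (u x) \<partial>M) * (\<integral>\<^sup>+x. k x * epow q (w x) \<partial>M))"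
    using q by (simp add: epow_half nn_integral_density)
  finally show ?thesis .
qed

text \<open>Minkowski's integral inequality shaped for Duhamel terms: the profile \<phi> of the
  norms is itself the weight in Jensen's inequality, and after division by \<phi> the q-norms are
  bounded uniformly in r.\<close>

lemma minkowski_time:
  fixes g :: "real \<Rightarrow> 'x \<Rightarrow> ennreal"
  assumes [measurable]: "(\<lambda>(r, x). g r x) \<in> borel_measurable (lborel \<Otimes>\<^sub>M M)" "\<phi> \<in> borel_measurable lborel"
    and M: "sigma_finite_measure M"
    and g: "\<And>r. 0 < r \<Longrightarrow> r < \<tau> \<Longrightarrow> (\<integral>\<^sup>+x. epow q (g r x) \<partial>M) \<le> ennreal ((c * \<phi> r) powr q)"
    and \<phi>: "\<And>r. 0 < r \<Longrightarrow> r < \<tau> \<Longrightarrow> 0 < \<phi> r" and \<Phi>: "(\<integral>\<^sup>+r. ennreal (\<phi> r) * indicator {0<..<\<tau>} r \<partial>lborel) \<le> ennreal \<Phi>" "0 < \<Phi>"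
    and q: "1 \<le> q" and c: "0 \<le> c"
  shows "(\<integral>\<^sup>+x. epow q (\<integral>\<^sup>+r. g r x * indicator {0<..<\<tau>} r \<partial>lborel) \<partial>M) \<le> ennreal ((c * \<Phi>) powr q)"
proof -
  interpret M: sigma_finite_measure M by fact
  interpret P: pair_sigma_finite lborel M by standard
  let ?k = "\<lambda>r. ennreal (\<phi> r) * indicator {0<..<\<tau>} r"
  let ?h = "\<lambda>r x. g r x * ennreal (1 / \<phi> r)"
  have e: "g r x * indicator {0<..<\<tau>} r = ?k r * ?h r x" for r x proof (cases "r \<in> {0<..<\<tau>}")
    case True
    then have "ennreal (\<phi> r) * ennreal (1 / \<phi> r) = 1" using \<phi>[of r] by (subst ennreal_mult[symmetric]) auto
    moreover have "?k r * ?h r x = g r x * (ennreal (\<phi> r) * ennreal (1 / \<phi> r))" using True by (simp add: mult_ac)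
    ultimately show ?thesis using True by simp
  qed simp
  have "(\<integral>\<^sup>+x. epow q (\<integral>\<^sup>+r. g r x * indicator {0<..<\<tau>} r \<partial>lborel) \<partial>M)
     \<le> (\<integral>\<^sup>+x. ennreal (\<Phi> powr (q - 1)) * (\<integral>\<^sup>+r. ?k r * epow q (?h r x) \<partial>lborel) \<partial>M)"
  proof (rule nn_integral_mono)
    fix x assume "x \<in> space M"
    then have [measurable]: "(\<lambda>r. g r x) \<in> borel_measurable lborel" using measurable_Pair1[OF assms(1)] by simp
    show "epow q (\<integral>\<^sup>+r. g r x * indicator {0<..<\<tau>} r \<partial>lborel) \<le> ennreal (\<Phi> powr (q - 1)) * (\<integral>\<^sup>+r. ?k r * epow q (?h r x) \<partial>lborel)"
      unfolding e by (rule jensen_epow) (measurable, use \<Phi> q in auto)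
  qed
  also have "\<dots> = ennreal (\<Phi> powr (q - 1)) * (\<integral>\<^sup>+x. (\<integral>\<^sup>+r. ?k r * epow q (?h r x) \<partial>lborel) \<partial>M)"
    by (rule nn_integral_cmult) measurable
  also have "(\<integral>\<^sup>+x. (\<integral>\<^sup>+r. ?k r * epow q (?h r x) \<partial>lborel) \<partial>M) = (\<integral>\<^sup>+r. (\<integral>\<^sup>+x. ?k r * epow q (?h r x) \<partial>M) \<partial>lborel)"
    by (rule P.Fubini') measurable
  also have "\<dots> \<le> (\<integral>\<^sup>+r. ennreal (c powr q) * ?k r \<partial>lborel)" proof (rule nn_integral_mono)
    fix r :: real
    show "(\<integral>\<^sup>+x. ?k r * epow q (?h r x) \<partial>M) \<le> ennreal (c powr q) * ?k r" proof (cases "r \<in> {0<..<\<tau>}")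
      case True
      then have r: "0 < r" "r < \<tau>" by auto
      have m[measurable]: "g r \<in> borel_measurable M" using measurable_Pair2[OF assms(1), of r] by simp
      have "(\<integral>\<^sup>+x. ?k r * epow q (?h r x) \<partial>M) = (\<integral>\<^sup>+x. ?k r * (ennreal ((1 / \<phi> r) powr q) * epow q (g r x)) \<partial>M)"
        using q \<phi>[OF r] by (intro nn_integral_cong) (simp add: epow_mult mult_ac)
      also have "\<dots> = ?k r * (ennreal ((1 / \<phi> r) powr q) * (\<integral>\<^sup>+x. epow q (g r x) \<partial>M))"
        by (simp add: nn_integral_cmult)
      also have "\<dots> \<le> ?k r * (ennreal ((1 / \<phi> r) powr q) * ennreal ((c * \<phi> r) powr q))" by (intro mult_left_mono g r) auto
      also have "ennreal ((1 / \<phi> r) powr q) * ennreal ((c * \<phi> r) powr q) = ennreal (c powr q)"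
        using \<phi>[OF r] c by (subst ennreal_mult[symmetric]) (auto simp flip: powr_mult)
      finally show ?thesis by (simp add: mult.commute)
    qed simp
  qed
  also have "\<dots> \<le> ennreal (c powr q) * ennreal \<Phi>" by (subst nn_integral_cmult) (auto intro!: mult_left_mono \<Phi>)
  finally have "(\<integral>\<^sup>+x. epow q (\<integral>\<^sup>+r. g r x * indicator {0<..<\<tau>} r \<partial>lborel) \<partial>M) \<le> ennreal (\<Phi> powr (q - 1)) * (ennreal (c powr q) * ennreal \<Phi>)"
    by (simp add: mult_left_mono)
  also have "\<dots> = ennreal ((c * \<Phi>) powr q)" using \<Phi>(2) c by (simp add: powr_mult powr_diff flip: ennreal_mult)
  finally show ?thesis .
qed

text \<open>A Beta integral up to constants: for r \<le> \<tau>/2 the factor with \<tau> - r is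
  comparable to a power of \<tau>, and otherwise the factor with r is.\<close>

lemma time_integral:
  fixes a b \<tau> :: real
  assumes a: "0 \<le> a" "a < 1" and b: "0 \<le> b" "b < 1" and \<tau>: "0 < \<tau>"
  shows "(\<integral>\<^sup>+r. ennreal ((\<tau> - r) powr (- a) * r powr (- b)) * indicator {0<..<\<tau>} r \<partial>lborel)
     \<le> ennreal ((2 / (1 - a) + 2 / (1 - b)) * \<tau> powr (1 - a - b))"
proof -
  have two: "(\<tau> / 2) powr (- p) \<le> 2 * \<tau> powr (- p)" if "0 \<le> p" "p < 1" for p proof -
    have "(\<tau> / 2) powr (- p) = 2 powr p * \<tau> powr (- p)" using \<tau> by (simp add: powr_divide powr_minus field_simps)
    also have "\<dots> \<le> 2 powr 1 * \<tau> powr (- p)" using that by (intro mult_right_mono powr_mono) auto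
    finally show ?thesis by simp
  qed
  have pt: "(\<tau> - r) powr (- a) * r powr (- b) \<le> 2 * \<tau> powr (- a) * r powr (- b) + 2 * \<tau> powr (- b) * (\<tau> - r) powr (- a)" if r: "0 < r" "r < \<tau>" for r
  proof (cases "r \<le> \<tau> / 2")
    case True
    have "(\<tau> - r) powr (- a) \<le> (\<tau> / 2) powr (- a)" using True a \<tau> by (intro powr_mono2') auto
    also have "\<dots> \<le> 2 * \<tau> powr (- a)" by (rule two[OF a])
    finally have "(\<tau> - r) powr (- a) * r powr (- b) \<le> 2 * \<tau> powr (- a) * r powr (- b)" by (intro mult_right_mono) auto
    then show ?thesis by (rule order_trans) simp
  next
    case False
    have "r powr (- b) \<le> (\<tau> / 2) powr (- b)" using False b \<tau> by (intro powr_mono2') auto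
    also have "\<dots> \<le> 2 * \<tau> powr (- b)" by (rule two[OF b])
    finally have "r powr (- b) * (\<tau> - r) powr (- a) \<le> 2 * \<tau> powr (- b) * (\<tau> - r) powr (- a)" by (intro mult_right_mono) auto
    also have "\<dots> \<le> 2 * \<tau> powr (- a) * r powr (- b) + 2 * \<tau> powr (- b) * (\<tau> - r) powr (- a)" by simp
    finally show ?thesis by (simp only: mult.commute)
  qed
  have hb: "(\<integral>\<^sup>+r. ennreal (r powr (- p)) * indicator {0<..<\<tau>} r \<partial>lborel) = ennreal (\<tau> powr (1 - p) / (1 - p))" if "p < 1" for p
    using nn_integral_powr_head[of \<tau> "1 - p"] that \<tau> by simp
  have ha: "(\<integral>\<^sup>+r. ennreal ((\<tau> - r) powr (- p)) * indicator {0<..<\<tau>} r \<partial>lborel) = ennreal (\<tau> powr (1 - p) / (1 - p))" if "p < 1" for p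
  proof -
    have "(\<integral>\<^sup>+r. ennreal ((\<tau> - r) powr (- p)) * indicator {0<..<\<tau>} r \<partial>lborel) = (\<integral>\<^sup>+r. ennreal (r powr (- p)) * indicator {0<..<\<tau>} r \<partial>lborel)"
      by (subst nn_integral_real_affine[of _ "-1" \<tau>]) (auto intro!: nn_integral_cong simp: indicator_def)
    then show ?thesis using hb[OF that] by simp
  qed
  have "(\<integral>\<^sup>+r. ennreal ((\<tau> - r) powr (- a) * r powr (- b)) * indicator {0<..<\<tau>} r \<partial>lborel)
    \<le> (\<integral>\<^sup>+r. ennreal (2 * \<tau> powr (- a)) * (ennreal (r powr (- b)) * indicator {0<..<\<tau>} r) + ennreal (2 * \<tau> powr (- b)) * (ennreal ((\<tau> - r) powr (- a)) * indicator {0<..<\<tau>} r) \<partial>lborel)"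
  proof (rule nn_integral_mono)
    fix r :: real
    show "ennreal ((\<tau> - r) powr (- a) * r powr (- b)) * indicator {0<..<\<tau>} r \<le> ennreal (2 * \<tau> powr (- a)) * (ennreal (r powr (- b)) * indicator {0<..<\<tau>} r) + ennreal (2 * \<tau> powr (- b)) * (ennreal ((\<tau> - r) powr (- a)) * indicator {0<..<\<tau>} r)"
    proof (cases "r \<in> {0<..<\<tau>}")
      case True
      then show ?thesis using ennreal_leI[OF pt[of r]] ennreal_lincomb[of "2 * \<tau> powr (- a)" "r powr (- b)" "2 * \<tau> powr (- b)" "(\<tau> - r) powr (- a)"]
        by simp
    qed simp
  qed
  also have "\<dots> = ennreal (2 * \<tau> powr (- a)) * ennreal (\<tau> powr (1 - b) / (1 - b)) + ennreal (2 * \<tau> powr (- b)) * ennreal (\<tau> powr (1 - a) / (1 - a))"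
    by (subst nn_integral_add, measurable) (simp add: nn_integral_cmult ha[OF a(2)] hb[OF b(2)] del: ennreal_mult' ennreal_mult'')
  also have "\<dots> = ennreal (2 * \<tau> powr (- a) * (\<tau> powr (1 - b) / (1 - b)) + 2 * \<tau> powr (- b) * (\<tau> powr (1 - a) / (1 - a)))"
    by (rule ennreal_lincomb) (use a b in auto)
  also have "2 * \<tau> powr (- a) * (\<tau> powr (1 - b) / (1 - b)) + 2 * \<tau> powr (- b) * (\<tau> powr (1 - a) / (1 - a)) = (2 / (1 - a) + 2 / (1 - b)) * \<tau> powr (1 - a - b)"
  proof -
    have "\<tau> powr (- a) * \<tau> powr (1 - b) = \<tau> powr (1 - a - b)" "\<tau> powr (- b) * \<tau> powr (1 - a) = \<tau> powr (1 - a - b)"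
      by (simp_all add: algebra_simps flip: powr_add)
    then show ?thesis by (simp add: field_simps) (simp add: algebra_simps)?
  qed
  finally show ?thesis .
qed

section \<open>Young-type convolution estimates\<close>

lemma nn_integral_translate:
  assumes [measurable]: "f \<in> borel_measurable borel"
  shows "(\<integral>\<^sup>+x. f (x - y) \<partial>lborel) = (\<integral>\<^sup>+x. f (x::real^'n::finite) \<partial>lborel)"
  using nn_integral_reflect[of "\<lambda>z. f (- z)" y] nn_integral_reflect[of f 0] by simp

text \<open>Young's inequality from L^q into L^q and into L^\<infinity>. In the second case the dual
  norm of k is interpolated between its mass W and its supremum K.\<close>

lemma conv_bounds:
  fixes k f :: "real^'n::finite \<Rightarrow> ennreal"
  assumes [measurable]: "k \<in> borel_measurable borel" "f \<in> borel_measurable borel"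
    and W: "(\<integral>\<^sup>+x. k x \<partial>lborel) \<le> ennreal W" "0 < W" and q: "1 \<le> q"
    and F: "(\<integral>\<^sup>+x. epow q (f x) \<partial>lborel) \<le> ennreal (F powr q)" "0 \<le> F"
  shows conv_Lq: "(\<integral>\<^sup>+x. epow q (\<integral>\<^sup>+y. k (x - y) * f y \<partial>lborel) \<partial>lborel) \<le> ennreal ((W * F) powr q)"
    and conv_sup: "\<And>K x. (\<And>x. k x \<le> ennreal K) \<Longrightarrow> 0 < K \<Longrightarrow> (\<integral>\<^sup>+y. k (x - y) * f y \<partial>lborel) \<le> ennreal (W powr (1 - 1 / q) * K powr (1 / q) * F)"
proof -
  have J: "epow q (\<integral>\<^sup>+y. k (x - y) * f y \<partial>lborel) \<le> ennreal (W powr (q - 1)) * (\<integral>\<^sup>+y. k (x - y) * epow q (f y) \<partial>lborel)" for x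
    by (rule jensen_epow) (use W q in \<open>auto simp: nn_integral_reflect\<close>)
  have "(\<integral>\<^sup>+x. epow q (\<integral>\<^sup>+y. k (x - y) * f y \<partial>lborel) \<partial>lborel)
     \<le> (\<integral>\<^sup>+x. ennreal (W powr (q - 1)) * (\<integral>\<^sup>+y. k (x - y) * epow q (f y) \<partial>lborel) \<partial>lborel)"
    by (intro nn_integral_mono J)
  also have "\<dots> = ennreal (W powr (q - 1)) * (\<integral>\<^sup>+x. (\<integral>\<^sup>+y. k (x - y) * epow q (f y) \<partial>lborel) \<partial>lborel)"
    by (rule nn_integral_cmult) measurable
  also have "(\<integral>\<^sup>+x. (\<integral>\<^sup>+y. k (x - y) * epow q (f y) \<partial>lborel) \<partial>lborel) = (\<integral>\<^sup>+y. (\<integral>\<^sup>+x. k (x - y) * epow q (f y) \<partial>lborel) \<partial>lborel)"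
    by (rule lborel_pair.Fubini') measurable
  also have "\<dots> = (\<integral>\<^sup>+y. (\<integral>\<^sup>+x. k x \<partial>lborel) * epow q (f y) \<partial>lborel)"
    by (simp add: nn_integral_multc nn_integral_translate)
  also have "\<dots> = (\<integral>\<^sup>+x. k x \<partial>lborel) * (\<integral>\<^sup>+y. epow q (f y) \<partial>lborel)" by (rule nn_integral_cmult) measurable
  also have "ennreal (W powr (q - 1)) * \<dots> \<le> ennreal (W powr (q - 1)) * (ennreal W * ennreal (F powr q))"
    by (intro mult_left_mono mult_mono W F) auto
  also have "\<dots> = ennreal ((W * F) powr q)" using W(2) F(2) by (simp add: powr_mult powr_diff flip: ennreal_mult)
  finally show "(\<integral>\<^sup>+x. epow q (\<integral>\<^sup>+y. k (x - y) * f y \<partial>lborel) \<partial>lborel) \<le> ennreal ((W * F) powr q)" .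
  fix K x assume K: "\<And>x. k x \<le> ennreal K" "0 < K"
  show "(\<integral>\<^sup>+y. k (x - y) * f y \<partial>lborel) \<le> ennreal (W powr (1 - 1 / q) * K powr (1 / q) * F)"
  proof (rule epow_le_cancel[of q])
    have "epow q (\<integral>\<^sup>+y. k (x - y) * f y \<partial>lborel) \<le> ennreal (W powr (q - 1)) * (\<integral>\<^sup>+y. ennreal K * epow q (f y) \<partial>lborel)"
      by (rule order_trans[OF J]) (intro mult_left_mono nn_integral_mono mult_right_mono K, auto)
    also have "\<dots> = ennreal (W powr (q - 1)) * (ennreal K * (\<integral>\<^sup>+y. epow q (f y) \<partial>lborel))"
      by (subst nn_integral_cmult) auto
    also have "\<dots> \<le> ennreal (W powr (q - 1)) * (ennreal K * ennreal (F powr q))" by (intro mult_left_mono F) auto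
    also have "\<dots> = ennreal ((W powr (1 - 1 / q) * K powr (1 / q) * F) powr q)" proof -
      have "(1 - 1 / q) * q = q - 1" using q by (simp add: field_simps)
      then have "(W powr (1 - 1 / q) * K powr (1 / q) * F) powr q = W powr (q - 1) * (K * F powr q)"
        using W(2) F(2) K(2) q by (simp add: powr_mult powr_powr)
      then show ?thesis using K(2) by (simp add: ennreal_mult)
    qed
    finally show "epow q (\<integral>\<^sup>+y. k (x - y) * f y \<partial>lborel) \<le> \<dots>" .
  qed (use q F in auto)
qed

text \<open>In the L^q bound one function meets the supremum of k and the other its mass; in the sup
  bound both meet the supremum. Hence K powr (1/q) in the first and K powr (2/q) in the
  second.\<close>

lemma conv_trilinear_bounds:
  fixes k u w :: "real^'n::finite \<Rightarrow> ennreal"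
  assumes [measurable]: "k \<in> borel_measurable borel" "u \<in> borel_measurable borel" "w \<in> borel_measurable borel"
    and W: "(\<integral>\<^sup>+x. k x \<partial>lborel) \<le> ennreal W" "0 < W" and K: "\<And>x. k x \<le> ennreal K" "0 < K" and q: "2 \<le> q"
    and B: "(\<integral>\<^sup>+x. epow q (u x) \<partial>lborel) \<le> ennreal (B powr q)" "0 \<le> B"
    and E: "(\<integral>\<^sup>+x. epow q (w x) \<partial>lborel) \<le> ennreal (E powr q)" "0 \<le> E"
  shows conv_trilinear_Lq: "(\<integral>\<^sup>+x. epow q (\<integral>\<^sup>+y. k (x - y) * (u y * w y) \<partial>lborel) \<partial>lborel) \<le> ennreal ((W powr (1 - 1 / q) * K powr (1 / q) * B * E) powr q)"
    and conv_trilinear_sup: "\<And>x. (\<integral>\<^sup>+y. k (x - y) * (u y * w y) \<partial>lborel) \<le> ennreal (W powr (1 - 2 / q) * K powr (2 / q) * B * E)"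
proof -
  have J: "epow q (\<integral>\<^sup>+y. k (x - y) * (u y * w y) \<partial>lborel) \<le> ennreal (W powr (q - 2)) * ((\<integral>\<^sup>+y. k (x - y) * epow q (u y) \<partial>lborel) * (\<integral>\<^sup>+y. k (x - y) * epow q (w y) \<partial>lborel))" for x
    by (rule trilinear_epow) (use W q in \<open>auto simp: nn_integral_reflect\<close>)
  have S: "(\<integral>\<^sup>+y. k (x - y) * epow q (v y) \<partial>lborel) \<le> ennreal (K * V powr q)"
    if [measurable]: "v \<in> borel_measurable borel" and V: "(\<integral>\<^sup>+x. epow q (v x) \<partial>lborel) \<le> ennreal (V powr q)" for v :: "real^'n \<Rightarrow> ennreal" and V x
  proof -
    have "(\<integral>\<^sup>+y. k (x - y) * epow q (v y) \<partial>lborel) \<le> (\<integral>\<^sup>+y. ennreal K * epow q (v y) \<partial>lborel)"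
      by (intro nn_integral_mono mult_right_mono K) auto
    also have "\<dots> \<le> ennreal K * ennreal (V powr q)" by (subst nn_integral_cmult) (auto intro!: mult_left_mono V)
    finally show ?thesis using K(2) by (simp add: ennreal_mult)
  qed
  note Su = S[OF assms(2) B(1)] and Sw = S[OF assms(3) E(1)]
  have L: "(\<integral>\<^sup>+x. (\<integral>\<^sup>+y. k (x - y) * epow q (u y) \<partial>lborel) \<partial>lborel) \<le> ennreal (W * B powr q)"
  proof -
    have "(\<integral>\<^sup>+x. (\<integral>\<^sup>+y. k (x - y) * epow q (u y) \<partial>lborel) \<partial>lborel) = (\<integral>\<^sup>+y. (\<integral>\<^sup>+x. k (x - y) * epow q (u y) \<partial>lborel) \<partial>lborel)"
      by (rule lborel_pair.Fubini') measurable
    also have "\<dots> = (\<integral>\<^sup>+y. (\<integral>\<^sup>+x. k x \<partial>lborel) * epow q (u y) \<partial>lborel)"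
      by (simp add: nn_integral_multc nn_integral_translate)
    also have "\<dots> = (\<integral>\<^sup>+x. k x \<partial>lborel) * (\<integral>\<^sup>+y. epow q (u y) \<partial>lborel)" by (rule nn_integral_cmult) measurable
    also have "\<dots> \<le> ennreal W * ennreal (B powr q)" by (intro mult_mono W B) auto
    finally show ?thesis using W(2) by (simp add: ennreal_mult)
  qed
  have "(\<integral>\<^sup>+x. epow q (\<integral>\<^sup>+y. k (x - y) * (u y * w y) \<partial>lborel) \<partial>lborel)
     \<le> (\<integral>\<^sup>+x. ennreal (W powr (q - 2)) * ((\<integral>\<^sup>+y. k (x - y) * epow q (u y) \<partial>lborel) * ennreal (K * E powr q)) \<partial>lborel)"
    by (intro nn_integral_mono order_trans[OF J] mult_left_mono Sw) auto
  also have "\<dots> = ennreal (W powr (q - 2)) * ((\<integral>\<^sup>+x. (\<integral>\<^sup>+y. k (x - y) * epow q (u y) \<partial>lborel) \<partial>lborel) * ennreal (K * E powr q))"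
    by (simp add: nn_integral_cmult nn_integral_multc)
  also have "\<dots> \<le> ennreal (W powr (q - 2)) * (ennreal (W * B powr q) * ennreal (K * E powr q))"
    by (intro mult_left_mono mult_right_mono L) auto
  also have "\<dots> = ennreal ((W powr (1 - 1 / q) * K powr (1 / q) * B * E) powr q)" proof -
    have "(1 - 1 / q) * q = q - 1" using q by (simp add: field_simps)
    moreover have "W powr (q - 1) = W powr (q - 2) * W" proof -
      have "W powr (q - 2) * W powr 1 = W powr (q - 1)" by (simp only: powr_add[symmetric]) simp
      then show ?thesis using W(2) by simp
    qed
    ultimately have "(W powr (1 - 1 / q) * K powr (1 / q) * B * E) powr q = W powr (q - 2) * (W * B powr q * (K * E powr q))"
      using W(2) B(2) K(2) E(2) q by (simp add: powr_mult powr_powr)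
    then show ?thesis using K(2) W(2) by (simp add: ennreal_mult)
  qed
  finally show "(\<integral>\<^sup>+x. epow q (\<integral>\<^sup>+y. k (x - y) * (u y * w y) \<partial>lborel) \<partial>lborel) \<le> ennreal ((W powr (1 - 1 / q) * K powr (1 / q) * B * E) powr q)" .
  fix x
  show "(\<integral>\<^sup>+y. k (x - y) * (u y * w y) \<partial>lborel) \<le> ennreal (W powr (1 - 2 / q) * K powr (2 / q) * B * E)"
  proof (rule epow_le_cancel[of q])
    have "epow q (\<integral>\<^sup>+y. k (x - y) * (u y * w y) \<partial>lborel) \<le> ennreal (W powr (q - 2)) * (ennreal (K * B powr q) * ennreal (K * E powr q))"
      by (rule order_trans[OF J]) (intro mult_left_mono mult_mono Su Sw, auto)
    also have "\<dots> = ennreal ((W powr (1 - 2 / q) * K powr (2 / q) * B * E) powr q)" proof -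
      have "(1 - 2 / q) * q = q - 2" using q by (simp add: field_simps)
      then have "(W powr (1 - 2 / q) * K powr (2 / q) * B * E) powr q = W powr (q - 2) * (K * B powr q * (K * E powr q))"
        using W(2) B(2) K(2) E(2) q by (simp add: powr_mult powr_powr powr_numeral power2_eq_square)
      then show ?thesis using K(2) by (simp add: ennreal_mult)
    qed
    finally show "epow q (\<integral>\<^sup>+y. k (x - y) * (u y * w y) \<partial>lborel) \<le> \<dots>" .
  qed (use q B E in auto)
qed

section \<open>Derivatives of functions with a holomorphic extension\<close>

text \<open>Holomorphy in each variable separately, on a polydisc about 0. Each later step is a
  one-variable Cauchy formula, which is why this form is convenient.\<close>

definition sep_hol :: "real \<Rightarrow> (('n \<Rightarrow> complex) \<Rightarrow> complex) \<Rightarrow> bool" where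
  "sep_hol r F \<longleftrightarrow> (\<forall>h. (\<forall>k. norm (h k) < r) \<longrightarrow> (\<forall>i. (\<lambda>z. F (h(i := z))) holomorphic_on ball 0 r))"

text \<open>The bound is a function of the real centre x, so that integrability of \<open>B\<close>
  carries over to all derivatives.\<close>

definition hol_ext :: "real \<Rightarrow> (real^'n::finite \<Rightarrow> real) \<Rightarrow> (real^'n \<Rightarrow> real) \<Rightarrow> bool" where
  "hol_ext r f B \<longleftrightarrow> (\<forall>x. \<exists>F. sep_hol r F \<and> (\<forall>h. (\<forall>k. norm (h k) < r) \<longrightarrow> norm (F h) \<le> B x) \<and>
     (\<forall>y. (\<forall>k. norm (y $ k) < r) \<longrightarrow> F (cvec y) = of_real (f (x + y))))"

text \<open>Cauchy's formula on the circle of radius e, parametrised over [0, 1]. As an average of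
  values of F, a partial derivative inherits bounds and holomorphy in the other variables.\<close>

lemma sep_hol_deriv_eq_integral:
  fixes F :: "('n \<Rightarrow> complex) \<Rightarrow> complex"
  assumes F: "sep_hol r F" and e: "0 < e" and h: "\<And>k. norm (h k) < r - e"
  shows "deriv (\<lambda>z. F (h(i := z))) (h i)
      = (LBINT t. indicator {0..1} t *\<^sub>R (F (h(i := h i + of_real e * exp (2 * of_real pi * \<i> * of_real t))) / (of_real e * exp (2 * of_real pi * \<i> * of_real t))))"
    and "set_integrable lborel {0..1} (\<lambda>t. F (h(i := h i + of_real e * exp (2 * of_real pi * \<i> * of_real t))) / (of_real e * exp (2 * of_real pi * \<i> * of_real t)))"
proof -
  let ?g = "\<lambda>z. F (h(i := z))" and ?w = "h i"
  let ?E = "\<lambda>t::real. of_real e * exp (2 * of_real pi * \<i> * of_real t)"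
  have sub: "cball ?w e \<subseteq> ball 0 r" proof
    fix z assume "z \<in> cball ?w e"
    then have "norm z \<le> norm (h i) + e" using norm_triangle_ineq2[of z "h i"] by (simp add: dist_norm norm_minus_commute)
    then show "z \<in> ball 0 r" using h[of i] by simp
  qed
  have hr: "norm (h k) < r" for k using h[of k] e by simp
  have hol: "?g holomorphic_on ball 0 r" using F hr unfolding sep_hol_def by blast
  have con: "continuous_on (cball ?w e) ?g" using hol sub by (blast intro: holomorphic_on_imp_continuous_on holomorphic_on_subset)
  have hb: "?g holomorphic_on ball ?w e" using hol sub ball_subset_cball by (blast intro: holomorphic_on_subset)
  have C: "(?g has_field_derivative (1 / (2 * of_real pi * \<i>) * contour_integral (circlepath ?w e) (\<lambda>u. ?g u / (u - ?w)\<^sup>2))) (at ?w)"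
    using Cauchy_derivative_integral_circlepath(2)[OF con hb, of ?w] e by simp
  have E0: "?E t \<noteq> 0" for t using e by simp
  have contE: "continuous_on {0..1} (\<lambda>t. ?g (?w + ?E t) / ?E t)" proof (intro continuous_on_divide)
    show "continuous_on {0..1} (\<lambda>t. ?g (?w + ?E t))"
      by (rule continuous_on_compose2[OF con]) (use e in \<open>auto intro!: continuous_intros simp: dist_norm norm_mult\<close>)
  qed (use e in \<open>auto intro!: continuous_intros\<close>)
  then show si: "set_integrable lborel {0..1} (\<lambda>t. F (h(i := h i + ?E t)) / ?E t)" by (rule borel_integrable_atLeastAtMost')
  have "contour_integral (circlepath ?w e) (\<lambda>u. ?g u / (u - ?w)\<^sup>2) = integral {0..1} (\<lambda>t. 2 * of_real pi * \<i> * (?g (?w + ?E t) / ?E t))"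
    unfolding contour_integral_integral proof (rule integral_cong)
    fix t :: real assume "t \<in> {0..1}"
    have "circlepath ?w e t = ?w + ?E t" by (simp add: circlepath mult_ac)
    moreover have "vector_derivative (circlepath ?w e) (at t) = 2 * of_real pi * \<i> * ?E t" by (simp add: vector_derivative_circlepath mult_ac)
    ultimately show "?g (circlepath ?w e t) / (circlepath ?w e t - ?w)\<^sup>2 * vector_derivative (circlepath ?w e) (at t) = 2 * of_real pi * \<i> * (?g (?w + ?E t) / ?E t)"
      using E0[of t] by (simp only: add_diff_cancel_left') (simp add: power2_eq_square field_simps)
  qed
  also have "\<dots> = 2 * of_real pi * \<i> * integral {0..1} (\<lambda>t. ?g (?w + ?E t) / ?E t)" by (rule integral_mult_right)
  finally have "deriv ?g ?w = integral {0..1} (\<lambda>t. ?g (?w + ?E t) / ?E t)" using DERIV_imp_deriv[OF C] by simp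
  also have "\<dots> = (LBINT t. indicator {0..1} t *\<^sub>R (?g (?w + ?E t) / ?E t))"
    using set_borel_integral_eq_integral(2)[OF si] by (simp add: set_lebesgue_integral_def)
  finally show "deriv ?g ?w = (LBINT t. indicator {0..1} t *\<^sub>R (F (h(i := h i + ?E t)) / ?E t))" .
qed

text \<open>Each derivative costs e of the radius and a factor 1/e. In the variable of
  differentiation holomorphy is that of a derivative; in any other variable it comes from the circle
  average.\<close>

lemma sep_hol_partial:
  fixes F :: "('n \<Rightarrow> complex) \<Rightarrow> complex"
  assumes F: "sep_hol r F" and e: "0 < e" and B: "\<And>h. (\<And>k. norm (h k) < r) \<Longrightarrow> norm (F h) \<le> B"
  shows "sep_hol (r - e) (\<lambda>h. deriv (\<lambda>z. F (h(i := z))) (h i))"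
    and "\<And>h. (\<And>k. norm (h k) < r - e) \<Longrightarrow> norm (deriv (\<lambda>z. F (h(i := z))) (h i)) \<le> B / e"
proof -
  let ?E = "\<lambda>t::real. of_real e * exp (2 * of_real pi * \<i> * of_real t)"
  have nE: "norm (?E t) = e" for t using e by (simp add: norm_mult)
  have up: "norm ((h(i := h i + ?E t)) k) < r" if "\<And>k. norm (h k) < r - e" for h :: "'n \<Rightarrow> complex" and t k proof (cases "k = i")
    case True
    have "norm (h i + ?E t) \<le> norm (h i) + e" using norm_triangle_ineq[of "h i" "?E t"] nE[of t] by simp
    then show ?thesis using True that[of i] by simp
  next
    case False
    then show ?thesis using that[of k] e by simp
  qed
  have Fb: "norm (F (h(i := h i + ?E t)) / ?E t) \<le> B / e" if "\<And>k. norm (h k) < r - e" for h t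
    using B[of "h(i := h i + ?E t)", OF up[OF that]] e unfolding norm_divide nE by (simp add: divide_right_mono)
  show "norm (deriv (\<lambda>z. F (h(i := z))) (h i)) \<le> B / e" if h: "\<And>k. norm (h k) < r - e" for h proof -
    have B0: "0 \<le> B / e" using order_trans[OF norm_ge_zero Fb[OF h]] .
    have "norm (deriv (\<lambda>z. F (h(i := z))) (h i)) \<le> (LBINT t. norm (indicator {0..1} t *\<^sub>R (F (h(i := h i + ?E t)) / ?E t)))"
      unfolding sep_hol_deriv_eq_integral(1)[where h = h and i = i, OF F e h] by (rule integral_norm_bound)
    also have "\<dots> \<le> (LBINT t. indicator {0..1} (t::real) * (B / e))" proof (rule integral_mono)
      show "integrable lborel (\<lambda>t. norm (indicator {0..1} t *\<^sub>R (F (h(i := h i + ?E t)) / ?E t)))"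
        using sep_hol_deriv_eq_integral(2)[where h = h and i = i, OF F e h] unfolding set_integrable_def by (rule integrable_norm)
      show "norm (indicator {0..1} t *\<^sub>R (F (h(i := h i + ?E t)) / ?E t)) \<le> indicator {0..1} t * (B / e)" for t
        using Fb[where h = h and t = t, OF h] by (simp add: indicator_def)
    qed simp
    also have "\<dots> = B / e" by simp
    finally show ?thesis .
  qed
  show "sep_hol (r - e) (\<lambda>h. deriv (\<lambda>z. F (h(i := z))) (h i))"
    unfolding sep_hol_def proof (intro allI impI)
    fix h :: "'n \<Rightarrow> complex" and j assume h: "\<forall>k. norm (h k) < r - e"
    have hr: "norm (h k) < r" for k using h[rule_format, of k] e by simp
    show "(\<lambda>z. deriv (\<lambda>w. F ((h(j := z))(i := w))) ((h(j := z)) i)) holomorphic_on ball 0 (r - e)" proof (cases "j = i")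
      case True
      have "(\<lambda>z. F (h(i := z))) holomorphic_on ball 0 r" using F hr unfolding sep_hol_def by blast
      then have "deriv (\<lambda>z. F (h(i := z))) holomorphic_on ball 0 r" by (rule holomorphic_deriv) simp
      then have "deriv (\<lambda>z. F (h(i := z))) holomorphic_on ball 0 (r - e)" by (rule holomorphic_on_subset) (use e in auto)
      then show ?thesis using True by simp
    next
      case False
      have hz: "norm ((h(j := z)) k) < r - e" if "z \<in> ball 0 (r - e)" for z k using h that by simp
      have sw: "(h(j := z))(i := h i + c) = (h(i := h i + c))(j := z)" for z c using False by (simp add: fun_upd_twist)
      have "(\<lambda>z. \<integral>t. indicator {0..1} t *\<^sub>R (F ((h(j := z))(i := h i + ?E t)) / ?E t) \<partial>lborel) holomorphic_on ball 0 (r - e)"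
      proof (rule holomorphic_lebesgue_integral[where B = "\<lambda>t. indicator {0..1} t * (B / e)"])
        show "AE t in lborel. (\<lambda>z. indicator {0..1} t *\<^sub>R (F ((h(j := z))(i := h i + ?E t)) / ?E t)) holomorphic_on ball 0 (r - e) \<and>
          (\<forall>z\<in>ball 0 (r - e). norm (indicator {0..1} t *\<^sub>R (F ((h(j := z))(i := h i + ?E t)) / ?E t)) \<le> indicator {0..1} t * (B / e))"
        proof (intro AE_I2 conjI ballI)
          fix t :: real
          have "(\<lambda>z. F ((h(i := h i + ?E t))(j := z))) holomorphic_on ball 0 r" using F up[of h t] h unfolding sep_hol_def by blast
          then have "(\<lambda>z. F ((h(i := h i + ?E t))(j := z))) holomorphic_on ball 0 (r - e)" by (rule holomorphic_on_subset) (use e in auto)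
          then have "(\<lambda>z. F ((h(i := h i + ?E t))(j := z)) / ?E t) holomorphic_on ball 0 (r - e)"
            by (intro holomorphic_on_divide holomorphic_on_const) (use e in auto)
          then show "(\<lambda>z. indicator {0..1} t *\<^sub>R (F ((h(j := z))(i := h i + ?E t)) / ?E t)) holomorphic_on ball 0 (r - e)"
            unfolding sw by (cases "t \<in> {0..1}") auto
          fix z :: complex assume z: "z \<in> ball 0 (r - e)"
          show "norm (indicator {0..1} t *\<^sub>R (F ((h(j := z))(i := h i + ?E t)) / ?E t)) \<le> indicator {0..1} t * (B / e)"
            using Fb[where h = "h(j := z)" and t = t, OF hz[OF z]] False by (simp add: indicator_def)
        qed
        show "(\<lambda>t. indicator {0..1} t *\<^sub>R (F ((h(j := z))(i := h i + ?E t)) / ?E t)) \<in> borel_measurable lborel" if "z \<in> ball 0 (r - e)" for z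
          using sep_hol_deriv_eq_integral(2)[where h = "h(j := z)" and i = i, OF F e hz[OF that]] False unfolding set_integrable_def by (auto dest: borel_measurable_integrable)
      qed auto
      then show ?thesis by (rule holomorphic_transform) (use sep_hol_deriv_eq_integral(1)[where h = "h(j := _)" and i = i, OF F e hz] False in simp)
    qed
  qed
qed

text \<open>Along the i-th real direction the extension coincides with f, so its complex derivative
  there is real and equals \<open>pdiff i f\<close>; the differentiated extension then serves for
  the derivative.\<close>

lemma hol_ext_pdiff:
  fixes f :: "real^'n::finite \<Rightarrow> real"
  assumes f: "hol_ext r f B" and e: "0 < e" "e < r"
  shows "has_pdiff i f x" "hol_ext (r - e) (pdiff i f) (\<lambda>x. B x / e)"
proof -
  have key: "has_pdiff i f (x + y) \<and> deriv (\<lambda>z. F ((cvec y)(i := z))) (cvec y i) = of_real (pdiff i f (x + y))"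
    if F: "sep_hol r F" and real: "\<And>y. (\<And>k. norm (y $ k) < r) \<Longrightarrow> F (cvec y) = of_real (f (x + y))" and y: "\<And>k. norm (y $ k) < r"
    for F x and y :: "real^'n" proof -
    let ?g = "\<lambda>z. F ((cvec y)(i := z))" and ?D = "deriv (\<lambda>z. F ((cvec y)(i := z))) (cvec y i)"
    let ?fe = "\<lambda>s. f (x + y + s *\<^sub>R axis i 1)"
    have "?g holomorphic_on ball 0 r" using F y unfolding sep_hol_def by (simp add: cvec_def)
    then have "(?g has_field_derivative ?D) (at (cvec y i))" by (rule holomorphic_derivI) (use y[of i] in \<open>auto simp: cvec_def\<close>)
    moreover have "cvec y i = of_real (y $ i + 0)" by (simp add: cvec_def)
    ultimately have g: "(?g has_field_derivative ?D) (at (of_real (y $ i + 0)))" by simp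
    have "((\<lambda>s. ?g (of_real (y $ i + s))) has_vector_derivative ?D) (at 0)" proof -
      have "((\<lambda>s. y $ i + s) has_vector_derivative 1) (at 0)" by (auto intro!: derivative_eq_intros)
      from vector_diff_chain_at[OF this has_vector_derivative_real_field[OF g]] show ?thesis by (simp add: o_def)
    qed
    moreover have "\<forall>\<^sub>F s in nhds (0::real). ?g (of_real (y $ i + s)) = of_real (?fe s)" proof -
      have "\<forall>\<^sub>F s in nhds 0. norm (y $ i + s) < r" proof -
        have "((\<lambda>s::real. norm (y $ i + s)) \<longlongrightarrow> norm (y $ i + 0)) (nhds 0)" by (intro tendsto_intros filterlim_ident)
        then show ?thesis using y[of i] by (intro order_tendstoD) auto
      qed
      then show ?thesis proof eventually_elim
        case (elim s)
        have c: "(cvec y)(i := of_real (y $ i + s)) = cvec (y + s *\<^sub>R axis i 1)" by (auto simp: cvec_def axis_def)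
        have "norm ((y + s *\<^sub>R axis i 1) $ k) < r" for k using y[of k] elim by (cases "k = i") (auto simp: axis_def)
        from real[OF this] show ?case unfolding c by (simp add: add.assoc)
      qed
    qed
    ultimately have v: "((\<lambda>s. complex_of_real (?fe s)) has_vector_derivative ?D) (at 0)"
      by (subst (asm) has_vector_derivative_cong_ev) (auto elim: eventually_mono dest: eventually_nhds_x_imp_x)
    have r: "(?fe has_vector_derivative Re ?D) (at 0)" using bounded_linear.has_vector_derivative[OF bounded_linear_Re v] by simp
    have "((\<lambda>s. 0) has_vector_derivative Im ?D) (at (0::real))" using bounded_linear.has_vector_derivative[OF bounded_linear_Im v] by simp
    then have "Im ?D = 0" using vector_derivative_unique_at[OF _ has_vector_derivative_const] by blast
    moreover have "pdiff i f (x + y) = Re ?D" unfolding pdiff_def by (rule vector_derivative_at[OF r])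
    ultimately have "?D = of_real (pdiff i f (x + y))" by (simp add: complex_eq_iff)
    moreover have "has_pdiff i f (x + y)" unfolding has_pdiff_def by (rule differentiableI_vector[OF r])
    ultimately show ?thesis by simp
  qed
  show "has_pdiff i f x" proof -
    obtain F :: "('n \<Rightarrow> complex) \<Rightarrow> complex" where F: "sep_hol r F" "\<And>y. (\<And>k. norm (y $ k) < r) \<Longrightarrow> F (cvec y) = of_real (f (x + y))"
      using f unfolding hol_ext_def by blast
    from key[OF F, of 0] show ?thesis using e by simp
  qed
  show "hol_ext (r - e) (pdiff i f) (\<lambda>x. B x / e)"
    unfolding hol_ext_def proof
    fix x
    obtain F :: "('n \<Rightarrow> complex) \<Rightarrow> complex" where F: "sep_hol r F" and B: "\<And>h. (\<And>k. norm (h k) < r) \<Longrightarrow> norm (F h) \<le> B x" and R: "\<And>y. (\<And>k. norm (y $ k) < r) \<Longrightarrow> F (cvec y) = of_real (f (x + y))"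
      using f unfolding hol_ext_def by blast
    have "deriv (\<lambda>z. F ((cvec y)(i := z))) (cvec y i) = of_real (pdiff i f (x + y))" if "\<forall>k. norm (y $ k) < r - e" for y :: "real^'n"
    proof -
      have "norm (y $ k) < r" for k using that[rule_format, of k] e by simp
      from key[OF F R this] show ?thesis by blast
    qed
    then show "\<exists>F. sep_hol (r - e) F \<and> (\<forall>h. (\<forall>k. norm (h k) < r - e) \<longrightarrow> norm (F h) \<le> B x / e) \<and>
      (\<forall>y. (\<forall>k. norm (y $ k) < r - e) \<longrightarrow> F (cvec y) = of_real (pdiff i f (x + y)))"
      using sep_hol_partial[where i = i, OF F e(1) B] by (intro exI[of _ "\<lambda>h. deriv (\<lambda>z. F (h(i := z))) (h i)"]) auto
  qed
qed

lemma hol_ext_pdiffs: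
  fixes f :: "real^'n::finite \<Rightarrow> real"
  assumes f: "hol_ext r f B" and e: "0 < e" "real (length is) * e < r"
  shows "hol_ext (r - real (length is) * e) (pdiffs is f) (\<lambda>x. B x / e ^ length is)"
  using e(2) proof (induction "is")
  case Nil
  then show ?case using f by simp
next
  case (Cons i js)
  have 1: "real (length js) * e < r" using Cons.prems e by (simp add: algebra_simps)
  have "e < r - real (length js) * e" using Cons.prems by (simp add: algebra_simps)
  from hol_ext_pdiff(2)[OF Cons.IH[OF 1] e(1) this, of i]
  show ?case by (simp add: algebra_simps)
qed

lemma hol_ext_derivative_bounds:
  fixes f :: "real^'n::finite \<Rightarrow> real"
  assumes f: "hol_ext r f B" and r: "0 < r"
  shows "has_pdiff i (pdiffs is f) x"
    and "\<bar>pdiffs is f x\<bar> \<le> B x * (2 / r) ^ length is * real (length is) ^ length is"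
proof -
  define n where "n = length is"
  \<comment> \<open>Taking n steps of size r/(n + 1) leaves one step of radius over, in which the
    last derivative is evaluated and can be differentiated once more.\<close>
  define e where "e = r / real (Suc n)"
  have e: "0 < e" "real (Suc n) * e = r" using r by (auto simp: e_def)
  then have "real n * e < r" by (simp add: algebra_simps)
  then have h: "hol_ext (r - real n * e) (pdiffs is f) (\<lambda>x. B x / e ^ n)" using hol_ext_pdiffs[OF f e(1), of "is"] by (simp add: n_def)
  moreover have re: "r - real n * e = e" using e by (simp add: algebra_simps)
  ultimately have h: "hol_ext e (pdiffs is f) (\<lambda>x. B x / e ^ n)" by simp
  show "has_pdiff i (pdiffs is f) x" by (rule hol_ext_pdiff(1)[OF h, of "e / 2"]) (use e in auto)
  obtain F :: "('n \<Rightarrow> complex) \<Rightarrow> complex" where F: "\<And>h. (\<And>k. norm (h k) < e) \<Longrightarrow> norm (F h) \<le> B x / e ^ n" "\<And>y. (\<And>k. norm (y $ k) < e) \<Longrightarrow> F (cvec y) = of_real (pdiffs is f (x + y))"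
    using h unfolding hol_ext_def by meson
  have b: "\<bar>pdiffs is f x\<bar> \<le> B x / e ^ n" using F(1)[of "cvec 0"] F(2)[of 0] e by (simp add: cvec_def)
  obtain G :: "('n \<Rightarrow> complex) \<Rightarrow> complex" where "\<And>h. (\<And>k. norm (h k) < r) \<Longrightarrow> norm (G h) \<le> B x" using f unfolding hol_ext_def by meson
  from this[of "\<lambda>_. 0"] r have B0: "0 \<le> B x" by (auto intro: order_trans[OF norm_ge_zero])
  have "B x / e ^ n = B x * (1 / r) ^ n * real (Suc n) ^ n" unfolding e_def using r by (simp add: power_divide field_simps)
  also have "\<dots> \<le> B x * (1 / r) ^ n * (2 ^ n * real n ^ n)" proof (rule mult_left_mono)
    \<comment> \<open>For n \<ge> 1 this is n + 1 \<le> 2 n; for n = 0 both sides are 1.\<close>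
    show "real (Suc n) ^ n \<le> 2 ^ n * real n ^ n" proof (cases n)
      case (Suc m)
      have "real (Suc n) ^ n \<le> (2 * real n) ^ n" by (rule power_mono) (use Suc in auto)
      then show ?thesis by (simp add: power_mult_distrib)
    qed simp
  qed (use B0 r in auto)
  also have "\<dots> = B x * (2 / r) ^ n * real n ^ n" by (simp add: power_divide)
  finally show "\<bar>pdiffs is f x\<bar> \<le> B x * (2 / r) ^ length is * real (length is) ^ length is" using b by (simp add: n_def)
qed

section \<open>Real analyticity\<close>

text \<open>Regroups an unconditional sum by the values of p; applied to the length of a word and to
  the numbers of its letters.\<close>

lemma has_sum_fibers:
  fixes T :: "'a \<Rightarrow> real"
  assumes T: "(T has_sum S) UNIV" and b: "\<And>y. (T has_sum b y) {w. p w = y}"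
  shows "(b has_sum S) UNIV"
proof (rule has_sum_Sigma[where f = "\<lambda>(y, w). T w" and B = "\<lambda>y. {w. p w = y}"])
  have "inj (\<lambda>w. (p w, w))" by (auto simp: inj_def)
  moreover have "range (\<lambda>w. (p w, w)) = Sigma UNIV (\<lambda>y. {w. p w = y})" by auto
  ultimately show "((\<lambda>(y, w). T w) has_sum S) (Sigma UNIV (\<lambda>y. {w. p w = y}))"
    using T has_sum_reindex[of "\<lambda>w. (p w, w)" UNIV "\<lambda>(y, w). T w" S] by (simp add: o_def)
  show "uniformly_continuous_on UNIV (\<lambda>(x::real, y). x + y)" by (rule uniformly_continuous_add)
qed (use b in auto)

lemma pdiff_line:
  fixes g :: "real^'n::finite \<Rightarrow> real"
  assumes "\<And>x. has_pdiff i g x"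
  shows "((\<lambda>s. g (x + s *\<^sub>R axis i 1)) has_real_derivative pdiff i g (x + s *\<^sub>R axis i 1)) (at s)"
proof -
  have "((\<lambda>h. g (x + s *\<^sub>R axis i 1 + h *\<^sub>R axis i 1)) has_vector_derivative pdiff i g (x + s *\<^sub>R axis i 1)) (at 0)"
    using assms[of "x + s *\<^sub>R axis i 1"] unfolding has_pdiff_def pdiff_def by (simp add: vector_derivative_works)
  then have "((\<lambda>h. g (x + (s + h) *\<^sub>R axis i 1)) has_real_derivative pdiff i g (x + s *\<^sub>R axis i 1)) (at 0)"
    by (simp add: has_real_derivative_iff_has_vector_derivative scaleR_add_left add.assoc)
  then show ?thesis using DERIV_shift[of "\<lambda>s. g (x + s *\<^sub>R axis i 1)" "pdiff i g (x + s *\<^sub>R axis i 1)" 0 s]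
    by (simp add: add.commute)
qed

lemma real_deriv_bound:
  fixes f :: "real \<Rightarrow> real"
  assumes "\<And>s. \<bar>s\<bar> \<le> \<bar>t\<bar> \<Longrightarrow> (f has_real_derivative f' s) (at s)" and "\<And>s. \<bar>s\<bar> \<le> \<bar>t\<bar> \<Longrightarrow> \<bar>f' s\<bar> \<le> B"
  shows "\<bar>f t - f 0\<bar> \<le> B * \<bar>t\<bar>"
proof -
  have "norm (f t - f 0) \<le> B * norm (t - 0)" by (rule field_differentiable_bound[of "{-\<bar>t\<bar>..\<bar>t\<bar>}" f f'])
       (use assms in \<open>auto intro: has_field_derivative_at_within simp: abs_le_iff\<close>)
  then show ?thesis by simp
qed

text \<open>The increment h restricted to the coordinates in S. Adding one coordinate at a time
  reduces estimates to derivatives along the axes.\<close>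

definition pvec :: "real^'n::finite \<Rightarrow> 'n set \<Rightarrow> real^'n" where
  "pvec h S = (\<Sum>i\<in>S. (h $ i) *\<^sub>R axis i 1)"

lemma pvec_UNIV: "pvec h UNIV = h"
  unfolding pvec_def by (rule vec_eq_iff[THEN iffD2]) (simp add: axis_def if_distrib cong: if_cong)

lemma pdiff_lipschitz:
  fixes g :: "real^'n::finite \<Rightarrow> real"
  assumes g: "\<And>i x. has_pdiff i g x" and M: "\<And>i x. \<bar>pdiff i g x\<bar> \<le> M"
  shows "\<bar>g (x + pvec h S) - g x\<bar> \<le> M * (\<Sum>i\<in>S. \<bar>h $ i\<bar>)"
proof -
  have "finite S" by simp
  then show ?thesis proof (induction S)
    case empty
    then show ?case by (simp add: pvec_def)
  next
    case (insert i S)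
    have e: "x + pvec h (insert i S) = x + pvec h S + (h $ i) *\<^sub>R axis i 1" using insert by (simp add: pvec_def)
    have "\<bar>g (x + pvec h S + (h $ i) *\<^sub>R axis i 1) - g (x + pvec h S + 0 *\<^sub>R axis i 1)\<bar> \<le> M * \<bar>h $ i\<bar>"
      by (rule real_deriv_bound[OF pdiff_line[OF g]]) (rule M)
    then show ?case unfolding e using insert by (simp add: distrib_left)
  qed
qed

text \<open>Induction over coordinates: along the new axis the error is quadratic by the mean value
  bound, and moving the base point of the derivative costs M times the earlier increments.\<close>

lemma pdiff_second_order:
  fixes g :: "real^'n::finite \<Rightarrow> real"
  assumes g: "\<And>i x. has_pdiff i g x" and g2: "\<And>i j x. has_pdiff j (pdiff i g) x" and M: "\<And>i j x. \<bar>pdiff j (pdiff i g) x\<bar> \<le> M"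
  shows "\<bar>g (x + pvec h S) - g x - (\<Sum>i\<in>S. h $ i * pdiff i g x)\<bar> \<le> M * (\<Sum>i\<in>S. \<bar>h $ i\<bar>)\<^sup>2"
proof -
  have M0: "0 \<le> M" using order_trans[OF abs_ge_zero M[of undefined undefined 0]] .
  have "finite S" by simp
  then show ?thesis proof (induction S)
    case empty
    then show ?case by (simp add: pvec_def)
  next
    case (insert i S)
    let ?y = "x + pvec h S" and ?A = "\<Sum>i\<in>S. \<bar>h $ i\<bar>" and ?a = "h $ i"
    have e: "x + pvec h (insert i S) = ?y + ?a *\<^sub>R axis i 1" using insert by (simp add: pvec_def)
    have 1: "\<bar>pdiff i g ?y - pdiff i g x\<bar> \<le> M * ?A" by (rule pdiff_lipschitz[OF g2 M])
    have 2: "\<bar>(g (?y + ?a *\<^sub>R axis i 1) - ?a * pdiff i g ?y) - (g (?y + 0 *\<^sub>R axis i 1) - 0 * pdiff i g ?y)\<bar> \<le> (M * \<bar>?a\<bar>) * \<bar>?a\<bar>"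
    proof (rule real_deriv_bound[where f' = "\<lambda>s. pdiff i g (?y + s *\<^sub>R axis i 1) - 1 * pdiff i g ?y"])
      show "((\<lambda>s. g (?y + s *\<^sub>R axis i 1) - s * pdiff i g ?y) has_real_derivative pdiff i g (?y + s *\<^sub>R axis i 1) - 1 * pdiff i g ?y) (at s)" for s
        by (intro DERIV_diff pdiff_line[OF g] DERIV_cmult_right DERIV_ident)
      fix s assume s: "\<bar>s\<bar> \<le> \<bar>?a\<bar>"
      have "\<bar>pdiff i g (?y + s *\<^sub>R axis i 1) - pdiff i g (?y + 0 *\<^sub>R axis i 1)\<bar> \<le> M * \<bar>s\<bar>"
        by (rule real_deriv_bound[OF pdiff_line[OF g2]]) (rule M)
      also have "\<dots> \<le> M * \<bar>?a\<bar>" by (rule mult_left_mono[OF s M0])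
      finally show "\<bar>pdiff i g (?y + s *\<^sub>R axis i 1) - 1 * pdiff i g ?y\<bar> \<le> M * \<bar>?a\<bar>" by simp
    qed
    have 3: "\<bar>?a * (pdiff i g ?y - pdiff i g x)\<bar> \<le> \<bar>?a\<bar> * (M * ?A)" unfolding abs_mult by (rule mult_left_mono[OF 1]) simp
    have "g (x + pvec h (insert i S)) - g x - (\<Sum>i\<in>insert i S. h $ i * pdiff i g x)
      = (g ?y - g x - (\<Sum>i\<in>S. h $ i * pdiff i g x)) + ((g (?y + ?a *\<^sub>R axis i 1) - ?a * pdiff i g ?y) - g ?y) + ?a * (pdiff i g ?y - pdiff i g x)"
      unfolding e using insert by (simp add: algebra_simps)
    moreover have "\<bar>(g (?y + ?a *\<^sub>R axis i 1) - ?a * pdiff i g ?y) - g ?y\<bar> \<le> (M * \<bar>?a\<bar>) * \<bar>?a\<bar>" using 2 by simp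
    ultimately have "\<bar>g (x + pvec h (insert i S)) - g x - (\<Sum>i\<in>insert i S. h $ i * pdiff i g x)\<bar> \<le> M * ?A\<^sup>2 + (M * \<bar>?a\<bar>) * \<bar>?a\<bar> + \<bar>?a\<bar> * (M * ?A)"
      using insert.IH 3 by linarith
    also have "\<dots> \<le> M * (\<bar>?a\<bar> + ?A)\<^sup>2" proof -
      have A0: "0 \<le> ?A" by (simp add: sum_nonneg)
      have "M * (\<bar>?a\<bar> + ?A)\<^sup>2 = M * ?A\<^sup>2 + (M * \<bar>?a\<bar>) * \<bar>?a\<bar> + \<bar>?a\<bar> * (M * ?A) + \<bar>?a\<bar> * (M * ?A)"
        by (simp add: power2_eq_square algebra_simps)
      then show ?thesis using A0 M0 by simp
    qed
    finally show ?case using insert by simp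
  qed
qed

text \<open>The quadratic error of \<open>pdiff_second_order\<close>, divided by t, tends to
  0.\<close>

lemma pdiff_chain_line:
  fixes g :: "real^'n::finite \<Rightarrow> real"
  assumes g: "\<And>i x. has_pdiff i g x" and g2: "\<And>i j x. has_pdiff j (pdiff i g) x" and M: "\<And>i j x. \<bar>pdiff j (pdiff i g) x\<bar> \<le> M"
  shows "((\<lambda>s. g (x + s *\<^sub>R h)) has_real_derivative (\<Sum>i\<in>UNIV. h $ i * pdiff i g (x + s *\<^sub>R h))) (at s)"
proof -
  let ?D = "\<Sum>i\<in>UNIV. h $ i * pdiff i g (x + s *\<^sub>R h)" and ?H = "\<Sum>i\<in>UNIV. \<bar>h $ i\<bar>"
  have b: "\<bar>(g (x + (s + t) *\<^sub>R h) - g (x + s *\<^sub>R h)) / t - ?D\<bar> \<le> M * ?H\<^sup>2 * \<bar>t\<bar>" if t: "t \<noteq> 0" for t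
  proof -
    have "\<bar>g (x + s *\<^sub>R h + pvec (t *\<^sub>R h) UNIV) - g (x + s *\<^sub>R h) - (\<Sum>i\<in>UNIV. (t *\<^sub>R h) $ i * pdiff i g (x + s *\<^sub>R h))\<bar> \<le> M * (\<Sum>i\<in>UNIV. \<bar>(t *\<^sub>R h) $ i\<bar>)\<^sup>2"
      by (rule pdiff_second_order[OF g g2 M])
    moreover have "(\<Sum>i\<in>UNIV. (t *\<^sub>R h) $ i * pdiff i g (x + s *\<^sub>R h)) = t * ?D" by (simp add: sum_distrib_left mult.assoc)
    moreover have "(\<Sum>i\<in>UNIV. \<bar>(t *\<^sub>R h) $ i\<bar>) = \<bar>t\<bar> * ?H" by (simp add: sum_distrib_left abs_mult)
    moreover have "x + s *\<^sub>R h + pvec (t *\<^sub>R h) UNIV = x + (s + t) *\<^sub>R h" by (simp add: pvec_UNIV scaleR_add_left add.assoc)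
    ultimately have "\<bar>g (x + (s + t) *\<^sub>R h) - g (x + s *\<^sub>R h) - t * ?D\<bar> \<le> M * ?H\<^sup>2 * \<bar>t\<bar> * \<bar>t\<bar>"
      by (simp add: power2_eq_square mult_ac)
    then have "\<bar>g (x + (s + t) *\<^sub>R h) - g (x + s *\<^sub>R h) - t * ?D\<bar> / \<bar>t\<bar> \<le> M * ?H\<^sup>2 * \<bar>t\<bar>"
      using t by (simp add: pos_divide_le_eq)
    moreover have "(g (x + (s + t) *\<^sub>R h) - g (x + s *\<^sub>R h)) / t - ?D = (g (x + (s + t) *\<^sub>R h) - g (x + s *\<^sub>R h) - t * ?D) / t"
      using t by (simp add: diff_divide_distrib)
    ultimately show ?thesis by (simp only: abs_divide)
  qed
  have "((\<lambda>t. (g (x + (s + t) *\<^sub>R h) - g (x + s *\<^sub>R h)) / t - ?D) \<longlongrightarrow> 0) (at 0)"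
  proof (rule Lim_null_comparison)
    show "\<forall>\<^sub>F t in at 0. norm ((g (x + (s + t) *\<^sub>R h) - g (x + s *\<^sub>R h)) / t - ?D) \<le> M * ?H\<^sup>2 * \<bar>t\<bar>"
      using b by (simp add: eventually_at_filter)
    have "((\<lambda>t. M * ?H\<^sup>2 * \<bar>t\<bar>) \<longlongrightarrow> M * ?H\<^sup>2 * \<bar>0\<bar>) (at 0)" by (intro tendsto_intros)
    then show "((\<lambda>t. M * ?H\<^sup>2 * \<bar>t\<bar>) \<longlongrightarrow> 0) (at 0)" by simp
  qed
  then show ?thesis unfolding DERIV_def by (rule LIM_zero_cancel)
qed

text \<open>Monomials are indexed by words, that is by lists of directions as in
  \<open>pdiffs\<close>. The k-th derivative along h is then the sum of \<open>hw h w\<close> times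
  \<open>pdiffs w g\<close> over the words of length k.\<close>

definition hw :: "real^'n \<Rightarrow> 'n list \<Rightarrow> real" where "hw h w = prod_list (map (\<lambda>i. h $ i) w)"

lemma hw_Cons[simp]: "hw h (i # w) = h $ i * hw h w" "hw h [] = 1" by (simp_all add: hw_def)

lemma finite_words: "finite {w :: 'n::finite list. length w = k}"
  using finite_lists_length_eq[of "UNIV :: 'n set" k] by simp

lemma words_Suc: "{w :: 'n list. length w = Suc k} = (\<lambda>(i, w). i # w) ` (UNIV \<times> {w. length w = k})"
  by (auto simp: length_Suc_conv image_iff)

lemma sum_words_Suc:
  "(\<Sum>w | length w = Suc k. F w) = (\<Sum>w | length w = k. \<Sum>i\<in>(UNIV::'n::finite set). F (i # w))" proof -
  have "(\<Sum>w | length w = Suc k. F w) = (\<Sum>(i, w)\<in>UNIV \<times> {w. length w = k}. F (i # w))"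
    unfolding words_Suc by (subst sum.reindex) (auto simp: inj_on_def case_prod_unfold)
  also have "\<dots> = (\<Sum>i\<in>UNIV. \<Sum>w | length w = k. F (i # w))" by (simp add: sum.cartesian_product)
  finally show ?thesis by (simp add: sum.swap[of _ UNIV])
qed

lemma sum_hw_abs: "(\<Sum>w | length w = k. \<bar>hw h w\<bar>) = (\<Sum>i\<in>(UNIV::'n::finite set). \<bar>h $ i\<bar>) ^ k"
proof (induction k)
  case (Suc k)
  have "(\<Sum>w | length w = Suc k. \<bar>hw h w\<bar>) = (\<Sum>w | length w = k. (\<Sum>i\<in>UNIV. \<bar>h $ i\<bar>) * \<bar>hw h w\<bar>)"
    unfolding sum_words_Suc by (simp add: abs_mult sum_distrib_right)
  then show ?case using Suc by (simp flip: sum_distrib_left)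
qed simp

lemma hw_count: "hw h w = (\<Prod>i\<in>(UNIV::'n::finite set). (h $ i) ^ count_list w i)"
proof (induction w)
  case (Cons j w)
  have "(\<Prod>i\<in>UNIV. (h $ i) ^ count_list (j # w) i) = (\<Prod>i\<in>UNIV. (if i = j then h $ j else 1) * (h $ i) ^ count_list w i)"
    by (rule prod.cong) auto
  also have "\<dots> = h $ j * hw h w" by (simp add: prod.distrib Cons)
  finally show ?case by simp
qed simp

lemma sum_count_list: "(\<Sum>i\<in>(UNIV::'n::finite set). count_list w i) = length w"
proof (induction w)
  case (Cons j w)
  have "count_list (j # w) i = (if i = j then 1 else 0) + count_list w i" for i by simp
  then show ?case using Cons by (simp only: sum.distrib) simp
qed simp

text \<open>The quotient k^k/k! is a single term of the series of exp(k).\<close>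

lemma self_power_le_fact: "real k ^ k \<le> exp 1 ^ k * fact k"
proof -
  have "(\<lambda>n. real k ^ n /\<^sub>R fact n) sums exp (real k)" by (rule exp_converges)
  then have "real k ^ k /\<^sub>R fact k \<le> exp (real k)"
    using sums_le[of "\<lambda>n. if n = k then real k ^ k /\<^sub>R fact k else 0" "\<lambda>n. real k ^ n /\<^sub>R fact n" "real k ^ k /\<^sub>R fact k"]
      sums_single[of k "\<lambda>_. real k ^ k /\<^sub>R fact k"] by (simp add: if_distrib)
  then have "real k ^ k / fact k \<le> exp 1 ^ k" by (simp add: exp_of_nat_mult[symmetric] divide_inverse mult.commute)
  then show ?thesis by (simp add: field_simps)
qed

text \<open>By k^k \<le> e^k k! the k-th Taylor term along the segment is at most A times the k-th
  power of |h|_1 L e < 1. So the remainder tends to 0, and the sum over all words converges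
  absolutely and can be regrouped by letter counts into a power series.\<close>

lemma power_series_of_derivative_bounds:
  fixes g :: "real^'n::finite \<Rightarrow> real" and h :: "real^'n"
  assumes ex: "\<And>is i x. has_pdiff i (pdiffs is g) x"
    and bd: "\<And>is x. \<bar>pdiffs is g x\<bar> \<le> A * L ^ length is * real (length is) ^ length is" and L: "0 < L"
    and h: "(\<Sum>i\<in>UNIV. \<bar>h $ i\<bar>) * L * exp 1 < 1"
  shows "((\<lambda>a. (\<Prod>i\<in>UNIV. (h $ i) ^ a i) * (\<Sum>w | (\<lambda>i. count_list w i) = a. pdiffs w g x / fact (length w))) has_sum g (x + h)) UNIV"
proof -
  let ?H = "\<Sum>i\<in>UNIV. \<bar>h $ i\<bar>"
  let ?q = "?H * L * exp 1"
  have A0: "0 \<le> A" using order_trans[OF abs_ge_zero bd[of "[]" 0]] by simp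
  have H0: "0 \<le> ?H" by (simp add: sum_nonneg)
  have q0: "0 \<le> ?q" using H0 L by simp
  have nq: "norm ?q < 1" using q0 h by (simp only: real_norm_def abs_of_nonneg)
  define diff where "diff k s = (\<Sum>w | length w = k. hw h w * pdiffs w g (x + s *\<^sub>R h))" for k s
  have der: "(diff k has_real_derivative diff (Suc k) s) (at s)" for k s proof -
    have "(diff k has_real_derivative (\<Sum>w | length w = k. hw h w * (\<Sum>i\<in>UNIV. h $ i * pdiff i (pdiffs w g) (x + s *\<^sub>R h)))) (at s)"
      unfolding diff_def proof (intro DERIV_sum DERIV_cmult)
      fix w :: "'n list" assume w: "w \<in> {w. length w = k}"
      show "((\<lambda>s. pdiffs w g (x + s *\<^sub>R h)) has_real_derivative (\<Sum>i\<in>UNIV. h $ i * pdiff i (pdiffs w g) (x + s *\<^sub>R h))) (at s)"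
      proof (rule pdiff_chain_line[OF ex])
        show "has_pdiff j (pdiff i (pdiffs w g)) x" for i j x using ex[of j "i # w" x] by simp
        show "\<bar>pdiff j (pdiff i (pdiffs w g)) x\<bar> \<le> A * L ^ (k + 2) * real (k + 2) ^ (k + 2)" for i j x
          using bd[of "j # i # w" x] w by simp
      qed
    qed
    also have "(\<Sum>w | length w = k. hw h w * (\<Sum>i\<in>UNIV. h $ i * pdiff i (pdiffs w g) (x + s *\<^sub>R h))) = diff (Suc k) s"
      unfolding diff_def sum_words_Suc by (simp add: sum_distrib_left mult_ac)
    finally show ?thesis .
  qed
  have db: "(\<Sum>w | length w = k. \<bar>hw h w * pdiffs w g y\<bar>) \<le> A * ?q ^ k * fact k" for k y proof -
    have "(\<Sum>w | length w = k. \<bar>hw h w * pdiffs w g y\<bar>) \<le> (\<Sum>w | length w = k. \<bar>hw h w\<bar> * (A * L ^ k * real k ^ k))"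
      unfolding abs_mult using bd[of _ y] by (intro sum_mono mult_left_mono) auto
    also have "\<dots> = ?H ^ k * (A * L ^ k * real k ^ k)" by (simp add: sum_hw_abs flip: sum_distrib_right)
    also have "\<dots> \<le> ?H ^ k * (A * L ^ k * (exp 1 ^ k * fact k))" using H0 A0 L by (intro mult_left_mono self_power_le_fact) auto
    also have "\<dots> = A * ?q ^ k * fact k" by (simp add: power_mult_distrib mult_ac)
    finally show ?thesis .
  qed
  have taylor: "(\<lambda>k. diff k 0 / fact k) sums g (x + h)" proof -
    have "\<bar>(\<Sum>m<n. diff m 0 / fact m) - g (x + h)\<bar> \<le> A * ?q ^ n" for n proof -
      have "\<exists>t. \<bar>t\<bar> \<le> \<bar>1\<bar> \<and> diff 0 1 = (\<Sum>m<n. diff m 0 / fact m * 1 ^ m) + diff n t / fact n * 1 ^ n"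
        by (rule Maclaurin_all_le) (use der in auto)
      then obtain t where t: "diff 0 1 = (\<Sum>m<n. diff m 0 / fact m) + diff n t / fact n" by auto
      have "diff 0 1 = g (x + h)" by (simp add: diff_def)
      moreover have "\<bar>diff n t\<bar> \<le> A * ?q ^ n * fact n"
        unfolding diff_def by (rule order_trans[OF sum_abs db])
      then have "\<bar>diff n t / fact n\<bar> \<le> A * ?q ^ n" by (simp add: divide_le_eq)
      ultimately show ?thesis using t by linarith
    qed
    moreover have "(\<lambda>n. A * ?q ^ n) \<longlonglongrightarrow> A * 0" by (intro tendsto_intros LIMSEQ_power_zero nq)
    ultimately have "(\<lambda>n. (\<Sum>m<n. diff m 0 / fact m) - g (x + h)) \<longlonglongrightarrow> 0"
      by (rule_tac Lim_null_comparison[of _ "\<lambda>n. A * ?q ^ n"]) simp_all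
    then show ?thesis unfolding sums_def by (rule LIM_zero_cancel)
  qed
  define T where "T w = hw h w * (pdiffs w g x / fact (length w))" for w
  have summ: "T summable_on UNIV" proof (rule abs_summable_summable, rule nonneg_bdd_above_summable_on)
    show "bdd_above (sum (\<lambda>w. norm (T w)) ` {F. F \<subseteq> UNIV \<and> finite F})" proof (rule bdd_aboveI2)
      fix F :: "'n list set" assume "F \<in> {F. F \<subseteq> UNIV \<and> finite F}"
      then have F: "finite F" by simp
      define N where "N = Suc (Max (insert 0 (length ` F)))"
      have sub: "F \<subseteq> (\<Union>k<N. {w. length w = k})" proof
        fix w assume "w \<in> F"
        then have "length w \<le> Max (insert 0 (length ` F))" using F by (intro Max_ge) auto
        then show "w \<in> (\<Union>k<N. {w. length w = k})" by (simp add: N_def)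
      qed
      have "sum (\<lambda>w. norm (T w)) F \<le> sum (\<lambda>w. norm (T w)) (\<Union>k<N. {w. length w = k})"
        by (rule sum_mono2[OF _ sub]) (auto simp: finite_words)
      also have "\<dots> = (\<Sum>k<N. \<Sum>w | length w = k. norm (T w))" by (rule sum.UNION_disjoint) (auto simp: finite_words)
      also have "\<dots> \<le> (\<Sum>k<N. A * ?q ^ k)" proof (rule sum_mono)
        fix k
        have "(\<Sum>w | length w = k. norm (T w)) = (\<Sum>w | length w = k. \<bar>hw h w * pdiffs w g x\<bar>) / fact k"
          by (simp add: T_def abs_mult sum_divide_distrib)
        also have "\<dots> \<le> A * ?q ^ k" using db[where k = k and y = x] by (simp add: divide_le_eq)
        finally show "(\<Sum>w | length w = k. norm (T w)) \<le> A * ?q ^ k" .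
      qed
      also have "\<dots> \<le> A * (1 / (1 - ?q))" proof -
        have "(\<Sum>k<N. ?q ^ k) \<le> (\<Sum>k. ?q ^ k)"
          by (rule sum_le_suminf[OF summable_geometric[OF nq]]) (simp_all only: finite_lessThan zero_le_power[OF q0])
        also have "\<dots> = 1 / (1 - ?q)" by (rule suminf_geometric[OF nq])
        finally have "A * (\<Sum>k<N. ?q ^ k) \<le> A * (1 / (1 - ?q))" by (rule mult_left_mono[OF _ A0])
        then show ?thesis by (simp only: sum_distrib_left)
      qed
      finally show "sum (\<lambda>w. norm (T w)) F \<le> A * (1 / (1 - ?q))" .
    qed
  qed simp
  have hs: "(T has_sum infsum T UNIV) UNIV" using summ by simp
  have "((\<lambda>k. diff k 0 / fact k) has_sum infsum T UNIV) UNIV" proof (rule has_sum_fibers[OF hs, where p = length])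
    show "(T has_sum diff k 0 / fact k) {w. length w = k}" for k by (rule has_sum_finiteI) (auto simp: finite_words T_def diff_def sum_divide_distrib)
  qed
  then have "(\<lambda>k. diff k 0 / fact k) sums infsum T UNIV" by (rule has_sum_imp_sums)
  then have "infsum T UNIV = g (x + h)" using taylor by (rule sums_unique2)
  with hs have hs: "(T has_sum g (x + h)) UNIV" by simp
  show ?thesis proof (rule has_sum_fibers[OF hs, where p = "\<lambda>w i. count_list w i"])
    fix a :: "'n \<Rightarrow> nat"
    have "{w. (\<lambda>i. count_list w i) = a} \<subseteq> {w. length w = sum a UNIV}" by (clarsimp simp: sum_count_list)
    then have fin: "finite {w. (\<lambda>i. count_list w i) = a}" using finite_words finite_subset by blast
    show "(T has_sum (\<Prod>i\<in>UNIV. (h $ i) ^ a i) * (\<Sum>w | (\<lambda>i. count_list w i) = a. pdiffs w g x / fact (length w))) {w. (\<lambda>i. count_list w i) = a}"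
      by (rule has_sum_finiteI[OF fin]) (auto simp: T_def hw_count sum_distrib_left intro!: sum.cong)
  qed
qed

lemma has_sum_vecI:
  fixes f :: "'a \<Rightarrow> real^'m::finite"
  assumes "\<And>j. ((\<lambda>a. f a $ j) has_sum s $ j) A"
  shows "(f has_sum s) A"
  unfolding has_sum_def proof (rule vec_tendstoI)
  show "((\<lambda>F. sum f F $ j) \<longlongrightarrow> s $ j) (finite_subsets_at_top A)" for j using assms[of j] by (simp add: has_sum_def)
qed

lemma real_analytic_onI:
  fixes f :: "real^'n::finite \<Rightarrow> real^'m::finite"
  assumes ex: "\<And>j is i x. has_pdiff i (pdiffs is (\<lambda>x. f x $ j)) x"
    and bd: "\<And>j is x. \<bar>pdiffs is (\<lambda>x. f x $ j) x\<bar> \<le> A * L ^ length is * real (length is) ^ length is" and L: "0 < L"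
  shows "real_analytic_on f UNIV"
  unfolding real_analytic_on_def proof
  fix x0 :: "real^'n"
  \<comment> \<open>As |h|_1 \<le> CARD('n) |h|, the ratio |h|_1 L e stays below 1/2 in this
    ball.\<close>
  define r where "r = 1 / (2 * real CARD('n) * L * exp 1)"
  have r: "0 < r" using L by (simp add: r_def)
  define c where "c a = (\<chi> j. \<Sum>w | (\<lambda>i. count_list w i) = a. pdiffs w (\<lambda>x. f x $ j) x0 / fact (length w))" for a :: "'n \<Rightarrow> nat"
  have "((\<lambda>a. (\<Prod>i\<in>UNIV. (x $ i - x0 $ i) ^ a i) *\<^sub>R c a) has_sum f x) UNIV" if x: "x \<in> ball x0 r" for x proof -
    define h where "h = x - x0"
    have "(\<Sum>i\<in>UNIV. \<bar>h $ i\<bar>) \<le> (\<Sum>i\<in>(UNIV::'n set). norm h)" by (intro sum_mono component_le_norm_cart)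
    also have "\<dots> < real CARD('n) * r" using x by (simp add: h_def dist_norm norm_minus_commute)
    finally have "(\<Sum>i\<in>UNIV. \<bar>h $ i\<bar>) * (L * exp 1) < real CARD('n) * r * (L * exp 1)"
      using L by (intro mult_strict_right_mono) auto
    also have "\<dots> \<le> 1" using L by (simp add: r_def)
    finally have hq: "(\<Sum>i\<in>UNIV. \<bar>h $ i\<bar>) * L * exp 1 < 1" by (simp add: mult.assoc)
    show ?thesis proof (rule has_sum_vecI)
      show "((\<lambda>a. ((\<Prod>i\<in>UNIV. (x $ i - x0 $ i) ^ a i) *\<^sub>R c a) $ j) has_sum f x $ j) UNIV" for j
        using power_series_of_derivative_bounds[OF ex[of _ _ j] bd[of _ j] L hq, of x0] by (simp add: c_def h_def)
    qed
  qed
  then show "\<exists>r>0. \<exists>c. \<forall>x\<in>ball x0 r. ((\<lambda>a. (\<Prod>i\<in>UNIV. (x $ i - x0 $ i) ^ a i) *\<^sub>R c a) has_sum f x) UNIV"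
    using r by blast
qed

section \<open>Restarting the integral equation\<close>

text \<open>The point x is rounded down to a grid of mesh 1/(k + 1), which has countably many
  points, and continuity in x gives the limit. The occasion is the Duhamel integrand, which the
  notion of mild solution controls in r for each fixed x.\<close>

lemma caratheodory_measurable:
  fixes f :: "real \<Rightarrow> real^'n::finite \<Rightarrow> real"
  assumes meas: "\<And>x. (\<lambda>r. f r x) \<in> borel_measurable borel" and cont: "\<And>r. continuous_on UNIV (f r)"
  shows "(\<lambda>(r, x). f r x) \<in> borel_measurable (borel \<Otimes>\<^sub>M borel)"
proof (rule borel_measurable_LIMSEQ_real)
  let ?fl = "\<lambda>k (x::real^'n) i. \<lfloor>real (Suc k) * x $ i\<rfloor>"
  let ?pt = "\<lambda>k c. (\<chi> i. of_int (c i) / real (Suc k)) :: real^'n"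
  show "(\<lambda>p. f (fst p) (?pt k (?fl k (snd p)))) \<in> borel_measurable (borel \<Otimes>\<^sub>M borel)" for k
  proof (rule measurable_compose_countable'[where I = UNIV and f = "\<lambda>c p. f (fst p) (?pt k c)"])
    show "(\<lambda>p. f (fst p) (?pt k c)) \<in> borel_measurable (borel \<Otimes>\<^sub>M borel)" for c
      by (rule measurable_compose[OF measurable_fst meas])
    show "countable (UNIV :: ('n \<Rightarrow> int) set)" by simp
    show "(\<lambda>p::real \<times> (real^'n). ?fl k (snd p)) \<in> borel \<Otimes>\<^sub>M borel \<rightarrow>\<^sub>M count_space UNIV"
    proof (subst measurable_count_space_eq2_countable, intro conjI ballI)
      fix c :: "'n \<Rightarrow> int"
      have "(\<lambda>p::real \<times> (real^'n). ?fl k (snd p)) -` {c} \<inter> space (borel \<Otimes>\<^sub>M borel) = {p \<in> space (borel \<Otimes>\<^sub>M borel). \<forall>i. ?fl k (snd p) i = c i}"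
        by (auto simp: fun_eq_iff)
      also have "\<dots> \<in> sets (borel \<Otimes>\<^sub>M borel)" by measurable
      finally show "(\<lambda>p::real \<times> (real^'n). ?fl k (snd p)) -` {c} \<inter> space (borel \<Otimes>\<^sub>M borel) \<in> sets (borel \<Otimes>\<^sub>M borel)" .
    qed auto
  qed
  fix p :: "real \<times> (real^'n)"
  have "(\<lambda>k. ?pt k (?fl k (snd p))) \<longlonglongrightarrow> snd p" proof (rule vec_tendstoI)
    fix i
    have "(\<lambda>k. of_int \<lfloor>real (Suc k) * snd p $ i\<rfloor> / real (Suc k) - snd p $ i) \<longlonglongrightarrow> 0"
    proof (rule Lim_null_comparison[OF _ LIMSEQ_inverse_real_of_nat], intro always_eventually allI)
      fix k
      have "of_int \<lfloor>real (Suc k) * snd p $ i\<rfloor> / real (Suc k) - snd p $ i = (of_int \<lfloor>real (Suc k) * snd p $ i\<rfloor> - real (Suc k) * snd p $ i) / real (Suc k)"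
        by (simp add: diff_divide_distrib del: of_nat_Suc)
      moreover have "\<bar>of_int \<lfloor>real (Suc k) * snd p $ i\<rfloor> - real (Suc k) * snd p $ i\<bar> \<le> 1" by linarith
      ultimately show "norm (of_int \<lfloor>real (Suc k) * snd p $ i\<rfloor> / real (Suc k) - snd p $ i) \<le> inverse (real (Suc k))"
        by (simp add: divide_inverse abs_mult mult_left_le_one_le del: of_nat_Suc)
    qed
    then show "(\<lambda>k. ?pt k (?fl k (snd p)) $ i) \<longlonglongrightarrow> snd p $ i" by (simp add: LIM_zero_iff)
  qed
  moreover have "isCont (f (fst p)) (snd p)" using cont[of "fst p"] by (simp add: continuous_on_eq_continuous_at)
  ultimately show "(\<lambda>k. f (fst p) (?pt k (?fl k (snd p)))) \<longlonglongrightarrow> (case p of (r, x) \<Rightarrow> f r x)"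
    unfolding case_prod_beta by (rule isCont_tendsto_compose[rotated])
qed

section \<open>Continuity and Fubini for convolutions with the kernels\<close>

context subordinator
begin

lemma km_finite: "0 < s \<Longrightarrow> km s (x::real^'n::finite) < \<infinity>"
  using le_less_trans[OF km_sup[of s x] ennreal_less_top] by simp

text \<open>Dominated convergence: once the points are within s powr (1/\<gamma>) of x,
  \<open>km s (x - y)\<close> dominates all the translated kernels.\<close>

lemma kr_conv_continuous:
  fixes f :: "real^'n::finite \<Rightarrow> real"
  assumes s: "0 < s" and [measurable]: "f \<in> borel_measurable borel"
    and fin: "\<And>x. (\<integral>\<^sup>+y. km s (x - y) * ennreal \<bar>f y\<bar> \<partial>lborel) < \<infinity>"
  shows "continuous_on UNIV (\<lambda>x. \<integral>y. kr m j l s (x - y) * f y \<partial>lborel)"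
  unfolding continuous_on_eq_continuous_at[OF open_UNIV] continuous_at_sequentially o_def proof (intro ballI allI impI)
  fix x :: "real^'n" and X assume X: "X \<longlonglongrightarrow> x"
  have "\<forall>\<^sub>F n in sequentially. norm (X n - x) < s powr (1 / \<gamma>)"
    using order_tendstoD(2)[OF tendsto_norm_zero[OF LIM_zero[OF X]], of "s powr (1 / \<gamma>)"] s by simp
  then obtain N where N: "\<forall>n\<ge>N. norm (X n - x) < s powr (1 / \<gamma>)" unfolding eventually_sequentially by blast
  have "(\<lambda>n. \<integral>y. kr m j l s (X (n + N) - y) * f y \<partial>lborel) \<longlonglongrightarrow> (LBINT y. kr m j l s (x - y) * f y)"
  proof (rule integral_dominated_convergence[where w = "\<lambda>y. enn2real (km s (x - y) * ennreal \<bar>f y\<bar>)"])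
    show "integrable lborel (\<lambda>y. enn2real (km s (x - y) * ennreal \<bar>f y\<bar>))" by (rule integrable_enn2real[OF _ fin]) measurable
    show "AE y in lborel. (\<lambda>n. kr m j l s (X (n + N) - y) * f y) \<longlonglongrightarrow> kr m j l s (x - y) * f y" proof (rule AE_I2)
      fix y
      have "(\<lambda>n. X (n + N) - y) \<longlonglongrightarrow> x - y" by (intro tendsto_diff LIMSEQ_ignore_initial_segment[OF X] tendsto_const)
      from isCont_tendsto_compose[OF kr_isCont[OF s] this] show "(\<lambda>n. kr m j l s (X (n + N) - y) * f y) \<longlonglongrightarrow> kr m j l s (x - y) * f y"
        by (rule tendsto_mult[OF _ tendsto_const])
    qed
    show "AE y in lborel. norm (kr m j l s (X (n + N) - y) * f y) \<le> enn2real (km s (x - y) * ennreal \<bar>f y\<bar>)" for n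
    proof (rule AE_I2, rule norm_le_enn2real)
      fix y
      have "norm (X (n + N) - x) \<le> s powr (1 / \<gamma>)" using N by (simp add: less_imp_le)
      from kr_shift_le_km[OF s this, of m j l "x - y"] have "ennreal \<bar>kr m j l s (X (n + N) - y)\<bar> \<le> km s (x - y)" by simp
      then show "ennreal (norm (kr m j l s (X (n + N) - y) * f y)) \<le> km s (x - y) * ennreal \<bar>f y\<bar>"
        by (simp add: abs_mult ennreal_mult mult_right_mono)
      show "km s (x - y) * ennreal \<bar>f y\<bar> < \<infinity>" using km_finite[OF s, of "x - y"] by (simp add: ennreal_mult_less_top)
    qed
  qed measurable
  then show "(\<lambda>n. \<integral>y. kr m j l s (X n - y) * f y \<partial>lborel) \<longlonglongrightarrow> (LBINT y. kr m j l s (x - y) * f y)"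
    by (rule LIMSEQ_offset)
qed

lemma conv_Gr_kr_reflect:
  assumes "0 < a" "0 < b"
  shows "(LBINT z. Gr a (x - z) * kr m j l b (z - y)) = kr m j l (a + b) (x - (y::real^'n::finite))"
proof -
  have "(LBINT z. Gr a (x - z) * kr m j l b (z - y)) = (LBINT z. Gr a z * kr m j l b ((x - y) - z))"
    by (subst integral_reflect[of "\<lambda>z. Gr a z * kr m j l b ((x - y) - z)" x, symmetric]) (auto simp: algebra_simps)
  then show ?thesis using conv_kr[OF assms] by simp
qed

lemma Gr_kr_Fubini:
  fixes f :: "real^'n::finite \<Rightarrow> real"
  assumes a: "0 < a" and b: "0 < b" and [measurable]: "f \<in> borel_measurable borel"
    and fin: "(\<integral>\<^sup>+z. gm a (x - z) * (\<integral>\<^sup>+y. km b (z - y) * ennreal \<bar>f y\<bar> \<partial>lborel) \<partial>lborel) < \<infinity>"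
  shows "integrable lborel (\<lambda>z. Gr a (x - z) * (LBINT y. kr m j l b (z - y) * f y))"
    and "(LBINT z. Gr a (x - z) * (LBINT y. kr m j l b (z - y) * f y)) = (LBINT y. kr m j l (a + b) (x - y) * f y)"
proof -
  let ?F = "\<lambda>(z, y). Gr a (x - z) * (kr m j l b (z - y) * f y)"
  have int: "integrable (lborel \<Otimes>\<^sub>M lborel) ?F" proof (rule integrableI_bounded)
    have "(\<integral>\<^sup>+p. ennreal (norm (?F p)) \<partial>(lborel \<Otimes>\<^sub>M lborel)) = (\<integral>\<^sup>+z. \<integral>\<^sup>+y. ennreal (norm (?F (z, y))) \<partial>lborel \<partial>lborel)"
      by (rule lborel.nn_integral_fst[symmetric]) measurable
    also have "\<dots> \<le> (\<integral>\<^sup>+z. \<integral>\<^sup>+y. gm a (x - z) * (km b (z - y) * ennreal \<bar>f y\<bar>) \<partial>lborel \<partial>lborel)"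
    proof (intro nn_integral_mono)
      fix z y :: "real^'n"
      have "ennreal (norm (?F (z, y))) = ennreal (Gr a (x - z)) * (ennreal \<bar>kr m j l b (z - y)\<bar> * ennreal \<bar>f y\<bar>)"
        using Gr_pos[OF a, of "x - z"] by (simp add: abs_mult ennreal_mult)
      also have "\<dots> \<le> gm a (x - z) * (km b (z - y) * ennreal \<bar>f y\<bar>)" by (intro mult_mono Gr_le_gm a kr_le_km b) auto
      finally show "ennreal (norm (?F (z, y))) \<le> gm a (x - z) * (km b (z - y) * ennreal \<bar>f y\<bar>)" .
    qed
    also have "\<dots> < \<infinity>" using fin by (subst nn_integral_cmult) auto
    finally show "(\<integral>\<^sup>+p. ennreal (norm (?F p)) \<partial>(lborel \<Otimes>\<^sub>M lborel)) < \<infinity>" .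
  qed measurable
  show "integrable lborel (\<lambda>z. Gr a (x - z) * (LBINT y. kr m j l b (z - y) * f y))" using lborel_pair.integrable_fst[OF int] by simp
  have "(LBINT z. Gr a (x - z) * (LBINT y. kr m j l b (z - y) * f y)) = (LBINT z. (LBINT y. ?F (z, y)))" by simp
  also have "\<dots> = (LBINT y. (LBINT z. ?F (z, y)))" by (rule lborel_pair.Fubini_integral[symmetric]) (use int in simp)
  also have "\<dots> = (LBINT y. (LBINT z. Gr a (x - z) * kr m j l b (z - y)) * f y)" by (simp add: mult.assoc[symmetric])
  finally show "(LBINT z. Gr a (x - z) * (LBINT y. kr m j l b (z - y) * f y)) = (LBINT y. kr m j l (a + b) (x - y) * f y)"
    by (simp add: conv_Gr_kr_reflect[OF a b])
qed

text \<open>Meant for \<open>u0\<close>, for which only the integrability in the definition of a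
  mild solution is available. As the kernels are positive, the double integral of absolute values
  equals that of \<open>Gr (a + b)\<close> against |f|.\<close>

lemma Gr_Gr_Fubini:
  fixes f :: "real^'n::finite \<Rightarrow> real"
  assumes a: "0 < a" and b: "0 < b" and [measurable]: "f \<in> borel_measurable borel"
    and fin: "integrable lborel (\<lambda>y. Gr (a + b) (x - y) * f y)"
  shows "integrable lborel (\<lambda>z. Gr a (x - z) * (LBINT y. Gr b (z - y) * f y))"
    and "(LBINT z. Gr a (x - z) * (LBINT y. Gr b (z - y) * f y)) = (LBINT y. Gr (a + b) (x - y) * f y)"
proof -
  let ?F = "\<lambda>(z, y). Gr a (x - z) * (Gr b (z - y) * f y)"
  have c: "(LBINT z. Gr a (x - z) * Gr b (z - y)) = Gr (a + b) (x - y)" for y proof -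
    have "(LBINT z. Gr a (x - z) * Gr b (z - y)) = (LBINT z. Gr a z * Gr b ((x - y) - z))"
      by (subst integral_reflect[of "\<lambda>z. Gr a z * Gr b ((x - y) - z)" x, symmetric]) (auto simp: algebra_simps)
    then show ?thesis using conv_Gr[OF a b] by simp
  qed
  have ab: "0 < a + b" using a b by simp
  \<comment> \<open>A non-integrable function has integral 0, whereas this integral is a value of
    \<open>Gr (a + b)\<close> and hence positive.\<close>
  have "integrable lborel (\<lambda>z. Gr a (x - z) * Gr b (z - y))" for y
    using c[of y] Gr_pos[OF ab, of "x - y"] not_integrable_integral_eq[of lborel "\<lambda>z. Gr a (x - z) * Gr b (z - y)"] by force
  then have nc: "(\<integral>\<^sup>+z. ennreal (Gr a (x - z) * Gr b (z - y)) \<partial>lborel) = ennreal (Gr (a + b) (x - y))" for y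
    using Gr_pos[OF a, where 'n='n] Gr_pos[OF b, where 'n='n] by (subst nn_integral_eq_integral) (auto simp: c intro!: AE_I2 mult_nonneg_nonneg less_imp_le)
  have int: "integrable (lborel \<Otimes>\<^sub>M lborel) ?F" proof (rule integrableI_bounded)
    have "(\<integral>\<^sup>+p. ennreal (norm (?F p)) \<partial>(lborel \<Otimes>\<^sub>M lborel)) = (\<integral>\<^sup>+y. \<integral>\<^sup>+z. ennreal (norm (?F (z, y))) \<partial>lborel \<partial>lborel)"
      by (rule lborel_pair.nn_integral_snd[symmetric]) measurable
    also have "\<dots> = (\<integral>\<^sup>+y. ennreal (Gr (a + b) (x - y)) * ennreal \<bar>f y\<bar> \<partial>lborel)"
    proof (rule nn_integral_cong)
      fix y
      have "(\<integral>\<^sup>+z. ennreal (norm (?F (z, y))) \<partial>lborel) = (\<integral>\<^sup>+z. ennreal (Gr a (x - z) * Gr b (z - y)) * ennreal \<bar>f y\<bar> \<partial>lborel)"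
        using Gr_pos[OF a, where 'n='n] Gr_pos[OF b, where 'n='n] by (intro nn_integral_cong) (simp add: abs_mult ennreal_mult less_imp_le mult.assoc abs_of_pos)
      then show "(\<integral>\<^sup>+z. ennreal (norm (?F (z, y))) \<partial>lborel) = ennreal (Gr (a + b) (x - y)) * ennreal \<bar>f y\<bar>"
        by (simp add: nn_integral_multc nc)
    qed
    also have "\<dots> = (\<integral>\<^sup>+y. ennreal (norm (Gr (a + b) (x - y) * f y)) \<partial>lborel)"
      using Gr_pos[OF ab, where 'n='n] by (intro nn_integral_cong) (simp add: abs_mult ennreal_mult less_imp_le abs_of_pos)
    also have "\<dots> < \<infinity>" using fin unfolding integrable_iff_bounded by simp
    finally show "(\<integral>\<^sup>+p. ennreal (norm (?F p)) \<partial>(lborel \<Otimes>\<^sub>M lborel)) < \<infinity>" .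
  qed measurable
  show "integrable lborel (\<lambda>z. Gr a (x - z) * (LBINT y. Gr b (z - y) * f y))" using lborel_pair.integrable_fst[OF int] by simp
  have "(LBINT z. Gr a (x - z) * (LBINT y. Gr b (z - y) * f y)) = (LBINT z. (LBINT y. ?F (z, y)))" by simp
  also have "\<dots> = (LBINT y. (LBINT z. ?F (z, y)))" by (rule lborel_pair.Fubini_integral[symmetric]) (use int in simp)
  also have "\<dots> = (LBINT y. (LBINT z. Gr a (x - z) * Gr b (z - y)) * f y)" by (simp add: mult.assoc[symmetric])
  finally show "(LBINT z. Gr a (x - z) * (LBINT y. Gr b (z - y) * f y)) = (LBINT y. Gr (a + b) (x - y) * f y)" by (simp add: c)
qed

definition NL :: "'n \<Rightarrow> real \<Rightarrow> (real^'n::finite \<Rightarrow> real^'n) \<Rightarrow> real^'n \<Rightarrow> real" where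
  "NL j s v x = (\<Sum>l\<in>UNIV. \<Sum>m\<in>UNIV. \<integral>y. kr m j l s (x - y) * (v y $ m * v y $ l) \<partial>lborel)"

lemma nl_integrand_eq: "0 < s \<Longrightarrow> nl_integrand \<gamma> s v x j l m = (\<lambda>y. kr m j l s (x - y) * (v y $ m * v y $ l))"
  by (rule ext) (simp add: nl_integrand_def pdiff_Kker mult.assoc)

lemma nonlin_eq: "0 < s \<Longrightarrow> nonlin \<gamma> s v x $ j = NL j s v x"
  by (simp add: nonlin_def NL_def nl_integrand_eq)

end

text \<open>\<open>kap\<close> is the exponent lost in passing from L^q to L^\<infinity>,
  \<open>alp\<close> the exponent of the weight in the hypothesis on u, and \<open>DD\<close> the
  number of pairs (l, m) in the nonlinearity.\<close>

locale mild = subordinator +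
  fixes q M KK DD kap alp :: real and T :: ereal and u0 :: "real^'n::finite \<Rightarrow> real^'n" and u :: "real \<Rightarrow> real^'n \<Rightarrow> real^'n"
  assumes KK_def: "KK = CK TYPE('n)" and kap_def: "kap = real CARD('n) / (q * \<gamma>)" and alp_def: "alp = 1 - 1 / \<gamma> - kap"
    and DD_def: "DD = (real CARD('n))\<^sup>2" and q: "real CARD('n) / (\<gamma> - 1) < q" and M: "0 < M" and sol: "mild_solution \<gamma> T u0 u"
    and umeas: "\<And>t. 0 < t \<Longrightarrow> ereal t < T \<Longrightarrow> u t \<in> borel_measurable borel"
    and ubound: "\<And>t. 0 < t \<Longrightarrow> ereal t < T \<Longrightarrow> (\<integral>\<^sup>+x. epow q (ennreal (norm (u t x))) \<partial>lborel)
        \<le> ennreal ((M * t powr (- (1 - 1 / \<gamma> - real CARD('n) / (q * \<gamma>)))) powr q)"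
begin

lemma KK_pos: "0 < KK" using CK_pos[where 'n='n] by (simp add: KK_def)

text \<open>The essential inequalities are 1/2 \<le> 1/\<gamma> < 1 and 0 < kap < 1 - 1/\<gamma>
  \<le> 1/2; they make all the time singularities below integrable.\<close>

lemma exponents:
  "1 < q" "0 < kap" "kap < 1 - 1 / \<gamma>" "1 - 1 / \<gamma> \<le> 1 / 2" "0 < alp" "alp < 1 / 2" "1 / \<gamma> + kap < 1" "0 < 1 / \<gamma>" "1 / \<gamma> < 1"
  "real CARD('n) / \<gamma> / q = kap" "1 \<le> real CARD('n)" proof -
  show d: "1 \<le> real CARD('n)" by (simp add: Suc_leI)
  have g: "0 < \<gamma> - 1" "\<gamma> - 1 \<le> 1" using g1 g2 by auto
  have dq: "real CARD('n) < q * (\<gamma> - 1)" using q g by (simp add: pos_divide_less_eq)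
  show q1: "1 < q" proof (rule ccontr)
    assume "\<not> 1 < q"
    then have "q * (\<gamma> - 1) \<le> 1 * 1 \<or> q < 0" using g mult_mono[of q 1 "\<gamma> - 1" 1] by linarith
    then show False using dq d g mult_neg_pos[of q "\<gamma> - 1"] by auto
  qed
  show "0 < kap" using d q1 g1 by (simp add: kap_def)
  have gam: "0 < \<gamma>" using g1 by simp
  have "kap * (q * \<gamma>) = real CARD('n)" using q1 gam by (simp add: kap_def)
  then have "kap * (q * \<gamma>) < (1 - 1 / \<gamma>) * (q * \<gamma>)" using dq gam mult_strict_left_mono[OF dq gam] by (simp add: field_simps)
  then show k: "kap < 1 - 1 / \<gamma>" using q1 gam by (simp add: mult_less_cancel_right)
  show h: "1 - 1 / \<gamma> \<le> 1 / 2" using gam g2 by (simp add: field_simps)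
  show "0 < alp" using k by (simp add: alp_def)
  show "alp < 1 / 2" using h \<open>0 < kap\<close> by (simp add: alp_def)
  show "1 / \<gamma> + kap < 1" using k by simp
  show "0 < 1 / \<gamma>" using gam by simp
  show "1 / \<gamma> < 1" using g1 by simp
  show "real CARD('n) / \<gamma> / q = kap" by (simp add: kap_def mult.commute)
qed

text \<open>Since \<gamma> \<le> 2, the number d/(\<gamma> - 1) is at least d.\<close>

lemma q_dim: "2 \<le> q \<or> CARD('n) = 1"
proof (cases "CARD('n) = 1")
  case False
  then have "2 \<le> real CARD('n)" using exponents(11) by (simp add: Suc_leI numeral_2_eq_2 not_less_eq_eq le_neq_implies_less)
  also have "\<dots> \<le> real CARD('n) / (\<gamma> - 1)" using g1 g2 by (simp add: le_divide_eq mult_left_le)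
  finally show ?thesis using q by simp
qed simp

lemma ub: "0 < t \<Longrightarrow> ereal t < T \<Longrightarrow> (\<integral>\<^sup>+x. epow q (ennreal (norm (u t x))) \<partial>lborel) \<le> ennreal ((M * t powr (- alp)) powr q)"
  using ubound[of t] by (simp add: alp_def kap_def)

lemma kernel_bounds:
  assumes "0 < s"
  shows "(\<integral>\<^sup>+x. gm s (x::real^'n) \<partial>lborel) \<le> ennreal KK"
    and "gm s (x::real^'n) \<le> ennreal (KK * s powr (- real CARD('n) / \<gamma>))"
    and "(\<integral>\<^sup>+x. km s (x::real^'n) \<partial>lborel) \<le> ennreal (KK * s powr (- 1 / \<gamma>))"
    and "km s (x::real^'n) \<le> ennreal (KK * s powr (- 1 / \<gamma> - real CARD('n) / \<gamma>))"
  unfolding KK_def by (fact gm_L1[OF assms] gm_sup[OF assms] km_L1[OF assms] km_sup[OF assms])+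

text \<open>The interpolated dual norm of \<open>gm\<close> carries the power (d/\<gamma>)(1/q) =
  kap of 1/s.\<close>

lemma gm_sup_conv:
  fixes f :: "real^'n \<Rightarrow> ennreal"
  assumes s: "0 < s" and [measurable]: "f \<in> borel_measurable borel" and F: "(\<integral>\<^sup>+x. epow q (f x) \<partial>lborel) \<le> ennreal (F powr q)" "0 \<le> F"
  shows "(\<integral>\<^sup>+y. gm s (x - y) * f y \<partial>lborel) \<le> ennreal (KK * s powr (- kap) * F)"
proof -
  have "(\<integral>\<^sup>+y. gm s (x - y) * f y \<partial>lborel) \<le> ennreal (KK powr (1 - 1 / q) * (KK * s powr (- real CARD('n) / \<gamma>)) powr (1 / q) * F)"
    using s KK_pos exponents(1) by (intro conv_sup[OF _ _ kernel_bounds(1)[OF s] KK_pos _ F] kernel_bounds(2)) auto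
  also have "KK powr (1 - 1 / q) * (KK * s powr (- real CARD('n) / \<gamma>)) powr (1 / q) = KK * s powr (- kap)" proof -
    have "KK powr (1 - 1 / q) * KK powr (1 / q) = KK" using KK_pos by (simp flip: powr_add)
    moreover have "(s powr (- real CARD('n) / \<gamma>)) powr (1 / q) = s powr (- kap)" by (simp add: powr_powr exponents(10)[symmetric])
    ultimately show ?thesis using KK_pos by (simp add: powr_mult mult.assoc[symmetric])
  qed
  finally show ?thesis .
qed

lemma gm_Lq_conv:
  assumes s: "0 < s" and [measurable]: "f \<in> borel_measurable borel" and F: "(\<integral>\<^sup>+x. epow q (f x) \<partial>lborel) \<le> ennreal (F powr q)" "0 \<le> F"
  shows "(\<integral>\<^sup>+x. epow q (\<integral>\<^sup>+y. gm s (x - (y::real^'n)) * f y \<partial>lborel) \<partial>lborel) \<le> ennreal ((KK * F) powr q)"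
  using exponents(1) by (intro conv_Lq[OF _ _ kernel_bounds(1)[OF s] KK_pos _ F]) auto

lemma km_Lq_conv:
  assumes s: "0 < s" and [measurable]: "f \<in> borel_measurable borel" and F: "(\<integral>\<^sup>+x. epow q (f x) \<partial>lborel) \<le> ennreal (F powr q)" "0 \<le> F"
  shows "(\<integral>\<^sup>+x. epow q (\<integral>\<^sup>+y. km s (x - (y::real^'n)) * f y \<partial>lborel) \<partial>lborel) \<le> ennreal ((KK * s powr (- (1 / \<gamma>)) * F) powr q)"
  using conv_Lq[OF _ assms(2) kernel_bounds(3)[OF s] _ _ F] exponents(1) KK_pos s by simp

text \<open>The derivative in the kernel costs s powr (-1/\<gamma>), and returning from a product of
  two L^q functions to L^q costs s powr (-kap).\<close>

lemma km_trilinear: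
  fixes v w :: "real^'n \<Rightarrow> ennreal"
  assumes s: "0 < s" and q2: "2 \<le> q" and [measurable]: "v \<in> borel_measurable borel" "w \<in> borel_measurable borel"
    and B: "(\<integral>\<^sup>+x. epow q (v x) \<partial>lborel) \<le> ennreal (B powr q)" "0 \<le> B"
    and E: "(\<integral>\<^sup>+x. epow q (w x) \<partial>lborel) \<le> ennreal (E powr q)" "0 \<le> E"
  shows "(\<integral>\<^sup>+x. epow q (\<integral>\<^sup>+y. km s (x - y) * (v y * w y) \<partial>lborel) \<partial>lborel) \<le> ennreal ((KK * s powr (- (1 / \<gamma> + kap)) * B * E) powr q)"
    and "(\<integral>\<^sup>+y. km s (x - y) * (v y * w y) \<partial>lborel) < \<infinity>"
proof -
  let ?W = "KK * s powr (- 1 / \<gamma>)" and ?K = "KK * s powr (- 1 / \<gamma> - real CARD('n) / \<gamma>)"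
  have pos: "0 < ?W" "0 < ?K" using s KK_pos by auto
  note b = conv_trilinear_bounds[OF _ assms(3,4) kernel_bounds(3)[OF s] pos(1) kernel_bounds(4)[OF s] pos(2) q2 B E]
  show "(\<integral>\<^sup>+y. km s (x - y) * (v y * w y) \<partial>lborel) < \<infinity>" using le_less_trans[OF b(2) ennreal_less_top] by simp
  have "?W powr (1 - 1 / q) * ?K powr (1 / q) = KK * s powr (- (1 / \<gamma> + kap))" proof -
    have "KK powr (1 - 1 / q) * KK powr (1 / q) = KK" using KK_pos by (simp flip: powr_add)
    moreover have "(s powr (- 1 / \<gamma>)) powr (1 - 1 / q) * (s powr (- 1 / \<gamma> - real CARD('n) / \<gamma>)) powr (1 / q) = s powr (- (1 / \<gamma> + kap))"
      unfolding powr_powr powr_add[symmetric] exponents(10)[symmetric] by (rule arg_cong) (simp add: algebra_simps diff_divide_distrib)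
    moreover have "(a * b) powr p * (a * c) powr r = (a powr p * a powr r) * (b powr p * c powr r)" if "0 \<le> a" "0 \<le> b" "0 \<le> c" for a b c p r :: real
      using that by (simp add: powr_mult)
    ultimately show ?thesis using KK_pos s by simp
  qed
  then show "(\<integral>\<^sup>+x. epow q (\<integral>\<^sup>+y. km s (x - y) * (v y * w y) \<partial>lborel) \<partial>lborel) \<le> ennreal ((KK * s powr (- (1 / \<gamma> + kap)) * B * E) powr q)"
    using b(1) by simp
qed

end

section \<open>Bounds for the nonlinearity, and the equation restarted at a positive time\<close>

context subordinator
begin

lemma norm_double_sum_le:
  fixes f :: "'n::finite \<Rightarrow> 'n \<Rightarrow> complex"
  assumes "\<And>l m. ennreal (norm (f l m)) \<le> I"
  shows "ennreal (norm (\<Sum>l\<in>UNIV. \<Sum>m\<in>UNIV. f l m)) \<le> ennreal ((real CARD('n))\<^sup>2) * I"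
proof -
  have "ennreal (norm (\<Sum>l\<in>UNIV. \<Sum>m\<in>UNIV. f l m)) \<le> ennreal (\<Sum>l\<in>UNIV. \<Sum>m\<in>UNIV. norm (f l m))"
    by (intro ennreal_leI order_trans[OF norm_sum sum_mono[OF norm_sum]])
  also have "\<dots> = (\<Sum>l\<in>UNIV. \<Sum>m\<in>UNIV. ennreal (norm (f l m)))" by (simp add: sum_nonneg flip: sum_ennreal)
  also have "\<dots> \<le> (\<Sum>l\<in>(UNIV::'n set). \<Sum>m\<in>(UNIV::'n set). I)" by (intro sum_mono assms)
  also have "\<dots> = ennreal ((real CARD('n))\<^sup>2) * I" by (simp add: power2_eq_square ennreal_mult mult.assoc ennreal_of_nat_eq_real_of_nat)
  finally show ?thesis .
qed

lemma NL_bound: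
  fixes v :: "real^'n::finite \<Rightarrow> real^'n"
  assumes s: "0 < s" and [measurable]: "v \<in> borel_measurable borel"
  shows "ennreal \<bar>NL j s v x\<bar> \<le> ennreal ((real CARD('n))\<^sup>2) * (\<integral>\<^sup>+y. km s (x - y) * (ennreal (norm (v y)) * ennreal (norm (v y))) \<partial>lborel)"
proof -
  let ?I = "\<integral>\<^sup>+y. km s (x - y) * (ennreal (norm (v y)) * ennreal (norm (v y))) \<partial>lborel"
  have I: "ennreal \<bar>\<integral>y. kr m j l s (x - y) * (v y $ m * v y $ l) \<partial>lborel\<bar> \<le> ?I" for l m proof -
    have "ennreal \<bar>\<integral>y. kr m j l s (x - y) * (v y $ m * v y $ l) \<partial>lborel\<bar> \<le> (\<integral>\<^sup>+y. ennreal (norm (kr m j l s (x - y) * (v y $ m * v y $ l))) \<partial>lborel)"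
      using norm_integral_le_nn_integral[of lborel "\<lambda>y. kr m j l s (x - y) * (v y $ m * v y $ l)"] by simp
    also have "\<dots> \<le> ?I" proof (rule nn_integral_mono)
      fix y
      have "ennreal (norm (kr m j l s (x - y) * (v y $ m * v y $ l))) = ennreal \<bar>kr m j l s (x - y)\<bar> * (ennreal \<bar>v y $ m\<bar> * ennreal \<bar>v y $ l\<bar>)"
        by (simp add: abs_mult ennreal_mult)
      also have "\<dots> \<le> km s (x - y) * (ennreal (norm (v y)) * ennreal (norm (v y)))"
        by (intro mult_mono kr_le_km s ennreal_leI component_le_norm_cart) auto
      finally show "ennreal (norm (kr m j l s (x - y) * (v y $ m * v y $ l))) \<le> km s (x - y) * (ennreal (norm (v y)) * ennreal (norm (v y)))" .
    qed
    finally show ?thesis .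
  qed
  then show ?thesis unfolding NL_def
    using norm_double_sum_le[of "\<lambda>l m. of_real (LBINT y. kr m j l s (x - y) * (v y $ m * v y $ l))" ?I] by (simp flip: of_real_sum)
qed

lemma NL_1d: "CARD('n::finite) = 1 \<Longrightarrow> 0 < s \<Longrightarrow> NL j s v (x::real^'n) = 0"
  by (simp add: NL_def kr_zero_1d)

end

context mild
begin

lemma DD_pos: "0 < DD" by (simp add: DD_def)

definition "un r y = ennreal (norm (u r y))"

lemma un_measurable: "0 < r \<Longrightarrow> ereal r < T \<Longrightarrow> un r \<in> borel_measurable borel"
  using umeas[of r] unfolding un_def by measurable

lemma un_Lq: "0 < r \<Longrightarrow> ereal r < T \<Longrightarrow> (\<integral>\<^sup>+x. epow q (un r x) \<partial>lborel) \<le> ennreal ((M * r powr (- alp)) powr q)"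
  using ub[of r] by (simp add: un_def)

lemma mild_component:
  assumes s: "0 < s" "ereal s < T"
  shows "integrable lborel (\<lambda>y. Gr s (x - y) * u0 y $ j)"
    and "integrable lborel (\<lambda>r. indicator {0<..<s} r * NL j (s - r) (u r) x)"
    and "u s x $ j = (LBINT y. Gr s (x - y) * u0 y $ j) - (LBINT r. indicator {0<..<s} r * NL j (s - r) (u r) x)"
proof -
  have m: "integrable lborel (\<lambda>y. Gr s (x - y) *\<^sub>R u0 y)" "set_integrable lborel {0<..<s} (\<lambda>r. nonlin \<gamma> (s - r) (u r) x)"
    "u s x = (LBINT y. Gr s (x - y) *\<^sub>R u0 y) - (LINT r:{0<..<s}|lborel. nonlin \<gamma> (s - r) (u r) x)"
    using sol[unfolded mild_solution_def, rule_format, OF conjI[OF s], of x] by (simp_all add: Gker_eq s)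
  note bl = bounded_linear_vec_nth[of j]
  have e: "(indicator {0<..<s} r *\<^sub>R nonlin \<gamma> (s - r) (u r) x) $ j = indicator {0<..<s} r * NL j (s - r) (u r) x" for r
    by (auto simp: indicator_def nonlin_eq)
  show 1: "integrable lborel (\<lambda>y. Gr s (x - y) * u0 y $ j)" using integrable_bounded_linear[OF bl m(1)] by simp
  show 2: "integrable lborel (\<lambda>r. indicator {0<..<s} r * NL j (s - r) (u r) x)"
    using integrable_bounded_linear[OF bl m(2)[unfolded set_integrable_def]] by (simp only: e)
  have "(LBINT y. Gr s (x - y) *\<^sub>R u0 y) $ j = (LBINT y. Gr s (x - y) * u0 y $ j)" using integral_bounded_linear[OF bl m(1)] by simp
  moreover have "(LINT r:{0<..<s}|lborel. nonlin \<gamma> (s - r) (u r) x) $ j = (LBINT r. indicator {0<..<s} r * NL j (s - r) (u r) x)"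
    unfolding set_lebesgue_integral_def integral_bounded_linear[OF bl m(2)[unfolded set_integrable_def], symmetric] by (simp only: e)
  ultimately show "u s x $ j = (LBINT y. Gr s (x - y) * u0 y $ j) - (LBINT r. indicator {0<..<s} r * NL j (s - r) (u r) x)"
    unfolding m(3) by simp
qed

text \<open>The product with \<open>Gr s\<close> is measurable by integrability and can be divided
  by the positive kernel.\<close>

lemma u0_measurable:
  assumes "0 < s" "ereal s < T"
  shows "(\<lambda>y. u0 y $ j) \<in> borel_measurable borel"
proof -
  have m: "(\<lambda>y. Gr s (0 - y) * u0 y $ j) \<in> borel_measurable borel"
    using borel_measurable_integrable[OF mild_component(1)[OF assms, of 0 j]] by simp
  have e: "(\<lambda>y. u0 y $ j) = (\<lambda>y. (Gr s (0 - y) * u0 y $ j) / Gr s (0 - y))" proof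
    fix y show "u0 y $ j = Gr s (0 - y) * u0 y $ j / Gr s (0 - y)" using Gr_pos[OF assms(1), of "0 - y"] by simp
  qed
  show ?thesis by (subst e, rule borel_measurable_divide[OF m]) measurable
qed

text \<open>Applying \<open>Gr \<tau>\<close> to the Duhamel term at time t0 ages every kernel by
  \<tau>. For absolute integrability, smoothing leaves a multiple of (t0 - r) powr (-(1/\<gamma> +
  kap)) r powr (-2 alp), and both exponents are above -1.\<close>

lemma swap_time:
  assumes t0: "0 < t0" and \<tau>: "0 < \<tau>" and T: "ereal t0 < T" and q2: "2 \<le> q"
  shows "integrable lborel (\<lambda>z. Gr \<tau> (x - z) * (LBINT r. indicator {0<..<t0} r * NL j (t0 - r) (u r) z))"
    and "(LBINT z. Gr \<tau> (x - z) * (LBINT r. indicator {0<..<t0} r * NL j (t0 - r) (u r) z))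
       = (LBINT r. indicator {0<..<t0} r * NL j (t0 + \<tau> - r) (u r) x)"
proof -
  have rT: "ereal r < T" if "r < t0" for r using that T by (meson ereal_less_eq(3) less_imp_le order_le_less_trans)
  let ?f = "\<lambda>r z. indicator {0<..<t0} r * NL j (t0 - r) (u r) z"
  let ?N = "\<lambda>r z. \<integral>\<^sup>+y. km (t0 - r) (z - y) * (un r y * un r y) \<partial>lborel"
  have N: "(\<integral>\<^sup>+z. epow q (?N r z) \<partial>lborel) \<le> ennreal ((KK * (t0 - r) powr (- (1 / \<gamma> + kap)) * (M * r powr (- alp)) * (M * r powr (- alp))) powr q)"
    "\<And>z. ?N r z < \<infinity>" if r: "0 < r" "r < t0" for r proof -
    note un_measurable[OF r(1) rT[OF r(2)], measurable]
    have s: "0 < t0 - r" using r by simp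
    have nn: "0 \<le> M * r powr (- alp)" using M by simp
    note k = km_trilinear[OF s q2 _ _ un_Lq[OF r(1) rT[OF r(2)]] nn un_Lq[OF r(1) rT[OF r(2)]] nn]
    show "(\<integral>\<^sup>+z. epow q (?N r z) \<partial>lborel) \<le> ennreal ((KK * (t0 - r) powr (- (1 / \<gamma> + kap)) * (M * r powr (- alp)) * (M * r powr (- alp))) powr q)"
      by (rule k(1)) measurable
    show "?N r z < \<infinity>" for z by (rule k(2)) measurable
  qed
  have [measurable]: "(\<lambda>(r, z). ?f r z) \<in> borel_measurable (borel \<Otimes>\<^sub>M borel)" proof (rule caratheodory_measurable)
    show "(\<lambda>r. ?f r z) \<in> borel_measurable borel" for z using borel_measurable_integrable[OF mild_component(2)[OF t0 T, of j z]] by simp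
    show "continuous_on UNIV (?f r)" for r proof (cases "r \<in> {0<..<t0}")
      case True
      then have r: "0 < r" "r < t0" by auto
      have [measurable]: "u r \<in> borel_measurable borel" using umeas rT r by blast
      have "continuous_on UNIV (\<lambda>z. NL j (t0 - r) (u r) z)" unfolding NL_def proof (intro continuous_on_sum kr_conv_continuous)
        fix l m and z :: "real^'n"
        show "0 < t0 - r" using r by simp
        have "(\<integral>\<^sup>+y. km (t0 - r) (z - y) * ennreal \<bar>u r y $ m * u r y $ l\<bar> \<partial>lborel) \<le> ?N r z"
          by (intro nn_integral_mono mult_left_mono) (auto simp: un_def abs_mult ennreal_mult intro!: mult_mono ennreal_leI component_le_norm_cart)
        then show "(\<integral>\<^sup>+y. km (t0 - r) (z - y) * ennreal \<bar>u r y $ m * u r y $ l\<bar> \<partial>lborel) < \<infinity>"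
          using N(2)[OF r, of z] by (rule order_le_less_trans)
      qed measurable
      then show ?thesis using True by simp
    qed simp
  qed
  have gN: "(\<integral>\<^sup>+z. gm \<tau> (x - z) * ?N r z \<partial>lborel) \<le> ennreal (KK * \<tau> powr (- kap) * KK * M * M * ((t0 - r) powr (- (1 / \<gamma> + kap)) * r powr (- (2 * alp))))" if r: "0 < r" "r < t0" for r
  proof -
    note un_measurable[OF r(1) rT[OF r(2)], measurable]
    have "(\<integral>\<^sup>+z. gm \<tau> (x - z) * ?N r z \<partial>lborel) \<le> ennreal (KK * \<tau> powr (- kap) * (KK * (t0 - r) powr (- (1 / \<gamma> + kap)) * (M * r powr (- alp)) * (M * r powr (- alp))))"
      by (rule gm_sup_conv[OF \<tau> _ N(1)[OF r]]) (use M KK_pos in auto)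
    also have "KK * \<tau> powr (- kap) * (KK * (t0 - r) powr (- (1 / \<gamma> + kap)) * (M * r powr (- alp)) * (M * r powr (- alp)))
      = KK * \<tau> powr (- kap) * KK * M * M * ((t0 - r) powr (- (1 / \<gamma> + kap)) * (r powr (- alp) * r powr (- alp)))" by (simp add: mult_ac)
    also have "r powr (- alp) * r powr (- alp) = r powr (- (2 * alp))" by (simp flip: powr_add)
    finally show ?thesis .
  qed
  have fN: "ennreal \<bar>?f r z\<bar> \<le> ennreal DD * ?N r z * indicator {0<..<t0} r" for r z proof (cases "r \<in> {0<..<t0}")
    case True
    then show ?thesis using NL_bound[of "t0 - r" "u r" j z] umeas[of r] rT[of r] by (simp add: un_def DD_def)
  qed simp
  have int: "integrable (lborel \<Otimes>\<^sub>M lborel) (\<lambda>(r, z). Gr \<tau> (x - z) * ?f r z)" proof (rule integrableI_bounded)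
    have "(\<integral>\<^sup>+p. ennreal (norm (case p of (r, z) \<Rightarrow> Gr \<tau> (x - z) * ?f r z)) \<partial>(lborel \<Otimes>\<^sub>M lborel))
      = (\<integral>\<^sup>+r. \<integral>\<^sup>+z. ennreal (norm (Gr \<tau> (x - z) * ?f r z)) \<partial>lborel \<partial>lborel)"
      by (subst lborel.nn_integral_fst[symmetric]) auto
    also have "\<dots> \<le> (\<integral>\<^sup>+r. ennreal (DD * (KK * \<tau> powr (- kap) * KK * M * M)) * (ennreal ((t0 - r) powr (- (1 / \<gamma> + kap)) * r powr (- (2 * alp))) * indicator {0<..<t0} r) \<partial>lborel)"
    proof (rule nn_integral_mono)
      fix r
      show "(\<integral>\<^sup>+z. ennreal (norm (Gr \<tau> (x - z) * ?f r z)) \<partial>lborel) \<le> ennreal (DD * (KK * \<tau> powr (- kap) * KK * M * M)) * (ennreal ((t0 - r) powr (- (1 / \<gamma> + kap)) * r powr (- (2 * alp))) * indicator {0<..<t0} r)"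
      proof (cases "r \<in> {0<..<t0}")
        case True
        then have r: "0 < r" "r < t0" by auto
        note un_measurable[OF r(1) rT[OF r(2)], measurable]
        have "(\<integral>\<^sup>+z. ennreal (norm (Gr \<tau> (x - z) * ?f r z)) \<partial>lborel) \<le> (\<integral>\<^sup>+z. ennreal DD * (gm \<tau> (x - z) * ?N r z) \<partial>lborel)"
        proof (rule nn_integral_mono)
          fix z
          have "ennreal (norm (Gr \<tau> (x - z) * ?f r z)) = ennreal (Gr \<tau> (x - z)) * ennreal \<bar>?f r z\<bar>"
            using Gr_pos[OF \<tau>, of "x - z"] by (simp add: abs_mult ennreal_mult)
          also have "\<dots> \<le> gm \<tau> (x - z) * (ennreal DD * ?N r z)"
            using Gr_le_gm[OF \<tau>, of "x - z"] fN[of r z] True by (intro mult_mono) auto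
          finally show "ennreal (norm (Gr \<tau> (x - z) * ?f r z)) \<le> ennreal DD * (gm \<tau> (x - z) * ?N r z)" by (simp add: mult_ac)
        qed
        also have "\<dots> = ennreal DD * (\<integral>\<^sup>+z. gm \<tau> (x - z) * ?N r z \<partial>lborel)" by (rule nn_integral_cmult) measurable
        also have "\<dots> \<le> ennreal DD * ennreal (KK * \<tau> powr (- kap) * KK * M * M * ((t0 - r) powr (- (1 / \<gamma> + kap)) * r powr (- (2 * alp))))"
          by (intro mult_left_mono gN r) auto
        finally show ?thesis using True KK_pos M DD_pos by (simp add: ennreal_mult mult_ac)
      qed simp
    qed
    also have "\<dots> = ennreal (DD * (KK * \<tau> powr (- kap) * KK * M * M)) * (\<integral>\<^sup>+r. ennreal ((t0 - r) powr (- (1 / \<gamma> + kap)) * r powr (- (2 * alp))) * indicator {0<..<t0} r \<partial>lborel)"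
      by (rule nn_integral_cmult) measurable
    also have "\<dots> < \<infinity>"
      using le_less_trans[OF time_integral[of "1 / \<gamma> + kap" "2 * alp" t0] ennreal_less_top] exponents t0 by (simp add: ennreal_mult_less_top)
    finally show "(\<integral>\<^sup>+p. ennreal (norm (case p of (r, z) \<Rightarrow> Gr \<tau> (x - z) * ?f r z)) \<partial>(lborel \<Otimes>\<^sub>M lborel)) < \<infinity>" .
  qed measurable
  show "integrable lborel (\<lambda>z. Gr \<tau> (x - z) * (LBINT r. ?f r z))" using lborel_pair.integrable_snd[OF int] by simp
  have "(LBINT z. Gr \<tau> (x - z) * (LBINT r. ?f r z)) = (LBINT z. (LBINT r. Gr \<tau> (x - z) * ?f r z))" by simp
  also have "\<dots> = (LBINT r. (LBINT z. Gr \<tau> (x - z) * ?f r z))" by (rule lborel_pair.Fubini_integral[OF int])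
  also have "\<dots> = (LBINT r. indicator {0<..<t0} r * NL j (t0 + \<tau> - r) (u r) x)" proof (rule Bochner_Integration.integral_cong[OF refl])
    fix r
    show "(LBINT z. Gr \<tau> (x - z) * ?f r z) = indicator {0<..<t0} r * NL j (t0 + \<tau> - r) (u r) x" proof (cases "r \<in> {0<..<t0}")
      case True
      then have r: "0 < r" "r < t0" by auto
      note un_measurable[OF r(1) rT[OF r(2)], measurable]
      have [measurable]: "u r \<in> borel_measurable borel" using umeas rT r by blast
      have s: "0 < t0 - r" using r by simp
      have fin: "(\<integral>\<^sup>+z. gm \<tau> (x - z) * (\<integral>\<^sup>+y. km (t0 - r) (z - y) * ennreal \<bar>u r y $ m * u r y $ l\<bar> \<partial>lborel) \<partial>lborel) < \<infinity>" for l m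
      proof -
        have "(\<integral>\<^sup>+z. gm \<tau> (x - z) * (\<integral>\<^sup>+y. km (t0 - r) (z - y) * ennreal \<bar>u r y $ m * u r y $ l\<bar> \<partial>lborel) \<partial>lborel) \<le> (\<integral>\<^sup>+z. gm \<tau> (x - z) * ?N r z \<partial>lborel)"
          by (intro nn_integral_mono mult_left_mono) (auto simp: un_def abs_mult ennreal_mult intro!: mult_mono ennreal_leI component_le_norm_cart)
        also have "\<dots> < \<infinity>" using le_less_trans[OF gN[OF r] ennreal_less_top] by simp
        finally show ?thesis .
      qed
      note F = Gr_kr_Fubini[OF \<tau> s _ fin]
      have i: "integrable lborel (\<lambda>z. Gr \<tau> (x - z) * (LBINT y. kr m j l (t0 - r) (z - y) * (u r y $ m * u r y $ l)))" for l m
        by (rule F(1)) measurable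
      have "(LBINT z. Gr \<tau> (x - z) * ?f r z) = (LBINT z. (\<Sum>l\<in>UNIV. \<Sum>m\<in>UNIV. Gr \<tau> (x - z) * (LBINT y. kr m j l (t0 - r) (z - y) * (u r y $ m * u r y $ l))))"
        using True by (simp add: NL_def sum_distrib_left)
      also have "\<dots> = (\<Sum>l\<in>UNIV. \<Sum>m\<in>UNIV. \<integral>z. Gr \<tau> (x - z) * (LBINT y. kr m j l (t0 - r) (z - y) * (u r y $ m * u r y $ l)) \<partial>lborel)"
        using i by (simp add: Bochner_Integration.integral_sum)
      also have "\<dots> = (\<Sum>l\<in>UNIV. \<Sum>m\<in>UNIV. \<integral>y. kr m j l (\<tau> + (t0 - r)) (x - y) * (u r y $ m * u r y $ l) \<partial>lborel)"
        by (intro sum.cong refl F(2)) measurable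
      finally show ?thesis using True by (simp add: NL_def algebra_simps)
    qed simp
  qed
  finally show "(LBINT z. Gr \<tau> (x - z) * (LBINT r. ?f r z)) = (LBINT r. indicator {0<..<t0} r * NL j (t0 + \<tau> - r) (u r) x)" .
qed

text \<open>The free evolution from t0 contains that of \<open>u0\<close> and the Duhamel part
  before t0; the rest of the time integral is translated by t0. For q < 2 the dimension is 1 and the
  nonlinear terms are zero.\<close>

lemma restart:
  assumes t0: "0 < t0" and \<tau>: "0 < \<tau>" and T: "ereal (t0 + \<tau>) < T"
  shows "integrable lborel (\<lambda>z. Gr \<tau> (x - z) * u t0 z $ j)"
    and "integrable lborel (\<lambda>r. indicator {0<..<\<tau>} r * NL j (\<tau> - r) (u (t0 + r)) x)"
    and "u (t0 + \<tau>) x $ j = (LBINT z. Gr \<tau> (x - z) * u t0 z $ j) - (LBINT r. indicator {0<..<\<tau>} r * NL j (\<tau> - r) (u (t0 + r)) x)"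
proof -
  have T0: "ereal t0 < T" using T \<tau> by (meson ereal_less_eq(3) le_add_same_cancel1 less_imp_le order_le_less_trans)
  have tt: "0 < t0 + \<tau>" using t0 \<tau> by simp
  let ?t = "t0 + \<tau>" and ?g = "\<lambda>z. \<integral>y. Gr t0 (z - y) * u0 y $ j \<partial>lborel"
  let ?h = "\<lambda>z. \<integral>r. indicator {0<..<t0} r * NL j (t0 - r) (u r) z \<partial>lborel"
  have "\<tau> + t0 = ?t" by simp
  note G = Gr_Gr_Fubini[OF \<tau> t0 u0_measurable[OF t0 T0], unfolded this, OF mild_component(1)[OF tt T]]
  have H: "integrable lborel (\<lambda>z. Gr \<tau> (x - z) * ?h z)
     \<and> (LBINT z. Gr \<tau> (x - z) * ?h z) = (LBINT r. indicator {0<..<t0} r * NL j (?t - r) (u r) x)"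
  proof (cases "2 \<le> q")
    case True
    then show ?thesis using swap_time[OF t0 \<tau> T0] by simp
  next
    case False
    then have d: "CARD('n) = 1" using q_dim by simp
    have z1: "indicator {0<..<t0} r * NL j (t0 - r) (u r) z = 0" for r z using NL_1d[OF d, of "t0 - r"] by (cases "r \<in> {0<..<t0}") auto
    have z2: "indicator {0<..<t0} r * NL j (?t - r) (u r) z = 0" for r z using NL_1d[OF d, of "?t - r"] \<tau> by (cases "r \<in> {0<..<t0}") auto
    show ?thesis by (simp only: z1 z2 mult_zero_right Bochner_Integration.integral_zero Bochner_Integration.integrable_zero simp_thms)
  qed
  have u0z: "u t0 z $ j = ?g z - ?h z" for z by (rule mild_component(3)[OF t0 T0])
  have e: "Gr \<tau> (x - z) * u t0 z $ j = Gr \<tau> (x - z) * ?g z - Gr \<tau> (x - z) * ?h z" for z by (simp add: u0z right_diff_distrib)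
  show "integrable lborel (\<lambda>z. Gr \<tau> (x - z) * u t0 z $ j)"
    unfolding e using G(1) H by auto
  have uz: "(LBINT z. Gr \<tau> (x - z) * u t0 z $ j) = (LBINT y. Gr ?t (x - y) * u0 y $ j) - (LBINT r. indicator {0<..<t0} r * NL j (?t - r) (u r) x)"
    unfolding e using G H by (subst Bochner_Integration.integral_diff) auto
  let ?N = "\<lambda>r. NL j (?t - r) (u r) x"
  note I = mild_component(2)[OF tt T, of j x]
  have i1: "integrable lborel (\<lambda>r. indicator {0<..<t0} r * ?N r)" proof -
    have e1: "indicator {0<..<t0} r *\<^sub>R (indicator {0<..<?t} r * ?N r) = indicator {0<..<t0} r * ?N r" for r
      using \<tau> by (auto simp: indicator_def)
    show ?thesis using integrable_mult_indicator[OF _ I, of "{0<..<t0}"] unfolding e1 by simp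
  qed
  have i2: "integrable lborel (\<lambda>r. indicator {t0<..<?t} r * ?N r)" proof -
    have e1: "indicator {t0<..<?t} r *\<^sub>R (indicator {0<..<?t} r * ?N r) = indicator {t0<..<?t} r * ?N r" for r
      using t0 by (auto simp: indicator_def)
    show ?thesis using integrable_mult_indicator[OF _ I, of "{t0<..<?t}"] unfolding e1 by simp
  qed
  have sh: "indicator {t0<..<?t} (t0 + 1 * r) * ?N (t0 + 1 * r) = indicator {0<..<\<tau>} r * NL j (\<tau> - r) (u (t0 + r)) x" for r
    by (auto simp: indicator_def algebra_simps)
  show "integrable lborel (\<lambda>r. indicator {0<..<\<tau>} r * NL j (\<tau> - r) (u (t0 + r)) x)"
    using lborel_integrable_real_affine[OF i2, of 1 t0] unfolding sh by simp
  have s2: "(LBINT r. indicator {t0<..<?t} r * ?N r) = (LBINT r. indicator {0<..<\<tau>} r * NL j (\<tau> - r) (u (t0 + r)) x)"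
    using lborel_integral_real_affine[of 1 "\<lambda>r. indicator {t0<..<?t} r * ?N r" t0] unfolding sh by simp
  have "(LBINT r. indicator {0<..<?t} r * ?N r) = (LBINT r. indicator {0<..<t0} r * ?N r + indicator {t0<..<?t} r * ?N r)"
  proof (rule integral_cong_AE)
    show "AE r in lborel. indicator {0<..<?t} r * ?N r = indicator {0<..<t0} r * ?N r + indicator {t0<..<?t} r * ?N r"
      using AE_lborel_singleton[of t0] by eventually_elim (use t0 \<tau> in \<open>auto simp: indicator_def\<close>)
  qed (use I i1 i2 in auto)
  also have "\<dots> = (LBINT r. indicator {0<..<t0} r * ?N r) + (LBINT r. indicator {0<..<\<tau>} r * NL j (\<tau> - r) (u (t0 + r)) x)"
    using i1 i2 s2 by simp
  finally show "u ?t x $ j = (LBINT z. Gr \<tau> (x - z) * u t0 z $ j) - (LBINT r. indicator {0<..<\<tau>} r * NL j (\<tau> - r) (u (t0 + r)) x)"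
    unfolding mild_component(3)[OF tt T] uz by simp
qed

end

section \<open>Picard iteration in complexified space\<close>

lemma epow_epow: "0 < q \<Longrightarrow> epow q (epow (1 / q) x) = x"
  by (cases x) (auto simp: powr_powr)

text \<open>A monotone map with monotone inverse commutes with suprema; this carries L^q bounds to
  increasing limits.\<close>

lemma epow_SUP_le:
  assumes "0 < q"
  shows "epow q (SUP n. f n) \<le> (SUP n. epow q (f n))"
proof -
  let ?c = "SUP n. epow q (f n)"
  have "f n \<le> epow (1 / q) ?c" for n proof -
    have "f n = epow (1 / q) (epow q (f n))" using epow_epow[of "1 / q" "f n"] assms by simp
    also have "\<dots> \<le> epow (1 / q) ?c" using assms by (intro epow_mono SUP_upper) auto
    finally show ?thesis .
  qed
  then have "epow q (SUP n. f n) \<le> epow q (epow (1 / q) ?c)" using assms by (intro epow_mono SUP_least) auto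
  then show ?thesis using epow_epow[OF assms] by simp
qed

text \<open>A crude triangle inequality, whose constant 4 reappears in \<open>QQ\<close>.\<close>

lemma Lq_add:
  assumes q: "1 \<le> q" and [measurable]: "f \<in> borel_measurable M" "g \<in> borel_measurable M"
    and f: "(\<integral>\<^sup>+x. epow q (f x) \<partial>M) \<le> ennreal (a powr q)" and g: "(\<integral>\<^sup>+x. epow q (g x) \<partial>M) \<le> ennreal (a powr q)" and a: "0 \<le> a"
  shows "(\<integral>\<^sup>+x. epow q (f x + g x) \<partial>M) \<le> ennreal ((4 * a) powr q)"
proof -
  have "(\<integral>\<^sup>+x. epow q (f x + g x) \<partial>M) \<le> (\<integral>\<^sup>+x. ennreal (2 powr q) * (epow q (f x) + epow q (g x)) \<partial>M)"
    using q by (intro nn_integral_mono epow_add) simp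
  also have "\<dots> = ennreal (2 powr q) * ((\<integral>\<^sup>+x. epow q (f x) \<partial>M) + (\<integral>\<^sup>+x. epow q (g x) \<partial>M))"
    by (simp add: nn_integral_cmult nn_integral_add)
  also have "\<dots> \<le> ennreal (2 powr q) * (ennreal (a powr q) + ennreal (a powr q))" by (intro mult_left_mono add_mono f g) simp
  also have "\<dots> = ennreal (2 powr q * (2 * a powr q))" by (simp add: ennreal_mult flip: ennreal_plus)
  also have "\<dots> \<le> ennreal ((4 * a) powr q)" proof (rule ennreal_leI)
    have "(2::real) = 2 powr 1" by simp
    also have "\<dots> \<le> 2 powr q" using q by (intro powr_mono) auto
    finally have "2 powr q * (2 * a powr q) \<le> 2 powr q * (2 powr q * a powr q)" by (intro mult_left_mono mult_right_mono) auto
    also have "\<dots> = (4 * a) powr q" using a powr_mult[of 2 2 q] by (simp add: powr_mult)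
    finally show "2 powr q * (2 * a powr q) \<le> (4 * a) powr q" .
  qed
  finally show ?thesis .
qed

text \<open>Telescoping: beyond index n the increments add up to at most 2 C/2^n. The explicit rate
  later yields convergence uniform in \<zeta>.\<close>

lemma geometric_limit:
  fixes a :: "nat \<Rightarrow> complex"
  assumes "\<And>n. norm (a (Suc n) - a n) \<le> C / 2 ^ n"
  shows "a \<longlonglongrightarrow> lim a" and "norm (a n - lim a) \<le> 2 * C / 2 ^ n"
proof -
  have b: "norm (a (n + k) - a n) \<le> 2 * C / 2 ^ n - 2 * C / 2 ^ (n + k)" for n k proof (induction k)
    case (Suc k)
    have "norm (a (n + Suc k) - a n) \<le> norm (a (Suc (n + k)) - a (n + k)) + norm (a (n + k) - a n)"
      using norm_triangle_ineq[of "a (Suc (n + k)) - a (n + k)" "a (n + k) - a n"] by simp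
    also have "\<dots> \<le> C / 2 ^ (n + k) + (2 * C / 2 ^ n - 2 * C / 2 ^ (n + k))" using assms Suc.IH by (intro add_mono) auto
    finally show ?case by (simp add: field_simps)
  qed simp
  have "0 \<le> C" using order_trans[OF norm_ge_zero assms[of 0]] by simp
  then have b': "norm (a (n + k) - a n) \<le> 2 * C / 2 ^ n" for n k proof -
    have "0 \<le> 2 * C / 2 ^ (n + k)" using \<open>0 \<le> C\<close> by simp
    then show ?thesis using b[of n k] by linarith
  qed
  have "Cauchy a" proof (rule metric_CauchyI)
    fix e :: real assume e: "0 < e"
    have "(\<lambda>n. 2 * C / 2 ^ n) \<longlonglongrightarrow> 0" by (rule LIMSEQ_divide_realpow_zero) simp
    then obtain m where m: "2 * C / 2 ^ m < e / 2" using eventually_happens[OF order_tendstoD(2)[of "\<lambda>n. 2 * C / 2 ^ n" 0 sequentially "e / 2"]] e by auto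
    have "dist (a n) (a m) < e / 2" if "m \<le> n" for n using b'[of m "n - m"] m that by (simp add: dist_norm)
    then have "\<forall>n\<ge>m. \<forall>k\<ge>m. dist (a n) (a k) < e" by (intro allI impI, rule_tac y = "a m" in dist_triangle_half_l) auto
    then show "\<exists>M. \<forall>m\<ge>M. \<forall>n\<ge>M. dist (a m) (a n) < e" by blast
  qed
  then show l: "a \<longlonglongrightarrow> lim a" by (simp add: Cauchy_convergent_iff convergent_LIMSEQ_iff)
  show "norm (a n - lim a) \<le> 2 * C / 2 ^ n" proof (rule Lim_bounded)
    show "(\<lambda>k. norm (a n - a k)) \<longlonglongrightarrow> norm (a n - lim a)" by (rule tendsto_norm[OF tendsto_diff[OF tendsto_const l]])
    show "\<forall>k\<ge>n. norm (a n - a k) \<le> 2 * C / 2 ^ n" proof (intro allI impI)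
      fix k assume "n \<le> k"
      then show "norm (a n - a k) \<le> 2 * C / 2 ^ n" using b'[of n "k - n"] by (simp add: norm_minus_commute)
    qed
  qed
qed

text \<open>For non-Borel f neither side is integrable and both integrals are 0; the functions
  \<open>w\<close> in \<open>NLc_translate\<close> are arbitrary.\<close>

lemma integral_translate:
  fixes f :: "real^'n::finite \<Rightarrow> 'b::{banach, second_countable_topology}"
  shows "(LBINT y. f (y + a)) = (LBINT y. f y)"
proof -
  have "(LBINT y. f y) = (\<integral>y. f y \<partial>distr lborel borel ((+) a))" by (simp add: lborel_distr_plus)
  also have "\<dots> = (LBINT y. f (a + y))" proof (cases "f \<in> borel_measurable borel")
    case True
    then show ?thesis by (subst integral_distr) auto
  next
    case False
    have "f \<in> borel_measurable borel" if "(\<lambda>y. f (a + y)) \<in> borel_measurable borel" proof -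
      have "(\<lambda>y. y - a) \<in> borel \<rightarrow>\<^sub>M borel" by measurable
      from measurable_compose[OF this that] show ?thesis by simp
    qed
    moreover have "(\<lambda>y. f (a + y)) \<in> borel_measurable borel" if "integrable lborel (\<lambda>y. f (a + y))"
      using borel_measurable_integrable[OF that] by simp
    moreover have "f \<in> borel_measurable borel" if "integrable (distr lborel borel ((+) a)) f" using borel_measurable_integrable[OF that] by simp
    ultimately have "\<not> integrable lborel (\<lambda>y. f (a + y))" "\<not> integrable (distr lborel borel ((+) a)) f" using False by blast+
    then show ?thesis by (simp add: not_integrable_integral_eq)
  qed
  finally show ?thesis by (simp add: add.commute)
qed

section \<open>Kernels with a complex shift linear in their age\<close>

context subordinator
begin

definition gcs :: "real \<Rightarrow> ('n \<Rightarrow> complex) \<Rightarrow> real^'n::finite \<Rightarrow> complex" where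
  "gcs t \<zeta> x = gc t (\<lambda>k. cvec x k + of_real t * \<zeta> k)"

definition kcs :: "'n \<Rightarrow> 'n \<Rightarrow> 'n \<Rightarrow> real \<Rightarrow> ('n \<Rightarrow> complex) \<Rightarrow> real^'n::finite \<Rightarrow> complex" where
  "kcs m j l t \<zeta> x = kc m j l t (\<lambda>k. cvec x k + of_real t * \<zeta> k)"

text \<open>The components are multiplied without conjugation, which keeps the expression
  holomorphic in w.\<close>

definition NLc :: "('n \<Rightarrow> complex) \<Rightarrow> 'n \<Rightarrow> real \<Rightarrow> (real^'n::finite \<Rightarrow> 'n \<Rightarrow> complex) \<Rightarrow> real^'n \<Rightarrow> complex" where
  "NLc \<zeta> j s w x = (\<Sum>l\<in>UNIV. \<Sum>m\<in>UNIV. \<integral>y. kcs m j l s \<zeta> (x - y) * (w y m * w y l) \<partial>lborel)"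

text \<open>S is the largest age that occurs. As 1/\<gamma> - 1 < 0, the bound at S implies t
  |\<zeta> k| < t powr (1/\<gamma>) for every age t \<le> S, so all kernels of the iteration stay
  within their range.\<close>

definition adm :: "real \<Rightarrow> ('n \<Rightarrow> complex) \<Rightarrow> bool" where
  "adm S \<zeta> \<longleftrightarrow> (\<forall>k. norm (\<zeta> k) < S powr (1 / \<gamma> - 1))"

lemma gcs_measurable[measurable (raw)]:
  assumes [measurable]: "t \<in> borel_measurable M" "f \<in> borel_measurable M"
  shows "(\<lambda>w. gcs (t w) \<zeta> (f w :: real^'n::finite)) \<in> borel_measurable M"
  unfolding gcs_def by measurable

lemma kcs_measurable[measurable (raw)]:
  assumes [measurable]: "t \<in> borel_measurable M" "f \<in> borel_measurable M"
  shows "(\<lambda>w. kcs m j l (t w) \<zeta> (f w :: real^'n::finite)) \<in> borel_measurable M"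
  unfolding kcs_def by measurable

lemma scaled_lt:
  assumes "0 < t" "t \<le> S" "norm (z::complex) < S powr (1 / \<gamma> - 1)"
  shows "norm (of_real t * z) < t powr (1 / \<gamma>)"
proof -
  have "S powr (1 / \<gamma> - 1) \<le> t powr (1 / \<gamma> - 1)" using assms g1 by (intro powr_mono2') auto
  then have "t * norm z < t * t powr (1 / \<gamma> - 1)" using assms by (intro mult_strict_left_mono) auto
  also have "\<dots> = t powr (1 / \<gamma>)" using assms(1) powr_add[of t 1 "1 / \<gamma> - 1"] by simp
  finally show ?thesis using assms(1) by (simp add: norm_mult)
qed

lemma gcs_bound: "adm S \<zeta> \<Longrightarrow> 0 < t \<Longrightarrow> t \<le> S \<Longrightarrow> ennreal (norm (gcs t \<zeta> (x::real^'n::finite))) \<le> gm t x"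
  unfolding gcs_def by (rule gc_bound) (simp_all add: adm_def less_imp_le[OF scaled_lt])

lemma kcs_bound: "adm S \<zeta> \<Longrightarrow> 0 < t \<Longrightarrow> t \<le> S \<Longrightarrow> ennreal (norm (kcs m j l t \<zeta> (x::real^'n::finite))) \<le> km t x"
  unfolding kcs_def by (rule kc_bound) (simp_all add: adm_def less_imp_le[OF scaled_lt])

lemma scaled_upd: "(\<lambda>k. c k + of_real t * (\<zeta>(i := z)) k) = (\<lambda>k. c k + ((\<lambda>k. of_real t * \<zeta> k)(i := of_real t * z)) k)"
  by auto

lemma scaled_holomorphic:
  fixes f :: "('n \<Rightarrow> complex) \<Rightarrow> complex" and c :: "'n \<Rightarrow> complex"
  assumes "adm S \<zeta>" "0 < t" "t \<le> S"
    and f: "\<And>h. (\<And>k. norm (h k) < t powr (1 / \<gamma>)) \<Longrightarrow> (\<lambda>z. f (\<lambda>k. c k + (h(i := z)) k)) holomorphic_on ball 0 (t powr (1 / \<gamma>))"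
  shows "(\<lambda>z. f (\<lambda>k. c k + of_real t * (\<zeta>(i := z)) k)) holomorphic_on ball 0 (S powr (1 / \<gamma> - 1))"
proof -
  let ?g = "\<lambda>z. f (\<lambda>k. c k + ((\<lambda>k. of_real t * \<zeta> k)(i := z)) k)"
  have "?g holomorphic_on ball 0 (t powr (1 / \<gamma>))" by (rule f) (use assms in \<open>auto simp: adm_def intro!: scaled_lt\<close>)
  moreover have "(\<lambda>z::complex. of_real t * z) ` ball 0 (S powr (1 / \<gamma> - 1)) \<subseteq> ball 0 (t powr (1 / \<gamma>))"
    using scaled_lt[OF assms(2,3)] by auto
  ultimately have "(?g \<circ> (\<lambda>z. of_real t * z)) holomorphic_on ball 0 (S powr (1 / \<gamma> - 1))"
    by (intro holomorphic_on_compose_gen[where g = ?g] holomorphic_intros)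
  then show ?thesis unfolding scaled_upd o_def .
qed

lemma kernels_holomorphic:
  assumes "adm S \<zeta>" "0 < t" "t \<le> S"
  shows gcs_holomorphic: "(\<lambda>z. gcs t (\<zeta>(i := z)) (x::real^'n::finite)) holomorphic_on ball 0 (S powr (1 / \<gamma> - 1))"
    and kcs_holomorphic: "(\<lambda>z. kcs m j l t (\<zeta>(i := z)) x) holomorphic_on ball 0 (S powr (1 / \<gamma> - 1))"
  unfolding gcs_def kcs_def by (intro scaled_holomorphic[OF assms] gc_holomorphic[OF assms(2)] kc_holomorphic[OF assms(2)]; assumption)+

lemma adm_upd: "adm S \<zeta> \<Longrightarrow> z \<in> ball 0 (S powr (1 / \<gamma> - 1)) \<Longrightarrow> adm S (\<zeta>(i := z))"
  by (auto simp: adm_def)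

lemma adm_0: "0 < S \<Longrightarrow> adm S (\<lambda>_. 0)" by (simp add: adm_def)

lemma NLc_term_bound:
  assumes "adm S \<zeta>" "0 < s" "s \<le> S" and w: "\<And>y m. ennreal (norm (w y m)) \<le> p y"
  shows "ennreal (norm (kcs m j l s \<zeta> (x - y) * (w y m * w y l))) \<le> km s (x - (y::real^'n::finite)) * (p y * p y)"
  unfolding norm_mult ennreal_mult[OF norm_ge_zero mult_nonneg_nonneg[OF norm_ge_zero norm_ge_zero]] ennreal_mult[OF norm_ge_zero norm_ge_zero]
  by (intro mult_mono kcs_bound[OF assms(1-3)] w) auto

lemma NLc_bound:
  fixes x :: "real^'n::finite"
  assumes "adm S \<zeta>" "0 < s" "s \<le> S" and w: "\<And>y m. ennreal (norm (w y m)) \<le> p y"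
  shows "ennreal (norm (NLc \<zeta> j s w x)) \<le> ennreal ((real CARD('n))\<^sup>2) * (\<integral>\<^sup>+y. km s (x - y) * (p y * p y) \<partial>lborel)"
  unfolding NLc_def by (intro norm_double_sum_le order_trans[OF norm_integral_le_nn_integral] nn_integral_mono NLc_term_bound[OF assms])

text \<open>The factorisation behind it is a b - a' b' = (a - a') b + a' (b - b').\<close>

lemma NLc_diff:
  fixes x :: "real^'n::finite"
  assumes S: "adm S \<zeta>" "0 < s" "s \<le> S" and w: "\<And>y m. ennreal (norm (w y m)) \<le> p y" and w': "\<And>y m. ennreal (norm (w' y m)) \<le> p' y"
    and d: "\<And>y m. ennreal (norm (w y m - w' y m)) \<le> d y"
    and [measurable]: "\<And>m. (\<lambda>y. w y m) \<in> borel_measurable borel" "\<And>m. (\<lambda>y. w' y m) \<in> borel_measurable borel"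
    and fin: "(\<integral>\<^sup>+y. km s (x - y) * (p y * p y) \<partial>lborel) < \<infinity>" "(\<integral>\<^sup>+y. km s (x - y) * (p' y * p' y) \<partial>lborel) < \<infinity>"
  shows "ennreal (norm (NLc \<zeta> j s w x - NLc \<zeta> j s w' x)) \<le> ennreal ((real CARD('n))\<^sup>2) * (\<integral>\<^sup>+y. km s (x - y) * (d y * (p y + p' y)) \<partial>lborel)"
proof -
  have i: "integrable lborel (\<lambda>y. kcs m j l s \<zeta> (x - y) * (w y m * w y l))" for m l
    by (rule integrable_of_nn_bound[OF _ NLc_term_bound[where w = w, OF S w] fin(1)]) measurable
  have i': "integrable lborel (\<lambda>y. kcs m j l s \<zeta> (x - y) * (w' y m * w' y l))" for m l
    by (rule integrable_of_nn_bound[OF _ NLc_term_bound[where w = w', OF S w'] fin(2)]) measurable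
  have "NLc \<zeta> j s w x - NLc \<zeta> j s w' x = (\<Sum>l\<in>UNIV. \<Sum>m\<in>UNIV. \<integral>y. kcs m j l s \<zeta> (x - y) * (w y m * w y l) - kcs m j l s \<zeta> (x - y) * (w' y m * w' y l) \<partial>lborel)"
    unfolding NLc_def by (simp add: i i' sum_subtractf)
  moreover have "ennreal (norm (LBINT y. kcs m j l s \<zeta> (x - y) * (w y m * w y l) - kcs m j l s \<zeta> (x - y) * (w' y m * w' y l))) \<le> (\<integral>\<^sup>+y. km s (x - y) * (d y * (p y + p' y)) \<partial>lborel)" for l m
  proof (intro order_trans[OF norm_integral_le_nn_integral] nn_integral_mono)
    fix y
    have "kcs m j l s \<zeta> (x - y) * (w y m * w y l) - kcs m j l s \<zeta> (x - y) * (w' y m * w' y l)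
        = kcs m j l s \<zeta> (x - y) * ((w y m - w' y m) * w y l + w' y m * (w y l - w' y l))" by (simp add: algebra_simps)
    then have "norm (kcs m j l s \<zeta> (x - y) * (w y m * w y l) - kcs m j l s \<zeta> (x - y) * (w' y m * w' y l))
        \<le> norm (kcs m j l s \<zeta> (x - y)) * (norm (w y m - w' y m) * norm (w y l) + norm (w' y m) * norm (w y l - w' y l))"
      by (simp add: norm_mult mult_left_mono norm_triangle_mono)
    then have "ennreal (norm (kcs m j l s \<zeta> (x - y) * (w y m * w y l) - kcs m j l s \<zeta> (x - y) * (w' y m * w' y l)))
        \<le> ennreal (norm (kcs m j l s \<zeta> (x - y))) * (ennreal (norm (w y m - w' y m)) * ennreal (norm (w y l)) + ennreal (norm (w' y m)) * ennreal (norm (w y l - w' y l)))"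
      by (simp add: ennreal_mult[symmetric] ennreal_plus[symmetric] ennreal_leI del: ennreal_plus)
    also have "\<dots> \<le> km s (x - y) * (d y * p y + p' y * d y)" by (intro mult_mono add_mono kcs_bound[OF S] w w' d) auto
    finally show "ennreal (norm (kcs m j l s \<zeta> (x - y) * (w y m * w y l) - kcs m j l s \<zeta> (x - y) * (w' y m * w' y l))) \<le> km s (x - y) * (d y * (p y + p' y))"
      by (simp add: algebra_simps)
  qed
  ultimately show ?thesis by (simp only: norm_double_sum_le)
qed

lemma NLc_real:
  fixes x :: "real^'n::finite"
  shows "NLc (\<lambda>_. 0) j s (\<lambda>y m. of_real (v y $ m)) x = of_real (NL j s v x)"
proof -
  have e: "kcs m j l s (\<lambda>_. 0) (x - y) * (of_real (v y $ m) * of_real (v y $ l)) = of_real (kr m j l s (x - y) * (v y $ m * v y $ l))" for m l y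
    by (simp add: kcs_def kc_real)
  show ?thesis unfolding NLc_def NL_def e of_real_sum integral_complex_of_real by (rule refl)
qed

text \<open>For real \<zeta> the shift is a translation: a kernel of age s contributes s h and a
  function at time c contributes c h. In the Duhamel integral s = \<tau> - r and c = r, so the total
  \<tau> h does not depend on r.\<close>

lemma NLc_translate:
  fixes x h :: "real^'n::finite"
  shows "NLc (cvec h) j s (\<lambda>y. w (y + c *\<^sub>R h)) x = NLc (\<lambda>_. 0) j s w (x + (s + c) *\<^sub>R h)"
proof -
  have "(LBINT y. kcs m j l s (cvec h) (x - y) * (w (y + c *\<^sub>R h) m * w (y + c *\<^sub>R h) l))
      = (LBINT y. kcs m j l s (\<lambda>_. 0) (x + (s + c) *\<^sub>R h - y) * (w y m * w y l))" for m l
  proof -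
    have e: "kcs m j l s (cvec h) (x - y) = kcs m j l s (\<lambda>_. 0) (x + (s + c) *\<^sub>R h - (y + c *\<^sub>R h))" for y
      unfolding kcs_def cvec_def by (rule arg_cong[where f = "kc m j l s"]) (auto simp: algebra_simps)
    show ?thesis unfolding e
      using integral_translate[of "\<lambda>y. kcs m j l s (\<lambda>_. 0) (x + (s + c) *\<^sub>R h - y) * (w y m * w y l)" "c *\<^sub>R h"] by simp
  qed
  then show ?thesis unfolding NLc_def by (intro sum.cong refl)
qed

end

context mild
begin

text \<open>Adds up the constants of \<open>time_integral\<close> for the three pairs of exponents
  that occur, so that it dominates each of them.\<close>

definition "cc = 2 / (1 - 1 / \<gamma>) + 2 / (1 - 2 * kap) + 2 / (1 - kap) + 2 / (1 - (1 / \<gamma> + kap)) + 2"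

lemma kap_small: "2 * kap < 1" "kap < 1" "1 - 1 / \<gamma> > 0"
  using exponents(2-4,9) by linarith+

lemma cc_pos: "0 < cc"
  using kap_small exponents(7) unfolding cc_def by (intro add_pos_pos divide_pos_pos) auto

end

text \<open>The equation is restarted at t0 and followed for a time S. The factor 64 in
  \<open>small\<close> leaves room for the iteration in two norms and for the comparison with the
  given solution.\<close>

locale restarted = mild where u0 = u0 and u = u
  for u0 :: "real^'n::finite \<Rightarrow> real^'n" and u :: "real \<Rightarrow> real^'n \<Rightarrow> real^'n" +
  fixes t0 S :: real
  assumes t0: "0 < t0" and S: "0 < S" and tT: "ereal (t0 + S) < T"
    and small: "64 * (DD * DD * KK * (KK + 1) * (M * t0 powr (- alp)) * cc * S powr alp) \<le> 1"
begin

text \<open>\<open>NN\<close> bounds u in L^q from time t0 on; \<open>BB\<close> is twice the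
  weighted sup bound of the linear part, \<open>QQ\<close> its L^q bound times the 4 of
  \<open>Lq_add\<close>, and \<open>eps\<close> bounds the time integrals.\<close>

definition "NN = M * t0 powr (- alp)"
definition "BB = 2 * KK * NN"
definition "QQ = 4 * (KK * NN)"
definition "eps = cc * S powr alp"

lemma csts: "0 < cc" "0 < NN" "0 < BB" "0 < QQ" "0 < eps" "64 * (DD * DD * KK * (KK + 1) * NN * eps) \<le> 1"
proof -
  show "0 < cc" by (rule cc_pos)
  show "0 < NN" using M t0 by (simp add: NN_def)
  then show "0 < BB" "0 < QQ" using KK_pos by (auto simp: BB_def QQ_def)
  show "0 < eps" using \<open>0 < cc\<close> S by (simp add: eps_def)
  show "64 * (DD * DD * KK * (KK + 1) * NN * eps) \<le> 1" using small by (simp add: NN_def eps_def mult_ac)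
qed

text \<open>The first inequality drives the iteration in the weighted sup norm and in L^q, the
  second the comparison with u. Both follow from 64 (X KK + X) \<le> 1.\<close>

lemma small_consts:
  "8 * (DD * KK * KK * NN * eps) \<le> 1" "DD * KK * DD * (4 * (QQ + NN)) * eps \<le> 1 / 2" proof -
  have "1 \<le> (real CARD('n))\<^sup>2" using exponents(11) by (intro one_le_power)
  then have D1: "1 \<le> DD" by (simp add: DD_def)
  define X where "X = DD * DD * KK * NN * eps"
  have "64 * (X * (KK + 1)) = 64 * (DD * DD * KK * (KK + 1) * NN * eps)" by (simp add: X_def mult_ac)
  with csts(6) have "64 * (X * (KK + 1)) \<le> 1" by linarith
  then have X: "0 < X" "64 * (X * (KK + 1)) \<le> 1" using csts DD_pos KK_pos by (simp_all add: X_def)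
  have XK: "64 * (X * KK) + 64 * X \<le> 1" using X by (simp add: algebra_simps)
  have p: "0 < X * KK" using X KK_pos by simp
  have "1 * (DD * KK * KK * NN * eps) \<le> DD * (DD * KK * KK * NN * eps)" using D1 DD_pos KK_pos csts by (intro mult_right_mono) auto
  then have e1: "DD * KK * KK * NN * eps \<le> X * KK" by (simp add: X_def mult_ac)
  have e2: "DD * KK * DD * (4 * (QQ + NN)) * eps = 16 * (X * KK) + 4 * X" by (simp add: X_def QQ_def algebra_simps)
  show "8 * (DD * KK * KK * NN * eps) \<le> 1" using e1 XK p X(1) by linarith
  show "DD * KK * DD * (4 * (QQ + NN)) * eps \<le> 1 / 2" unfolding e2 using XK X p by linarith
qed

text \<open>The three integrals belong to the products of sup norm with sup norm, of sup norm with
  L^q, and of L^q with L^q.\<close>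

lemma time_ints:
  assumes "0 < \<tau>" "\<tau> \<le> S"
  shows "(\<integral>\<^sup>+r. ennreal ((\<tau> - r) powr (- (1 / \<gamma>)) * r powr (- (2 * kap))) * indicator {0<..<\<tau>} r \<partial>lborel) \<le> ennreal (eps * \<tau> powr (- kap))"
    and "(\<integral>\<^sup>+r. ennreal ((\<tau> - r) powr (- (1 / \<gamma>)) * r powr (- kap)) * indicator {0<..<\<tau>} r \<partial>lborel) \<le> ennreal eps"
    and "(\<integral>\<^sup>+r. ennreal ((\<tau> - r) powr (- (1 / \<gamma> + kap))) * indicator {0<..<\<tau>} r \<partial>lborel) \<le> ennreal eps"
proof -
  have mono: "\<tau> powr alp \<le> S powr alp" using assms exponents(1-9) by (intro powr_mono2) auto
  have p: "0 \<le> 2 / (1 - 1 / \<gamma>)" "0 \<le> 2 / (1 - 2 * kap)" "0 \<le> 2 / (1 - kap)" "0 \<le> 2 / (1 - (1 / \<gamma> + kap))" using kap_small exponents(7) by auto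
  have "0 < cc" by (rule csts)
  have c: "a * \<tau> powr alp \<le> eps" if "a \<le> cc" for a using that mono \<open>0 < cc\<close> unfolding eps_def by (intro mult_mono) auto
  have "\<tau> powr (1 - 1 / \<gamma> - 2 * kap) = \<tau> powr alp * \<tau> powr (- kap)" by (simp add: alp_def flip: powr_add)
  then have "(2 / (1 - 1 / \<gamma>) + 2 / (1 - 2 * kap)) * \<tau> powr (1 - 1 / \<gamma> - 2 * kap) = ((2 / (1 - 1 / \<gamma>) + 2 / (1 - 2 * kap)) * \<tau> powr alp) * \<tau> powr (- kap)" by simp
  also have "\<dots> \<le> eps * \<tau> powr (- kap)" using p by (intro mult_right_mono c) (auto simp: cc_def)
  finally show "(\<integral>\<^sup>+r. ennreal ((\<tau> - r) powr (- (1 / \<gamma>)) * r powr (- (2 * kap))) * indicator {0<..<\<tau>} r \<partial>lborel) \<le> ennreal (eps * \<tau> powr (- kap))"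
    using exponents(2,8) kap_small by (intro order_trans[OF time_integral ennreal_leI]) (use assms in auto)
  have "(2 / (1 - 1 / \<gamma>) + 2 / (1 - kap)) * \<tau> powr (1 - 1 / \<gamma> - kap) \<le> eps" using p c[of "2 / (1 - 1 / \<gamma>) + 2 / (1 - kap)"] by (simp add: cc_def alp_def)
  then show "(\<integral>\<^sup>+r. ennreal ((\<tau> - r) powr (- (1 / \<gamma>)) * r powr (- kap)) * indicator {0<..<\<tau>} r \<partial>lborel) \<le> ennreal eps"
    using exponents(2,8) kap_small by (intro order_trans[OF time_integral ennreal_leI]) (use assms in auto)
  have "1 - (1 / \<gamma> + kap) - 0 = alp" by (simp add: alp_def)
  then have "(2 / (1 - (1 / \<gamma> + kap)) + 2 / (1 - 0)) * \<tau> powr (1 - (1 / \<gamma> + kap) - 0) \<le> eps" using p c[of "2 / (1 - (1 / \<gamma> + kap)) + 2"] by (simp add: cc_def)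
  then have "(\<integral>\<^sup>+r. ennreal ((\<tau> - r) powr (- (1 / \<gamma> + kap)) * r powr (- 0)) * indicator {0<..<\<tau>} r \<partial>lborel) \<le> ennreal eps"
    using exponents(1-9) kap_small by (intro order_trans[OF time_integral ennreal_leI]) (use assms in auto)
  moreover have "(\<integral>\<^sup>+r. ennreal ((\<tau> - r) powr (- (1 / \<gamma> + kap))) * indicator {0<..<\<tau>} r \<partial>lborel)
    = (\<integral>\<^sup>+r. ennreal ((\<tau> - r) powr (- (1 / \<gamma> + kap)) * r powr (- 0)) * indicator {0<..<\<tau>} r \<partial>lborel)"
    by (intro nn_integral_cong) (simp add: indicator_def)
  ultimately show "(\<integral>\<^sup>+r. ennreal ((\<tau> - r) powr (- (1 / \<gamma> + kap))) * indicator {0<..<\<tau>} r \<partial>lborel) \<le> ennreal eps" by simp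
qed

lemma t0T: "0 \<le> r \<Longrightarrow> r \<le> S \<Longrightarrow> ereal (t0 + r) < T"
  using tT by (meson add_left_mono ereal_less_eq(3) order_le_less_trans)

lemma ut0_measurable[measurable]: "u t0 \<in> borel_measurable borel" "un t0 \<in> borel_measurable borel"
  using umeas[OF t0] un_measurable[OF t0] t0T[of 0] S by auto

lemma ut0_Lq: "(\<integral>\<^sup>+x. epow q (un t0 x) \<partial>lborel) \<le> ennreal (NN powr q)"
  using un_Lq[OF t0] t0T[of 0] S by (simp add: NN_def)

section \<open>Scalar majorants of the iteration, uniform in \<zeta>\<close>

definition Plin :: "real \<Rightarrow> real^'n \<Rightarrow> ennreal" where
  "Plin \<tau> x = (\<integral>\<^sup>+y. gm \<tau> (x - y) * un t0 y \<partial>lborel)"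

definition Pquad :: "(real \<Rightarrow> real^'n \<Rightarrow> ennreal) \<Rightarrow> real \<Rightarrow> real^'n \<Rightarrow> ennreal" where
  "Pquad p \<tau> x = (\<integral>\<^sup>+r. (\<integral>\<^sup>+y. km (\<tau> - r) (x - y) * (p r y * p r y) \<partial>lborel) * indicator {0<..<\<tau>} r \<partial>lborel)"

text \<open>The Picard scheme with kernels replaced by their majorants and the minus sign by a plus.
  It increases with n, dominates the iterates for every admissible \<zeta>, and does not involve
  \<zeta>.\<close>

fun PP :: "nat \<Rightarrow> real \<Rightarrow> real^'n \<Rightarrow> ennreal" where
  "PP 0 \<tau> x = 0"
| "PP (Suc n) \<tau> x = Plin \<tau> x + ennreal DD * Pquad (PP n) \<tau> x"

lemma Plin_measurable[measurable]: "(\<lambda>(\<tau>, x). Plin \<tau> x) \<in> borel_measurable (borel \<Otimes>\<^sub>M borel)"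
  unfolding Plin_def by measurable

lemma Pquad_measurable:
  assumes [measurable]: "(\<lambda>(\<tau>, x). p \<tau> x) \<in> borel_measurable (borel \<Otimes>\<^sub>M borel)"
  shows "(\<lambda>(\<tau>, x). Pquad p \<tau> x) \<in> borel_measurable (borel \<Otimes>\<^sub>M borel)"
  unfolding Pquad_def indicator_def greaterThanLessThan_iff by measurable

lemma PP_measurable[measurable]: "(\<lambda>(\<tau>, x). PP n \<tau> x) \<in> borel_measurable (borel \<Otimes>\<^sub>M borel)"
proof (induction n)
  case (Suc n)
  note Pquad_measurable[OF Suc, measurable]
  show ?case by simp
qed simp

lemma PP_mono: "PP n \<tau> x \<le> PP (Suc n) \<tau> x"
proof (induction n arbitrary: \<tau> x)
  case (Suc n)
  have "Pquad (PP n) \<tau> x \<le> Pquad (PP (Suc n)) \<tau> x"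
    unfolding Pquad_def by (intro nn_integral_mono mult_right_mono mult_left_mono mult_mono Suc.IH) auto
  then show ?case unfolding PP.simps by (intro add_left_mono mult_left_mono) auto
qed simp

lemma km_conv_const:
  assumes s: "0 < s" and "\<And>y. p y \<le> ennreal b" and b: "0 \<le> b"
  shows "(\<integral>\<^sup>+y. km s (x - (y::real^'n)) * p y \<partial>lborel) \<le> ennreal (KK * s powr (- (1 / \<gamma>)) * b)"
proof -
  have "(\<integral>\<^sup>+y. km s (x - y) * p y \<partial>lborel) \<le> (\<integral>\<^sup>+y. km s (x - y) * ennreal b \<partial>lborel)"
    by (intro nn_integral_mono mult_left_mono assms) auto
  also have "\<dots> = (\<integral>\<^sup>+y. km s (y::real^'n) \<partial>lborel) * ennreal b"
    by (subst nn_integral_multc) (auto simp: nn_integral_reflect)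
  also have "\<dots> \<le> ennreal (KK * s powr (- 1 / \<gamma>)) * ennreal b" by (intro mult_right_mono kernel_bounds s) auto
  finally show ?thesis using KK_pos b by (simp add: ennreal_mult)
qed

lemma Pquad_sup:
  fixes p p' :: "real \<Rightarrow> real^'n \<Rightarrow> ennreal"
  assumes p: "\<And>r y. 0 < r \<Longrightarrow> r \<le> S \<Longrightarrow> p r y \<le> ennreal (b * r powr (- kap))" and p': "\<And>r y. 0 < r \<Longrightarrow> r \<le> S \<Longrightarrow> p' r y \<le> ennreal (b' * r powr (- kap))"
    and b: "0 \<le> b" "0 \<le> b'" and \<tau>: "0 < \<tau>" "\<tau> \<le> S"
  shows "(\<integral>\<^sup>+r. (\<integral>\<^sup>+y. km (\<tau> - r) (x - y) * (p r y * p' r y) \<partial>lborel) * indicator {0<..<\<tau>} r \<partial>lborel) \<le> ennreal (KK * b * b' * eps * \<tau> powr (- kap))"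
proof -
  have "(\<integral>\<^sup>+r. (\<integral>\<^sup>+y. km (\<tau> - r) (x - y) * (p r y * p' r y) \<partial>lborel) * indicator {0<..<\<tau>} r \<partial>lborel)
    \<le> (\<integral>\<^sup>+r. ennreal (KK * b * b') * (ennreal ((\<tau> - r) powr (- (1 / \<gamma>)) * r powr (- (2 * kap))) * indicator {0<..<\<tau>} r) \<partial>lborel)"
  proof (rule nn_integral_mono)
    fix r
    show "(\<integral>\<^sup>+y. km (\<tau> - r) (x - y) * (p r y * p' r y) \<partial>lborel) * indicator {0<..<\<tau>} r
      \<le> ennreal (KK * b * b') * (ennreal ((\<tau> - r) powr (- (1 / \<gamma>)) * r powr (- (2 * kap))) * indicator {0<..<\<tau>} r)"
    proof (cases "r \<in> {0<..<\<tau>}")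
      case True
      then have r: "0 < r" "r \<le> S" "0 < \<tau> - r" using \<tau> by auto
      have "p r y * p' r y \<le> ennreal ((b * r powr (- kap)) * (b' * r powr (- kap)))" for y
        using mult_mono[OF p[OF r(1,2), of y] p'[OF r(1,2), of y]] b by (simp add: ennreal_mult)
      from km_conv_const[where p = "\<lambda>y. p r y * p' r y", OF r(3) this, of x]
      have "(\<integral>\<^sup>+y. km (\<tau> - r) (x - y) * (p r y * p' r y) \<partial>lborel) \<le> ennreal (KK * (\<tau> - r) powr (- (1 / \<gamma>)) * ((b * r powr (- kap)) * (b' * r powr (- kap))))"
        using b by simp
      also have "KK * (\<tau> - r) powr (- (1 / \<gamma>)) * ((b * r powr (- kap)) * (b' * r powr (- kap))) = KK * b * b' * ((\<tau> - r) powr (- (1 / \<gamma>)) * (r powr (- kap) * r powr (- kap)))"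
        by (simp add: mult_ac)
      also have "r powr (- kap) * r powr (- kap) = r powr (- (2 * kap))" by (simp flip: powr_add)
      finally show ?thesis using True b KK_pos by (simp add: ennreal_mult)
    qed simp
  qed
  also have "\<dots> = ennreal (KK * b * b') * (\<integral>\<^sup>+r. ennreal ((\<tau> - r) powr (- (1 / \<gamma>)) * r powr (- (2 * kap))) * indicator {0<..<\<tau>} r \<partial>lborel)"
    by (rule nn_integral_cmult) measurable
  also have "\<dots> \<le> ennreal (KK * b * b') * ennreal (eps * \<tau> powr (- kap))" by (intro mult_left_mono time_ints \<tau>) auto
  finally show ?thesis using b KK_pos csts(5) by (simp add: ennreal_mult mult_ac)
qed

text \<open>The induction closes because the quadratic term, of size \<open>BB\<close> squared times
  \<open>eps\<close>, is at most the bound KK NN of the linear term.\<close>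

lemma PP_sup: "0 < \<tau> \<Longrightarrow> \<tau> \<le> S \<Longrightarrow> PP n \<tau> x \<le> ennreal (BB * \<tau> powr (- kap))"
proof (induction n arbitrary: \<tau> x)
  case (Suc n)
  have "Plin \<tau> x \<le> ennreal (KK * \<tau> powr (- kap) * NN)"
    unfolding Plin_def using csts(2) by (intro gm_sup_conv Suc.prems ut0_Lq) auto
  moreover have "Pquad (PP n) \<tau> x \<le> ennreal (KK * BB * BB * eps * \<tau> powr (- kap))"
    unfolding Pquad_def by (rule Pquad_sup[OF Suc.IH Suc.IH]) (use csts(3) Suc.prems in auto)
  ultimately have "PP (Suc n) \<tau> x \<le> ennreal (KK * \<tau> powr (- kap) * NN) + ennreal DD * ennreal (KK * BB * BB * eps * \<tau> powr (- kap))"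
    unfolding PP.simps by (intro add_mono mult_left_mono) auto
  also have "\<dots> = ennreal (KK * \<tau> powr (- kap) * NN + DD * (KK * BB * BB * eps * \<tau> powr (- kap)))"
    using KK_pos csts DD_pos by (simp add: ennreal_mult[symmetric] ennreal_plus[symmetric] del: ennreal_plus)
  also have "\<dots> \<le> ennreal (BB * \<tau> powr (- kap))" proof (rule ennreal_leI)
    have "DD * (KK * BB * BB * eps) = (8 * (DD * KK * KK * NN * eps)) * (KK * NN / 2)" by (simp add: BB_def)
    also have "\<dots> \<le> 1 * (KK * NN / 2)" using small_consts(1) KK_pos csts(2) by (intro mult_right_mono) auto
    finally have "DD * (KK * BB * BB * eps) \<le> KK * NN" using KK_pos csts(2) by (simp add: field_simps)
    then have "(KK * NN + DD * (KK * BB * BB * eps)) * \<tau> powr (- kap) \<le> BB * \<tau> powr (- kap)"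
      by (intro mult_right_mono) (auto simp: BB_def)
    then show "KK * \<tau> powr (- kap) * NN + DD * (KK * BB * BB * eps * \<tau> powr (- kap)) \<le> BB * \<tau> powr (- kap)"
      by (simp add: algebra_simps)
  qed
  finally show ?case .
qed simp

lemma epow_scale: "0 \<le> c \<Longrightarrow> epow q (ennreal c * x) = ennreal (c powr q) * epow q x"
  using exponents(1-9) by (simp add: epow_mult)

text \<open>One factor of the square is taken in the weighted sup norm and the other in L^q, so the
  estimate is linear in \<open>QQ\<close>. The linear and the quadratic part are each at most KK
  NN.\<close>

lemma PP_Lq: "0 < \<tau> \<Longrightarrow> \<tau> \<le> S \<Longrightarrow> (\<integral>\<^sup>+x. epow q (PP n \<tau> x) \<partial>lborel) \<le> ennreal (QQ powr q)"
proof (induction n arbitrary: \<tau>)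
  case (Suc n)
  have q1: "1 \<le> q" using exponents(1-9) by simp
  have m: "(\<lambda>x. Plin \<tau> x) \<in> borel_measurable borel" "(\<lambda>x. Pquad (PP n) \<tau> x) \<in> borel_measurable borel"
    using Pquad_measurable[OF PP_measurable[of n]] by measurable
  have 1: "(\<integral>\<^sup>+x. epow q (Plin \<tau> x) \<partial>lborel) \<le> ennreal ((KK * NN) powr q)"
    unfolding Plin_def using csts(2) by (intro gm_Lq_conv Suc.prems ut0_Lq) auto
  have "(\<integral>\<^sup>+x. epow q (Pquad (PP n) \<tau> x) \<partial>lborel) \<le> ennreal ((KK * BB * QQ * eps) powr q)"
    unfolding Pquad_def proof (rule minkowski_time[where \<phi> = "\<lambda>r. (\<tau> - r) powr (- (1 / \<gamma>)) * r powr (- kap)"])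
    show "sigma_finite_measure (lborel :: (real^'n) measure)" by (rule lborel.sigma_finite_measure_axioms)
    fix r assume r: "0 < r" "r < \<tau>"
    have rS: "r \<le> S" "0 < \<tau> - r" using r Suc.prems by auto
    have [measurable]: "PP n r \<in> borel_measurable borel" by measurable
    have "(\<integral>\<^sup>+y. epow q (PP n r y * PP n r y) \<partial>lborel) \<le> (\<integral>\<^sup>+y. epow q (ennreal (BB * r powr (- kap)) * PP n r y) \<partial>lborel)"
      using q1 PP_sup[OF r(1) rS(1)] by (intro nn_integral_mono epow_mono mult_right_mono) auto
    also have "\<dots> = ennreal ((BB * r powr (- kap)) powr q) * (\<integral>\<^sup>+y. epow q (PP n r y) \<partial>lborel)"
      using csts(3) by (simp add: epow_scale nn_integral_cmult)
    also have "\<dots> \<le> ennreal ((BB * r powr (- kap)) powr q) * ennreal (QQ powr q)" by (intro mult_left_mono Suc.IH r rS) auto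
    also have "\<dots> = ennreal ((BB * r powr (- kap) * QQ) powr q)" using csts by (simp add: powr_mult ennreal_mult)
    finally have "(\<integral>\<^sup>+y. epow q (PP n r y * PP n r y) \<partial>lborel) \<le> ennreal ((BB * r powr (- kap) * QQ) powr q)" .
    from km_Lq_conv[where f = "\<lambda>y. PP n r y * PP n r y", OF rS(2) _ this]
    show "(\<integral>\<^sup>+x. epow q (\<integral>\<^sup>+y. km (\<tau> - r) (x - y) * (PP n r y * PP n r y) \<partial>lborel) \<partial>lborel) \<le> ennreal ((KK * BB * QQ * ((\<tau> - r) powr (- (1 / \<gamma>)) * r powr (- kap))) powr q)"
      using csts by (simp add: mult_ac)
  qed (use time_ints(2)[OF Suc.prems] csts KK_pos q1 in auto)
  then have "(\<integral>\<^sup>+x. epow q (ennreal DD * Pquad (PP n) \<tau> x) \<partial>lborel) \<le> ennreal (DD powr q) * ennreal ((KK * BB * QQ * eps) powr q)"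
    using DD_pos m(2) by (simp add: epow_scale nn_integral_cmult mult_left_mono)
  also have "\<dots> = ennreal ((DD * (KK * BB * QQ * eps)) powr q)" using csts DD_pos KK_pos by (simp add: powr_mult ennreal_mult)
  also have "\<dots> \<le> ennreal ((KK * NN) powr q)" proof (intro ennreal_leI powr_mono2)
    have "DD * (KK * BB * QQ * eps) = (8 * (DD * KK * KK * NN * eps)) * (KK * NN)" by (simp add: BB_def QQ_def)
    also have "\<dots> \<le> 1 * (KK * NN)" using small_consts(1) KK_pos csts(2) by (intro mult_right_mono) auto
    finally show "DD * (KK * BB * QQ * eps) \<le> KK * NN" by simp
  qed (use q1 csts DD_pos KK_pos in auto)
  finally have 2: "(\<integral>\<^sup>+x. epow q (ennreal DD * Pquad (PP n) \<tau> x) \<partial>lborel) \<le> ennreal ((KK * NN) powr q)" .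
  show ?case unfolding PP.simps QQ_def using KK_pos csts(2) m by (intro Lq_add q1 1 2) auto
qed simp

text \<open>As an increasing limit it keeps the L^q bound by monotone convergence; this function
  will bound the solution on the whole polydisc.\<close>

definition Pinf :: "real \<Rightarrow> real^'n \<Rightarrow> ennreal" where "Pinf \<tau> x = (SUP n. PP n \<tau> x)"

lemma Pinf_measurable[measurable]: "Pinf \<tau> \<in> borel_measurable borel"
proof -
  have [measurable]: "PP n \<tau> \<in> borel_measurable borel" for n by measurable
  show ?thesis unfolding Pinf_def by measurable
qed

lemma Pinf_sup: "0 < \<tau> \<Longrightarrow> \<tau> \<le> S \<Longrightarrow> Pinf \<tau> x \<le> ennreal (BB * \<tau> powr (- kap))"
  unfolding Pinf_def by (intro SUP_least PP_sup)

lemma Pinf_Lq: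
  assumes "0 < \<tau>" "\<tau> \<le> S" shows "(\<integral>\<^sup>+x. epow q (Pinf \<tau> x) \<partial>lborel) \<le> ennreal (QQ powr q)"
proof -
  have q: "0 < q" using exponents(1-9) by simp
  have [measurable]: "PP n \<tau> \<in> borel_measurable borel" for n by measurable
  have "(\<integral>\<^sup>+x. epow q (Pinf \<tau> x) \<partial>lborel) \<le> (\<integral>\<^sup>+x. (SUP n. epow q (PP n \<tau> x)) \<partial>lborel)"
    unfolding Pinf_def by (intro nn_integral_mono epow_SUP_le q)
  also have "\<dots> = (SUP n. \<integral>\<^sup>+x. epow q (PP n \<tau> x) \<partial>lborel)"
    by (rule nn_integral_monotone_convergence_SUP) (auto intro!: incseq_SucI le_funI epow_mono q PP_mono simp del: PP.simps)
  also have "\<dots> \<le> ennreal (QQ powr q)" by (intro SUP_least PP_Lq assms)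
  finally show ?thesis .
qed

section \<open>Complex Picard iterates and their limit\<close>

definition lin :: "('n \<Rightarrow> complex) \<Rightarrow> real \<Rightarrow> real^'n \<Rightarrow> 'n \<Rightarrow> complex" where
  "lin \<zeta> \<tau> x j = (LBINT y. gcs \<tau> \<zeta> (x - y) * of_real (u t0 y $ j))"

definition quad :: "('n \<Rightarrow> complex) \<Rightarrow> (real \<Rightarrow> real^'n \<Rightarrow> 'n \<Rightarrow> complex) \<Rightarrow> real \<Rightarrow> real^'n \<Rightarrow> 'n \<Rightarrow> complex" where
  "quad \<zeta> w \<tau> x j = (LBINT r. indicator {0<..<\<tau>} r *\<^sub>R NLc \<zeta> j (\<tau> - r) (w r) x)"

fun VV :: "nat \<Rightarrow> ('n \<Rightarrow> complex) \<Rightarrow> real \<Rightarrow> real^'n \<Rightarrow> 'n \<Rightarrow> complex" where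
  "VV 0 \<zeta> \<tau> x j = 0"
| "VV (Suc n) \<zeta> \<tau> x j = lin \<zeta> \<tau> x j - quad \<zeta> (VV n \<zeta>) \<tau> x j"

lemma lin_measurable[measurable]: "(\<lambda>(\<tau>, x). lin \<zeta> \<tau> x j) \<in> borel_measurable (borel \<Otimes>\<^sub>M borel)"
  unfolding lin_def by measurable

lemma quad_measurable:
  assumes [measurable]: "\<And>m. (\<lambda>(r, y). w r y m) \<in> borel_measurable (borel \<Otimes>\<^sub>M borel)"
  shows "(\<lambda>(\<tau>, x). quad \<zeta> w \<tau> x j) \<in> borel_measurable (borel \<Otimes>\<^sub>M borel)"
  unfolding quad_def NLc_def indicator_def greaterThanLessThan_iff by measurable

lemma VV_measurable[measurable]: "(\<lambda>(\<tau>, x). VV n \<zeta> \<tau> x j) \<in> borel_measurable (borel \<Otimes>\<^sub>M borel)"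
proof (induction n arbitrary: j)
  case (Suc n)
  note quad_measurable[OF Suc, measurable]
  show ?case by simp
qed simp

lemma lin_bound:
  assumes "adm S \<zeta>" "0 < \<tau>" "\<tau> \<le> S"
  shows "ennreal (norm (gcs \<tau> \<zeta> (x - y) * of_real (u t0 y $ j))) \<le> gm \<tau> (x - y) * un t0 y"
    and "ennreal (norm (lin \<zeta> \<tau> x j)) \<le> Plin \<tau> x"
proof -
  show b: "ennreal (norm (gcs \<tau> \<zeta> (x - y) * of_real (u t0 y $ j))) \<le> gm \<tau> (x - y) * un t0 y" for y
    unfolding norm_mult ennreal_mult[OF norm_ge_zero norm_ge_zero] un_def
    by (intro mult_mono gcs_bound[OF assms] ennreal_leI) (auto simp: component_le_norm_cart)
  show "ennreal (norm (lin \<zeta> \<tau> x j)) \<le> Plin \<tau> x"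
    unfolding lin_def Plin_def by (intro order_trans[OF norm_integral_le_nn_integral] nn_integral_mono b)
qed

lemma quad_term_bound:
  fixes w :: "real \<Rightarrow> real^'n \<Rightarrow> 'n \<Rightarrow> complex" and p :: "real \<Rightarrow> real^'n \<Rightarrow> ennreal"
  assumes "adm S \<zeta>" "\<tau> \<le> S" and w: "\<And>r y m. 0 < r \<Longrightarrow> r \<le> S \<Longrightarrow> ennreal (norm (w r y m)) \<le> p r y"
  shows "ennreal (norm (indicator {0<..<\<tau>} r *\<^sub>R NLc \<zeta> j (\<tau> - r) (w r) x))
    \<le> ennreal DD * ((\<integral>\<^sup>+y. km (\<tau> - r) (x - y) * (p r y * p r y) \<partial>lborel) * indicator {0<..<\<tau>} r)"
proof (cases "r \<in> {0<..<\<tau>}")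
  case True
  then show ?thesis using NLc_bound[OF assms(1), of "\<tau> - r" "w r" "p r" j x] w[of r] assms(2) by (simp add: DD_def)
qed simp

lemma quad_bound:
  assumes "adm S \<zeta>" "\<tau> \<le> S" and w: "\<And>r y m. 0 < r \<Longrightarrow> r \<le> S \<Longrightarrow> ennreal (norm (w r y m)) \<le> p r y"
    and [measurable]: "(\<lambda>(\<tau>, x). p \<tau> x) \<in> borel_measurable (borel \<Otimes>\<^sub>M borel)"
  shows "ennreal (norm (quad \<zeta> w \<tau> x j)) \<le> ennreal DD * Pquad p \<tau> x"
proof -
  have "ennreal (norm (quad \<zeta> w \<tau> x j)) \<le> (\<integral>\<^sup>+r. ennreal DD * ((\<integral>\<^sup>+y. km (\<tau> - r) (x - y) * (p r y * p r y) \<partial>lborel) * indicator {0<..<\<tau>} r) \<partial>lborel)"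
    unfolding quad_def by (intro order_trans[OF norm_integral_le_nn_integral] nn_integral_mono quad_term_bound[OF assms(1-3)])
  also have "\<dots> = ennreal DD * Pquad p \<tau> x" unfolding Pquad_def by (rule nn_integral_cmult) measurable
  finally show ?thesis .
qed

lemma ennreal_norm_diff: "ennreal (norm (a - b)) \<le> ennreal (norm a) + ennreal (norm b)"
  by (simp add: ennreal_plus[symmetric] ennreal_leI norm_triangle_ineq4 del: ennreal_plus)

lemma VV_bound:
  assumes "adm S \<zeta>"
  shows "0 < \<tau> \<Longrightarrow> \<tau> \<le> S \<Longrightarrow> ennreal (norm (VV n \<zeta> \<tau> x j)) \<le> PP n \<tau> x"
proof (induction n arbitrary: \<tau> x j)
  case (Suc n)
  have "ennreal (norm (VV (Suc n) \<zeta> \<tau> x j)) \<le> ennreal (norm (lin \<zeta> \<tau> x j)) + ennreal (norm (quad \<zeta> (VV n \<zeta>) \<tau> x j))"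
    unfolding VV.simps by (rule ennreal_norm_diff)
  also have "\<dots> \<le> PP (Suc n) \<tau> x"
    unfolding PP.simps by (intro add_mono lin_bound(2) quad_bound assms Suc.IH Suc.prems PP_measurable)
  finally show ?case .
qed simp

lemma VV_sup:
  assumes "adm S \<zeta>" "0 < \<tau>" "\<tau> \<le> S" shows "norm (VV n \<zeta> \<tau> x j) \<le> BB * \<tau> powr (- kap)"
  using order_trans[OF VV_bound[OF assms] PP_sup[OF assms(2,3)]] csts(3) by (simp add: ennreal_le_iff)

lemma km_const_finite:
  assumes "0 < s" "0 \<le> b"
  shows "(\<integral>\<^sup>+y. km s (x - (y::real^'n)) * (ennreal b * ennreal b) \<partial>lborel) < \<infinity>"
  using le_less_trans[OF km_conv_const[where p = "\<lambda>_. ennreal b * ennreal b" and b = "b * b" and x = x, OF assms(1)] ennreal_less_top] assms(2)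
  by (simp add: ennreal_mult)

lemma quad_integrable:
  fixes w :: "real \<Rightarrow> real^'n \<Rightarrow> 'n \<Rightarrow> complex"
  assumes a: "adm S \<zeta>" and \<tau>: "0 < \<tau>" "\<tau> \<le> S"
    and [measurable]: "\<And>m. (\<lambda>(r, y). w r y m) \<in> borel_measurable (borel \<Otimes>\<^sub>M borel)"
    and w: "\<And>r y m. 0 < r \<Longrightarrow> r \<le> S \<Longrightarrow> norm (w r y m) \<le> b * r powr (- kap)" and nn: "0 \<le> b"
  shows "integrable lborel (\<lambda>r. indicator {0<..<\<tau>} r *\<^sub>R NLc \<zeta> j (\<tau> - r) (w r) x)"
proof (rule integrable_of_nn_bound)
  let ?b = "\<lambda>r (y::real^'n). ennreal (b * r powr (- kap))"
  show "(\<lambda>r. indicator {0<..<\<tau>} r *\<^sub>R NLc \<zeta> j (\<tau> - r) (w r) x) \<in> borel_measurable lborel"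
    unfolding NLc_def by measurable
  show "ennreal (norm (indicator {0<..<\<tau>} r *\<^sub>R NLc \<zeta> j (\<tau> - r) (w r) x)) \<le> ennreal DD * ((\<integral>\<^sup>+y. km (\<tau> - r) (x - y) * (?b r y * ?b r y) \<partial>lborel) * indicator {0<..<\<tau>} r)" for r
    by (rule quad_term_bound[OF a \<tau>(2)]) (rule ennreal_leI[OF w])
  have "(\<integral>\<^sup>+r. ennreal DD * ((\<integral>\<^sup>+y. km (\<tau> - r) (x - y) * (?b r y * ?b r y) \<partial>lborel) * indicator {0<..<\<tau>} r) \<partial>lborel)
    = ennreal DD * (\<integral>\<^sup>+r. (\<integral>\<^sup>+y. km (\<tau> - r) (x - y) * (?b r y * ?b r y) \<partial>lborel) * indicator {0<..<\<tau>} r \<partial>lborel)"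
    by (rule nn_integral_cmult) measurable
  also have "\<dots> < \<infinity>"
    using le_less_trans[OF Pquad_sup[where p = ?b and p' = ?b, OF _ _ nn nn \<tau>, of x] ennreal_less_top] by (simp add: ennreal_mult_less_top)
  finally show "(\<integral>\<^sup>+r. ennreal DD * ((\<integral>\<^sup>+y. km (\<tau> - r) (x - y) * (?b r y * ?b r y) \<partial>lborel) * indicator {0<..<\<tau>} r) \<partial>lborel) < \<infinity>" .
qed

text \<open>In each product of the difference one factor is of size d, and the two companions
  together are of size 2 b.\<close>

lemma quad_lipschitz:
  assumes a: "adm S \<zeta>" and \<tau>: "0 < \<tau>" "\<tau> \<le> S"
    and [measurable]: "\<And>m. (\<lambda>(r, y). w r y m) \<in> borel_measurable (borel \<Otimes>\<^sub>M borel)" "\<And>m. (\<lambda>(r, y). w' r y m) \<in> borel_measurable (borel \<Otimes>\<^sub>M borel)"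
    and b: "\<And>r y m. 0 < r \<Longrightarrow> r \<le> S \<Longrightarrow> norm (w r y m) \<le> b * r powr (- kap)" "\<And>r y m. 0 < r \<Longrightarrow> r \<le> S \<Longrightarrow> norm (w' r y m) \<le> b * r powr (- kap)"
    and d: "\<And>r y m. 0 < r \<Longrightarrow> r \<le> S \<Longrightarrow> norm (w r y m - w' r y m) \<le> d * r powr (- kap)" and nn: "0 \<le> b" "0 \<le> d"
  shows "norm (quad \<zeta> w \<tau> x j - quad \<zeta> w' \<tau> x j) \<le> DD * KK * d * (2 * b) * eps * \<tau> powr (- kap)"
proof -
  let ?b = "\<lambda>r (y::real^'n). ennreal (b * r powr (- kap))" and ?d = "\<lambda>r (y::real^'n). ennreal (d * r powr (- kap))"
  have fin: "(\<integral>\<^sup>+y. km (\<tau> - r) (x - y) * (?b r y * ?b r y) \<partial>lborel) < \<infinity>" if "0 < r" "r < \<tau>" for r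
    using that nn by (intro km_const_finite) auto
  have iw: "integrable lborel (\<lambda>r. indicator {0<..<\<tau>} r *\<^sub>R NLc \<zeta> j (\<tau> - r) (w r) x)" by (rule quad_integrable[OF a \<tau> _ b(1) nn(1)]) measurable
  have iw': "integrable lborel (\<lambda>r. indicator {0<..<\<tau>} r *\<^sub>R NLc \<zeta> j (\<tau> - r) (w' r) x)" by (rule quad_integrable[OF a \<tau> _ b(2) nn(1)]) measurable
  have "quad \<zeta> w \<tau> x j - quad \<zeta> w' \<tau> x j = (LBINT r. indicator {0<..<\<tau>} r *\<^sub>R (NLc \<zeta> j (\<tau> - r) (w r) x - NLc \<zeta> j (\<tau> - r) (w' r) x))"
    unfolding quad_def scaleR_diff_right using iw iw' by simp
  then have "ennreal (norm (quad \<zeta> w \<tau> x j - quad \<zeta> w' \<tau> x j))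
    \<le> (\<integral>\<^sup>+r. ennreal (norm (indicator {0<..<\<tau>} r *\<^sub>R (NLc \<zeta> j (\<tau> - r) (w r) x - NLc \<zeta> j (\<tau> - r) (w' r) x))) \<partial>lborel)"
    by (simp only: norm_integral_le_nn_integral)
  also have "\<dots> \<le> (\<integral>\<^sup>+r. ennreal DD * ((\<integral>\<^sup>+y. km (\<tau> - r) (x - y) * (?d r y * (?b r y + ?b r y)) \<partial>lborel) * indicator {0<..<\<tau>} r) \<partial>lborel)"
  proof (rule nn_integral_mono)
    fix r
    show "ennreal (norm (indicator {0<..<\<tau>} r *\<^sub>R (NLc \<zeta> j (\<tau> - r) (w r) x - NLc \<zeta> j (\<tau> - r) (w' r) x)))
      \<le> ennreal DD * ((\<integral>\<^sup>+y. km (\<tau> - r) (x - y) * (?d r y * (?b r y + ?b r y)) \<partial>lborel) * indicator {0<..<\<tau>} r)"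
    proof (cases "r \<in> {0<..<\<tau>}")
      case True
      then have r: "0 < r" "r < \<tau>" "r \<le> S" "0 < \<tau> - r" "\<tau> - r \<le> S" using \<tau> by auto
      have [measurable]: "(\<lambda>y. w r y m) \<in> borel_measurable borel" "(\<lambda>y. w' r y m) \<in> borel_measurable borel" for m by measurable
      have "ennreal (norm (NLc \<zeta> j (\<tau> - r) (w r) x - NLc \<zeta> j (\<tau> - r) (w' r) x)) \<le> ennreal ((real CARD('n))\<^sup>2) * (\<integral>\<^sup>+y. km (\<tau> - r) (x - y) * (?d r y * (?b r y + ?b r y)) \<partial>lborel)"
        by (rule NLc_diff[OF a r(4,5) _ _ _ _ _ fin[OF r(1,2)] fin[OF r(1,2)]]) (auto intro!: ennreal_leI b d r)
      then show ?thesis using True by (simp add: DD_def)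
    qed simp
  qed
  also have "\<dots> = ennreal DD * (\<integral>\<^sup>+r. (\<integral>\<^sup>+y. km (\<tau> - r) (x - y) * (?d r y * (?b r y + ?b r y)) \<partial>lborel) * indicator {0<..<\<tau>} r \<partial>lborel)"
    by (rule nn_integral_cmult) measurable
  also have "\<dots> \<le> ennreal DD * ennreal (KK * d * (2 * b) * eps * \<tau> powr (- kap))"
    by (intro mult_left_mono Pquad_sup \<tau>) (use nn in \<open>auto simp: ennreal_plus[symmetric] simp del: ennreal_plus\<close>)
  also have "\<dots> = ennreal (DD * KK * d * (2 * b) * eps * \<tau> powr (- kap))"
    using DD_pos KK_pos nn csts by (simp add: ennreal_mult[symmetric] mult.assoc)
  finally show ?thesis using DD_pos KK_pos nn csts by (simp add: ennreal_le_iff)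
qed

text \<open>The 8 in \<open>small_consts\<close> is composed of 2 for the two bounds in
  \<open>quad_lipschitz\<close>, 2 from \<open>BB = 2 * KK * NN\<close>, and 2 for the
  halving.\<close>

lemma VV_step:
  assumes "adm S \<zeta>"
  shows "0 < \<tau> \<Longrightarrow> \<tau> \<le> S \<Longrightarrow> norm (VV (Suc n) \<zeta> \<tau> x j - VV n \<zeta> \<tau> x j) \<le> BB * \<tau> powr (- kap) / 2 ^ n"
proof (induction n arbitrary: \<tau> x j)
  case 0
  then show ?case using VV_sup[OF assms 0, of 1 x j] by simp
next
  case (Suc n)
  have "norm (VV (Suc (Suc n)) \<zeta> \<tau> x j - VV (Suc n) \<zeta> \<tau> x j) = norm (quad \<zeta> (VV (Suc n) \<zeta>) \<tau> x j - quad \<zeta> (VV n \<zeta>) \<tau> x j)"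
    by (simp only: VV.simps(2)[of "Suc n"] VV.simps(2)[of n \<zeta> \<tau>] norm_minus_commute diff_diff_eq2 add_diff_cancel_left' diff_add_cancel) (simp add: norm_minus_commute algebra_simps)
  also have "\<dots> \<le> DD * KK * (BB / 2 ^ n) * (2 * BB) * eps * \<tau> powr (- kap)"
    by (rule quad_lipschitz[OF assms Suc.prems VV_measurable VV_measurable VV_sup[OF assms] VV_sup[OF assms]])
      (use Suc.IH csts(3) in auto)
  also have "\<dots> = (8 * (DD * KK * KK * NN * eps)) * (BB * \<tau> powr (- kap) / 2 ^ Suc n)" by (simp add: BB_def)
  also have "\<dots> \<le> 1 * (BB * \<tau> powr (- kap) / 2 ^ Suc n)" using small_consts(1) csts(3) by (intro mult_right_mono) auto
  finally show ?case by simp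
qed

definition UU :: "('n \<Rightarrow> complex) \<Rightarrow> real \<Rightarrow> real^'n \<Rightarrow> 'n \<Rightarrow> complex" where
  "UU \<zeta> \<tau> x j = lim (\<lambda>n. VV n \<zeta> \<tau> x j)"

lemma UU_limit:
  assumes "adm S \<zeta>" "0 < \<tau>" "\<tau> \<le> S"
  shows "(\<lambda>n. VV n \<zeta> \<tau> x j) \<longlonglongrightarrow> UU \<zeta> \<tau> x j"
    and "norm (VV n \<zeta> \<tau> x j - UU \<zeta> \<tau> x j) \<le> 2 * BB / 2 ^ n * \<tau> powr (- kap)"
    and "ennreal (norm (UU \<zeta> \<tau> x j)) \<le> Pinf \<tau> x"
proof -
  show l: "(\<lambda>n. VV n \<zeta> \<tau> x j) \<longlonglongrightarrow> UU \<zeta> \<tau> x j"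
    unfolding UU_def by (rule geometric_limit[OF VV_step[OF assms]])
  show "norm (VV n \<zeta> \<tau> x j - UU \<zeta> \<tau> x j) \<le> 2 * BB / 2 ^ n * \<tau> powr (- kap)" proof -
    have "norm (VV n \<zeta> \<tau> x j - UU \<zeta> \<tau> x j) \<le> 2 * (BB * \<tau> powr (- kap)) / 2 ^ n"
      unfolding UU_def by (rule geometric_limit(2)[OF VV_step[OF assms]])
    then show ?thesis by simp
  qed
  have "(\<lambda>n. ennreal (norm (VV n \<zeta> \<tau> x j))) \<longlonglongrightarrow> ennreal (norm (UU \<zeta> \<tau> x j))"
    by (rule tendsto_ennrealI[OF tendsto_norm[OF l]])
  then show "ennreal (norm (UU \<zeta> \<tau> x j)) \<le> Pinf \<tau> x"
    unfolding Pinf_def by (rule Lim_bounded[where M = 0]) (intro allI impI, rule SUP_upper2[OF UNIV_I], rule VV_bound[OF assms])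
qed

lemma UU_measurable[measurable]: "(\<lambda>(\<tau>, x). UU \<zeta> \<tau> x j) \<in> borel_measurable (borel \<Otimes>\<^sub>M borel)"
  unfolding UU_def case_prod_beta by (rule borel_measurable_lim_metric) measurable

lemma UU_sup:
  assumes "adm S \<zeta>" "0 < \<tau>" "\<tau> \<le> S" shows "norm (UU \<zeta> \<tau> x j) \<le> BB * \<tau> powr (- kap)"
  using order_trans[OF UU_limit(3)[OF assms] Pinf_sup[OF assms(2,3)]] csts(3) by (simp add: ennreal_le_iff)

lemma UU_fixed_point:
  assumes "adm S \<zeta>" "0 < \<tau>" "\<tau> \<le> S" shows "UU \<zeta> \<tau> x j = lin \<zeta> \<tau> x j - quad \<zeta> (UU \<zeta>) \<tau> x j"
proof (rule LIMSEQ_unique)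
  show "(\<lambda>n. VV (Suc n) \<zeta> \<tau> x j) \<longlonglongrightarrow> UU \<zeta> \<tau> x j" by (rule LIMSEQ_Suc[OF UU_limit(1)[OF assms]])
  have "(\<lambda>n. quad \<zeta> (VV n \<zeta>) \<tau> x j - quad \<zeta> (UU \<zeta>) \<tau> x j) \<longlonglongrightarrow> 0"
  proof (rule Lim_null_comparison)
    show "\<forall>\<^sub>F n in sequentially. norm (quad \<zeta> (VV n \<zeta>) \<tau> x j - quad \<zeta> (UU \<zeta>) \<tau> x j) \<le> (DD * KK * (2 * BB) * (2 * BB) * eps * \<tau> powr (- kap)) / 2 ^ n"
    proof (rule always_eventually, rule allI)
      fix n
      have "norm (quad \<zeta> (VV n \<zeta>) \<tau> x j - quad \<zeta> (UU \<zeta>) \<tau> x j) \<le> DD * KK * (2 * BB / 2 ^ n) * (2 * BB) * eps * \<tau> powr (- kap)"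
        by (rule quad_lipschitz[OF assms VV_measurable UU_measurable VV_sup[OF assms(1)] UU_sup[OF assms(1)] UU_limit(2)[OF assms(1)]])
          (use csts(3) in auto)
      then show "norm (quad \<zeta> (VV n \<zeta>) \<tau> x j - quad \<zeta> (UU \<zeta>) \<tau> x j) \<le> (DD * KK * (2 * BB) * (2 * BB) * eps * \<tau> powr (- kap)) / 2 ^ n" by simp
    qed
    show "(\<lambda>n. (DD * KK * (2 * BB) * (2 * BB) * eps * \<tau> powr (- kap)) / 2 ^ n) \<longlonglongrightarrow> 0" by (rule LIMSEQ_divide_realpow_zero) simp
  qed
  then have "(\<lambda>n. quad \<zeta> (VV n \<zeta>) \<tau> x j) \<longlonglongrightarrow> quad \<zeta> (UU \<zeta>) \<tau> x j" by (rule LIM_zero_cancel)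
  then show "(\<lambda>n. VV (Suc n) \<zeta> \<tau> x j) \<longlonglongrightarrow> lin \<zeta> \<tau> x j - quad \<zeta> (UU \<zeta>) \<tau> x j"
    unfolding VV.simps by (rule tendsto_diff[OF tendsto_const])
qed

text \<open>Induction through the integrals over y and r. Their majorants are built from
  \<open>gm\<close>, \<open>km\<close>, \<open>un t0\<close> and \<open>PP n\<close>, none of which
  involves the variable z.\<close>

lemma VV_holomorphic:
  assumes a: "adm S \<zeta>"
  shows "0 < \<tau> \<Longrightarrow> \<tau> \<le> S \<Longrightarrow> (\<lambda>z. VV n (\<zeta>(i := z)) \<tau> x j) holomorphic_on ball 0 (S powr (1 / \<gamma> - 1))"
proof (induction n arbitrary: \<tau> x j)
  case (Suc n)
  note \<tau> = Suc.prems
  have fin1: "Plin \<tau> x < \<infinity>"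
    using order_trans[OF gm_sup_conv[OF \<tau>(1) ut0_measurable(2) ut0_Lq, of x] order_refl] csts(2) le_less_trans[OF _ ennreal_less_top] by (simp add: Plin_def)
  have h1: "(\<lambda>z. lin (\<zeta>(i := z)) \<tau> x j) holomorphic_on ball 0 (S powr (1 / \<gamma> - 1))"
    unfolding lin_def proof (rule holomorphic_lebesgue_integral_strong[OF open_ball, where B = "\<lambda>y. enn2real (gm \<tau> (x - y) * un t0 y)"])
    show "integrable lborel (\<lambda>y. enn2real (gm \<tau> (x - y) * un t0 y))"
      by (rule integrable_enn2real) (use fin1 in \<open>auto simp: Plin_def\<close>)
    show "(\<lambda>z. gcs \<tau> (\<zeta>(i := z)) (x - y) * of_real (u t0 y $ j)) holomorphic_on ball 0 (S powr (1 / \<gamma> - 1))" for y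
      by (intro holomorphic_intros gcs_holomorphic a \<tau>)
    fix z :: complex and y assume z: "z \<in> ball 0 (S powr (1 / \<gamma> - 1))"
    show "(\<lambda>y. gcs \<tau> (\<zeta>(i := z)) (x - y) * of_real (u t0 y $ j)) \<in> borel_measurable lborel" by measurable
    have "gm \<tau> (x - y) * un t0 y < \<infinity>"
      using le_less_trans[OF kernel_bounds(2)[OF \<tau>(1), of "x - y"] ennreal_less_top] by (simp add: un_def ennreal_mult_less_top)
    then show "norm (gcs \<tau> (\<zeta>(i := z)) (x - y) * of_real (u t0 y $ j)) \<le> enn2real (gm \<tau> (x - y) * un t0 y)"
      by (intro norm_le_enn2real lin_bound(1) adm_upd[OF a z] \<tau>)
  qed
  have PPfin: "PP n r y < \<infinity>" if "0 < r" "r \<le> S" for r y using le_less_trans[OF PP_sup[OF that] ennreal_less_top] by simp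
  have kmfin: "(\<integral>\<^sup>+y. km (\<tau> - r) (x - y) * (PP n r y * PP n r y) \<partial>lborel) < \<infinity>" if r: "0 < r" "r < \<tau>" for r
  proof -
    have rS: "r \<le> S" using r \<tau> by simp
    have "PP n r y * PP n r y \<le> ennreal ((BB * r powr (- kap)) * (BB * r powr (- kap)))" for y
      using mult_mono[OF PP_sup[OF r(1) rS, of n y] PP_sup[OF r(1) rS, of n y]] csts(3) by (simp add: ennreal_mult)
    from km_conv_const[where p = "\<lambda>y. PP n r y * PP n r y", OF _ this, of "\<tau> - r" x] r csts(3)
    have "(\<integral>\<^sup>+y. km (\<tau> - r) (x - y) * (PP n r y * PP n r y) \<partial>lborel) \<le> ennreal (KK * (\<tau> - r) powr (- (1 / \<gamma>)) * ((BB * r powr (- kap)) * (BB * r powr (- kap))))" by simp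
    then show ?thesis using le_less_trans[OF _ ennreal_less_top] by simp
  qed
  have fin2: "ennreal DD * Pquad (PP n) \<tau> x < \<infinity>" proof -
    have "Pquad (PP n) \<tau> x \<le> ennreal (KK * BB * BB * eps * \<tau> powr (- kap))"
      unfolding Pquad_def by (rule Pquad_sup) (use PP_sup csts(3) \<tau> in auto)
    from le_less_trans[OF this ennreal_less_top] show ?thesis by (simp add: ennreal_mult_less_top)
  qed
  let ?B = "\<lambda>r. ennreal DD * ((\<integral>\<^sup>+y. km (\<tau> - r) (x - y) * (PP n r y * PP n r y) \<partial>lborel) * indicator {0<..<\<tau>} r)"
  have h2: "(\<lambda>z. quad (\<zeta>(i := z)) (VV n (\<zeta>(i := z))) \<tau> x j) holomorphic_on ball 0 (S powr (1 / \<gamma> - 1))"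
    unfolding quad_def proof (rule holomorphic_lebesgue_integral_strong[OF open_ball, where B = "\<lambda>r. enn2real (?B r)"])
    show "integrable lborel (\<lambda>r. enn2real (?B r))" proof (rule integrable_enn2real)
      have "(\<integral>\<^sup>+r. ?B r \<partial>lborel) = ennreal DD * Pquad (PP n) \<tau> x" unfolding Pquad_def by (rule nn_integral_cmult) measurable
      then show "(\<integral>\<^sup>+r. ?B r \<partial>lborel) < \<infinity>" using fin2 by simp
    qed measurable
    show "(\<lambda>r. indicator {0<..<\<tau>} r *\<^sub>R NLc (\<zeta>(i := z)) j (\<tau> - r) (VV n (\<zeta>(i := z)) r) x) \<in> borel_measurable lborel" for z
      unfolding NLc_def by measurable
    fix r
    show "(\<lambda>z. indicator {0<..<\<tau>} r *\<^sub>R NLc (\<zeta>(i := z)) j (\<tau> - r) (VV n (\<zeta>(i := z)) r) x) holomorphic_on ball 0 (S powr (1 / \<gamma> - 1))"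
    proof (cases "r \<in> {0<..<\<tau>}")
      case True
      then have r: "0 < r" "r < \<tau>" "r \<le> S" "0 < \<tau> - r" "\<tau> - r \<le> S" using \<tau> by auto
      have "(\<lambda>z. NLc (\<zeta>(i := z)) j (\<tau> - r) (VV n (\<zeta>(i := z)) r) x) holomorphic_on ball 0 (S powr (1 / \<gamma> - 1))"
        unfolding NLc_def proof (intro holomorphic_on_sum)
        fix l m
        show "(\<lambda>z. \<integral>y. kcs m j l (\<tau> - r) (\<zeta>(i := z)) (x - y) * (VV n (\<zeta>(i := z)) r y m * VV n (\<zeta>(i := z)) r y l) \<partial>lborel) holomorphic_on ball 0 (S powr (1 / \<gamma> - 1))"
        proof (rule holomorphic_lebesgue_integral_strong[OF open_ball, where B = "\<lambda>y. enn2real (km (\<tau> - r) (x - y) * (PP n r y * PP n r y))"])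
          show "integrable lborel (\<lambda>y. enn2real (km (\<tau> - r) (x - y) * (PP n r y * PP n r y)))"
            by (rule integrable_enn2real[OF _ kmfin[OF r(1,2)]]) measurable
          show "(\<lambda>z. kcs m j l (\<tau> - r) (\<zeta>(i := z)) (x - y) * (VV n (\<zeta>(i := z)) r y m * VV n (\<zeta>(i := z)) r y l)) holomorphic_on ball 0 (S powr (1 / \<gamma> - 1))" for y
            by (intro holomorphic_on_mult kcs_holomorphic a r Suc.IH)
          fix z :: complex and y assume z: "z \<in> ball 0 (S powr (1 / \<gamma> - 1))"
          show "(\<lambda>y. kcs m j l (\<tau> - r) (\<zeta>(i := z)) (x - y) * (VV n (\<zeta>(i := z)) r y m * VV n (\<zeta>(i := z)) r y l)) \<in> borel_measurable lborel" by measurable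
          have "km (\<tau> - r) (x - y) * (PP n r y * PP n r y) < \<infinity>"
            using km_finite[OF r(4), of "x - y"] PPfin[OF r(1,3), of y] by (simp add: ennreal_mult_less_top)
          then show "norm (kcs m j l (\<tau> - r) (\<zeta>(i := z)) (x - y) * (VV n (\<zeta>(i := z)) r y m * VV n (\<zeta>(i := z)) r y l)) \<le> enn2real (km (\<tau> - r) (x - y) * (PP n r y * PP n r y))"
            by (rule norm_le_enn2real[OF NLc_term_bound[where w = "VV n (\<zeta>(i := z)) r", OF adm_upd[OF a z] r(4,5) VV_bound[OF adm_upd[OF a z] r(1,3)]]])
        qed
      qed
      then show ?thesis using True by simp
    qed simp
    fix z :: complex assume z: "z \<in> ball 0 (S powr (1 / \<gamma> - 1))"
    have "?B r < \<infinity>" using kmfin[of r] by (cases "r \<in> {0<..<\<tau>}") (simp_all add: ennreal_mult_less_top)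
    then show "norm (indicator {0<..<\<tau>} r *\<^sub>R NLc (\<zeta>(i := z)) j (\<tau> - r) (VV n (\<zeta>(i := z)) r) x) \<le> enn2real (?B r)"
      by (intro norm_le_enn2real quad_term_bound adm_upd[OF a z] \<tau> VV_bound)
  qed
  show ?case unfolding VV.simps by (intro holomorphic_on_diff h1 h2)
qed simp

text \<open>The rate in \<open>UU_limit\<close> is the same for all admissible \<zeta>, so
  convergence is uniform and holomorphy passes to the limit.\<close>

lemma UU_holomorphic:
  assumes a: "adm S \<zeta>" and \<tau>: "0 < \<tau>" "\<tau> \<le> S"
  shows "(\<lambda>z. UU (\<zeta>(i := z)) \<tau> x j) holomorphic_on ball 0 (S powr (1 / \<gamma> - 1))"
proof (rule holomorphic_uniform_sequence[OF open_ball VV_holomorphic[OF a \<tau>]])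
  let ?D = "ball 0 (S powr (1 / \<gamma> - 1)) :: complex set"
  have "uniform_limit ?D (\<lambda>n z. VV n (\<zeta>(i := z)) \<tau> x j) (\<lambda>z. UU (\<zeta>(i := z)) \<tau> x j) sequentially"
    unfolding uniform_limit_iff proof (intro allI impI)
    fix e :: real assume "0 < e"
    moreover have "(\<lambda>n. (2 * BB * \<tau> powr (- kap)) / 2 ^ n) \<longlonglongrightarrow> 0" by (rule LIMSEQ_divide_realpow_zero) simp
    ultimately have "\<forall>\<^sub>F n in sequentially. (2 * BB * \<tau> powr (- kap)) / 2 ^ n < e" by (rule_tac order_tendstoD(2))
    then show "\<forall>\<^sub>F n in sequentially. \<forall>z\<in>?D. dist (VV n (\<zeta>(i := z)) \<tau> x j) (UU (\<zeta>(i := z)) \<tau> x j) < e"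
    proof eventually_elim
      case (elim n)
      show ?case proof
        fix z :: complex assume z: "z \<in> ?D"
        show "dist (VV n (\<zeta>(i := z)) \<tau> x j) (UU (\<zeta>(i := z)) \<tau> x j) < e" proof -
          have "norm (VV n (\<zeta>(i := z)) \<tau> x j - UU (\<zeta>(i := z)) \<tau> x j) \<le> 2 * BB / 2 ^ n * \<tau> powr (- kap)"
            by (rule UU_limit(2)[OF adm_upd[OF a z] \<tau>])
          then show ?thesis using elim by (simp add: dist_norm)
        qed
      qed
    qed
  qed
  note lim = this
  fix z assume "z \<in> ?D"
  then obtain d where "0 < d" "cball z d \<subseteq> ?D" using bspec[OF iffD1[OF open_contains_cball open_ball]] by blast
  with uniform_limit_on_subset[OF lim] show "\<exists>d>0. cball z d \<subseteq> ?D \<and> uniform_limit (cball z d) (\<lambda>n z. VV n (\<zeta>(i := z)) \<tau> x j) (\<lambda>z. UU (\<zeta>(i := z)) \<tau> x j) sequentially"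
    by blast
qed

lemma lin_translate: "lin (cvec h) \<tau> x j = lin (\<lambda>_. 0) \<tau> (x + \<tau> *\<^sub>R h) j"
proof -
  have "gcs \<tau> (cvec h) (x - y) = gcs \<tau> (\<lambda>_. 0) (x + \<tau> *\<^sub>R h - y)" for y
    unfolding gcs_def cvec_def by (rule arg_cong[where f = "gc \<tau>"]) (auto simp: algebra_simps)
  then show ?thesis by (simp add: lin_def)
qed

text \<open>At real \<zeta> each iterate is the unshifted one at a translated point; this makes
  \<open>UU\<close> an extension of a function of the real variable.\<close>

lemma VV_translate: "VV n (cvec h) \<tau> x j = VV n (\<lambda>_. 0) \<tau> (x + \<tau> *\<^sub>R h) j"
proof (induction n arbitrary: \<tau> x j)
  case (Suc n)
  have "VV n (cvec h) r = (\<lambda>y. VV n (\<lambda>_. 0) r (y + r *\<^sub>R h))" for r by (intro ext Suc.IH)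
  then have "NLc (cvec h) j (\<tau> - r) (VV n (cvec h) r) x = NLc (\<lambda>_. 0) j (\<tau> - r) (VV n (\<lambda>_. 0) r) (x + \<tau> *\<^sub>R h)" for r
    using NLc_translate[of h j "\<tau> - r" "VV n (\<lambda>_. 0) r" r x] by simp
  then show ?case by (simp add: quad_def lin_translate)
qed simp

lemma UU_translate: "UU (cvec h) \<tau> x j = UU (\<lambda>_. 0) \<tau> (x + \<tau> *\<^sub>R h) j"
  unfolding UU_def VV_translate ..

section \<open>Identification of the limit with the given solution\<close>

definition uc :: "real \<Rightarrow> real^'n \<Rightarrow> 'n \<Rightarrow> complex" where "uc r y m = of_real (u (t0 + r) y $ m)"

lemma uc_restart:
  assumes "0 < \<tau>" "\<tau> \<le> S"
  shows "uc \<tau> x j = lin (\<lambda>_. 0) \<tau> x j - quad (\<lambda>_. 0) uc \<tau> x j"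
    and "integrable lborel (\<lambda>r. indicator {0<..<\<tau>} r *\<^sub>R NLc (\<lambda>_. 0) j (\<tau> - r) (uc r) x)"
proof -
  have N: "NLc (\<lambda>_. 0) j s (uc r) x = of_real (NL j s (u (t0 + r)) x)" for r s using NLc_real[of j s "u (t0 + r)" x] unfolding uc_def .
  have e: "indicator {0<..<\<tau>} r *\<^sub>R NLc (\<lambda>_. 0) j (\<tau> - r) (uc r) x = complex_of_real (indicator {0<..<\<tau>} r * NL j (\<tau> - r) (u (t0 + r)) x)" for r
    unfolding N by (simp add: scaleR_conv_of_real)
  note R = restart[OF t0 assms(1) t0T[of \<tau>], where x = x and j = j]
  have r: "0 \<le> \<tau>" using assms by simp
  show "integrable lborel (\<lambda>r. indicator {0<..<\<tau>} r *\<^sub>R NLc (\<lambda>_. 0) j (\<tau> - r) (uc r) x)"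
    unfolding e using R(2)[OF r assms(2)] by (rule integrable_of_real)
  have "gcs \<tau> (\<lambda>_. 0) z = of_real (Gr \<tau> z)" for z :: "real^'n" by (simp add: gcs_def gc_real)
  then have l: "lin (\<lambda>_. 0) \<tau> x j = of_real (LBINT y. Gr \<tau> (x - y) * u t0 y $ j)"
    unfolding lin_def integral_complex_of_real[symmetric] by simp
  show "uc \<tau> x j = lin (\<lambda>_. 0) \<tau> x j - quad (\<lambda>_. 0) uc \<tau> x j"
    unfolding l quad_def e integral_complex_of_real uc_def R(3)[OF r assms(2)] by simp
qed

lemma uc_measurable: "0 < r \<Longrightarrow> r \<le> S \<Longrightarrow> (\<lambda>y. uc r y m) \<in> borel_measurable borel"
proof -
  assume "0 < r" "r \<le> S"
  then have [measurable]: "u (t0 + r) \<in> borel_measurable borel" using umeas[of "t0 + r"] t0T[of r] t0 by simp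
  show ?thesis unfolding uc_def by measurable
qed

lemma uc_Lq:
  assumes "0 < r" "r \<le> S"
  shows "(\<integral>\<^sup>+x. epow q (un (t0 + r) x) \<partial>lborel) \<le> ennreal (NN powr q)"
proof (rule order_trans[OF un_Lq])
  have "(t0 + r) powr (- alp) \<le> t0 powr (- alp)" using assms t0 exponents(5) by (intro powr_mono2') auto
  then have "M * (t0 + r) powr (- alp) \<le> NN" using M unfolding NN_def by (intro mult_left_mono) auto
  then show "ennreal ((M * (t0 + r) powr (- alp)) powr q) \<le> ennreal (NN powr q)" using M exponents(1) by (intro ennreal_leI powr_mono2) auto
qed (use assms t0 t0T[of r] in auto)

text \<open>Integrability of the Duhamel integrand gives measurability in r; the L^q bounds with q
  \<ge> 2 give continuity in x.\<close>

lemma NLc_caratheodory: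
  assumes \<tau>: "\<tau> \<le> S" and int: "\<And>x. integrable lborel (\<lambda>r. indicator {0<..<\<tau>} r *\<^sub>R NLc (\<lambda>_. 0) j (\<tau> - r) (uc r) x)"
    and q2: "2 \<le> q"
  shows "(\<lambda>(r, x). indicator {0<..<\<tau>} r * NL j (\<tau> - r) (u (t0 + r)) x) \<in> borel_measurable (borel \<Otimes>\<^sub>M borel)"
proof (rule caratheodory_measurable)
  fix x
  have N: "NLc (\<lambda>_. 0) j s (uc r) x = of_real (NL j s (u (t0 + r)) x)" for r s using NLc_real[of j s "u (t0 + r)" x] unfolding uc_def .
  have "indicator {0<..<\<tau>} r * NL j (\<tau> - r) (u (t0 + r)) x = Re (indicator {0<..<\<tau>} r *\<^sub>R NLc (\<lambda>_. 0) j (\<tau> - r) (uc r) x)" for r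
    unfolding N by simp
  note e = this
  have "(\<lambda>r. indicator {0<..<\<tau>} r *\<^sub>R NLc (\<lambda>_. 0) j (\<tau> - r) (uc r) x) \<in> borel_measurable borel"
    using borel_measurable_integrable[OF int[of x]] by simp
  then show "(\<lambda>r. indicator {0<..<\<tau>} r * NL j (\<tau> - r) (u (t0 + r)) x) \<in> borel_measurable borel"
    unfolding e by measurable
next
  fix r
  show "continuous_on UNIV (\<lambda>x. indicator {0<..<\<tau>} r * NL j (\<tau> - r) (u (t0 + r)) x)" proof (cases "r \<in> {0<..<\<tau>}")
    case True
    then have r: "0 < r" "r \<le> S" "0 < \<tau> - r" using \<tau> by auto
    have [measurable]: "u (t0 + r) \<in> borel_measurable borel" "un (t0 + r) \<in> borel_measurable borel"
      using umeas[of "t0 + r"] un_measurable[of "t0 + r"] t0T[of r] t0 r by auto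
    have "continuous_on UNIV (\<lambda>x. NL j (\<tau> - r) (u (t0 + r)) x)" unfolding NL_def proof (intro continuous_on_sum kr_conv_continuous r(3))
      fix l m and x :: "real^'n"
      have "(\<integral>\<^sup>+y. km (\<tau> - r) (x - y) * ennreal \<bar>u (t0 + r) y $ m * u (t0 + r) y $ l\<bar> \<partial>lborel) \<le> (\<integral>\<^sup>+y. km (\<tau> - r) (x - y) * (un (t0 + r) y * un (t0 + r) y) \<partial>lborel)"
        by (intro nn_integral_mono mult_left_mono) (auto simp: un_def abs_mult ennreal_mult intro!: mult_mono ennreal_leI component_le_norm_cart)
      also have "\<dots> < \<infinity>" by (rule km_trilinear(2)[OF r(3) q2 _ _ uc_Lq[OF r(1,2)] _ uc_Lq[OF r(1,2)]]) (use csts(2) in auto)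
      finally show "(\<integral>\<^sup>+y. km (\<tau> - r) (x - y) * ennreal \<bar>u (t0 + r) y $ m * u (t0 + r) y $ l\<bar> \<partial>lborel) < \<infinity>" .
    qed measurable
    then show ?thesis using True by simp
  qed simp
qed

text \<open>The constant is the square of d = CARD('n): comparing the sum with the largest term
  costs d powr q, and bounding the maximum by the sum of powers costs d \<le> d powr q.\<close>

lemma Lq_sum:
  fixes f :: "'n \<Rightarrow> real^'n \<Rightarrow> ennreal"
  assumes [measurable]: "\<And>j. f j \<in> borel_measurable borel" and f: "\<And>j. (\<integral>\<^sup>+x. epow q (f j x) \<partial>lborel) \<le> ennreal (a powr q)" and a: "0 \<le> a"
  shows "(\<integral>\<^sup>+x. epow q (\<Sum>j\<in>UNIV. f j x) \<partial>lborel) \<le> ennreal ((DD * a) powr q)"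
proof -
  let ?d = "real CARD('n)"
  have q: "1 < q" by (rule exponents)
  have s: "(\<Sum>j\<in>UNIV. f j x) \<le> ennreal ?d * (SUP j. f j x)" for x proof -
    have "(\<Sum>j\<in>UNIV. f j x) \<le> (\<Sum>j\<in>(UNIV::'n set). (SUP j. f j x))" by (intro sum_mono SUP_upper) auto
    then show ?thesis by (simp add: ennreal_of_nat_eq_real_of_nat)
  qed
  have "epow q (\<Sum>j\<in>UNIV. f j x) \<le> ennreal (?d powr q) * (\<Sum>j\<in>UNIV. epow q (f j x))" for x proof -
    \<comment> \<open>The supremum over finitely many components is attained.\<close>
    have "(SUP j. f j x) \<in> range (\<lambda>j. f j x)" using Max_in[of "range (\<lambda>j. f j x)"] by (simp add: Max_Sup)
    then obtain j where j: "(SUP j. f j x) = f j x" by auto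
    have "epow q (\<Sum>j\<in>UNIV. f j x) \<le> epow q (ennreal ?d * f j x)" using s[of x] q unfolding j by (intro epow_mono) auto
    also have "\<dots> = ennreal (?d powr q) * epow q (f j x)" by (simp add: epow_scale)
    also have "\<dots> \<le> ennreal (?d powr q) * (\<Sum>j\<in>UNIV. epow q (f j x))" by (intro mult_left_mono member_le_sum) auto
    finally show ?thesis .
  qed
  then have "(\<integral>\<^sup>+x. epow q (\<Sum>j\<in>UNIV. f j x) \<partial>lborel) \<le> (\<integral>\<^sup>+x. ennreal (?d powr q) * (\<Sum>j\<in>UNIV. epow q (f j x)) \<partial>lborel)"
    by (intro nn_integral_mono)
  also have "\<dots> = ennreal (?d powr q) * (\<Sum>j\<in>UNIV. \<integral>\<^sup>+x. epow q (f j x) \<partial>lborel)"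
    by (simp add: nn_integral_cmult nn_integral_sum)
  also have "\<dots> \<le> ennreal (?d powr q) * (\<Sum>j\<in>(UNIV::'n set). ennreal (a powr q))" by (intro mult_left_mono sum_mono f) auto
  also have "\<dots> = ennreal (?d powr q * (?d * a powr q))" by (simp add: ennreal_mult ennreal_of_nat_eq_real_of_nat)
  also have "\<dots> \<le> ennreal ((DD * a) powr q)" proof (rule ennreal_leI)
    have "?d powr 1 \<le> ?d powr q" using q exponents(11) by (intro powr_mono) auto
    then have "?d powr q * (?d * a powr q) \<le> ?d powr q * (?d powr q * a powr q)" by (intro mult_left_mono mult_right_mono) auto
    also have "\<dots> = (DD * a) powr q" using a by (simp add: DD_def power2_eq_square powr_mult)
    finally show "?d powr q * (?d * a powr q) \<le> (DD * a) powr q" .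
  qed
  finally show ?thesis .
qed

definition errj :: "nat \<Rightarrow> real \<Rightarrow> 'n \<Rightarrow> real^'n \<Rightarrow> ennreal" where
  "errj n \<tau> j x = ennreal (norm (VV n (\<lambda>_. 0) \<tau> x j - uc \<tau> x j))"

lemma errj_measurable:
  assumes "0 < \<tau>" "\<tau> \<le> S" shows "errj n \<tau> j \<in> borel_measurable borel"
proof -
  have [measurable]: "(\<lambda>x. VV n (\<lambda>_. 0) \<tau> x j) \<in> borel_measurable borel" by measurable
  note uc_measurable[OF assms, measurable]
  show ?thesis unfolding errj_def by measurable
qed

text \<open>With L^q bounds alone the kernel must absorb a product of two L^q functions. The
  singularity is then the power 1/\<gamma> + kap of the age, without a weight in r, since the L^q
  norms are uniformly bounded after t0.\<close>

lemma errj_step: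
  assumes q2: "2 \<le> q" and \<tau>: "0 < \<tau>" "\<tau> \<le> S" and E: "0 \<le> E"
    and IH: "\<And>r m. 0 < r \<Longrightarrow> r \<le> S \<Longrightarrow> (\<integral>\<^sup>+x. epow q (errj n r m x) \<partial>lborel) \<le> ennreal (E powr q)"
  shows "(\<integral>\<^sup>+x. epow q (errj (Suc n) \<tau> j x) \<partial>lborel) \<le> ennreal ((E / 2) powr q)"
proof -
  have q1: "1 \<le> q" "0 < q" using q2 by auto
  let ?V = "VV n (\<lambda>_. 0)"
  \<comment> \<open>The part belonging to u is written with \<open>NL\<close>, the form in which
    \<open>NLc_caratheodory\<close> supplies joint measurability.\<close>
  let ?G = "\<lambda>r x. indicator {0<..<\<tau>} r *\<^sub>R NLc (\<lambda>_. 0) j (\<tau> - r) (?V r) x - complex_of_real (indicator {0<..<\<tau>} r * NL j (\<tau> - r) (u (t0 + r)) x)"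
  have G: "?G r x = indicator {0<..<\<tau>} r *\<^sub>R NLc (\<lambda>_. 0) j (\<tau> - r) (?V r) x - indicator {0<..<\<tau>} r *\<^sub>R NLc (\<lambda>_. 0) j (\<tau> - r) (uc r) x" for r x
    using NLc_real[of j "\<tau> - r" "u (t0 + r)" x] unfolding uc_def by (simp add: scaleR_conv_of_real)
  note NLc_caratheodory[OF \<tau>(2) uc_restart(2)[OF \<tau>] q2, of j, measurable]
  have [measurable]: "(\<lambda>(r, x). ?G r x) \<in> borel_measurable (borel \<Otimes>\<^sub>M borel)"
    unfolding NLc_def by measurable
  have "errj (Suc n) \<tau> j x \<le> (\<integral>\<^sup>+r. ennreal (norm (?G r x)) * indicator {0<..<\<tau>} r \<partial>lborel)" for x proof -
    have iV: "integrable lborel (\<lambda>r. indicator {0<..<\<tau>} r *\<^sub>R NLc (\<lambda>_. 0) j (\<tau> - r) (?V r) x)"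
      by (rule quad_integrable[OF adm_0[OF S] \<tau> VV_measurable VV_sup[OF adm_0[OF S]]]) (use csts in auto)
    have "VV (Suc n) (\<lambda>_. 0) \<tau> x j - uc \<tau> x j = - (quad (\<lambda>_. 0) ?V \<tau> x j - quad (\<lambda>_. 0) uc \<tau> x j)"
      unfolding VV.simps uc_restart(1)[OF \<tau>, of x j] by simp
    also have "quad (\<lambda>_. 0) ?V \<tau> x j - quad (\<lambda>_. 0) uc \<tau> x j = (LBINT r. ?G r x)"
      unfolding G quad_def by (rule Bochner_Integration.integral_diff[symmetric, OF iV uc_restart(2)[OF \<tau>]])
    finally have "errj (Suc n) \<tau> j x = ennreal (norm (LBINT r. ?G r x))" unfolding errj_def by (simp only: norm_minus_cancel)
    also have "\<dots> \<le> (\<integral>\<^sup>+r. ennreal (norm (?G r x)) \<partial>lborel)" by (rule norm_integral_le_nn_integral)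
    also have "\<dots> = (\<integral>\<^sup>+r. ennreal (norm (?G r x)) * indicator {0<..<\<tau>} r \<partial>lborel)"
      by (intro nn_integral_cong) (simp add: indicator_def)
    finally show ?thesis .
  qed
  then have "(\<integral>\<^sup>+x. epow q (errj (Suc n) \<tau> j x) \<partial>lborel) \<le> (\<integral>\<^sup>+x. epow q (\<integral>\<^sup>+r. ennreal (norm (?G r x)) * indicator {0<..<\<tau>} r \<partial>lborel) \<partial>lborel)"
    by (intro nn_integral_mono epow_mono q1)
  also have "\<dots> \<le> ennreal ((DD * KK * (DD * E) * (4 * (QQ + NN)) * eps) powr q)"
  proof (rule minkowski_time[where \<phi> = "\<lambda>r. (\<tau> - r) powr (- (1 / \<gamma> + kap))"])
    show "sigma_finite_measure (lborel :: (real^'n) measure)" by (rule lborel.sigma_finite_measure_axioms)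
    show "(\<lambda>(r, x). ennreal (norm (?G r x))) \<in> borel_measurable (lborel \<Otimes>\<^sub>M lborel)" by measurable
    fix r assume r: "0 < r" "r < \<tau>"
    have rS: "r \<le> S" "0 < \<tau> - r" "\<tau> - r \<le> S" using r \<tau> by auto
    note errj_measurable[OF r(1) rS(1), measurable] uc_measurable[OF r(1) rS(1), measurable]
    have [measurable]: "PP n r \<in> borel_measurable borel" "\<And>m. (\<lambda>y. ?V r y m) \<in> borel_measurable borel" by measurable
    have [measurable]: "un (t0 + r) \<in> borel_measurable borel" using un_measurable[of "t0 + r"] t0T[of r] t0 r rS by simp
    let ?d = "\<lambda>y. \<Sum>m\<in>UNIV. errj n r m y"
    let ?I = "\<lambda>x. \<integral>\<^sup>+y. km (\<tau> - r) (x - y) * (?d y * (PP n r y + un (t0 + r) y)) \<partial>lborel"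
    have b: "ennreal (norm (?G r x)) \<le> ennreal DD * ?I x" for x proof -
      have "ennreal (norm (NLc (\<lambda>_. 0) j (\<tau> - r) (?V r) x - NLc (\<lambda>_. 0) j (\<tau> - r) (uc r) x)) \<le> ennreal ((real CARD('n))\<^sup>2) * ?I x"
      proof (rule NLc_diff[OF adm_0[OF S] rS(2,3) VV_bound[OF adm_0[OF S] r(1) rS(1)]])
        show "ennreal (norm (uc r y m)) \<le> un (t0 + r) y" for y m by (simp add: uc_def un_def component_le_norm_cart ennreal_leI)
        show "ennreal (norm (?V r y m - uc r y m)) \<le> ?d y" for y m
          unfolding errj_def[symmetric] by (rule member_le_sum) auto
        show "(\<integral>\<^sup>+y. km (\<tau> - r) (x - y) * (PP n r y * PP n r y) \<partial>lborel) < \<infinity>"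
          by (rule km_trilinear(2)[OF rS(2) q2 _ _ PP_Lq[OF r(1) rS(1)] _ PP_Lq[OF r(1) rS(1)]]) (use csts(4) in auto)
        show "(\<integral>\<^sup>+y. km (\<tau> - r) (x - y) * (un (t0 + r) y * un (t0 + r) y) \<partial>lborel) < \<infinity>"
          by (rule km_trilinear(2)[OF rS(2) q2 _ _ uc_Lq[OF r(1) rS(1)] _ uc_Lq[OF r(1) rS(1)]]) (use csts(2) in auto)
      qed measurable
      then show ?thesis unfolding G using r by (simp add: DD_def)
    qed
    have dq: "(\<integral>\<^sup>+y. epow q (?d y) \<partial>lborel) \<le> ennreal ((DD * E) powr q)"
      by (rule Lq_sum[OF _ IH[OF r(1) rS(1)] E]) measurable
    have pq: "(\<integral>\<^sup>+y. epow q (PP n r y + un (t0 + r) y) \<partial>lborel) \<le> ennreal ((4 * (QQ + NN)) powr q)"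
    proof (rule Lq_add[OF q1(1)])
      show "(\<integral>\<^sup>+y. epow q (PP n r y) \<partial>lborel) \<le> ennreal ((QQ + NN) powr q)"
        by (rule order_trans[OF PP_Lq[OF r(1) rS(1)]]) (use csts q1 in \<open>auto intro!: ennreal_leI powr_mono2\<close>)
      show "(\<integral>\<^sup>+y. epow q (un (t0 + r) y) \<partial>lborel) \<le> ennreal ((QQ + NN) powr q)"
        by (rule order_trans[OF uc_Lq[OF r(1) rS(1)]]) (use csts q1 in \<open>auto intro!: ennreal_leI powr_mono2\<close>)
    qed (use csts in auto)
    have "(\<integral>\<^sup>+x. epow q (ennreal (norm (?G r x))) \<partial>lborel) \<le> (\<integral>\<^sup>+x. epow q (ennreal DD * ?I x) \<partial>lborel)"
      by (intro nn_integral_mono epow_mono q1 b)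
    also have "\<dots> = ennreal (DD powr q) * (\<integral>\<^sup>+x. epow q (?I x) \<partial>lborel)"
      using DD_pos by (simp add: epow_scale nn_integral_cmult)
    also have "\<dots> \<le> ennreal (DD powr q) * ennreal ((KK * (\<tau> - r) powr (- (1 / \<gamma> + kap)) * (DD * E) * (4 * (QQ + NN))) powr q)"
      by (intro mult_left_mono km_trilinear(1)[OF rS(2) q2 _ _ dq _ pq]) (use csts E DD_pos in auto)
    also have "\<dots> = ennreal ((DD * KK * (DD * E) * (4 * (QQ + NN)) * (\<tau> - r) powr (- (1 / \<gamma> + kap))) powr q)" proof -
      have "ennreal (DD powr q) * ennreal ((KK * (\<tau> - r) powr (- (1 / \<gamma> + kap)) * (DD * E) * (4 * (QQ + NN))) powr q)
        = ennreal ((DD * (KK * (\<tau> - r) powr (- (1 / \<gamma> + kap)) * (DD * E) * (4 * (QQ + NN)))) powr q)"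
        using DD_pos KK_pos E csts by (subst powr_mult) (auto simp: ennreal_mult)
      then show ?thesis by (simp only: mult_ac)
    qed
    finally show "(\<integral>\<^sup>+x. epow q (ennreal (norm (?G r x))) \<partial>lborel) \<le> ennreal ((DD * KK * (DD * E) * (4 * (QQ + NN)) * (\<tau> - r) powr (- (1 / \<gamma> + kap))) powr q)" .
  qed (use time_ints(3)[OF \<tau>] csts KK_pos DD_pos E q1 in auto)
  also have "\<dots> \<le> ennreal ((E / 2) powr q)" proof (intro ennreal_leI powr_mono2)
    have "DD * KK * (DD * E) * (4 * (QQ + NN)) * eps = (DD * KK * DD * (4 * (QQ + NN)) * eps) * E" by (simp add: mult_ac)
    also have "\<dots> \<le> (1 / 2) * E" by (intro mult_right_mono small_consts(2) E)
    finally show "DD * KK * (DD * E) * (4 * (QQ + NN)) * eps \<le> E / 2" by simp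
  qed (use csts KK_pos DD_pos E q1 in auto)
  finally show ?thesis .
qed

lemma errj_bound:
  assumes q2: "2 \<le> q"
  shows "0 < \<tau> \<Longrightarrow> \<tau> \<le> S \<Longrightarrow> (\<integral>\<^sup>+x. epow q (errj n \<tau> j x) \<partial>lborel) \<le> ennreal ((NN / 2 ^ n) powr q)"
proof (induction n arbitrary: \<tau> j)
  case 0
  have "(\<integral>\<^sup>+x. epow q (errj 0 \<tau> j x) \<partial>lborel) \<le> (\<integral>\<^sup>+x. epow q (un (t0 + \<tau>) x) \<partial>lborel)"
    using exponents(1) by (intro nn_integral_mono epow_mono) (auto simp: errj_def uc_def un_def component_le_norm_cart intro!: ennreal_leI)
  also have "\<dots> \<le> ennreal (NN powr q)" by (rule uc_Lq[OF 0])
  finally show ?case by simp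
next
  case (Suc n)
  have "(\<integral>\<^sup>+x. epow q (errj (Suc n) \<tau> j x) \<partial>lborel) \<le> ennreal ((NN / 2 ^ n / 2) powr q)"
    by (rule errj_step[OF q2 Suc.prems _ Suc.IH]) (use csts(2) in auto)
  then show ?case by (simp add: mult.commute)
qed

text \<open>By Fatou the L^q norm of the limiting error is at most the lower limit of NN/2^n, which
  is 0.\<close>

lemma uc_AE:
  assumes q2: "2 \<le> q" and \<tau>: "0 < \<tau>" "\<tau> \<le> S"
  shows "AE x in lborel. uc \<tau> x j = UU (\<lambda>_. 0) \<tau> x j"
proof -
  have q: "0 < q" using q2 by simp
  note uc_measurable[OF \<tau>, measurable] errj_measurable[OF \<tau>, measurable]
  have [measurable]: "(\<lambda>x. UU (\<lambda>_. 0) \<tau> x j) \<in> borel_measurable borel" by measurable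
  let ?f = "\<lambda>x. ennreal (norm (UU (\<lambda>_. 0) \<tau> x j - uc \<tau> x j) powr q)"
  have "(\<lambda>n. epow q (errj n \<tau> j x)) \<longlonglongrightarrow> ?f x" for x proof -
    have "(\<lambda>n. norm (VV n (\<lambda>_. 0) \<tau> x j - uc \<tau> x j) powr q) \<longlonglongrightarrow> norm (UU (\<lambda>_. 0) \<tau> x j - uc \<tau> x j) powr q"
      by (rule tendsto_powr2[OF tendsto_norm[OF tendsto_diff[OF UU_limit(1)[OF adm_0[OF S] \<tau>] tendsto_const]] tendsto_const _ q]) auto
    then show ?thesis unfolding errj_def by (simp add: tendsto_ennrealI)
  qed
  then have "(\<integral>\<^sup>+x. ?f x \<partial>lborel) = (\<integral>\<^sup>+x. liminf (\<lambda>n. epow q (errj n \<tau> j x)) \<partial>lborel)"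
    by (intro nn_integral_cong lim_imp_Liminf[symmetric]) auto
  also have "\<dots> \<le> liminf (\<lambda>n. \<integral>\<^sup>+x. epow q (errj n \<tau> j x) \<partial>lborel)"
    by (rule nn_integral_liminf) measurable
  also have "\<dots> \<le> liminf (\<lambda>n. ennreal ((NN / 2 ^ n) powr q))" by (intro Liminf_mono always_eventually allI errj_bound[OF q2 \<tau>])
  also have "\<dots> = 0" proof (rule lim_imp_Liminf)
    have "(\<lambda>n. (NN / 2 ^ n) powr q) \<longlonglongrightarrow> 0 powr q"
      by (rule tendsto_powr2[OF LIMSEQ_divide_realpow_zero tendsto_const _ q]) (use csts(2) in auto)
    then show "(\<lambda>n. ennreal ((NN / 2 ^ n) powr q)) \<longlonglongrightarrow> 0" using tendsto_ennrealI by fastforce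
  qed simp
  finally have "(\<integral>\<^sup>+x. ?f x \<partial>lborel) = 0" by simp
  then have "AE x in lborel. ?f x = 0" by (subst (asm) nn_integral_0_iff_AE) auto
  then show ?thesis by eventually_elim (simp add: ennreal_eq_0_iff)
qed

text \<open>Equality almost everywhere becomes equality at every point through the integral
  equation: the nonlinear terms depend only on equivalence classes, and both functions satisfy the
  equation pointwise. For q < 2 the dimension is 1 and the unshifted kernel vanishes.\<close>

lemma uc_eq_UU:
  assumes \<tau>: "0 < \<tau>" "\<tau> \<le> S"
  shows "uc \<tau> x j = UU (\<lambda>_. 0) \<tau> x j"
proof -
  have "NLc (\<lambda>_. 0) j (\<tau> - r) (uc r) x = NLc (\<lambda>_. 0) j (\<tau> - r) (UU (\<lambda>_. 0) r) x" if r: "0 < r" "r < \<tau>" for r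
  proof (cases "2 \<le> q")
    case True
    have rS: "r \<le> S" using r \<tau> by simp
    note uc_measurable[OF r(1) rS, measurable]
    have [measurable]: "(\<lambda>x. UU (\<lambda>_. 0) r x m) \<in> borel_measurable borel" for m by measurable
    show ?thesis unfolding NLc_def proof (intro sum.cong refl integral_cong_AE)
      fix l m
      show "AE y in lborel. kcs m j l (\<tau> - r) (\<lambda>_. 0) (x - y) * (uc r y m * uc r y l) = kcs m j l (\<tau> - r) (\<lambda>_. 0) (x - y) * (UU (\<lambda>_. 0) r y m * UU (\<lambda>_. 0) r y l)"
        using uc_AE[OF True r(1) rS, of m] uc_AE[OF True r(1) rS, of l] by eventually_elim simp
    qed measurable
  next
    case False
    then have "CARD('n) = 1" using q_dim by simp
    then have "kcs m j l (\<tau> - r) (\<lambda>_. 0) z = 0" for m l and z :: "real^'n" using r by (simp add: kcs_def kc_real kr_zero_1d)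
    then show ?thesis by (simp add: NLc_def)
  qed
  then have "quad (\<lambda>_. 0) uc \<tau> x j = quad (\<lambda>_. 0) (UU (\<lambda>_. 0)) \<tau> x j"
    unfolding quad_def by (intro Bochner_Integration.integral_cong refl) (auto simp: indicator_def)
  then show ?thesis using uc_restart(1)[OF \<tau>, of x j] UU_fixed_point[OF adm_0[OF S] \<tau>, of x j] by simp
qed

text \<open>A displacement h at time S corresponds to \<zeta> = h/S, so the radius S powr
  (1/\<gamma> - 1) for \<zeta> becomes S powr (1/\<gamma>) for h.\<close>

lemma solution_hol_ext:
  "hol_ext (S powr (1 / \<gamma>)) (\<lambda>x. u (t0 + S) x $ j) (\<lambda>x. enn2real (Pinf S x))"
  unfolding hol_ext_def proof (intro allI exI conjI impI)
  fix x :: "real^'n"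
  let ?R = "S powr (1 / \<gamma>)" and ?D = "S powr (1 / \<gamma> - 1)"
  have R: "?R / S = ?D" using S by (simp add: powr_diff)
  let ?F = "\<lambda>h. UU (\<lambda>k. h k / of_real S) S x j"
  have ad: "adm S (\<lambda>k. h k / of_real S)" if "\<forall>k. norm (h k) < ?R" for h
    unfolding adm_def R[symmetric] using that S by (auto simp: norm_divide intro!: divide_strict_right_mono)
  show "sep_hol ?R ?F"
    unfolding sep_hol_def proof (intro allI impI)
    fix h :: "'n \<Rightarrow> complex" and i assume h: "\<forall>k. norm (h k) < ?R"
    have hol: "(\<lambda>z. UU ((\<lambda>k. h k / of_real S)(i := z)) S x j) holomorphic_on ball 0 ?D"
      by (rule UU_holomorphic[OF ad[OF h] S order_refl])
    have "(\<lambda>z::complex. z / of_real S) ` ball 0 ?R \<subseteq> ball 0 ?D"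
      unfolding R[symmetric] using S by (auto simp: norm_divide intro!: divide_strict_right_mono)
    then have "((\<lambda>z. UU ((\<lambda>k. h k / of_real S)(i := z)) S x j) \<circ> (\<lambda>z. z / of_real S)) holomorphic_on ball 0 ?R"
      using S by (intro holomorphic_on_compose_gen[OF _ hol] holomorphic_intros) auto
    moreover have "(\<lambda>k. (h(i := z)) k / of_real S) = (\<lambda>k. h k / of_real S)(i := z / of_real S)" for z by auto
    ultimately show "(\<lambda>z. UU (\<lambda>k. (h(i := z)) k / of_real S) S x j) holomorphic_on ball 0 ?R" by (simp add: o_def)
  qed
  show "norm (?F h) \<le> enn2real (Pinf S x)" if "\<forall>k. norm (h k) < ?R" for h
    by (rule norm_le_enn2real[OF UU_limit(3)[OF ad[OF that] S order_refl]])
      (use le_less_trans[OF Pinf_sup[OF S order_refl] ennreal_less_top] in simp)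
  fix y :: "real^'n" assume "\<forall>k. norm (y $ k) < ?R"
  have "(\<lambda>k. cvec y k / of_real S) = cvec ((1 / S) *\<^sub>R y)" by (auto simp: cvec_def)
  then have "?F (cvec y) = UU (\<lambda>_. 0) S (x + y) j" using S by (simp add: UU_translate)
  then show "?F (cvec y) = of_real (u (t0 + S) (x + y) $ j)" using uc_eq_UU[OF S order_refl, of "x + y" j] by (simp add: uc_def)
qed

end

section \<open>Estimates for the solution\<close>

lemma has_vector_derivative_cart:
  fixes g :: "real \<Rightarrow> real^'m::finite"
  assumes "\<And>j. ((\<lambda>s. g s $ j) has_vector_derivative d j) (at a)"
  shows "(g has_vector_derivative (\<chi> j. d j)) (at a)"
  unfolding has_vector_derivative_def proof (subst has_derivative_componentwise_within, intro ballI)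
  fix b :: "real^'m" assume "b \<in> Basis"
  then obtain j where "b = axis j 1" by (auto simp: Basis_vec_def)
  then show "((\<lambda>x. g x \<bullet> b) has_derivative (\<lambda>x. (x *\<^sub>R (\<chi> j. d j)) \<bullet> b)) (at a)"
    using assms[of j] by (simp add: inner_axis has_vector_derivative_def)
qed

text \<open>Holomorphic extensions are scalar, so derivatives are obtained for components first and
  assembled here.\<close>

lemma pdiffs_cart:
  fixes f :: "real^'n::finite \<Rightarrow> real^'m::finite"
  assumes ex: "\<And>j is i x. has_pdiff i (pdiffs is (\<lambda>x. f x $ j)) x"
  shows "pdiffs is f = (\<lambda>x. \<chi> j. pdiffs is (\<lambda>x. f x $ j) x)"
    and "has_pdiff i (pdiffs is f) x"
proof -
  have d: "((\<lambda>s. \<chi> j. pdiffs is (\<lambda>x. f x $ j) (x + s *\<^sub>R axis i 1)) has_vector_derivative (\<chi> j. pdiff i (pdiffs is (\<lambda>x. f x $ j)) x)) (at 0)" for "is" x i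
    using ex by (intro has_vector_derivative_cart) (simp add: has_pdiff_def pdiff_def vector_derivative_works)
  have c: "pdiffs is f = (\<lambda>x. \<chi> j. pdiffs is (\<lambda>x. f x $ j) x)" for "is" proof (induction "is")
    case (Cons i "is")
    show ?case unfolding pdiffs.simps Cons.IH by (rule ext, subst pdiff_def) (rule vector_derivative_at[OF d])
  qed simp
  show "pdiffs is f = (\<lambda>x. \<chi> j. pdiffs is (\<lambda>x. f x $ j) x)" by (rule c)
  show "has_pdiff i (pdiffs is f) x" unfolding has_pdiff_def c using d by (auto simp: differentiable_def has_vector_derivative_def)
qed

lemma pdiff_measurable:
  fixes f :: "real^'n::finite \<Rightarrow> 'b::euclidean_space"
  assumes [measurable]: "f \<in> borel_measurable borel" and ex: "\<And>x. has_pdiff i f x"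
  shows "pdiff i f \<in> borel_measurable borel"
proof (rule borel_measurable_LIMSEQ_metric)
  let ?h = "\<lambda>n. inverse (real (Suc n))"
  show "(\<lambda>x. (f (x + ?h n *\<^sub>R axis i 1) - f x) /\<^sub>R ?h n) \<in> borel_measurable borel" for n by measurable
  fix x
  let ?g = "\<lambda>s. f (x + s *\<^sub>R axis i 1)"
  have "(?g has_vector_derivative pdiff i f x) (at 0)" using ex[of x] by (simp add: has_pdiff_def pdiff_def vector_derivative_works)
  then have n: "((\<lambda>h. norm (?g (0 + h) - ?g 0 - h *\<^sub>R pdiff i f x) / norm h) \<longlongrightarrow> 0) (at 0)"
    unfolding has_vector_derivative_def has_derivative_at by (rule conjunct2)
  have "((\<lambda>h. norm ((?g (0 + h) - ?g 0) /\<^sub>R h - pdiff i f x)) \<longlongrightarrow> 0) (at 0)"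
  proof (rule Lim_transform_eventually[OF n])
    have "norm (v - h *\<^sub>R w) / norm h = norm (v /\<^sub>R h - w)" if "h \<noteq> 0" for h :: real and v w :: 'b proof -
      have "v /\<^sub>R h - w = (v - h *\<^sub>R w) /\<^sub>R h" using that by (simp add: scaleR_diff_right)
      then show ?thesis by (simp add: divide_inverse mult.commute)
    qed
    then show "\<forall>\<^sub>F h in at 0. norm (?g (0 + h) - ?g 0 - h *\<^sub>R pdiff i f x) / norm h = norm ((?g (0 + h) - ?g 0) /\<^sub>R h - pdiff i f x)"
      unfolding eventually_at_filter by (intro always_eventually) blast
  qed
  then have "((\<lambda>h. (?g (0 + h) - ?g 0) /\<^sub>R h) \<longlongrightarrow> pdiff i f x) (at 0)"
    by (rule LIM_zero_cancel[OF tendsto_norm_zero_cancel])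
  moreover have "filterlim ?h (at 0) sequentially"
    unfolding filterlim_at using LIMSEQ_inverse_real_of_nat by auto
  ultimately show "(\<lambda>n. (f (x + ?h n *\<^sub>R axis i 1) - f x) /\<^sub>R ?h n) \<longlonglongrightarrow> pdiff i f x"
    using filterlim_compose[of "\<lambda>h. (?g (0 + h) - ?g 0) /\<^sub>R h" "nhds (pdiff i f x)" "at 0" ?h sequentially] by simp
qed

lemma pdiffs_measurable:
  fixes f :: "real^'n::finite \<Rightarrow> 'b::euclidean_space"
  assumes "f \<in> borel_measurable borel" and "\<And>is i x. has_pdiff i (pdiffs is f) x"
  shows "pdiffs is f \<in> borel_measurable borel"
  using assms by (induction "is") (auto intro: pdiff_measurable)

text \<open>Pointwise, |f| powr q' \<le> Z powr (q' - q) times |f| powr q.\<close>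

lemma Lnorm_interpolation:
  fixes f :: "real^'n \<Rightarrow> 'b::euclidean_space"
  assumes [measurable]: "f \<in> borel_measurable borel" and Z: "\<And>x. norm (f x) \<le> Z" "0 < Z"
    and Y: "(\<integral>\<^sup>+x. ennreal (norm (f x) powr q) \<partial>lborel) \<le> ennreal (Y powr q)" "0 < Y" and q: "0 < q" "q \<le> q'"
  shows "Lnorm (ereal q') f \<le> ereal (Z powr (1 - q / q') * Y powr (q / q'))"
proof -
  let ?I = "\<integral>\<^sup>+x. ennreal (norm (f x) powr q') \<partial>lborel"
  have "?I \<le> (\<integral>\<^sup>+x. ennreal (Z powr (q' - q)) * ennreal (norm (f x) powr q) \<partial>lborel)" proof (rule nn_integral_mono)
    fix x
    have "norm (f x) powr q' = norm (f x) powr (q' - q) * norm (f x) powr q" by (simp flip: powr_add)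
    also have "\<dots> \<le> Z powr (q' - q) * norm (f x) powr q" using Z q by (intro mult_right_mono powr_mono2) auto
    finally show "ennreal (norm (f x) powr q') \<le> ennreal (Z powr (q' - q)) * ennreal (norm (f x) powr q)"
      by (simp add: ennreal_leI flip: ennreal_mult)
  qed
  also have "\<dots> = ennreal (Z powr (q' - q)) * (\<integral>\<^sup>+x. ennreal (norm (f x) powr q) \<partial>lborel)" by (simp add: nn_integral_cmult)
  also have "\<dots> \<le> ennreal (Z powr (q' - q)) * ennreal (Y powr q)" by (intro mult_left_mono Y) auto
  finally have I: "?I \<le> ennreal (Z powr (q' - q) * Y powr q)" by (simp add: ennreal_mult)
  then have fin: "?I \<noteq> \<infinity>" using le_less_trans[OF _ ennreal_less_top] by (metis infinity_ennreal_def less_irrefl)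
  have "enn2real ?I \<le> Z powr (q' - q) * Y powr q" using I by (intro enn2real_leI) auto
  then have "enn2real ?I powr (1 / q') \<le> (Z powr (q' - q) * Y powr q) powr (1 / q')" using q by (intro powr_mono2) auto
  also have "\<dots> = Z powr ((q' - q) * (1 / q')) * Y powr (q * (1 / q'))" by (simp add: powr_mult powr_powr)
  also have "(q' - q) * (1 / q') = 1 - q / q'" using q by (simp add: field_simps)
  finally show ?thesis using fin by (simp add: Lnorm_def Let_def)
qed

lemma Lnorm_infinity_le:
  fixes f :: "real^'n \<Rightarrow> 'b::euclidean_space"
  assumes [measurable]: "f \<in> borel_measurable borel" and Z: "\<And>x. norm (f x) \<le> Z"
  shows "Lnorm \<infinity> f \<le> ereal Z"
proof -
  have "esssup lborel (\<lambda>x. ereal (norm (f x))) \<le> ereal Z" by (rule esssup_I) (use Z in auto)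
  then show ?thesis by (simp add: Lnorm_def)
qed

text \<open>\<open>Lnorm\<close> is \<infinity> for non-measurable functions and for divergent
  integrals, so a finite bound with c > 0 yields both measurability and the integral
  estimate.\<close>

lemma Lnorm_leD:
  fixes f :: "real^'n \<Rightarrow> 'b::euclidean_space"
  assumes "ereal c * Lnorm (ereal q) f \<le> ereal M" and c: "0 < c" and M: "0 \<le> M" and q: "0 < q"
  shows "f \<in> borel_measurable borel" and "(\<integral>\<^sup>+x. ennreal (norm (f x) powr q) \<partial>lborel) \<le> ennreal ((M / c) powr q)"
proof -
  let ?I = "\<integral>\<^sup>+x. ennreal (norm (f x) powr q) \<partial>lborel"
  have n: "Lnorm (ereal q) f \<noteq> \<infinity>" using assms by auto
  then show m: "f \<in> borel_measurable borel" by (auto simp: Lnorm_def split: if_splits)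
  then have I: "?I \<noteq> \<infinity>" and L: "Lnorm (ereal q) f = ereal (enn2real ?I powr (1 / q))"
    using n by (auto simp: Lnorm_def Let_def split: if_splits)
  have "enn2real ?I powr (1 / q) \<le> M / c" using assms(1) c by (simp add: L field_simps)
  then have "(enn2real ?I powr (1 / q)) powr q \<le> (M / c) powr q" using q by (intro powr_mono2) auto
  then have "enn2real ?I \<le> (M / c) powr q" using q by (simp add: powr_powr)
  then show "?I \<le> ennreal ((M / c) powr q)" using I by (metis ennreal_enn2real ennreal_leI infinity_ennreal_def less_top)
qed

section \<open>Choice of the restart time, and the final estimates\<close>

context mild
begin

text \<open>With S = dl t0 the powers of t0 in \<open>small\<close> cancel, and the condition reads
  Ac dl powr alp \<le> 1. The value of \<open>dl\<close> below gives equality and does not depend on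
  t.\<close>

definition "Ac = 64 * (DD * DD * KK * (KK + 1) * M * cc)"

definition "dl = (1 / Ac) powr (1 / alp)"

lemma Ac_pos: "0 < Ac"
  unfolding Ac_def using cc_pos DD_pos KK_pos M by (intro mult_pos_pos) auto

lemma dl_pos: "0 < dl" using Ac_pos by (simp add: dl_def)

lemma split_time: "t / (1 + dl) + dl * (t / (1 + dl)) = t"
proof -
  have "t / (1 + dl) + dl * (t / (1 + dl)) = (1 + dl) * (t / (1 + dl))" by (simp only: distrib_right mult_1)
  also have "\<dots> = t" using dl_pos by simp
  finally show ?thesis .
qed

text \<open>The restart time t0 = t/(1 + dl) and the running time dl t0 add up to t, so every t is
  the end point of its own restarted problem.\<close>

lemma restarted_at:
  assumes t: "0 < t" "ereal t < T"
  shows "restarted \<gamma> \<mu> q M KK DD kap alp T u0 u (t / (1 + dl)) (dl * (t / (1 + dl)))"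
proof -
  have d: "dl powr alp = 1 / Ac" using Ac_pos exponents(5) by (simp add: dl_def powr_powr)
  define t0 where "t0 = t / (1 + dl)"
  have t0: "0 < t0" "t0 + dl * t0 = t" using t dl_pos split_time[of t] by (auto simp: t0_def)
  have "t0 powr (- alp) * (dl * t0) powr alp = dl powr alp * (t0 powr (- alp) * t0 powr alp)" using t0 dl_pos by (simp add: powr_mult)
  also have "t0 powr (- alp) * t0 powr alp = 1" using t0 by (simp flip: powr_add)
  finally have "Ac * (t0 powr (- alp) * (dl * t0) powr alp) = 1" using Ac_pos d by simp
  moreover have "64 * (DD * DD * KK * (KK + 1) * (M * t0 powr (- alp)) * cc * (dl * t0) powr alp)
      = Ac * (t0 powr (- alp) * (dl * t0) powr alp)"
    unfolding Ac_def by (simp only: mult_ac)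
  ultimately have s: "64 * (DD * DD * KK * (KK + 1) * (M * t0 powr (- alp)) * cc * (dl * t0) powr alp) \<le> 1" by linarith
  show ?thesis
    unfolding t0_def[symmetric] by (intro restarted.intro mild_axioms restarted_axioms.intro t0(1) mult_pos_pos dl_pos s) (simp add: t0(2) t(2))
qed

text \<open>Collects what both conclusions need: one function of x that controls all derivatives at
  time t, with the right powers of t in the sup norm and in L^q.\<close>

definition majorised :: "real \<Rightarrow> real \<Rightarrow> real \<Rightarrow> (real^'n \<Rightarrow> real) \<Rightarrow> bool" where
  "majorised A L t B \<longleftrightarrow> (\<forall>x. 0 \<le> B x \<and> B x \<le> A * t powr (- alp - kap))
     \<and> (\<integral>\<^sup>+x. ennreal (B x powr q) \<partial>lborel) \<le> ennreal ((A * t powr (- alp)) powr q) \<and> B \<in> borel_measurable borel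
     \<and> (\<forall>j is i x. has_pdiff i (pdiffs is (\<lambda>x. u t x $ j)) x
        \<and> \<bar>pdiffs is (\<lambda>x. u t x $ j) x\<bar> \<le> B x * (L * t powr (- (1 / \<gamma>))) ^ length is * real (length is) ^ length is)"

lemma derivative_majorant:
  "\<exists>A L. 0 < A \<and> 0 < L \<and> (\<forall>t. 0 < t \<and> ereal t < T \<longrightarrow> (\<exists>B. majorised A L t B))" proof -
  \<comment> \<open>The running time is \<rho> t. \<open>E\<close> converts the L^q bound at t/(1 +
    dl) into a power of t, \<open>A\<close> adds the constants of the L^q and sup bounds, and
    \<open>L\<close> is 2 over the radius of the polydisc at t = 1.\<close>
  define \<rho> where "\<rho> = dl / (1 + dl)"
  have \<rho>: "0 < \<rho>" using dl_pos by (simp add: \<rho>_def)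
  define E where "E = M * (1 + dl) powr alp"
  have E: "0 < E" using M dl_pos by (simp add: E_def)
  define A where "A = 4 * KK * E + 2 * KK * E * \<rho> powr (- kap)"
  define L where "L = 2 * \<rho> powr (- (1 / \<gamma>))"
  have A: "0 < A" using KK_pos E \<rho> by (simp add: A_def add_pos_pos)
  have L: "0 < L" using \<rho> by (simp add: L_def)
  show ?thesis proof (rule exI[of _ A], rule exI[of _ L], intro conjI A L allI impI)
    fix t assume "0 < t \<and> ereal t < T"
    then have t: "0 < t" "ereal t < T" by auto
    interpret R: restarted \<gamma> \<mu> q M KK DD kap alp T u0 u "t / (1 + dl)" "dl * (t / (1 + dl))" by (rule restarted_at[OF t])
    let ?S = "dl * (t / (1 + dl))"
    let ?B = "\<lambda>x. enn2real (R.Pinf ?S x)"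
    have S: "?S = \<rho> * t" "t / (1 + dl) + ?S = t" using split_time by (auto simp: \<rho>_def)
    have NN: "R.NN = E * t powr (- alp)" using t dl_pos by (simp add: R.NN_def E_def powr_divide powr_minus field_simps)
    have r: "?S powr (1 / \<gamma>) = \<rho> powr (1 / \<gamma>) * t powr (1 / \<gamma>)" unfolding S(1) using t \<rho> by (simp add: powr_mult)
    have rk: "?S powr (- kap) = \<rho> powr (- kap) * t powr (- kap)" unfolding S(1) using t \<rho> by (simp add: powr_mult)
    have r': "2 / ?S powr (1 / \<gamma>) = L * t powr (- (1 / \<gamma>))" unfolding r L_def by (simp add: powr_minus divide_simps)
    have S0: "0 < ?S" by (rule R.S)
    note Pm = R.Pinf_measurable[of ?S, measurable]
    have sup: "?B x \<le> A * t powr (- alp - kap)" for x proof -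
      have "?B x \<le> R.BB * ?S powr (- kap)" using R.Pinf_sup[OF S0 order_refl, of x] R.csts(3) by (intro enn2real_leI) auto
      also have "\<dots> = 2 * KK * E * \<rho> powr (- kap) * (t powr (- alp) * t powr (- kap))"
        unfolding rk R.BB_def NN by (simp only: mult_ac)
      also have "t powr (- alp) * t powr (- kap) = t powr (- alp - kap)" by (simp flip: powr_add)
      also have "2 * KK * E * \<rho> powr (- kap) * t powr (- alp - kap) \<le> A * t powr (- alp - kap)"
        using KK_pos E by (intro mult_right_mono) (auto simp: A_def)
      finally show ?thesis .
    qed
    have Lq: "(\<integral>\<^sup>+x. ennreal (?B x powr q) \<partial>lborel) \<le> ennreal ((A * t powr (- alp)) powr q)" proof -
      have "(\<integral>\<^sup>+x. ennreal (?B x powr q) \<partial>lborel) = (\<integral>\<^sup>+x. epow q (R.Pinf ?S x) \<partial>lborel)"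
      proof (rule nn_integral_cong)
        fix x
        have "R.Pinf ?S x < \<top>" using le_less_trans[OF R.Pinf_sup[OF S0 order_refl, of x] ennreal_less_top] .
        then show "ennreal (?B x powr q) = epow q (R.Pinf ?S x)" by (cases "R.Pinf ?S x") auto
      qed
      also have "\<dots> \<le> ennreal (R.QQ powr q)" by (rule R.Pinf_Lq[OF S0 order_refl])
      also have "\<dots> \<le> ennreal ((A * t powr (- alp)) powr q)" proof (intro ennreal_leI powr_mono2)
        have "R.QQ = 4 * KK * E * t powr (- alp)" by (simp add: R.QQ_def NN)
        also have "\<dots> \<le> A * t powr (- alp)" using KK_pos E by (intro mult_right_mono) (auto simp: A_def)
        finally show "R.QQ \<le> A * t powr (- alp)" .
      qed (use exponents(1) R.csts(4) in auto)
      finally show ?thesis .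
    qed
    have he: "hol_ext (?S powr (1 / \<gamma>)) (\<lambda>x. u t x $ j) ?B" for j using R.solution_hol_ext[of j] by (simp only: S(2))
    have "0 < ?S powr (1 / \<gamma>)" using S0 unfolding powr_gt_zero by linarith
    note D = hol_ext_derivative_bounds[OF he this, unfolded r']
    show "\<exists>B. majorised A L t B" unfolding majorised_def by (intro exI[of _ ?B] conjI allI enn2real_nonneg sup Lq D) measurable
  qed
qed

lemma derivative_norms:
  "\<exists>C. \<forall>t. 0 < t \<and> ereal t < T \<longrightarrow> all_pdiffs_exist (u t) \<and>
     (\<forall>q'::ereal. ereal q \<le> q' \<longrightarrow> (\<forall>is. Lnorm q' (pdiffs is (u t))
        \<le> ereal (C ^ (length is + 1) * t powr (- real (length is) / \<gamma> - (1 - 1/\<gamma> - real CARD('n) * real_of_ereal (inverse q') / \<gamma>)) * real (length is) ^ length is)))"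
proof -
  obtain A L where A: "0 < A" and L: "0 < L" and maj: "\<forall>t. 0 < t \<and> ereal t < T \<longrightarrow> (\<exists>B. majorised A L t B)"
    using derivative_majorant by blast
  let ?d = "real CARD('n)"
  \<comment> \<open>Chosen so that C^(k + 1) \<ge> (d A) L^k; the factor d comes from summing the
    components of a vector.\<close>
  define C where "C = ?d * A + L"
  have d: "1 \<le> ?d" by (rule exponents)
  have C: "0 < C" "?d * A \<le> C" "L \<le> C" using A L d by (auto simp: C_def add_nonneg_pos)
  show ?thesis proof (intro exI[of _ C] allI impI conjI)
    fix t assume "0 < t \<and> ereal t < T"
    then have t: "0 < t" "ereal t < T" by auto
    obtain B where mB: "majorised A L t B" using maj t by blast
    have B: "0 \<le> B x" "B x \<le> A * t powr (- alp - kap)" for x using mB unfolding majorised_def by auto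
    have Bq: "(\<integral>\<^sup>+x. ennreal (B x powr q) \<partial>lborel) \<le> ennreal ((A * t powr (- alp)) powr q)" and [measurable]: "B \<in> borel_measurable borel"
      using mB unfolding majorised_def by auto
    have ex: "has_pdiff i (pdiffs is (\<lambda>x. u t x $ j)) x" for j "is" i x using mB unfolding majorised_def by auto
    have bd: "\<bar>pdiffs is (\<lambda>x. u t x $ j) x\<bar> \<le> B x * (L * t powr (- (1 / \<gamma>))) ^ length is * real (length is) ^ length is" for j "is" x using mB unfolding majorised_def by auto
    note ex' = pdiffs_cart(2)[of "u t", OF ex]
    show "all_pdiffs_exist (u t)" unfolding all_pdiffs_exist_def using ex' by blast
    fix q' :: ereal and "is" :: "'n list" assume q': "ereal q \<le> q'"
    let ?f = "pdiffs is (u t)" and ?k = "length is"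
    have [measurable]: "?f \<in> borel_measurable borel" by (rule pdiffs_measurable[OF umeas[OF t] ex'])
    define G where "G = (L * t powr (- (1 / \<gamma>))) ^ ?k * real ?k ^ ?k"
    have "0 < real ?k ^ ?k" by (cases ?k) auto
    then have G: "0 < G" using L t by (simp add: G_def)
    have fB: "norm (?f x) \<le> ?d * G * B x" for x proof -
      have "norm (?f x) \<le> (\<Sum>j\<in>UNIV. \<bar>?f x $ j\<bar>)" by (rule norm_le_l1_cart)
      also have "\<dots> \<le> (\<Sum>j\<in>(UNIV::'n set). B x * G)"
        using bd[of "is" _ x] by (intro sum_mono) (simp add: pdiffs_cart(1)[of "u t", OF ex] G_def mult.assoc)
      finally show ?thesis by (simp add: mult_ac)
    qed
    define Z where "Z = ?d * G * (A * t powr (- alp - kap))"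
    define Y where "Y = ?d * G * (A * t powr (- alp))"
    have ZY: "0 < Z" "0 < Y" using d G A t by (auto simp: Z_def Y_def)
    have fZ: "norm (?f x) \<le> Z" for x
      unfolding Z_def using d G by (intro order_trans[OF fB] mult_left_mono B) auto
    have fY: "(\<integral>\<^sup>+x. ennreal (norm (?f x) powr q) \<partial>lborel) \<le> ennreal (Y powr q)" proof -
      have "(\<integral>\<^sup>+x. ennreal (norm (?f x) powr q) \<partial>lborel) \<le> (\<integral>\<^sup>+x. ennreal ((?d * G) powr q) * ennreal (B x powr q) \<partial>lborel)"
      proof (rule nn_integral_mono)
        fix x
        have "norm (?f x) powr q \<le> (?d * G * B x) powr q" using exponents(1) by (intro powr_mono2 fB) auto
        also have "\<dots> = (?d * G) powr q * B x powr q" by (rule powr_mult)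
        finally show "ennreal (norm (?f x) powr q) \<le> ennreal ((?d * G) powr q) * ennreal (B x powr q)"
          by (simp add: ennreal_leI flip: ennreal_mult)
      qed
      also have "\<dots> = ennreal ((?d * G) powr q) * (\<integral>\<^sup>+x. ennreal (B x powr q) \<partial>lborel)" by (rule nn_integral_cmult) measurable
      also have "\<dots> \<le> ennreal ((?d * G) powr q) * ennreal ((A * t powr (- alp)) powr q)" by (intro mult_left_mono Bq) auto
      also have "\<dots> = ennreal (Y powr q)" using d G A unfolding Y_def by (subst powr_mult) (auto simp: ennreal_mult)
      finally show ?thesis .
    qed
    have Gt: "?d * G * A * t powr (- e) \<le> C ^ (?k + 1) * t powr (- real ?k / \<gamma> - e) * real ?k ^ ?k" for e proof -
      have tk: "(t powr (- (1 / \<gamma>))) ^ ?k = t powr (- real ?k / \<gamma>)" using t by (simp add: powr_power mult.commute)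
      have "?d * G * A * t powr (- e) = (?d * A) * L ^ ?k * (t powr (- real ?k / \<gamma> + - e) * real ?k ^ ?k)"
        unfolding G_def power_mult_distrib tk powr_add by (simp only: mult_ac)
      also have "\<dots> \<le> (C * C ^ ?k) * (t powr (- real ?k / \<gamma> + - e) * real ?k ^ ?k)"
        using C L A d by (intro mult_right_mono mult_mono power_mono) auto
      finally show ?thesis by (simp add: mult_ac)
    qed
    show "Lnorm q' ?f \<le> ereal (C ^ (?k + 1) * t powr (- real ?k / \<gamma> - (1 - 1/\<gamma> - ?d * real_of_ereal (inverse q') / \<gamma>)) * real ?k ^ ?k)"
    proof (cases q')
      case (real p)
      have p: "0 < q" "q \<le> p" using q' exponents(1) real by auto
      have "Lnorm q' ?f \<le> ereal (Z powr (1 - q / p) * Y powr (q / p))"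
        unfolding real by (rule Lnorm_interpolation[OF _ fZ ZY(1) fY ZY(2) p]) measurable
      also have "Z powr (1 - q / p) * Y powr (q / p) = ?d * G * A * t powr (- (1 - 1 / \<gamma> - ?d * (1 / p) / \<gamma>))" proof -
        define H where "H = ?d * G * A"
        have H: "0 < H" using d G A by (simp add: H_def)
        have ZH: "Z = H * t powr (- alp - kap)" "Y = H * t powr (- alp)" by (simp_all add: Z_def Y_def H_def mult.assoc)
        have "Z powr (1 - q / p) * Y powr (q / p) = (H powr (1 - q / p) * H powr (q / p)) * (t powr ((- alp - kap) * (1 - q / p)) * t powr (- alp * (q / p)))"
          unfolding ZH using H by (simp add: powr_mult powr_powr)
        also have "H powr (1 - q / p) * H powr (q / p) = H" using H by (simp flip: powr_add)
        also have "t powr ((- alp - kap) * (1 - q / p)) * t powr (- alp * (q / p)) = t powr ((- alp - kap) * (1 - q / p) + (- alp * (q / p)))" by (simp flip: powr_add)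
        \<comment> \<open>The sum alp + kap = 1 - 1/\<gamma> is the exponent for q' = \<infinity>,
          and kap q/p = d/(p \<gamma>) corrects it for finite p; together they form the exponent
          \<alpha>' of the claim.\<close>
        also have "(- alp - kap) * (1 - q / p) + (- alp * (q / p)) = - (alp + kap) + kap * q / p" by (simp add: algebra_simps)
        also have "alp + kap = 1 - 1 / \<gamma>" by (simp add: alp_def)
        also have "kap * q / p = ?d * (1 / p) / \<gamma>" using p by (simp add: kap_def)
        also have "- (1 - 1 / \<gamma>) + ?d * (1 / p) / \<gamma> = - (1 - 1 / \<gamma> - ?d * (1 / p) / \<gamma>)" by simp
        finally show ?thesis unfolding H_def .
      qed
      also have "ereal \<dots> \<le> ereal (C ^ (?k + 1) * t powr (- real ?k / \<gamma> - (1 - 1 / \<gamma> - ?d * (1 / p) / \<gamma>)) * real ?k ^ ?k)"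
        unfolding ereal_less_eq(3) by (rule Gt)
      finally have "Lnorm q' ?f \<le> ereal (C ^ (?k + 1) * t powr (- real ?k / \<gamma> - (1 - 1 / \<gamma> - ?d * (1 / p) / \<gamma>)) * real ?k ^ ?k)" .
      moreover have "real_of_ereal (inverse q') = 1 / p" using p by (simp add: real inverse_eq_divide)
      ultimately show ?thesis by (simp only:)
    next
      case PInf
      have "Lnorm q' ?f \<le> ereal Z" unfolding PInf by (rule Lnorm_infinity_le[OF _ fZ]) measurable
      also have "Z = ?d * G * A * t powr (- (1 - 1 / \<gamma> - ?d * 0 / \<gamma>))" by (simp add: Z_def alp_def mult.assoc)
      also have "ereal \<dots> \<le> ereal (C ^ (?k + 1) * t powr (- real ?k / \<gamma> - (1 - 1 / \<gamma> - ?d * 0 / \<gamma>)) * real ?k ^ ?k)"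
        unfolding ereal_less_eq(3) by (rule Gt)
      finally have "Lnorm q' ?f \<le> ereal (C ^ (?k + 1) * t powr (- real ?k / \<gamma> - (1 - 1 / \<gamma> - ?d * 0 / \<gamma>)) * real ?k ^ ?k)" .
      moreover have "real_of_ereal (inverse q') = 0" by (simp add: PInf)
      ultimately show ?thesis by (simp only:)
    qed (use q' in auto)
  qed
qed

text \<open>The sup bound on the majorant makes the derivative bounds uniform in x, as
  \<open>real_analytic_onI\<close> requires.\<close>

lemma solution_analytic:
  assumes t: "0 < t" "ereal t < T" shows "real_analytic_on (u t) UNIV"
proof -
  obtain A L B where L: "0 < L" and mB: "majorised A L t B" using derivative_majorant t by blast
  have B: "B x \<le> A * t powr (- alp - kap)" for x using mB unfolding majorised_def by auto
  have ex: "has_pdiff i (pdiffs is (\<lambda>x. u t x $ j)) x" for j "is" i x using mB unfolding majorised_def by auto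
  have bd: "\<bar>pdiffs is (\<lambda>x. u t x $ j) x\<bar> \<le> B x * (L * t powr (- (1 / \<gamma>))) ^ length is * real (length is) ^ length is" for j "is" x using mB unfolding majorised_def by auto
  show ?thesis proof (rule real_analytic_onI[OF ex])
    show "\<bar>pdiffs is (\<lambda>x. u t x $ j) x\<bar> \<le> (A * t powr (- alp - kap)) * (L * t powr (- (1 / \<gamma>))) ^ length is * real (length is) ^ length is" for j "is" x
      using L t by (intro order_trans[OF bd] mult_right_mono B) auto
    show "0 < L * t powr (- (1 / \<gamma>))" using L t by simp
  qed
qed

end

text \<open>The quotient d/q' is written with \<open>inverse q'\<close>, which is 0 at q' =
  \<infinity>, and D^k is represented by the words of k directions; \<open>real k ^ k\<close> is 1
  for k = 0.\<close>

theorem theorem2p2: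
  fixes \<gamma> q :: real and T :: ereal
    and u0 :: "real^'n::finite \<Rightarrow> real^'n"
    and u :: "real \<Rightarrow> real^'n \<Rightarrow> real^'n"
  assumes "1 < \<gamma>" "\<gamma> \<le> 2" "0 < T"
    and "real CARD('n) / (\<gamma> - 1) < q"
    and "weakly_div_free u0"
    and "\<forall>t. 0 < t \<and> ereal t < T \<longrightarrow> weakly_div_free (u t)"
    and "mild_solution \<gamma> T u0 u"
    and "\<exists>M::real. \<forall>t. 0 < t \<and> ereal t < T \<longrightarrow>
           ereal (t powr (1 - 1/\<gamma> - real CARD('n) / (q * \<gamma>))) * Lnorm (ereal q) (u t) \<le> ereal M"
  shows "(\<exists>C::real. \<forall>t. 0 < t \<and> ereal t < T \<longrightarrow>
           all_pdiffs_exist (u t) \<and>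
           (\<forall>q'::ereal. ereal q \<le> q' \<longrightarrow> (\<forall>k::nat. \<forall>is::'n list. length is = k \<longrightarrow>
              Lnorm q' (pdiffs is (u t))
                \<le> ereal (C ^ (k + 1) * t powr (- real k / \<gamma>
                     - (1 - 1/\<gamma> - real CARD('n) * real_of_ereal (inverse q') / \<gamma>))
                     * real k ^ k))))
         \<and> (\<forall>t. 0 < t \<and> ereal t < T \<longrightarrow> real_analytic_on (u t) UNIV)"
proof -
  \<comment> \<open>The stable index \<gamma>/2 lies in (1/2, 1].\<close>
  obtain \<mu> :: "real measure" where \<mu>: "subordinator \<gamma> \<mu>"
    using stable_subordinator[of "\<gamma> / 2"] assms(1,2) by (auto simp: subordinator_def)
  define a where "a = 1 - 1/\<gamma> - real CARD('n) / (q * \<gamma>)"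
  from assms(8) obtain M0 where M0: "\<And>t. 0 < t \<Longrightarrow> ereal t < T \<Longrightarrow> ereal (t powr a) * Lnorm (ereal q) (u t) \<le> ereal M0"
    unfolding a_def by blast
  \<comment> \<open>The maximum with 1 makes the constant positive, as the locale requires.\<close>
  define M where "M = max M0 1"
  have q: "0 < q" using assms(1) by (intro le_less_trans[OF _ assms(4)] divide_nonneg_pos) auto
  have b: "ereal (t powr a) * Lnorm (ereal q) (u t) \<le> ereal M" if "0 < t" "ereal t < T" for t
    using M0[OF that] by (rule order_trans) (simp add: M_def)
  note D = Lnorm_leD[OF b _ _ q]
  interpret subordinator \<gamma> \<mu> by (rule \<mu>)
  interpret mild \<gamma> \<mu> q M "CK TYPE('n)" "(real CARD('n))\<^sup>2" "real CARD('n) / (q * \<gamma>)" "1 - 1/\<gamma> - real CARD('n) / (q * \<gamma>)" T u0 u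
  proof
    show "0 < M" by (simp add: M_def)
    fix t :: real assume t: "0 < t" "ereal t < T"
    show "u t \<in> borel_measurable borel" using D(1)[OF t] t by (simp add: M_def)
    have "M / t powr a = M * t powr (- a)" by (simp add: powr_minus divide_inverse)
    then show "(\<integral>\<^sup>+x. epow q (ennreal (norm (u t x))) \<partial>lborel) \<le> ennreal ((M * t powr (- (1 - 1 / \<gamma> - real CARD('n) / (q * \<gamma>)))) powr q)"
      using D(2)[OF t] t by (simp add: M_def a_def)
  qed (use assms in auto)
  from derivative_norms obtain C where C: "\<And>t. 0 < t \<and> ereal t < T \<Longrightarrow> all_pdiffs_exist (u t) \<and>
     (\<forall>q'::ereal. ereal q \<le> q' \<longrightarrow> (\<forall>is. Lnorm q' (pdiffs is (u t))
        \<le> ereal (C ^ (length is + 1) * t powr (- real (length is) / \<gamma> - (1 - 1/\<gamma> - real CARD('n) * real_of_ereal (inverse q') / \<gamma>)) * real (length is) ^ length is)))"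
    by blast
  show ?thesis proof (intro conjI exI[of _ C] allI impI)
    fix t assume t: "0 < t \<and> ereal t < T"
    show "all_pdiffs_exist (u t)" using C[OF t] by blast
    show "real_analytic_on (u t) UNIV" using solution_analytic t by blast
    fix q' :: ereal and k :: nat and "is" :: "'n list" assume "ereal q \<le> q'" "length is = k"
    then show "Lnorm q' (pdiffs is (u t)) \<le> ereal (C ^ (k + 1) * t powr (- real k / \<gamma>
                     - (1 - 1/\<gamma> - real CARD('n) * real_of_ereal (inverse q') / \<gamma>)) * real k ^ k)"
      using C[OF t] by blast
  qed
qed

end
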